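(* Let $(W,S)$ be an irreducible, right-angled Coxeter system with $S$ finite and $|S|\ge 3$. There are finite factor representations $\lambda_{\mathbf a}$, $\mathbf a=(a_s)_{s\in S}\in(-1,1)^S$, of $W$ such that for every $\mathbf a\in(-1,1)^S$, with $\mathbf q=(q_s)_{s\in S}$ defined by $q_s^{1/2}=\frac{1-|a_s|}{\sqrt{1-a_s^2}}$, $$\mathcal N_{\mathbf q}(W)\cong\lambda_{\mathbf a}(W)''\oplus A_{\mathbf a}$$ for some finite dimensional abelian von Neumann algebra $A_{\mathbf a}$ (possibly zero) depending on $\mathbf a$. Further, there is an open set $U\subset(-1,1)^S$ containing $\mathbf 0$ such that the representations $(\lambda_{\mathbf a})_{\mathbf a\in U}$ are pairwise unitarily inequivalent.
   Context: A right-angled Coxeter system $(W,S)$ is given by $W=\langle S\mid (st)^{m_{st}}=e\rangle$ with $m_{ss}=1$ and $m_{st}=m_{ts}\in\{2,\infty\}$ for $s\ne t$ (no relation when $m_{st}=\infty$). It is irreducible if there is no partition $S=S_1\sqcup S_2$ into non-empty sets with $W=\langle S_1\rangle\oplus\langle S_2\rangle$. $|w|$ denotes word length with respect to $S$. For $\mathbf q\in(0,1]^S$ the Hecke von Neumann algebra $\mathcal N_{\mathbf q}(W)$ is the von Neumann algebra on $\ell^2(W)$ generated by the self-adjoint bounded operators $T_s^{(\mathbf q)}$, $s\in S$, where $$T_s^{(\mathbf q)}\delta_w=\begin{cases}\delta_{sw}&\text{if }|sw|>|w|,\\ \delta_{sw}+\frac{q_s-1}{\sqrt{q_s}}\,\delta_w&\text{if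 }|sw|<|w|.\end{cases}$$ A finite factor representation of $W$ is a unitary representation $\pi$ such that $\pi(W)''$ is a finite factor. *)

theory Defs
  imports
    "HOL-Analysis.Analysis"
    "HOL-Library.Extended_Nat"
    "HOL-Algebra.Module"
    "HOL-Algebra.Generated_Groups"
    "HOL-Algebra.RingHom"
    "HOL-Algebra.QuotRing"
begin

section \<open>Right-angled Coxeter systems\<close>

text \<open>
  In a word, the letter \<open>(s, True)\<close> stands for the generator \<open>s\<close> and \<open>(s, False)\<close> for its
  formal inverse. Two words are identified by \<open>presentation_eq S R\<close> iff they represent the same
  element of the group with presentation \<open>\<langle>S | r = e (r \<in> R)\<rangle>\<close>.
\<close>

inductive presentation_eq :: "'s set \<Rightarrow> ('s \<times> bool) list set \<Rightarrow>
    ('s \<times> bool) list \<Rightarrow> ('s \<times> bool) list \<Rightarrow> bool" for S R where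
  refl: "presentation_eq S R u u"
| sym: "presentation_eq S R u v \<Longrightarrow> presentation_eq S R v u"
| trans: "presentation_eq S R u v \<Longrightarrow> presentation_eq S R v w \<Longrightarrow> presentation_eq S R u w"
| cancel: "s \<in> S \<Longrightarrow> presentation_eq S R (u @ [(s, b), (s, \<not> b)] @ v) (u @ v)"
| relator: "r \<in> R \<Longrightarrow> presentation_eq S R (u @ r @ v) (u @ v)"

definition word_value :: "('w, 'b) monoid_scheme \<Rightarrow> ('w \<times> bool) list \<Rightarrow> 'w" where
  "word_value W u =
     foldr (\<lambda>(s, b) g. (if b then s else inv\<^bsub>W\<^esub> s) \<otimes>\<^bsub>W\<^esub> g) u \<one>\<^bsub>W\<^esub>"

definition has_presentation ::
    "('w, 'b) monoid_scheme \<Rightarrow> 'w set \<Rightarrow> ('w \<times> bool) list set \<Rightarrow> bool" where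
  "has_presentation W S R \<longleftrightarrow>
     group W \<and> S \<subseteq> carrier W \<and> generate W S = carrier W \<and>
     (\<forall>u \<in> lists (S \<times> UNIV). word_value W u = \<one>\<^bsub>W\<^esub> \<longleftrightarrow> presentation_eq S R u [])"

definition coxeter_relators :: "'s set \<Rightarrow> ('s \<Rightarrow> 's \<Rightarrow> enat) \<Rightarrow> ('s \<times> bool) list set" where
  "coxeter_relators S m =
     {concat (replicate n [(s, True), (t, True)]) | s t n. s \<in> S \<and> t \<in> S \<and> m s t = enat n}"

definition right_angled_coxeter_system ::
    "('w, 'b) monoid_scheme \<Rightarrow> 'w set \<Rightarrow> ('w \<Rightarrow> 'w \<Rightarrow> enat) \<Rightarrow> bool" where
  "right_angled_coxeter_system W S m \<longleftrightarrow>
     (\<forall>s \<in> S. m s s = 1) \<and>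
     (\<forall>s \<in> S. \<forall>t \<in> S. s \<noteq> t \<longrightarrow> m s t = m t s \<and> m s t \<in> {2, \<infinity>}) \<and>
     has_presentation W S (coxeter_relators S m)"

definition irreducible_system :: "('w, 'b) monoid_scheme \<Rightarrow> 'w set \<Rightarrow> bool" where
  "irreducible_system W S \<longleftrightarrow>
     \<not> (\<exists>S1 S2. S1 \<noteq> {} \<and> S2 \<noteq> {} \<and> S1 \<inter> S2 = {} \<and> S1 \<union> S2 = S \<and>
          (\<lambda>(x, y). x \<otimes>\<^bsub>W\<^esub> y) \<in>
            iso (W\<lparr>carrier := generate W S1\<rparr> \<times>\<times> W\<lparr>carrier := generate W S2\<rparr>) W)"

text \<open>Generators of a Coxeter system are involutions, so inverse letters are not needed here.\<close>

definition word_length :: "('w, 'b) monoid_scheme \<Rightarrow> 'w set \<Rightarrow> 'w \<Rightarrow> nat" where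
  "word_length W S w =
     (LEAST n. \<exists>ss \<in> lists S. length ss = n \<and> foldr (\<otimes>\<^bsub>W\<^esub>) ss \<one>\<^bsub>W\<^esub> = w)"


section \<open>Complex Hilbert spaces\<close>

definition complex_ring :: "complex ring" where
  "complex_ring = \<lparr>carrier = UNIV, mult = (*), one = 1, zero = 0, add = (+)\<rparr>"

text \<open>
  The record of modules carries the fields \<open>mult\<close> and \<open>one\<close> of rings; they play no role for
  a Hilbert space. The inner product \<open>ip\<close> is linear in the first argument.
\<close>

record 'v hilbert = "(complex, 'v) module" +
  ip :: "'v \<Rightarrow> 'v \<Rightarrow> complex"

definition hnorm :: "('v, 'c) hilbert_scheme \<Rightarrow> 'v \<Rightarrow> real" where
  "hnorm H x = sqrt (Re (ip H x x))"

locale hilbert_space = Module.module complex_ring H for H :: "('v, 'c) hilbert_scheme" (structure) +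
  assumes ip_add_left: "\<lbrakk>x \<in> carrier H; y \<in> carrier H; z \<in> carrier H\<rbrakk> \<Longrightarrow>
      ip H (x \<oplus> y) z = ip H x z + ip H y z"
    and ip_smult_left: "\<lbrakk>x \<in> carrier H; y \<in> carrier H\<rbrakk> \<Longrightarrow> ip H (c \<odot> x) y = c * ip H x y"
    and ip_cnj: "\<lbrakk>x \<in> carrier H; y \<in> carrier H\<rbrakk> \<Longrightarrow> ip H y x = cnj (ip H x y)"
    and ip_nonneg: "x \<in> carrier H \<Longrightarrow> 0 \<le> Re (ip H x x)"
    and ip_definite: "x \<in> carrier H \<Longrightarrow> ip H x x = 0 \<Longrightarrow> x = \<zero>"
    and complete: "\<lbrakk>\<And>n :: nat. X n \<in> carrier H;
        \<And>e. 0 < e \<Longrightarrow> \<exists>N. \<forall>i \<ge> N. \<forall>j \<ge> N. hnorm H (X i \<ominus> X j) < e\<rbrakk> \<Longrightarrow>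
      \<exists>x \<in> carrier H. (\<lambda>n. hnorm H (X n \<ominus> x)) \<longlonglongrightarrow> 0"

text \<open>\<open>ell2 I\<close> is the Hilbert space of square-summable families indexed by the set \<open>I\<close>.\<close>

definition ell2 :: "'i set \<Rightarrow> ('i \<Rightarrow> complex) hilbert" where
  "ell2 I =
     \<lparr>carrier = {f. (\<forall>i. i \<notin> I \<longrightarrow> f i = 0) \<and> (\<lambda>i. (cmod (f i))\<^sup>2) summable_on I},
      mult = undefined, one = undefined,
      zero = (\<lambda>_. 0), add = (\<lambda>f g i. f i + g i), smult = (\<lambda>c f i. c * f i),
      ip = (\<lambda>f g. \<Sum>\<^sub>\<infinity>i\<in>I. f i * cnj (g i))\<rparr>"

definition delta :: "'i \<Rightarrow> 'i \<Rightarrow> complex" where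
  "delta i = (\<lambda>j. if j = i then 1 else 0)"

definition hilbert_sum :: "'v hilbert \<Rightarrow> 'u hilbert \<Rightarrow> ('v \<times> 'u) hilbert" where
  "hilbert_sum H K =
     \<lparr>carrier = carrier H \<times> carrier K,
      mult = undefined, one = undefined,
      zero = (\<zero>\<^bsub>H\<^esub>, \<zero>\<^bsub>K\<^esub>),
      add = (\<lambda>(x, y) (x', y'). (x \<oplus>\<^bsub>H\<^esub> x', y \<oplus>\<^bsub>K\<^esub> y')),
      smult = (\<lambda>c (x, y). (c \<odot>\<^bsub>H\<^esub> x, c \<odot>\<^bsub>K\<^esub> y)),
      ip = (\<lambda>(x, y) (x', y'). ip H x x' + ip K y y')\<rparr>"


section \<open>Bounded operators and von Neumann algebras\<close>

text \<open>
  The algebra of bounded operators on \<open>H\<close>. Operators are extensional functions on the carrier,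
  so that equality of operators is equality of functions.
\<close>

definition bounded_ops :: "('v, 'c) hilbert_scheme \<Rightarrow> (complex, 'v \<Rightarrow> 'v) module" where
  "bounded_ops H =
     \<lparr>carrier = {T \<in> carrier H \<rightarrow>\<^sub>E carrier H.
         (\<forall>x \<in> carrier H. \<forall>y \<in> carrier H. T (x \<oplus>\<^bsub>H\<^esub> y) = T x \<oplus>\<^bsub>H\<^esub> T y) \<and>
         (\<forall>c. \<forall>x \<in> carrier H. T (c \<odot>\<^bsub>H\<^esub> x) = c \<odot>\<^bsub>H\<^esub> T x) \<and>
         (\<exists>C. \<forall>x \<in> carrier H. hnorm H (T x) \<le> C * hnorm H x)},
      mult = compose (carrier H), one = (\<lambda>x \<in> carrier H. x),
      zero = (\<lambda>x \<in> carrier H. \<zero>\<^bsub>H\<^esub>),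
      add = (\<lambda>T T'. \<lambda>x \<in> carrier H. T x \<oplus>\<^bsub>H\<^esub> T' x),
      smult = (\<lambda>c T. \<lambda>x \<in> carrier H. c \<odot>\<^bsub>H\<^esub> T x)\<rparr>"

definition adj :: "('v, 'c) hilbert_scheme \<Rightarrow> ('v \<Rightarrow> 'v) \<Rightarrow> 'v \<Rightarrow> 'v" where
  "adj H T = (THE T'. T' \<in> carrier (bounded_ops H) \<and>
     (\<forall>x \<in> carrier H. \<forall>y \<in> carrier H. ip H (T x) y = ip H x (T' y)))"

definition commutant :: "('v, 'c) hilbert_scheme \<Rightarrow> ('v \<Rightarrow> 'v) set \<Rightarrow> ('v \<Rightarrow> 'v) set" where
  "commutant H M = {T \<in> carrier (bounded_ops H).
     \<forall>T' \<in> M. T \<otimes>\<^bsub>bounded_ops H\<^esub> T' = T' \<otimes>\<^bsub>bounded_ops H\<^esub> T}"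

definition von_neumann_algebra :: "('v, 'c) hilbert_scheme \<Rightarrow> ('v \<Rightarrow> 'v) set \<Rightarrow> bool" where
  "von_neumann_algebra H M \<longleftrightarrow>
     M \<subseteq> carrier (bounded_ops H) \<and> adj H ` M \<subseteq> M \<and> commutant H (commutant H M) = M"

definition abelian_algebra :: "('v, 'c) hilbert_scheme \<Rightarrow> ('v \<Rightarrow> 'v) set \<Rightarrow> bool" where
  "abelian_algebra H M \<longleftrightarrow>
     (\<forall>T \<in> M. \<forall>T' \<in> M. T \<otimes>\<^bsub>bounded_ops H\<^esub> T' = T' \<otimes>\<^bsub>bounded_ops H\<^esub> T)"

definition finite_dimensional :: "('v, 'c) hilbert_scheme \<Rightarrow> ('v \<Rightarrow> 'v) set \<Rightarrow> bool" where
  "finite_dimensional H M \<longleftrightarrow>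
     (\<exists>B \<subseteq> M. finite B \<and>
        (\<forall>T \<in> M. \<exists>c. T = (\<Oplus>\<^bsub>bounded_ops H\<^esub>b\<in>B. c b \<odot>\<^bsub>bounded_ops H\<^esub> b)))"

definition factor :: "('v, 'c) hilbert_scheme \<Rightarrow> ('v \<Rightarrow> 'v) set \<Rightarrow> bool" where
  "factor H M \<longleftrightarrow>
     von_neumann_algebra H M \<and> carrier H \<noteq> {\<zero>\<^bsub>H\<^esub>} \<and>
     M \<inter> commutant H M = range (\<lambda>c. c \<odot>\<^bsub>bounded_ops H\<^esub> \<one>\<^bsub>bounded_ops H\<^esub>)"

text \<open>Finiteness in the sense of Murray and von Neumann: every isometry in \<open>M\<close> is unitary.\<close>

definition finite_algebra :: "('v, 'c) hilbert_scheme \<Rightarrow> ('v \<Rightarrow> 'v) set \<Rightarrow> bool" where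
  "finite_algebra H M \<longleftrightarrow>
     (\<forall>V \<in> M. adj H V \<otimes>\<^bsub>bounded_ops H\<^esub> V = \<one>\<^bsub>bounded_ops H\<^esub> \<longrightarrow>
              V \<otimes>\<^bsub>bounded_ops H\<^esub> adj H V = \<one>\<^bsub>bounded_ops H\<^esub>)"

definition direct_sum ::
    "'v hilbert \<Rightarrow> ('v \<Rightarrow> 'v) set \<Rightarrow> 'u hilbert \<Rightarrow> ('u \<Rightarrow> 'u) set \<Rightarrow> ('v \<times> 'u \<Rightarrow> 'v \<times> 'u) set" where
  "direct_sum H M K N =
     {(\<lambda>(x, y) \<in> carrier (hilbert_sum H K). (T x, T' y)) | T T'. T \<in> M \<and> T' \<in> N}"

text \<open>
  Isomorphism means \<open>*\<close>-isomorphism; between von Neumann algebras these are automatically normal.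
\<close>

definition vn_isomorphic :: "('v, 'c) hilbert_scheme \<Rightarrow> ('v \<Rightarrow> 'v) set \<Rightarrow>
    ('u, 'd) hilbert_scheme \<Rightarrow> ('u \<Rightarrow> 'u) set \<Rightarrow> bool" where
  "vn_isomorphic H M K N \<longleftrightarrow>
     (\<exists>\<phi> \<in> ring_iso (bounded_ops H\<lparr>carrier := M\<rparr>) (bounded_ops K\<lparr>carrier := N\<rparr>).
        (\<forall>c. \<forall>T \<in> M. \<phi> (c \<odot>\<^bsub>bounded_ops H\<^esub> T) = c \<odot>\<^bsub>bounded_ops K\<^esub> \<phi> T) \<and>
        (\<forall>T \<in> M. \<phi> (adj H T) = adj K (\<phi> T)))"


section \<open>Unitary representations\<close>

definition unitaries :: "('v, 'c) hilbert_scheme \<Rightarrow> ('v \<Rightarrow> 'v) set" where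
  "unitaries H = {U \<in> carrier (bounded_ops H).
     adj H U \<otimes>\<^bsub>bounded_ops H\<^esub> U = \<one>\<^bsub>bounded_ops H\<^esub> \<and>
     U \<otimes>\<^bsub>bounded_ops H\<^esub> adj H U = \<one>\<^bsub>bounded_ops H\<^esub>}"

definition unitary_representation ::
    "('w, 'b) monoid_scheme \<Rightarrow> ('v, 'c) hilbert_scheme \<Rightarrow> ('w \<Rightarrow> 'v \<Rightarrow> 'v) \<Rightarrow> bool" where
  "unitary_representation W H \<pi> \<longleftrightarrow>
     hilbert_space H \<and> \<pi> \<in> hom W (bounded_ops H\<lparr>carrier := unitaries H\<rparr>)"

definition rep_algebra ::
    "('w, 'b) monoid_scheme \<Rightarrow> ('v, 'c) hilbert_scheme \<Rightarrow> ('w \<Rightarrow> 'v \<Rightarrow> 'v) \<Rightarrow> ('v \<Rightarrow> 'v) set" where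
  "rep_algebra W H \<pi> = commutant H (commutant H (\<pi> ` carrier W))"

definition finite_factor_representation ::
    "('w, 'b) monoid_scheme \<Rightarrow> ('v, 'c) hilbert_scheme \<Rightarrow> ('w \<Rightarrow> 'v \<Rightarrow> 'v) \<Rightarrow> bool" where
  "finite_factor_representation W H \<pi> \<longleftrightarrow>
     unitary_representation W H \<pi> \<and>
     factor H (rep_algebra W H \<pi>) \<and> finite_algebra H (rep_algebra W H \<pi>)"

definition unitarily_equivalent :: "('w, 'b) monoid_scheme \<Rightarrow>
    ('v, 'c) hilbert_scheme \<Rightarrow> ('w \<Rightarrow> 'v \<Rightarrow> 'v) \<Rightarrow>
    ('u, 'd) hilbert_scheme \<Rightarrow> ('w \<Rightarrow> 'u \<Rightarrow> 'u) \<Rightarrow> bool" where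
  "unitarily_equivalent W H \<pi> K \<rho> \<longleftrightarrow>
     (\<exists>U. bij_betw U (carrier H) (carrier K) \<and>
        (\<forall>x \<in> carrier H. \<forall>y \<in> carrier H. U (x \<oplus>\<^bsub>H\<^esub> y) = U x \<oplus>\<^bsub>K\<^esub> U y) \<and>
        (\<forall>c. \<forall>x \<in> carrier H. U (c \<odot>\<^bsub>H\<^esub> x) = c \<odot>\<^bsub>K\<^esub> U x) \<and>
        (\<forall>x \<in> carrier H. \<forall>y \<in> carrier H. ip K (U x) (U y) = ip H x y) \<and>
        (\<forall>g \<in> carrier W. \<forall>x \<in> carrier H. U (\<pi> g x) = \<rho> g (U x)))"


section \<open>Hecke von Neumann algebras\<close>

definition hecke_operator ::
    "('w, 'b) monoid_scheme \<Rightarrow> 'w set \<Rightarrow> ('w \<Rightarrow> real) \<Rightarrow> 'w \<Rightarrow> ('w \<Rightarrow> complex) \<Rightarrow> 'w \<Rightarrow> complex" where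
  "hecke_operator W S q s = (THE T. T \<in> carrier (bounded_ops (ell2 (carrier W))) \<and>
     (\<forall>w \<in> carrier W. T (delta w) =
        (if word_length W S (s \<otimes>\<^bsub>W\<^esub> w) > word_length W S w then delta (s \<otimes>\<^bsub>W\<^esub> w)
         else delta (s \<otimes>\<^bsub>W\<^esub> w) \<oplus>\<^bsub>ell2 (carrier W)\<^esub>
              complex_of_real ((q s - 1) / sqrt (q s)) \<odot>\<^bsub>ell2 (carrier W)\<^esub> delta w)))"

definition hecke_algebra :: "('w, 'b) monoid_scheme \<Rightarrow> 'w set \<Rightarrow> ('w \<Rightarrow> real) \<Rightarrow>
    (('w \<Rightarrow> complex) \<Rightarrow> 'w \<Rightarrow> complex) set" where
  "hecke_algebra W S q =
     von_neumann_algebra (ell2 (carrier W)) hull (hecke_operator W S q ` S)"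

definition hecke_parameter :: "'s set \<Rightarrow> ('s \<Rightarrow> real) \<Rightarrow> 's \<Rightarrow> real" where
  "hecke_parameter S a = (\<lambda>s \<in> S. ((1 - \<bar>a s\<bar>) / sqrt (1 - (a s)\<^sup>2))\<^sup>2)"

lemma sqrt_hecke_parameter:
  assumes "a \<in> S \<rightarrow> {-1<..<1}" "s \<in> S"
  shows "sqrt (hecke_parameter S a s) = (1 - \<bar>a s\<bar>) / sqrt (1 - (a s)\<^sup>2)"
proof -
  have "\<bar>a s\<bar> < 1" using assms by (auto simp: Pi_iff abs_less_iff)
  moreover from this have "(a s)\<^sup>2 < 1" by (simp add: abs_square_less_1)
  ultimately show ?thesis using assms(2) by (simp add: hecke_parameter_def)
qed

text \<open>The space \<open>(-1,1)\<^sup>S\<close> with the product topology; its points are extensional on \<open>S\<close>.\<close>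

abbreviation open_cube :: "'s set \<Rightarrow> ('s \<Rightarrow> real) topology" where
  "open_cube S \<equiv> product_topology (\<lambda>_. top_of_set {-1<..<1}) S"

lemma topspace_open_cube: "topspace (open_cube S) = S \<rightarrow>\<^sub>E {-1<..<1}"
  by simp

end

theory Submission
  imports Defs
begin

text \<open>
  Put \<open>r\<^sub>s = q\<^sub>s\<^sup>1\<^sup>/\<^sup>2\<close>. A vector of \<open>\<ell>\<^sup>2(W)\<close> on which all left Hecke operators \<open>L\<^sub>s\<close> agree with their right
  counterparts is, modulo \<open>\<delta>\<^sub>e\<close>, a combination of joint eigenvectors \<open>w \<mapsto> \<Prod> \<theta>(s\<^sub>i)\<close> with
  \<open>\<theta>(s) \<in> {r\<^sub>s, - 1 / r\<^sub>s}\<close>: the commutators \<open>(L\<^sub>s L\<^sub>t - L\<^sub>t L\<^sub>s) z\<close> and then the vectors \<open>L\<^sub>s z - r\<^sub>s z\<close> satisfy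
  recurrences along chains in \<open>W\<close> whose roots are not inside the unit disc, so they vanish since
  \<open>z\<close> vanishes at infinity. There are finitely many square-summable joint eigenvectors. On their
  orthogonal complement \<open>H\<close> the Hecke operators generate a factor, which is finite because \<open>\<delta>\<^sub>e\<close> projects to
  a trace vector, and on their span they generate the diagonal algebra.

  For \<open>d\<^sub>s = \<plusminus>(1 - a\<^sub>s\<^sup>2)\<^sup>1\<^sup>/\<^sup>2\<close> the operators \<open>a\<^sub>s + d\<^sub>s L\<^sub>s\<close> are reflections that commute whenever the
  generators do, so they define a unitary representation of \<open>W\<close>, and \<open>\<lambda>\<^sub>a\<close> is its restriction to \<open>H\<close>.

  If all \<open>a\<^sub>s\<close> are small, no joint eigenvector is square-summable, since \<open>W\<close> grows too fast. Then the
  convex combinations of the conjugates of \<open>\<lambda>\<^sub>a(s)\<close> have trace \<open>a\<^sub>s\<close> and contain a sequence converging weakly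
  to the scalar \<open>a\<^sub>s\<close>. Hence \<open>a\<^sub>s\<close> is an invariant of unitary equivalence.
\<close>

text \<open>For adjacent generators \<open>s\<close>, \<open>t\<close> both characteristic roots
  avoid the open unit disc only if \<open>r s\<close> is at most \<open>r t\<close>. A recurrence
  therefore gives an eigenvalue equation only for a generator that has a neighbour with no smaller
  parameter. The other generators commute with each other, and their eigenspaces are split off one
  at a time. The main obstacle is that the chains in W grow only outside the set of words whose
  letters are \<open>s\<close>, \<open>t\<close> or commute with both. At a word inside this set the
  equation has to be transported from words with more letters; this is where connectedness of the
  Coxeter graph and the presence of three generators enter. The identity element remains an
  exception, for which a multiple of its basis vector compensates. Lengths and descents are derived
  from the bare presentation by letting W act on normal forms of words.\<close>

section \<open>Words and relations of a right-angled Coxeter group\<close>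

locale racg =
  fixes W :: "('w, 'b) monoid_scheme" (structure) and S :: "'w set" and m :: "'w \<Rightarrow> 'w \<Rightarrow> enat"
  assumes coxeter: "right_angled_coxeter_system W S m"
begin

sublocale group W
  using coxeter by (simp add: right_angled_coxeter_system_def has_presentation_def)

text \<open>Adjacency in the Coxeter graph: labels of distinct generators are 2 or \<infinity>, so
  an edge means the label \<infinity>. "Neighbour" and "adjacent" refer to this graph
  throughout.\<close>

definition nc :: "'w \<Rightarrow> 'w \<Rightarrow> bool" where
  "nc s t \<longleftrightarrow> s \<in> S \<and> t \<in> S \<and> s \<noteq> t \<and> m s t \<noteq> 2"

definition val :: "'w list \<Rightarrow> 'w" where
  "val u = foldr (\<otimes>) u \<one>"

lemma val_simps [simp]: "val [] = \<one>" "val (s # u) = s \<otimes> val u"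
  by (simp_all add: val_def)

lemma S_carrier: "s \<in> S \<Longrightarrow> s \<in> carrier W"
  using coxeter by (auto simp: right_angled_coxeter_system_def has_presentation_def)

lemma word_value_eq_one_iff: "u \<in> lists (S \<times> UNIV) \<Longrightarrow>
    word_value W u = \<one> \<longleftrightarrow> presentation_eq S (coxeter_relators S m) u []"
  using coxeter by (simp add: right_angled_coxeter_system_def has_presentation_def)

lemma nc_sym: "nc s t \<longleftrightarrow> nc t s"
  using coxeter by (auto simp: nc_def right_angled_coxeter_system_def)

lemma nc_irrefl [simp]: "\<not> nc s s"
  by (simp add: nc_def)

lemma m_cases: "s \<in> S \<Longrightarrow> t \<in> S \<Longrightarrow> m s t = (if s = t then 1 else if nc s t then \<infinity> else 2)"
  using coxeter by (auto simp: nc_def right_angled_coxeter_system_def)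

lemma relator_value: "r \<in> coxeter_relators S m \<Longrightarrow> word_value W r = \<one>"
proof -
  assume r: "r \<in> coxeter_relators S m"
  hence "set r \<subseteq> S \<times> UNIV" by (auto simp: coxeter_relators_def split: if_splits)
  hence "r \<in> lists (S \<times> UNIV)" by auto
  from word_value_eq_one_iff[OF this] presentation_eq.relator[OF r, of S "[]" "[]"]
  show ?thesis by simp
qed

lemma gen_square: assumes "s \<in> S" shows "s \<otimes> s = \<one>"
proof -
  have "concat (replicate 1 [(s, True), (s, True)]) \<in> coxeter_relators S m"
    unfolding coxeter_relators_def using assms m_cases[of s s] by (force simp: one_enat_def)
  from relator_value[OF this] show ?thesis
    using assms by (simp add: word_value_def S_carrier)
qed

lemma gen_inv: "s \<in> S \<Longrightarrow> inv s = s"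
  using gen_square S_carrier by (metis inv_equality)

lemma gen_commute: assumes "s \<in> S" "t \<in> S" "\<not> nc s t" shows "s \<otimes> t = t \<otimes> s"
proof (cases "s = t")
  case False
  have "concat (replicate 2 [(s, True), (t, True)]) \<in> coxeter_relators S m"
    unfolding coxeter_relators_def using assms m_cases[of s t] False by (force simp: numeral_eq_enat)
  from relator_value[OF this] have "(s \<otimes> t) \<otimes> (s \<otimes> t) = \<one>"
    using assms by (simp add: word_value_def S_carrier numeral_2_eq_2 m_assoc)
  hence "s \<otimes> t = inv (s \<otimes> t)"
    using assms by (simp add: S_carrier inv_equality)
  thus ?thesis
    using assms by (simp add: S_carrier inv_mult_group gen_inv)
qed simp

lemma val_closed [simp]: "u \<in> lists S \<Longrightarrow> val u \<in> carrier W"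
  by (induction u) (auto simp: S_carrier)

lemma val_append: "u \<in> lists S \<Longrightarrow> v \<in> lists S \<Longrightarrow> val (u @ v) = val u \<otimes> val v"
  by (induction u) (auto simp: S_carrier m_assoc)

lemma val_rev: "u \<in> lists S \<Longrightarrow> val (rev u) = inv (val u)"
proof (induction u)
  case (Cons a u)
  hence "rev u \<in> lists S" "[a] \<in> lists S" by auto
  from val_append[OF this] Cons show ?case by (simp add: S_carrier inv_mult_group gen_inv)
qed simp

lemma cancel_left [simp]: "s \<in> S \<Longrightarrow> w \<in> carrier W \<Longrightarrow> s \<otimes> (s \<otimes> w) = w"
  by (simp add: m_assoc[symmetric] S_carrier gen_square)

lemma cancel_right [simp]: "s \<in> S \<Longrightarrow> w \<in> carrier W \<Longrightarrow> (w \<otimes> s) \<otimes> s = w"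
  by (simp add: m_assoc S_carrier gen_square)

lemma gen_left_commute:
  "s \<in> S \<Longrightarrow> t \<in> S \<Longrightarrow> \<not> nc s t \<Longrightarrow> w \<in> carrier W \<Longrightarrow> s \<otimes> (t \<otimes> w) = t \<otimes> (s \<otimes> w)"
  by (metis S_carrier gen_commute m_assoc)

lemma ex_word: assumes "w \<in> carrier W" shows "\<exists>u \<in> lists S. val u = w"
proof -
  have "w \<in> generate W S"
    using assms coxeter by (simp add: right_angled_coxeter_system_def has_presentation_def)
  thus ?thesis
  proof (induction w rule: generate.induct)
    case one show ?case by (rule bexI[of _ "[]"]) auto
  next
    case (incl s) thus ?case by (intro bexI[of _ "[s]"]) (auto simp: S_carrier)
  next
    case (inv s) thus ?case by (intro bexI[of _ "[s]"]) (auto simp: S_carrier gen_inv)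
  next
    case (eng g h) thus ?case by (metis append_in_lists_conv val_append)
  qed
qed

text \<open>The universal property of the presentation: involutions that commute whenever the
  generators do define an action of W. It serves twice, for normal forms of group elements and for
  the unitary representation.\<close>

lemma foldr_act_cong:
  assumes sq: "\<And>s x. s \<in> S \<Longrightarrow> act s (act s x) = x"
    and com: "\<And>s t x. s \<in> S \<Longrightarrow> t \<in> S \<Longrightarrow> s \<noteq> t \<Longrightarrow> \<not> nc s t \<Longrightarrow> act s (act t x) = act t (act s x)"
    and u: "u \<in> lists S" and v: "v \<in> lists S" and eq: "val u = val v"
  shows "foldr act u x = foldr act v x"
proof -
  \<comment> \<open>A formal inverse may act like the letter itself because every
    \<open>act s\<close> is an involution.\<close>
  define ev where "ev = foldr (\<lambda>(s :: 'w, b :: bool) x. act s x)"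
  have ev_app: "ev (a @ b) x = ev a (ev b x)" for a b x
    by (simp add: ev_def)
  have rel: "ev r x = x" if "r \<in> coxeter_relators S m" for r x
  proof -
    from that obtain s t n where st: "s \<in> S" "t \<in> S" "m s t = enat n"
      and r: "r = concat (replicate n [(s, True), (t, True)])"
      unfolding coxeter_relators_def by blast
    from st m_cases[of s t] have "(s = t \<and> n = 1) \<or> (s \<noteq> t \<and> \<not> nc s t \<and> n = 2)"
      by (auto split: if_splits simp: one_enat_def numeral_eq_enat)
    thus ?thesis
    proof
      assume "s = t \<and> n = 1" thus ?thesis using st r sq by (simp add: ev_def)
    next
      assume *: "s \<noteq> t \<and> \<not> nc s t \<and> n = 2"
      hence "ev r x = act s (act t (act s (act t x)))" using r by (simp add: ev_def numeral_2_eq_2)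
      also have "\<dots> = act s (act t (act t (act s x)))" using com[OF st(1,2), of x] * by simp
      finally show ?thesis using sq st by simp
    qed
  qed
  have key: "ev a x = ev b x" if "presentation_eq S (coxeter_relators S m) a b" for a b x
    using that
  proof (induction arbitrary: x rule: presentation_eq.induct)
    case (cancel s u b v)
    have "ev [(s, b), (s, \<not> b)] y = y" for y using cancel sq by (simp add: ev_def)
    thus ?case by (metis ev_app)
  next
    case (relator r u v) thus ?case by (simp add: ev_app rel)
  qed auto
  have ev_map: "ev (map (\<lambda>s. (s, True)) a) x = foldr act a x" for a x
    by (induction a) (auto simp: ev_def)
  have wv: "word_value W (map (\<lambda>s. (s, True)) a) = val a" for a
    by (induction a) (auto simp: word_value_def)
  have undo: "foldr act (rev a) (foldr act a y) = y" if "a \<in> lists S" for a y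
    using that by (induction a arbitrary: y) (auto simp: sq)
  \<comment> \<open>The presentation only decides which words represent the identity, so
    \<open>u\<close> and \<open>v\<close> are compared through \<open>u @ rev v\<close>.\<close>
  have "val (u @ rev v) = \<one>"
    using val_append[OF u, of "rev v"] val_rev[OF v] v eq val_closed[OF v] by (simp add: in_lists_conv_set)
  hence "word_value W (map (\<lambda>s. (s, True)) (u @ rev v)) = \<one>" using wv by metis
  moreover have "map (\<lambda>s. (s, True)) (u @ rev v) \<in> lists (S \<times> UNIV)"
    using u v by (auto simp: in_lists_conv_set)
  ultimately have "presentation_eq S (coxeter_relators S m) (map (\<lambda>s. (s, True)) (u @ rev v)) []"
    using word_value_eq_one_iff by blast
  from key[OF this, of "foldr act v x"] have "foldr act (u @ rev v) (foldr act v x) = foldr act v x"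
    by (simp add: ev_map del: map_append) (simp add: ev_def)
  thus ?thesis using undo[OF v] by simp
qed

section \<open>Reduced words\<close>

text \<open>A word is determined up to swaps of commuting letters by its projections: \<open>proj u s\<close> records the
  positions of \<open>s\<close> among the letters that do not commute with \<open>s\<close>.\<close>

definition proj :: "'w list \<Rightarrow> 'w \<Rightarrow> bool list" where
  "proj u s = map (\<lambda>t. t = s) (filter (\<lambda>t. t = s \<or> nc s t) u)"

text \<open>For \<open>p = proj u\<close> this says that the first \<open>s\<close> of
  \<open>u\<close> precedes every letter that could block it, so that it can be commuted to the
  front.\<close>

definition starts :: "('w \<Rightarrow> bool list) \<Rightarrow> 'w \<Rightarrow> bool" where
  "starts p s \<longleftrightarrow> p s \<noteq> [] \<and> hd (p s)"

text \<open>A combinatorial form of reducedness: prepending \<open>s\<close> is forbidden if it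
  would cancel against an \<open>s\<close> that can be brought to the front. \<open>len_red\<close>
  and \<open>red_len\<close> identify these words with those of minimal length.\<close>

fun red :: "'w list \<Rightarrow> bool" where
  "red [] \<longleftrightarrow> True"
| "red (s # u) \<longleftrightarrow> s \<in> S \<and> red u \<and> \<not> starts (proj u) s"

lemma red_lists: "red u \<Longrightarrow> u \<in> lists S"
  by (induction u) auto

lemma proj_Nil [simp]: "proj [] = (\<lambda>_. [])"
  by (simp add: proj_def fun_eq_iff)

lemma proj_Cons: "proj (s # u) t = (if t = s \<or> nc t s then (s = t) # proj u t else proj u t)"
  by (auto simp: proj_def)

lemma proj_append: "proj (u @ v) t = proj u t @ proj v t"
  by (simp add: proj_def)

lemma starts_split: "starts (proj u) s \<Longrightarrow> \<exists>x y. u = x @ s # y \<and> (\<forall>t \<in> set x. t \<noteq> s \<and> \<not> nc s t)"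
proof (induction u)
  case (Cons a u)
  show ?case
  proof (cases "s = a \<or> nc s a")
    case True
    hence "a = s" using Cons.prems by (auto simp: starts_def proj_Cons)
    thus ?thesis by (intro exI[of _ "[]"] exI[of _ u]) auto
  next
    case False
    hence "starts (proj u) s" using Cons.prems by (simp add: starts_def proj_Cons)
    then obtain x y where "u = x @ s # y" "\<forall>t \<in> set x. t \<noteq> s \<and> \<not> nc s t" using Cons.IH by blast
    thus ?thesis using False by (intro exI[of _ "a # x"] exI[of _ y]) auto
  qed
qed (simp add: starts_def)

lemma proj_indep: "\<forall>t \<in> set x. t \<noteq> s \<and> \<not> nc s t \<Longrightarrow> proj x s = []"
  by (induction x) (auto simp: proj_Cons)

lemma starts_splitI: "\<forall>t \<in> set x. t \<noteq> s \<and> \<not> nc s t \<Longrightarrow> starts (proj (x @ s # y)) s"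
  by (simp add: starts_def proj_append proj_indep proj_Cons)

lemma proj_move:
  assumes "\<forall>t \<in> set x. t \<noteq> s \<and> \<not> nc s t"
  shows "proj (x @ s # y) = proj (s # x @ y)"
proof
  fix t
  show "proj (x @ s # y) t = proj (s # x @ y) t"
    using assms
  proof (induction x)
    case (Cons a x)
    hence IH: "proj (x @ s # y) t = proj (s # x @ y) t" by auto
    show ?case using IH Cons.prems by (auto simp: proj_Cons nc_sym)
  qed simp
qed

lemma starts_append_indep: "\<forall>t \<in> set x. t \<noteq> s \<and> \<not> nc s t \<Longrightarrow> starts (proj (x @ y)) s = starts (proj y) s"
  by (simp add: starts_def proj_append proj_indep)

lemma red_remove:
  assumes "red (x @ s # y)" "\<forall>t \<in> set x. t \<noteq> s \<and> \<not> nc s t"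
  shows "red (x @ y) \<and> \<not> starts (proj (x @ y)) s"
proof
  show "red (x @ y)"
    using assms
  proof (induction x)
    case (Cons a x)
    hence "proj (x @ s # y) a = proj (x @ y) a" by (auto simp: proj_append proj_Cons nc_sym)
    thus ?case using Cons by (auto simp: starts_def)
  qed simp
  have "red (s # y)" using assms(1) by (induction x) auto
  thus "\<not> starts (proj (x @ y)) s" using assms(2) by (simp add: starts_append_indep)
qed

lemma val_move:
  assumes "\<forall>t \<in> set x. t \<noteq> s \<and> \<not> nc s t" "x \<in> lists S" "y \<in> lists S" "s \<in> S"
  shows "val (x @ s # y) = s \<otimes> val (x @ y)"
  using assms
proof (induction x)
  case (Cons a x)
  have "val (x @ y) \<in> carrier W" by (rule val_closed) (use Cons.prems in auto)
  hence "a \<otimes> (s \<otimes> val (x @ y)) = s \<otimes> (a \<otimes> val (x @ y))"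
    using Cons.prems by (intro gen_left_commute) (auto simp: nc_sym)
  thus ?case using Cons by auto
qed simp

text \<open>Van der Waerden's trick: a generator cancels a letter at the front of a reduced word or
  is prepended to it, expressed on projections. Elsewhere it is the identity, so that the relations
  hold for every argument, as \<open>foldr_act_cong\<close> requires.\<close>

definition act :: "'w \<Rightarrow> ('w \<Rightarrow> bool list) \<Rightarrow> 'w \<Rightarrow> bool list" where
  "act s p = (if p \<in> proj ` Collect red then
      (if starts p s then (\<lambda>t. if t = s \<or> nc t s then tl (p t) else p t)
       else (\<lambda>t. if t = s \<or> nc t s then (s = t) # p t else p t))
    else p)"

lemma act_push: "red u \<Longrightarrow> \<not> starts (proj u) s \<Longrightarrow> act s (proj u) = proj (s # u)"
  by (auto simp: act_def fun_eq_iff proj_Cons)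

lemma act_pop:
  assumes "red (x @ s # y)" "\<forall>t \<in> set x. t \<noteq> s \<and> \<not> nc s t"
  shows "act s (proj (x @ s # y)) = proj (x @ y)"
proof -
  have "proj (x @ s # y) \<in> proj ` Collect red" using assms by auto
  moreover have "starts (proj (x @ s # y)) s" by (rule starts_splitI) (rule assms)
  ultimately show ?thesis
    unfolding act_def proj_move[OF assms(2)] by (simp add: fun_eq_iff proj_Cons)
qed

lemma act_red:
  assumes "red u" "s \<in> S"
  shows "\<exists>v. red v \<and> act s (proj u) = proj v \<and> val v = s \<otimes> val u \<and> length v \<le> Suc (length u)"
proof (cases "starts (proj u) s")
  case True
  then obtain x y where u: "u = x @ s # y" and x: "\<forall>t \<in> set x. t \<noteq> s \<and> \<not> nc s t"
    using starts_split by blast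
  have l: "x \<in> lists S" "y \<in> lists S" using red_lists[OF assms(1)] u by auto
  hence "s \<otimes> val u = val (x @ y)" using val_move[OF x l assms(2)] u assms(2) val_closed[of "x @ y"] by auto
  thus ?thesis using red_remove act_pop assms u x by (intro exI[of _ "x @ y"]) auto
next
  case False
  thus ?thesis using act_push assms by (intro exI[of _ "s # u"]) auto
qed

lemma act_square: assumes "s \<in> S" shows "act s (act s p) = p"
proof (cases "p \<in> proj ` Collect red")
  case True
  then obtain u where u: "red u" "p = proj u" by blast
  show ?thesis
  proof (cases "starts (proj u) s")
    case True
    then obtain x y where xy: "u = x @ s # y" and x: "\<forall>t \<in> set x. t \<noteq> s \<and> \<not> nc s t"
      using starts_split by blast
    have "act s p = proj (x @ y)" using act_pop u xy x by auto
    moreover have "act s (proj (x @ y)) = proj (s # x @ y)"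
      using red_remove u xy x by (intro act_push) auto
    ultimately show ?thesis using proj_move[OF x] u xy by metis
  next
    case False
    have r: "red (s # u)" using u False assms by auto
    have "act s p = proj (s # u)" using act_push u False by auto
    moreover have "act s (proj ([] @ s # u)) = proj ([] @ u)" by (rule act_pop) (use r in auto)
    ultimately show ?thesis using u by simp
  qed
qed (simp add: act_def)

text \<open>An \<open>s\<close> that can be moved to the front precedes every \<open>t\<close>
  adjacent to it and so heads the list of \<open>t\<close> as a foreign letter. In particular, two
  adjacent generators cannot both start a word.\<close>

lemma starts_nc:
  assumes "starts (proj u) s" "nc t s" shows "\<exists>l. proj u t = False # l"
proof -
  obtain x y where xy: "u = x @ s # y" "\<forall>t \<in> set x. t \<noteq> s \<and> \<not> nc s t"
    using assms starts_split by blast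
  hence "proj u = proj (s # x @ y)" using proj_move by auto
  thus ?thesis using assms by (auto simp: proj_Cons)
qed

lemma act_commute:
  assumes "s \<in> S" "t \<in> S" "s \<noteq> t" "\<not> nc s t" shows "act s (act t p) = act t (act s p)"
proof (cases "p \<in> proj ` Collect red")
  case True
  then obtain u where u: "red u" "p = proj u" by blast
  obtain v v' where v: "red v" "act s p = proj v" "red v'" "act t p = proj v'"
    using act_red u assms by metis
  have V: "act s p \<in> proj ` Collect red" "act t p \<in> proj ` Collect red" using v by auto
  have ts: "\<not> nc t s" using assms nc_sym by blast
  have tops: "starts (act t p) s = starts p s" "starts (act s p) t = starts p t"
    using assms ts by (auto simp: act_def starts_def)
  \<comment> \<open>Only lists of generators adjacent to both \<open>s\<close> and \<open>t\<close>
    are changed twice. Every entry pushed there is False, and so is every entry popped, so the order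
    is immaterial.\<close>
  have hd_s: "\<exists>l. p x = False # l" if "starts p s" "nc x s" for x using starts_nc that u by auto
  have hd_t: "\<exists>l. p x = False # l" if "starts p t" "nc x t" for x using starts_nc that u by auto
  show ?thesis
  proof
    fix x
    have A: "act s (act t p) x = (if x = s \<or> nc x s then (if starts p s then tl (act t p x) else (s = x) # act t p x) else act t p x)"
      by (subst act_def) (auto simp: V tops)
    have B: "act t (act s p) x = (if x = t \<or> nc x t then (if starts p t then tl (act s p x) else (t = x) # act s p x) else act s p x)"
      by (subst act_def) (auto simp: V tops)
    have C: "act t p x = (if x = t \<or> nc x t then (if starts p t then tl (p x) else (t = x) # p x) else p x)"
      "act s p x = (if x = s \<or> nc x s then (if starts p s then tl (p x) else (s = x) # p x) else p x)"
      using True by (auto simp: act_def)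
    show "act s (act t p) x = act t (act s p) x"
      unfolding A B C using assms ts hd_s[of x] hd_t[of x] by auto
  qed
qed (simp add: act_def)

lemma foldr_act_red: "red u \<Longrightarrow> foldr act u (\<lambda>_. []) = proj u"
  by (induction u) (auto simp: act_push)

text \<open>A reduced word rebuilds its own projections from the empty ones when its letters act,
  and the action depends on the group element alone.\<close>

lemma red_proj_unique:
  assumes "red u" "red v" "val u = val v" shows "proj u = proj v"
proof -
  have "foldr act u (\<lambda>_. []) = foldr act v (\<lambda>_. [])"
    by (rule foldr_act_cong) (use assms act_square act_commute red_lists in blast)+
  thus ?thesis using assms by (simp add: foldr_act_red)
qed

lemma ex_red_le: "u \<in> lists S \<Longrightarrow> \<exists>v. red v \<and> val v = val u \<and> length v \<le> length u"
proof (induction u)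
  case (Cons s u)
  then obtain v where v: "red v" "val v = val u" "length v \<le> length u" by auto
  obtain v' where "red v'" "val v' = s \<otimes> val v" "length v' \<le> Suc (length v)"
    using act_red[OF v(1), of s] Cons.prems by auto
  thus ?case using v by (intro exI[of _ v']) auto
qed (auto intro: exI[of _ "[]"])

lemma ex_red: "w \<in> carrier W \<Longrightarrow> \<exists>u. red u \<and> val u = w"
  using ex_word ex_red_le by metis

lemma count_proj: "count (mset u) s = length (filter (\<lambda>b. b) (proj u s))"
  by (induction u) (auto simp: proj_Cons)

lemma red_mset_unique: "red u \<Longrightarrow> red v \<Longrightarrow> val u = val v \<Longrightarrow> mset u = mset v"
  by (intro multiset_eqI) (auto simp: count_proj dest: red_proj_unique)

text \<open>By \<open>red_mset_unique\<close> all reduced words for \<open>w\<close> have the same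
  letters with multiplicity. Besides the length this records the support of \<open>w\<close>, which
  decides with which generators \<open>w\<close> commutes.\<close>

definition letters :: "'w \<Rightarrow> 'w multiset" where
  "letters w = mset (SOME u. red u \<and> val u = w)"

lemma letters_red: "red u \<Longrightarrow> letters (val u) = mset u"
  unfolding letters_def by (rule red_mset_unique; metis (mono_tags, lifting) someI_ex)

lemma set_letters: "w \<in> carrier W \<Longrightarrow> set_mset (letters w) \<subseteq> S"
  using ex_red letters_red red_lists by (metis in_listsD set_mset_mset subsetI)

abbreviation len :: "'w \<Rightarrow> nat" where "len w \<equiv> size (letters w)"

lemma len_red: "red u \<Longrightarrow> len (val u) = length u"
  by (simp add: letters_red)

lemma len_le: "u \<in> lists S \<Longrightarrow> len (val u) \<le> length u"
  using ex_red_le len_red by metis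

lemma word_length_eq: assumes "w \<in> carrier W" shows "word_length W S w = len w"
  unfolding word_length_def val_def[symmetric]
proof (rule Least_equality)
  obtain u where "red u" "val u = w" using ex_red assms by blast
  thus "\<exists>ss\<in>lists S. length ss = len w \<and> val ss = w"
    using len_red red_lists by (intro bexI[of _ u]) auto
qed (use len_le in auto)

definition desc :: "'w \<Rightarrow> 'w \<Rightarrow> bool" where
  "desc s w \<longleftrightarrow> len (s \<otimes> w) < len w"

lemma desc_red_aux:
  assumes "red u" "s \<in> S"
  shows "(starts (proj u) s \<longrightarrow> letters (val u) = add_mset s (letters (s \<otimes> val u))) \<and>
    (\<not> starts (proj u) s \<longrightarrow> letters (s \<otimes> val u) = add_mset s (letters (val u)))"
proof (intro conjI impI)
  assume "starts (proj u) s"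
  then obtain x y where xy: "u = x @ s # y" and x: "\<forall>t \<in> set x. t \<noteq> s \<and> \<not> nc s t"
    using starts_split by blast
  have l: "x \<in> lists S" "y \<in> lists S" using red_lists[OF assms(1)] xy by auto
  have "s \<otimes> val u = val (x @ y)" using val_move[OF x l assms(2)] xy assms(2) l val_closed[of "x @ y"] by auto
  moreover have "red (x @ y)" using red_remove assms xy x by auto
  ultimately show "letters (val u) = add_mset s (letters (s \<otimes> val u))"
    using letters_red[of "x @ y"] letters_red[OF assms(1)] xy by simp
next
  assume "\<not> starts (proj u) s"
  hence "red (s # u)" using assms by simp
  from letters_red[OF this] letters_red[OF assms(1)]
  show "letters (s \<otimes> val u) = add_mset s (letters (val u))" by simp
qed

lemma desc_red: "red u \<Longrightarrow> s \<in> S \<Longrightarrow> desc s (val u) \<longleftrightarrow> starts (proj u) s"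
  using desc_red_aux[of u s] unfolding desc_def
  by (metis add.commute lessI not_less_eq plus_1_eq_Suc size_add_mset not_less_iff_gr_or_eq)

lemma letters_up: "s \<in> S \<Longrightarrow> w \<in> carrier W \<Longrightarrow> \<not> desc s w \<Longrightarrow> letters (s \<otimes> w) = add_mset s (letters w)"
  using ex_red[of w] desc_red desc_red_aux by metis

lemma letters_down: "s \<in> S \<Longrightarrow> w \<in> carrier W \<Longrightarrow> desc s w \<Longrightarrow> letters w = add_mset s (letters (s \<otimes> w))"
  using ex_red[of w] desc_red desc_red_aux by metis

lemma desc_flip: "s \<in> S \<Longrightarrow> w \<in> carrier W \<Longrightarrow> desc s (s \<otimes> w) \<longleftrightarrow> \<not> desc s w"
  by (metis cancel_left desc_def letters_up not_less_iff_gr_or_eq lessI size_add_mset)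

lemma red_len: "u \<in> lists S \<Longrightarrow> len (val u) = length u \<Longrightarrow> red u"
proof (induction u)
  case (Cons s u)
  have s: "s \<in> S" "u \<in> lists S" using Cons.prems by auto
  have "len (s \<otimes> val u) = Suc (length u)" using Cons.prems by simp
  moreover have "len (val u) \<le> length u" using len_le s by auto
  moreover have "desc s (val u) \<or> len (s \<otimes> val u) = Suc (len (val u))"
    using letters_up[OF s(1) val_closed[OF s(2)]] by (cases "desc s (val u)") simp_all
  ultimately have "\<not> desc s (val u)" "len (val u) = length u" unfolding desc_def by linarith+
  thus ?case using Cons.IH s desc_red by auto
qed simp

text \<open>Inversion reverses words and hence cannot increase the length; being an involution, it
  preserves it.\<close>

lemma red_rev: assumes "red u" shows "red (rev u)"
proof (rule red_len)
  have u: "u \<in> lists S" using assms red_lists by auto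
  thus "rev u \<in> lists S" by auto
  have le: "len (inv w) \<le> len w" if w: "w \<in> carrier W" for w
  proof -
    obtain v where v: "red v" "val v = w" using ex_red w by blast
    have "len (inv w) \<le> length (rev v)" using len_le[of "rev v"] v val_rev[of v] red_lists[OF v(1)] by (simp add: in_lists_conv_set)
    thus ?thesis using len_red[OF v(1)] v by simp
  qed
  have "len (val u) = len (inv (val u))"
    using le[of "val u"] le[of "inv (val u)"] val_closed[OF u] by simp
  thus "len (val (rev u)) = length (rev u)" using val_rev[OF u] len_red[OF assms] by simp
qed

lemma letters_inv: assumes "w \<in> carrier W" shows "letters (inv w) = letters w"
proof -
  obtain u where u: "red u" "val u = w" using ex_red assms by blast
  have "letters (val (rev u)) = mset u" using letters_red red_rev u by (metis mset_rev)
  thus ?thesis using u val_rev red_lists letters_red by metis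
qed

lemma len_gen_le: "s \<in> S \<Longrightarrow> w \<in> carrier W \<Longrightarrow> len (s \<otimes> w) \<le> Suc (len w)"
  using letters_up[of s w] by (cases "desc s w") (auto simp: desc_def)

definition rdesc :: "'w \<Rightarrow> 'w \<Rightarrow> bool" where
  "rdesc s w \<longleftrightarrow> len (w \<otimes> s) < len w"

lemma rdesc_inv: "s \<in> S \<Longrightarrow> w \<in> carrier W \<Longrightarrow> rdesc s w \<longleftrightarrow> desc s (inv w)"
  unfolding rdesc_def desc_def
  by (metis S_carrier gen_inv inv_mult_group letters_inv m_closed inv_closed)

lemma letters_inv_mult: "s \<in> S \<Longrightarrow> w \<in> carrier W \<Longrightarrow> letters (s \<otimes> inv w) = letters (w \<otimes> s)"
  by (metis S_carrier gen_inv inv_mult_group letters_inv m_closed inv_closed)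

lemma letters_rup: "s \<in> S \<Longrightarrow> w \<in> carrier W \<Longrightarrow> \<not> rdesc s w \<Longrightarrow> letters (w \<otimes> s) = add_mset s (letters w)"
  using letters_up[of s "inv w"] by (simp add: rdesc_inv letters_inv letters_inv_mult)

lemma letters_rdown: "s \<in> S \<Longrightarrow> w \<in> carrier W \<Longrightarrow> rdesc s w \<Longrightarrow> letters w = add_mset s (letters (w \<otimes> s))"
  using letters_down[of s "inv w"] by (simp add: rdesc_inv letters_inv letters_inv_mult)

lemma rdesc_flip: "s \<in> S \<Longrightarrow> w \<in> carrier W \<Longrightarrow> rdesc s (w \<otimes> s) \<longleftrightarrow> \<not> rdesc s w"
  by (metis cancel_right rdesc_def letters_rup not_less_iff_gr_or_eq lessI size_add_mset)

definition indep :: "'w \<Rightarrow> 'w \<Rightarrow> bool" where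
  "indep s w \<longleftrightarrow> (\<forall>a \<in># letters w. a \<noteq> s \<and> \<not> nc s a)"

lemma desc_nc: assumes "w \<in> carrier W" "desc s w" "desc t w" "s \<in> S" "t \<in> S" shows "\<not> nc s t"
proof
  assume "nc s t"
  obtain u where u: "red u" "val u = w" using ex_red assms by blast
  hence "starts (proj u) s" "starts (proj u) t" using desc_red assms by auto
  thus False using starts_nc[of u t s] \<open>nc s t\<close> by (auto simp: starts_def)
qed

lemma rdesc_nc: "w \<in> carrier W \<Longrightarrow> rdesc s w \<Longrightarrow> rdesc t w \<Longrightarrow> s \<in> S \<Longrightarrow> t \<in> S \<Longrightarrow> \<not> nc s t"
  using desc_nc[of "inv w" s t] by (simp add: rdesc_inv)

text \<open>The folding condition in right-angled form. In a reduced word for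
  \<open>w \<otimes> t\<close> the \<open>s\<close> that can be moved to the front must be the final
  letter, since \<open>w\<close> has no such \<open>s\<close>. So \<open>t\<close> equals
  \<open>s\<close> and passes every letter of \<open>w\<close>.\<close>

lemma folding:
  assumes "w \<in> carrier W" "s \<in> S" "t \<in> S" "\<not> desc s w" "\<not> rdesc t w" "desc s (w \<otimes> t)"
  shows "s = t \<and> indep s w"
proof -
  obtain u where u: "red u" "val u = w" using ex_red assms by blast
  have l: "u \<in> lists S" using u red_lists by auto
  have v: "val (u @ [t]) = w \<otimes> t" using val_append[OF l, of "[t]"] u assms by (simp add: S_carrier)
  have "len (w \<otimes> t) = Suc (len w)" using letters_rup assms by auto
  hence "red (u @ [t])" using v u len_red l assms by (intro red_len) auto
  hence t: "starts (proj (u @ [t])) s" using desc_red v assms by metis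
  have nt: "\<not> starts (proj u) s" using desc_red u assms by metis
  have "proj u s = []" using t nt by (cases "proj u s") (auto simp: starts_def proj_append)
  moreover from this have "s = t" using t by (auto simp: starts_def proj_append proj_Cons split: if_splits)
  ultimately show ?thesis
    using letters_red[OF u(1)] u(2) by (auto simp: indep_def proj_def filter_empty_conv)
qed

lemma indep_commute: assumes "w \<in> carrier W" "s \<in> S" "indep s w" shows "s \<otimes> w = w \<otimes> s"
proof -
  obtain u where u: "red u" "val u = w" using ex_red assms by blast
  have l: "u \<in> lists S" using u red_lists by auto
  have x: "\<forall>t\<in>set u. t \<noteq> s \<and> \<not> nc s t" using assms u letters_red by (auto simp: indep_def)
  have "val (u @ [s]) = s \<otimes> val u" using val_move[OF x l _ assms(2), of "[]"] by simp
  thus ?thesis using u val_append[OF l, of "[s]"] assms by (auto simp: S_carrier)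
qed

lemma commute_indep:
  assumes "w \<in> carrier W" "s \<in> S" "s \<otimes> w = w \<otimes> s" "\<not> desc s w" shows "indep s w"
proof -
  have "\<not> rdesc s w" using assms by (simp add: desc_def rdesc_def)
  moreover have "desc s (w \<otimes> s)" using assms desc_flip by metis
  ultimately show ?thesis using folding assms by blast
qed

lemma desc_if_commuting_letters:
  assumes "w \<in> carrier W" "s \<in># letters w" "\<forall>a \<in># letters w. \<not> nc s a" shows "desc s w"
proof -
  obtain u where u: "red u" "val u = w" using ex_red assms by blast
  have s: "s \<in> S" using assms set_letters by auto
  have ms: "letters w = mset u" using u letters_red by auto
  hence "s \<in> set u" using assms by auto
  then obtain x y where "u = x @ s # y" "s \<notin> set x" by (meson split_list_first)
  hence "starts (proj u) s" using assms ms by (auto intro!: starts_splitI)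
  thus ?thesis using desc_red u s by blast
qed

lemma desc_commuting_mult:
  assumes "w \<in> carrier W" "s \<in> S" "v \<in> S" "v \<noteq> s" "\<not> nc v s" "\<not> desc s w" shows "\<not> desc s (v \<otimes> w)"
proof (cases "desc v w")
  case True
  show ?thesis
  proof
    assume "desc s (v \<otimes> w)"
    hence "Suc (len (s \<otimes> (v \<otimes> w))) = len (v \<otimes> w)" using letters_down assms by (auto simp: S_carrier)
    moreover have "Suc (len (v \<otimes> w)) = len w" using letters_down[of v w] True assms by auto
    moreover have "len (s \<otimes> w) = Suc (len w)" using letters_up assms by auto
    moreover have "v \<otimes> (s \<otimes> (v \<otimes> w)) = s \<otimes> w"
      using gen_left_commute[of v s "v \<otimes> w"] assms by (simp add: S_carrier)
    hence "len (s \<otimes> w) \<le> Suc (len (s \<otimes> (v \<otimes> w)))"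
      using len_gen_le[of v "s \<otimes> (v \<otimes> w)"] assms by (simp add: S_carrier)
    ultimately show False by simp
  qed
next
  case False
  obtain u where u: "red u" "val u = w" using ex_red assms by blast
  have "red (v # u)" using u False desc_red assms by auto
  moreover have "\<not> starts (proj (v # u)) s"
    using desc_red u assms by (auto simp: starts_def proj_Cons nc_sym)
  ultimately show ?thesis using desc_red[of "v # u" s] u assms by auto
qed

end

context racg
begin

section \<open>Irreducibility\<close>

lemma letters_one [simp]: "letters \<one> = {#}"
  using letters_red[of "[]"] by simp

lemma letters_empty: "w \<in> carrier W \<Longrightarrow> letters w = {#} \<Longrightarrow> w = \<one>"
  using ex_red letters_red by (metis mset_zero_iff val_simps(1))

lemma letters_subset: assumes "s \<in> S" "w \<in> carrier W"
  shows "set_mset (letters (s \<otimes> w)) \<subseteq> insert s (set_mset (letters w))"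
  by (cases "desc s w") (use letters_up letters_down assms in auto)

lemma letters_val: "u \<in> lists S \<Longrightarrow> set_mset (letters (val u)) \<subseteq> set u"
proof (induction u)
  case (Cons s u)
  thus ?case using letters_subset[of s "val u"] by auto
qed simp

lemma generate_eq_val: assumes "B \<subseteq> S" shows "generate W B = val ` lists B"
proof
  have BS: "u \<in> lists S" if "u \<in> lists B" for u using that assms by auto
  show "generate W B \<subseteq> val ` lists B"
  proof
    fix w assume "w \<in> generate W B"
    thus "w \<in> val ` lists B"
    proof (induction w rule: generate.induct)
      case one show ?case by (rule image_eqI[of _ _ "[]"]) auto
    next
      case (incl s) thus ?case using assms by (intro image_eqI[of _ _ "[s]"]) (auto simp: S_carrier)
    next
      case (inv s) thus ?case using assms by (intro image_eqI[of _ _ "[s]"]) (auto simp: S_carrier gen_inv subset_iff)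
    next
      case (eng g h)
      then obtain u v where uv: "u \<in> lists B" "v \<in> lists B" "g = val u" "h = val v" by blast
      hence "g \<otimes> h = val (u @ v)" using val_append[OF BS BS] by simp
      moreover have "u @ v \<in> lists B" using uv by auto
      ultimately show ?case by blast
    qed
  qed
  have "val u \<in> generate W B" if "u \<in> lists B" for u
    using that by (induction u) (auto intro: generate.one generate.eng generate.incl)
  thus "val ` lists B \<subseteq> generate W B" by blast
qed

lemma commute_if_independent:
  assumes "u \<in> lists S" "v \<in> lists S" "\<And>a b. a \<in> set u \<Longrightarrow> b \<in> set v \<Longrightarrow> \<not> nc a b"
  shows "val u \<otimes> val v = val v \<otimes> val u"
  using assms
proof (induction u rule: list.induct)
  case (Cons s u)
  have s: "s \<in> S" and u: "val u \<in> carrier W" using Cons.prems(1) by auto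
  have sv: "s \<otimes> val v = val v \<otimes> s"
    using Cons.prems(2,3)
  proof (induction v rule: list.induct)
    case (Cons t v)
    have c: "val v \<in> carrier W" "t \<in> S" using Cons.prems by auto
    have "s \<otimes> (t \<otimes> val v) = t \<otimes> (s \<otimes> val v)" using Cons.prems c s by (intro gen_left_commute) auto
    thus ?case using Cons c s by (simp add: m_assoc S_carrier)
  qed (use s in \<open>simp add: S_carrier\<close>)
  have "s \<otimes> val u \<otimes> val v = s \<otimes> (val v \<otimes> val u)" using Cons s u by (simp add: m_assoc S_carrier)
  also have "\<dots> = val v \<otimes> (s \<otimes> val u)"
    using sv s u val_closed[OF Cons.prems(2)] by (simp add: m_assoc[symmetric] S_carrier)
  finally show ?case by simp
qed simp

text \<open>Irreducibility makes the Coxeter graph connected: if no edge left \<open>B\<close>, the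
  subgroups generated by \<open>B\<close> and its complement would commute, meet trivially and
  generate W, so that multiplication would be an isomorphism from their product.\<close>

lemma connected:
  assumes irr: "irreducible_system W S" and B: "B \<subseteq> S" "B \<noteq> {}" "B \<noteq> S"
  shows "\<exists>b \<in> B. \<exists>v \<in> S - B. nc b v"
proof (rule ccontr)
  assume no: "\<not> ?thesis"
  define B' where "B' = S - B"
  have B': "B' \<subseteq> S" "B' \<noteq> {}" "B \<inter> B' = {}" "B \<union> B' = S" using B by (auto simp: B'_def)
  define G1 where "G1 = generate W B"
  define G2 where "G2 = generate W B'"
  have sub: "subgroup G1 W" "subgroup G2 W"
    unfolding G1_def G2_def using B B' S_carrier by (auto intro!: generate_is_subgroup)
  have car: "g \<in> carrier W" if "g \<in> G1 \<or> g \<in> G2" for g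
    using that sub by (auto dest: subgroup.mem_carrier)
  have com: "x \<otimes> y = y \<otimes> x" if xy: "x \<in> G1" "y \<in> G2" for x y
  proof -
    obtain u v where uv: "u \<in> lists B" "v \<in> lists B'" "x = val u" "y = val v"
      using xy generate_eq_val B B' by (auto simp: G1_def G2_def)
    show ?thesis unfolding uv
      by (rule commute_if_independent) (use uv B B' no in \<open>auto simp: B'_def\<close>)
  qed
  \<comment> \<open>The support of such an element lies both in \<open>B\<close> and in its
    complement.\<close>
  have triv: "x = \<one>" if "x \<in> G1" "x \<in> G2" for x
  proof -
    have "x \<in> val ` lists B" "x \<in> val ` lists B'"
      using that generate_eq_val[OF B(1)] generate_eq_val[OF B'(1)] by (simp_all add: G1_def G2_def)
    then obtain u v where uv: "u \<in> lists B" "v \<in> lists B'" "x = val u" "x = val v"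
      by blast
    have l: "u \<in> lists S" "v \<in> lists S"
      using subsetD[OF lists_mono[OF B(1)] uv(1)] subsetD[OF lists_mono[OF B'(1)] uv(2)] by auto
    have "set_mset (letters x) \<subseteq> set u" "set_mset (letters x) \<subseteq> set v"
      using letters_val[OF l(1)] letters_val[OF l(2)] unfolding uv(3)[symmetric] uv(4)[symmetric] .
    hence "set_mset (letters x) \<subseteq> B \<inter> B'" using uv by auto
    hence "letters x = {#}" using B'(3) by auto
    thus ?thesis using that car letters_empty by auto
  qed
  have "(\<lambda>(x, y). x \<otimes> y) \<in> iso (W\<lparr>carrier := G1\<rparr> \<times>\<times> W\<lparr>carrier := G2\<rparr>) W"
    unfolding iso_def
  proof (intro CollectI conjI homI)
    fix a b assume "a \<in> carrier (W\<lparr>carrier := G1\<rparr> \<times>\<times> W\<lparr>carrier := G2\<rparr>)"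
      "b \<in> carrier (W\<lparr>carrier := G1\<rparr> \<times>\<times> W\<lparr>carrier := G2\<rparr>)"
    then obtain x y x' y' where xy: "a = (x, y)" "b = (x', y')" "x \<in> G1" "x' \<in> G1" "y \<in> G2" "y' \<in> G2"
      by auto
    have "x \<otimes> x' \<otimes> (y \<otimes> y') = x \<otimes> (x' \<otimes> y) \<otimes> y'" using xy car by (simp add: m_assoc)
    also have "\<dots> = x \<otimes> (y \<otimes> x') \<otimes> y'" by (simp only: com[OF xy(4,5)])
    also have "\<dots> = x \<otimes> y \<otimes> (x' \<otimes> y')" using xy car by (simp add: m_assoc)
    finally show "(case a \<otimes>\<^bsub>W\<lparr>carrier := G1\<rparr> \<times>\<times> W\<lparr>carrier := G2\<rparr>\<^esub> b of (x, y) \<Rightarrow> x \<otimes> y) =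
        (case a of (x, y) \<Rightarrow> x \<otimes> y) \<otimes> (case b of (x, y) \<Rightarrow> x \<otimes> y)"
      using xy by simp
  next
    show "bij_betw (\<lambda>(x, y). x \<otimes> y) (carrier (W\<lparr>carrier := G1\<rparr> \<times>\<times> W\<lparr>carrier := G2\<rparr>)) (carrier W)"
      unfolding bij_betw_def
    proof
      show "inj_on (\<lambda>(x, y). x \<otimes> y) (carrier (W\<lparr>carrier := G1\<rparr> \<times>\<times> W\<lparr>carrier := G2\<rparr>))"
      proof (rule inj_onI, clarsimp)
        fix x y x' y' assume xy: "x \<in> G1" "y \<in> G2" "x' \<in> G1" "y' \<in> G2" "x \<otimes> y = x' \<otimes> y'"
        have c: "x \<in> carrier W" "y \<in> carrier W" "x' \<in> carrier W" "y' \<in> carrier W" using xy car by auto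
        have "inv x' \<otimes> x = y' \<otimes> inv y"
        proof -
          have "x \<otimes> y \<otimes> inv y = x' \<otimes> y' \<otimes> inv y" by (simp only: xy(5))
          hence "x = x' \<otimes> (y' \<otimes> inv y)" using c by (simp only: m_assoc r_inv r_one inv_closed m_closed)
          moreover have "inv x' \<otimes> (x' \<otimes> (y' \<otimes> inv y)) = y' \<otimes> inv y"
            using c by (simp only: m_assoc[symmetric] l_inv l_one inv_closed m_closed)
          ultimately show ?thesis by simp
        qed
        moreover have "inv x' \<otimes> x \<in> G1" "y' \<otimes> inv y \<in> G2"
          using xy sub by (auto intro: subgroup.m_closed subgroup.m_inv_closed)
        ultimately have "inv x' \<otimes> x = \<one>" "y' \<otimes> inv y = \<one>" using triv by auto
        thus "x = x' \<and> y = y'" using c by (metis inv_equality inv_inv inv_closed)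
      qed
      show "(\<lambda>(x, y). x \<otimes> y) ` carrier (W\<lparr>carrier := G1\<rparr> \<times>\<times> W\<lparr>carrier := G2\<rparr>) = carrier W"
      proof (intro equalityI subsetI)
        fix w assume "w \<in> carrier W"
        then obtain u where "u \<in> lists S" "w = val u" using ex_word by blast
        hence "\<exists>x \<in> G1. \<exists>y \<in> G2. w = x \<otimes> y"
        proof (induction u arbitrary: w rule: list.induct)
          case Nil thus ?case unfolding G1_def G2_def by (intro bexI[of _ \<one>]) (auto intro: generate.one)
        next
          case (Cons s u)
          then obtain x y where xy: "x \<in> G1" "y \<in> G2" "val u = x \<otimes> y" by auto
          have s: "s \<in> S" using Cons.prems by auto
          have c: "x \<in> carrier W" "y \<in> carrier W" "s \<in> carrier W" using xy car s S_carrier by auto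
          show ?case
          proof (cases "s \<in> B")
            case True
            hence "s \<otimes> x \<in> G1" using xy unfolding G1_def by (auto intro: generate.eng generate.incl)
            thus ?thesis using xy c Cons.prems by (intro bexI[of _ "s \<otimes> x"] bexI[of _ y]) (auto simp: m_assoc)
          next
            case False
            hence "s \<in> G2" "s \<otimes> y \<in> G2" using xy B' s unfolding G2_def by (auto intro: generate.eng generate.incl)
            moreover from this have "s \<otimes> x = x \<otimes> s" using com xy by simp
            hence "s \<otimes> (x \<otimes> y) = x \<otimes> (s \<otimes> y)" using c by (simp add: m_assoc[symmetric])
            ultimately show ?thesis using xy c Cons.prems by (intro bexI[of _ x] bexI[of _ "s \<otimes> y"]) auto
          qed
        qed
        thus "w \<in> (\<lambda>(x, y). x \<otimes> y) ` carrier (W\<lparr>carrier := G1\<rparr> \<times>\<times> W\<lparr>carrier := G2\<rparr>)" by force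
      qed (use car in auto)
    qed
  qed (use car in auto)
  thus False using irr B B' unfolding irreducible_system_def G1_def G2_def by blast
qed

section \<open>Descents under multiplication from the other side\<close>

text \<open>Multiplication from the other side can disturb a left descent only if \<open>s\<close>
  and \<open>t\<close> move \<open>w\<close> to the same element. Otherwise a new descent
  contradicts a length count or \<open>folding\<close>.\<close>

lemma desc_mult_right:
  assumes w: "w \<in> carrier W" "s \<in> S" "t \<in> S" and ne: "s \<otimes> w \<noteq> w \<otimes> t"
  shows "desc s (w \<otimes> t) \<longleftrightarrow> desc s w"
proof -
  have step: "\<not> desc s (w \<otimes> t)" if w: "w \<in> carrier W" and ne: "s \<otimes> w \<noteq> w \<otimes> t" and nd: "\<not> desc s w" for w
  proof (cases "rdesc t w")
    case True
    show ?thesis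
    proof
      assume d: "desc s (w \<otimes> t)"
      have "len w = Suc (len (w \<otimes> t))" using letters_rdown[of t w] True w assms by simp
      moreover have "len (w \<otimes> t) = Suc (len (s \<otimes> (w \<otimes> t)))"
        using letters_down[OF assms(2) _ d] w assms by (simp add: S_carrier)
      moreover have "len (s \<otimes> w) = Suc (len w)" using letters_up nd w assms by simp
      moreover have "len (s \<otimes> w) \<le> Suc (len (s \<otimes> w \<otimes> t))"
        using letters_rdown[of t "s \<otimes> w"] w assms by (cases "rdesc t (s \<otimes> w)") (auto simp: rdesc_def S_carrier)
      ultimately show False using w assms by (simp add: m_assoc S_carrier)
    qed
  next
    case False
    show ?thesis
      using folding[OF w assms(2,3) nd False] indep_commute[OF w assms(2)] ne by auto
  qed
  show ?thesis
  proof (cases "desc s w")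
    case True
    have "s \<otimes> (s \<otimes> w) \<noteq> s \<otimes> w \<otimes> t"
    proof
      assume "s \<otimes> (s \<otimes> w) = s \<otimes> w \<otimes> t"
      hence "s \<otimes> w = s \<otimes> (s \<otimes> w \<otimes> t)" using assms by simp
      thus False using ne assms by (simp add: m_assoc S_carrier)
    qed
    hence "\<not> desc s (s \<otimes> w \<otimes> t)" using step[of "s \<otimes> w"] assms True desc_flip by (simp add: S_carrier)
    thus ?thesis using True assms desc_flip[of s "w \<otimes> t"] by (simp add: m_assoc S_carrier)
  qed (use step assms in auto)
qed

lemma rdesc_mult_left:
  assumes w: "w \<in> carrier W" "s \<in> S" "t \<in> S" and ne: "s \<otimes> w \<noteq> w \<otimes> t"
  shows "rdesc t (s \<otimes> w) \<longleftrightarrow> rdesc t w"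
proof -
  have "t \<otimes> inv w \<noteq> inv w \<otimes> s"
  proof
    assume "t \<otimes> inv w = inv w \<otimes> s"
    hence "inv (t \<otimes> inv w) = inv (inv w \<otimes> s)" by simp
    thus False using assms by (simp add: inv_mult_group S_carrier gen_inv)
  qed
  from desc_mult_right[OF _ _ _ this] show ?thesis
    using assms by (simp add: rdesc_inv S_carrier inv_mult_group gen_inv)
qed

lemma exchange_eq:
  assumes w: "w \<in> carrier W" "s \<in> S" "t \<in> S" and eq: "s \<otimes> w = w \<otimes> t"
  shows "s = t" "desc s w \<longleftrightarrow> rdesc t w"
proof -
  have step: "s = t" if w: "w \<in> carrier W" and eq: "s \<otimes> w = w \<otimes> t" and nd: "\<not> desc s w" for w
  proof -
    have "\<not> rdesc t w" using nd eq by (simp add: desc_def rdesc_def)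
    moreover have "desc s (w \<otimes> t)" using nd eq desc_flip w assms by metis
    ultimately show ?thesis using folding w assms nd by blast
  qed
  show "s = t"
  proof (cases "desc s w")
    case True
    have "s \<otimes> (s \<otimes> w) = s \<otimes> w \<otimes> t" using eq assms by (metis cancel_left cancel_right)
    moreover have "\<not> desc s (s \<otimes> w)" using True desc_flip assms by blast
    ultimately show ?thesis by (intro step) (use assms S_carrier in auto)
  qed (use step assms in auto)
  show "desc s w \<longleftrightarrow> rdesc t w" using eq by (simp add: desc_def rdesc_def)
qed

end

section \<open>Hecke operators\<close>

text \<open>The parameter \<open>r s\<close> is \<open>q\<^sub>s\<^sup>1\<^sup>/\<^sup>2\<close>, so that the quadratic relation is \<open>T\<^sub>s\<^sup>2 = 1 + (r s - 1 / r s) T\<^sub>s\<close>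
  with eigenvalues \<open>r s\<close> and \<open>- 1 / r s\<close>.\<close>

locale hecke = racg W S m for W :: "('w, 'b) monoid_scheme" (structure) and S m +
  fixes r :: "'w \<Rightarrow> real"
  assumes r_range: "s \<in> S \<Longrightarrow> 0 < r s \<and> r s \<le> 1"
begin

definition p :: "'w \<Rightarrow> complex" where "p s = of_real (r s - 1 / r s)"

text \<open>\<open>LO s\<close> and \<open>RO s\<close> are left and right multiplication by the
  Hecke generator, written in coordinates. They are defined on all functions on W, so that their
  algebraic identities can be checked pointwise.\<close>

definition LO :: "'w \<Rightarrow> ('w \<Rightarrow> complex) \<Rightarrow> 'w \<Rightarrow> complex" where
  "LO s f w = (if w \<in> carrier W then f (s \<otimes> w) + (if desc s w then p s * f w else 0) else 0)"

definition RO :: "'w \<Rightarrow> ('w \<Rightarrow> complex) \<Rightarrow> 'w \<Rightarrow> complex" where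
  "RO s f w = (if w \<in> carrier W then f (w \<otimes> s) + (if rdesc s w then p s * f w else 0) else 0)"

lemma LO_add: "LO s (\<lambda>w. f w + g w) = (\<lambda>w. LO s f w + LO s g w)"
  and LO_diff: "LO s (\<lambda>w. f w - g w) = (\<lambda>w. LO s f w - LO s g w)"
  and LO_scale: "LO s (\<lambda>w. c * f w) = (\<lambda>w. c * LO s f w)"
  and RO_add: "RO s (\<lambda>w. f w + g w) = (\<lambda>w. RO s f w + RO s g w)"
  and RO_diff: "RO s (\<lambda>w. f w - g w) = (\<lambda>w. RO s f w - RO s g w)"
  and RO_scale: "RO s (\<lambda>w. c * f w) = (\<lambda>w. c * RO s f w)"
  by (auto simp: LO_def RO_def fun_eq_iff algebra_simps)

lemma LO_off [simp]: "w \<notin> carrier W \<Longrightarrow> LO s f w = 0"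
  and RO_off [simp]: "w \<notin> carrier W \<Longrightarrow> RO s f w = 0"
  by (auto simp: LO_def RO_def)

lemma LO_square:
  assumes "s \<in> S" "\<And>w. w \<notin> carrier W \<Longrightarrow> f w = 0"
  shows "LO s (LO s f) = (\<lambda>w. f w + p s * LO s f w)"
proof
  fix w show "LO s (LO s f) w = f w + p s * LO s f w"
    using assms desc_flip[of s w] by (auto simp: LO_def S_carrier algebra_simps)
qed

lemma LO_commute:
  assumes "s \<in> S" "t \<in> S" "\<not> nc s t" shows "LO s (LO t f) = LO t (LO s f)"
proof (cases "s = t")
  case False
  have ts: "\<not> nc t s" using assms nc_sym by blast
  have d: "desc s (t \<otimes> w) \<longleftrightarrow> desc s w" "desc t (s \<otimes> w) \<longleftrightarrow> desc t w" if "w \<in> carrier W" for w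
  proof -
    have *: "desc s (t \<otimes> w) \<longleftrightarrow> desc s w" if st: "s \<in> S" "t \<in> S" "t \<noteq> s" "\<not> nc t s" for s t
      using desc_commuting_mult[OF \<open>w \<in> carrier W\<close> st]
        desc_commuting_mult[of "t \<otimes> w", OF _ st] st that \<open>w \<in> carrier W\<close> by (auto simp: S_carrier)
    show "desc s (t \<otimes> w) \<longleftrightarrow> desc s w" "desc t (s \<otimes> w) \<longleftrightarrow> desc t w"
      using * assms False ts by auto
  qed
  show ?thesis
  proof
    fix w show "LO s (LO t f) w = LO t (LO s f) w"
      using assms d[of w] gen_left_commute[of s t w] by (auto simp: LO_def S_carrier algebra_simps)
  qed
qed simp

lemma LO_RO: assumes "s \<in> S" "t \<in> S" shows "LO s (RO t f) = RO t (LO s f)"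
proof
  fix w
  show "LO s (RO t f) w = RO t (LO s f) w"
  proof (cases "w \<in> carrier W")
    case w: True
    note c = w assms S_carrier[OF assms(1)] S_carrier[OF assms(2)]
    show ?thesis
    proof (cases "s \<otimes> w = w \<otimes> t")
      \<comment> \<open>Both multiplications move \<open>w\<close> to the same element here, so left
        and right descents coincide and flip together.\<close>
      case True
      have "s = t" "desc s w \<longleftrightarrow> rdesc t w" using exchange_eq[OF w assms True] by auto
      moreover have "desc s (w \<otimes> t) \<longleftrightarrow> \<not> desc s w" using True desc_flip[OF assms(1) w] by simp
      moreover have "rdesc t (s \<otimes> w) \<longleftrightarrow> \<not> rdesc t w" using True rdesc_flip[OF assms(2) w] by simp
      moreover have "s \<otimes> (w \<otimes> t) = w" using True c by (metis cancel_left)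
      ultimately show ?thesis using c True by (auto simp: LO_def RO_def m_assoc algebra_simps)
    next
      case False
      show ?thesis
        using desc_mult_right[OF w assms False] rdesc_mult_left[OF w assms False] c
        by (auto simp: LO_def RO_def m_assoc algebra_simps)
    qed
  qed simp
qed

text \<open>Convergence to 0 at infinity in W. This is the form in which square-summability enters
  the recurrences.\<close>

definition vanishing :: "('w \<Rightarrow> complex) \<Rightarrow> bool" where
  "vanishing f \<longleftrightarrow> (\<forall>x :: nat \<Rightarrow> 'w. inj x \<longrightarrow> range x \<subseteq> carrier W \<longrightarrow> (\<lambda>n. f (x n)) \<longlonglongrightarrow> 0)"

lemma vanishing_diff: "vanishing f \<Longrightarrow> vanishing g \<Longrightarrow> vanishing (\<lambda>w. f w - g w)"
  unfolding vanishing_def using tendsto_diff by fastforce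

lemma vanishing_scale: "vanishing f \<Longrightarrow> vanishing (\<lambda>w. c * f w)"
  unfolding vanishing_def using tendsto_mult_right_zero by fastforce

lemma vanishing_LO: assumes "s \<in> S" "vanishing f" shows "vanishing (LO s f)"
  unfolding vanishing_def
proof (intro allI impI)
  fix x :: "nat \<Rightarrow> 'w" assume x: "inj x" "range x \<subseteq> carrier W"
  have "inj (\<lambda>n. s \<otimes> x n)" "range (\<lambda>n. s \<otimes> x n) \<subseteq> carrier W"
    using x assms S_carrier unfolding inj_def by (metis cancel_left range_subsetD, auto)
  hence 1: "(\<lambda>n. f (s \<otimes> x n)) \<longlonglongrightarrow> 0" using assms by (auto simp: vanishing_def)
  have 2: "(\<lambda>n. f (x n)) \<longlonglongrightarrow> 0" using assms x by (auto simp: vanishing_def)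
  have "(\<lambda>n. norm (f (s \<otimes> x n)) + norm (p s) * norm (f (x n))) \<longlonglongrightarrow> 0 + norm (p s) * 0"
    using 1 2 by (intro tendsto_intros) (auto simp: tendsto_norm_zero_iff)
  hence lim: "(\<lambda>n. norm (f (s \<otimes> x n)) + norm (p s) * norm (f (x n))) \<longlonglongrightarrow> 0" by simp
  show "(\<lambda>n. LO s f (x n)) \<longlonglongrightarrow> 0"
  proof (rule Lim_null_comparison[OF _ lim], intro always_eventually allI)
    fix n
    show "norm (LO s f (x n)) \<le> norm (f (s \<otimes> x n)) + norm (p s) * norm (f (x n))"
      by (auto simp: LO_def intro: order_trans[OF norm_triangle_ineq] simp: norm_mult)
  qed
qed

lemma vanishing_zero:
  assumes f: "vanishing f" and v: "\<And>n. v n \<in> carrier W" "\<And>n. len (v n) < len (v (Suc n))"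
    and c: "\<And>n. norm (f (v n)) \<ge> c"
  shows "c \<le> 0"
proof -
  have "strict_mono (\<lambda>n. len (v n))" using v by (simp add: strict_mono_Suc_iff)
  hence "inj v" by (metis (no_types, lifting) injI strict_mono_eq)
  hence "(\<lambda>n. f (v n)) \<longlonglongrightarrow> 0" using f v by (auto simp: vanishing_def)
  hence "(\<lambda>n. norm (f (v n))) \<longlonglongrightarrow> 0" by (simp add: tendsto_norm_zero_iff)
  thus ?thesis using c by (meson LIMSEQ_le_const)
qed

end

section \<open>Dihedral words, conjugation chains and anticommuting vectors\<close>

context racg
begin

text \<open>For adjacent \<open>s\<close> and \<open>t\<close> these are the elements of the
  dihedral group of \<open>s\<close>, \<open>t\<close> multiplied by elements commuting with both.
  Conjugation chains need not grow here, so this is the exceptional set of the recurrences.\<close>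

definition dihedral_like :: "'w \<Rightarrow> 'w \<Rightarrow> 'w \<Rightarrow> bool" where
  "dihedral_like s t w \<longleftrightarrow> (\<forall>a \<in># letters w. a = s \<or> a = t \<or> (\<not> nc s a \<and> \<not> nc t a))"

lemma dihedral_like_sym: "dihedral_like s t w \<longleftrightarrow> dihedral_like t s w"
  by (auto simp: dihedral_like_def)

lemma dihedral_like_cong:
  assumes "insert a (set_mset (letters v)) = insert a (set_mset (letters w))" "a \<in> {s, t}"
  shows "dihedral_like s t v \<longleftrightarrow> dihedral_like s t w"
proof -
  have "dihedral_like s t u \<longleftrightarrow>
      (\<forall>b \<in> insert a (set_mset (letters u)). b = s \<or> b = t \<or> (\<not> nc s b \<and> \<not> nc t b))" for u
    using assms(2) by (auto simp: dihedral_like_def)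
  from this[of v] this[of w] show ?thesis by (simp only: assms(1))
qed

lemma insert_letters_left:
  "a \<in> S \<Longrightarrow> w \<in> carrier W \<Longrightarrow> insert a (set_mset (letters (a \<otimes> w))) = insert a (set_mset (letters w))"
  using letters_up[of a w] letters_down[of a w] by (cases "desc a w") simp_all

lemma insert_letters_right:
  "a \<in> S \<Longrightarrow> w \<in> carrier W \<Longrightarrow> insert a (set_mset (letters (w \<otimes> a))) = insert a (set_mset (letters w))"
  using letters_rup[of a w] letters_rdown[of a w] by (cases "rdesc a w") simp_all

lemma dihedral_like_left:
  "a \<in> S \<Longrightarrow> w \<in> carrier W \<Longrightarrow> a \<in> {s, t} \<Longrightarrow> dihedral_like s t (a \<otimes> w) \<longleftrightarrow> dihedral_like s t w"
  by (rule dihedral_like_cong[OF insert_letters_left])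

lemma dihedral_like_right:
  "a \<in> S \<Longrightarrow> w \<in> carrier W \<Longrightarrow> a \<in> {s, t} \<Longrightarrow> dihedral_like s t (w \<otimes> a) \<longleftrightarrow> dihedral_like s t w"
  by (rule dihedral_like_cong[OF insert_letters_right])

lemma ncS: "nc s t \<Longrightarrow> s \<in> S \<and> t \<in> S"
  by (simp add: nc_def)

lemma conj_up:
  assumes "w \<in> carrier W" "s \<in> S" "\<not> desc s w" "\<not> rdesc s w" "s \<otimes> w \<noteq> w \<otimes> s"
  shows "\<not> desc s (w \<otimes> s)" "\<not> rdesc s (s \<otimes> w)" "letters (s \<otimes> w \<otimes> s) = add_mset s (add_mset s (letters w))"
    "desc s (s \<otimes> w \<otimes> s)" "rdesc s (s \<otimes> w \<otimes> s)"
proof -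
  show 1: "\<not> desc s (w \<otimes> s)" "\<not> rdesc s (s \<otimes> w)"
    using desc_mult_right[of w s s] rdesc_mult_left[of w s s] assms by auto
  show "letters (s \<otimes> w \<otimes> s) = add_mset s (add_mset s (letters w))"
    using letters_up[of s w] letters_rup[of s "s \<otimes> w"] 1 assms by (simp add: S_carrier)
  show "desc s (s \<otimes> w \<otimes> s)" using 1 desc_flip[of s "w \<otimes> s"] assms by (simp add: S_carrier m_assoc)
  show "rdesc s (s \<otimes> w \<otimes> s)" using 1 rdesc_flip[of s "s \<otimes> w"] assms by (simp add: S_carrier)
qed

text \<open>Conjugation by \<open>s\<close> lengthens \<open>w\<close> and makes \<open>s\<close> a
  descent on both sides. The adjacent \<open>t\<close> is then a descent on neither side, and
  conjugation by \<open>t\<close> lengthens again. Alternating produces an infinite chain in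
  W.\<close>

lemma conj_nc_step:
  assumes "w \<in> carrier W" "nc s t" "\<not> desc s w" "\<not> rdesc s w" "s \<otimes> w \<noteq> w \<otimes> s"
  defines "v \<equiv> s \<otimes> w \<otimes> s"
  shows "v \<in> carrier W" "\<not> desc t v" "\<not> rdesc t v" "t \<otimes> v \<noteq> v \<otimes> t"
    "letters v = add_mset s (add_mset s (letters w))"
proof -
  have S: "s \<in> S" "t \<in> S" using assms ncS by auto
  show v: "v \<in> carrier W" using assms S by (simp add: S_carrier)
  note u = conj_up[OF assms(1) S(1) assms(3-5), folded v_def]
  show nd: "\<not> desc t v" "\<not> rdesc t v"
    using desc_nc[of v s t] rdesc_nc[of v s t] u v S assms by auto
  show l: "letters v = add_mset s (add_mset s (letters w))" by (rule u)
  show "t \<otimes> v \<noteq> v \<otimes> t"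
    using commute_indep[OF v S(2) _ nd(1)] l assms(2) nc_sym by (auto simp: indep_def)
qed

lemma len_mult_val: "x \<in> carrier W \<Longrightarrow> l \<in> lists S \<Longrightarrow> len (x \<otimes> val l) \<le> len x + length l"
proof (induction l rule: rev_induct)
  case (snoc a l)
  have l: "l \<in> lists S" "a \<in> S" using snoc.prems by auto
  have "val (l @ [a]) = val l \<otimes> a" using val_append[OF l(1), of "[a]"] l by (simp add: S_carrier)
  hence eq: "x \<otimes> val (l @ [a]) = (x \<otimes> val l) \<otimes> a" using snoc.prems l by (simp add: m_assoc S_carrier)
  have "len ((x \<otimes> val l) \<otimes> a) \<le> Suc (len (x \<otimes> val l))"
    using letters_rup[of a "x \<otimes> val l"] snoc.prems l
    by (cases "rdesc a (x \<otimes> val l)") (auto simp: rdesc_def)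
  thus ?case using snoc.IH[OF snoc.prems(1) l(1)] eq by simp
qed simp

lemma desc_mult_val:
  assumes "x \<in> carrier W" "l \<in> lists S" "len (x \<otimes> val l) = len x + length l" "s \<in> S" "desc s x"
  shows "desc s (x \<otimes> val l)"
proof -
  have "len (s \<otimes> x \<otimes> val l) \<le> len (s \<otimes> x) + length l" using assms by (intro len_mult_val) (auto simp: S_carrier)
  thus ?thesis using assms by (simp add: desc_def m_assoc S_carrier)
qed

text \<open>In a product without cancellation, a descent that \<open>x\<close> does not have comes
  from a letter of \<open>l\<close>, which has to travel through \<open>x\<close>.\<close>

lemma desc_mult_val_indep:
  assumes "x \<in> carrier W" "l \<in> lists S" "len (x \<otimes> val l) = len x + length l" "s \<in> S"
    "\<not> desc s x" "desc s (x \<otimes> val l)"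
  shows "indep s x"
  using assms(2,3,6)
proof (induction l rule: rev_induct)
  case Nil thus ?case using assms by simp
next
  case (snoc a l)
  have l: "l \<in> lists S" "a \<in> S" using snoc.prems by auto
  have "val (l @ [a]) = val l \<otimes> a" using val_append[OF l(1), of "[a]"] l by (simp add: S_carrier)
  hence eq: "x \<otimes> val (l @ [a]) = (x \<otimes> val l) \<otimes> a" using assms(1) l by (simp add: m_assoc S_carrier)
  have c: "x \<otimes> val l \<in> carrier W" using assms l by simp
  have le: "len (x \<otimes> val l) \<le> len x + length l" by (rule len_mult_val) (use assms l in auto)
  moreover have "len ((x \<otimes> val l) \<otimes> a) \<le> Suc (len (x \<otimes> val l))"
    using letters_rup[of a "x \<otimes> val l"] c l by (cases "rdesc a (x \<otimes> val l)") (auto simp: rdesc_def)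
  ultimately have add: "len (x \<otimes> val l) = len x + length l" using snoc.prems(2) eq by simp
  show ?case
  proof (cases "desc s (x \<otimes> val l)")
    case True thus ?thesis using snoc.IH l add by blast
  next
    case False
    have "\<not> rdesc a (x \<otimes> val l)" using snoc.prems(2) eq add by (simp add: rdesc_def)
    hence "indep s (x \<otimes> val l)" using folding[OF c assms(4) l(2) False] snoc.prems(3) eq by metis
    moreover have "set_mset (letters x) \<subseteq> set_mset (letters (x \<otimes> val l))"
      using l(1) add
    proof (induction l rule: rev_induct)
      case (snoc b k)
      have k: "k \<in> lists S" "b \<in> S" using snoc.prems by auto
      have "val (k @ [b]) = val k \<otimes> b" using val_append[OF k(1), of "[b]"] k by (simp add: S_carrier)
      hence eq: "x \<otimes> val (k @ [b]) = (x \<otimes> val k) \<otimes> b" using assms(1) k by (simp add: m_assoc S_carrier)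
      have ck: "x \<otimes> val k \<in> carrier W" using assms k by simp
      have "len (x \<otimes> val k) \<le> len x + length k" by (rule len_mult_val) (use assms k in auto)
      hence nr: "\<not> rdesc b (x \<otimes> val k)" and up: "len (x \<otimes> val k) = len x + length k"
        using snoc.prems(2) eq letters_rup[OF k(2) ck]
        by (cases "rdesc b (x \<otimes> val k)"; simp add: rdesc_def)+
      show ?case using snoc.IH[OF k(1) up] letters_rup[OF k(2) ck nr] eq by auto
    qed (use assms in simp)
    ultimately show ?thesis by (auto simp: indep_def)
  qed
qed

end

context hecke
begin

lemma decay_constant:
  assumes "vanishing f" "\<And>n. v n \<in> carrier W" "\<And>n. len (v n) < len (v (Suc n))"
    "\<And>n. norm (f (v n)) = norm (f (v 0))"
  shows "f (v 0) = 0"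
proof -
  have "norm (f (v 0)) \<le> 0"
    by (rule vanishing_zero[where v = v, OF assms(1-3)]) (rule eq_refl[OF assms(4)[symmetric]])
  thus ?thesis by simp
qed

text \<open>Where conjugation by \<open>a\<close> lengthens \<open>w\<close>, the hypothesis gives
  \<open>f (a \<otimes> w \<otimes> a) = - f w\<close>, so the modulus of \<open>f\<close> is
  constant along the alternating chains and decay forces 0. Words that start no such chain are
  treated by linear algebra or by rotating their letters.\<close>

lemma anticentral_zero:
  fixes f :: "'w \<Rightarrow> complex"
  assumes st: "nc s t" and van: "vanishing f"
    and anti: "\<And>a w. a \<in> {s, t} \<Longrightarrow> w \<in> carrier W \<Longrightarrow> LO a f w + RO a f w = p a * f w"
    and w: "w \<in> carrier W" and nG: "\<not> dihedral_like s t w"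
  shows "f w = 0"
proof -
  have S: "a \<in> S" if "a \<in> {s, t}" for a using that st ncS by auto
  have car: "a \<in> carrier W" if "a \<in> {s, t}" for a using that S S_carrier by auto
  have K1: "f (a \<otimes> w \<otimes> a) = - f w"
    if a: "a \<in> {s, t}" and w: "w \<in> carrier W" "\<not> desc a w" "\<not> rdesc a w" "a \<otimes> w \<noteq> w \<otimes> a" for a w
  proof -
    have "desc a (a \<otimes> w)" "\<not> rdesc a (a \<otimes> w)"
      using conj_up[OF w(1) S[OF a] w(2-4)] desc_flip[OF S[OF a] w(1)] w by auto
    thus ?thesis using anti[OF a, of "a \<otimes> w"] w S[OF a] car[OF a] by (simp add: LO_def RO_def add_eq_0_iff)
  qed
  \<comment> \<open>If \<open>a\<close> commutes with \<open>w\<close>, the equations at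
    \<open>w\<close> and at \<open>a \<otimes> w\<close> form a linear system with determinant
    \<open>4 + (p a)\<^sup>2\<close>, which is positive because \<open>p a\<close> is real.\<close>
  have K2': "f w = 0 \<and> f (a \<otimes> w) = 0"
    if a: "a \<in> {s, t}" and w: "w \<in> carrier W" "\<not> desc a w" "a \<otimes> w = w \<otimes> a" for a w
  proof -
    have nr: "\<not> rdesc a w" using w by (simp add: desc_def rdesc_def)
    have d: "desc a (a \<otimes> w)" "rdesc a (a \<otimes> w)"
      using desc_flip[OF S[OF a] w(1)] rdesc_flip[OF S[OF a] w(1)] w nr by auto
    have e1: "2 * f (a \<otimes> w) = p a * f w"
      using anti[OF a w(1)] w nr by (simp add: LO_def RO_def)
    have undo: "a \<otimes> (w \<otimes> a) = w" using w S[OF a] by (metis cancel_left)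
    have e2: "2 * f w = - p a * f (a \<otimes> w)"
      using anti[OF a, of "a \<otimes> w"] w d S[OF a] car[OF a] undo
      by (simp add: LO_def RO_def eq_neg_iff_add_eq_0 algebra_simps)
    have "(4 + (p a)\<^sup>2) * f w = 2 * (2 * f w) + p a * (p a * f w)" by (simp add: power2_eq_square algebra_simps)
    also have "\<dots> = 0" unfolding e2 e1[symmetric] by simp
    finally have "(4 + (p a)\<^sup>2) * f w = 0" .
    moreover have "4 + (p a)\<^sup>2 = of_real (4 + (r a - 1 / r a)\<^sup>2)" by (simp add: p_def)
    hence "4 + (p a)\<^sup>2 \<noteq> 0"
      by (metis add_pos_nonneg less_irrefl of_real_eq_0_iff zero_le_power2 zero_less_numeral)
    ultimately have "f w = 0" by simp
    thus ?thesis using e1 by simp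
  qed
  have K2: "f w = 0" if a: "a \<in> {s, t}" and w: "w \<in> carrier W" "a \<otimes> w = w \<otimes> a" for a w
  proof (cases "desc a w")
    case True
    have d: "\<not> desc a (a \<otimes> w)" using True desc_flip[OF S[OF a] w(1)] by blast
    have e: "a \<otimes> (a \<otimes> w) = a \<otimes> w \<otimes> a"
      using w S[OF a] by (metis cancel_left cancel_right)
    have "a \<otimes> w \<in> carrier W" using w car[OF a] by simp
    from K2'[OF a this d e] have "f (a \<otimes> (a \<otimes> w)) = 0" by blast
    thus ?thesis by (simp only: cancel_left[OF S[OF a] w(1)])
  qed (use K2' that in blast)
  have K4: "f w = 0" if a: "nc a b" "{a, b} = {s, t}"
    and w: "w \<in> carrier W" "\<not> desc a w" "\<not> rdesc a w" "a \<otimes> w \<noteq> w \<otimes> a" for a b w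
  proof -
    define x where "x n = (if even n then a else b)" for n :: nat
    define v where "v = rec_nat w (\<lambda>n u. x n \<otimes> u \<otimes> x n)"
    have v_simps: "v 0 = w" "\<And>n. v (Suc n) = x n \<otimes> v n \<otimes> x n" by (simp_all add: v_def)
    have xs: "x n \<in> {s, t}" "nc (x n) (x (Suc n))" for n using a nc_sym by (auto simp: x_def)
    have inv: "v n \<in> carrier W \<and> \<not> desc (x n) (v n) \<and> \<not> rdesc (x n) (v n) \<and> x n \<otimes> v n \<noteq> v n \<otimes> x n" for n
    proof (induction n)
      case 0 thus ?case using w by (simp add: v_simps x_def)
    next
      case (Suc n) thus ?case using conj_nc_step[of "v n" "x n" "x (Suc n)"] xs(2)[of n] by (simp add: v_simps)
    qed
    have "f (v 0) = 0"
    proof (rule decay_constant[OF van])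
      show "v n \<in> carrier W" for n using inv by blast
      show "len (v n) < len (v (Suc n))" for n
        using conj_nc_step(5)[of "v n" "x n" "x (Suc n)"] xs inv[of n] by (simp add: v_simps)
      show "norm (f (v n)) = norm (f (v 0))" for n
      proof (induction n)
        case (Suc n) thus ?case using K1[OF xs(1), of "v n" n] inv[of n] by (simp add: v_simps)
      qed simp
    qed
    thus ?thesis by (simp add: v_simps)
  qed
  have K4': "f w = 0" if a: "a \<in> {s, t}" and w: "w \<in> carrier W" "\<not> desc a w" "\<not> rdesc a w" for a w
  proof (cases "a \<otimes> w = w \<otimes> a")
    case True thus ?thesis using K2 a w by blast
  next
    case False
    obtain b where "nc a b" "{a, b} = {s, t}" using a st nc_sym by auto
    thus ?thesis using K4 w False by blast
  qed
  have K5: "f w = 0" if a: "a \<in> {s, t}" and w: "w \<in> carrier W" "desc a w" "rdesc a w" for a w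
  proof (cases "a \<otimes> w = w \<otimes> a")
    case True thus ?thesis using K2 a w by blast
  next
    case False
    define v where "v = a \<otimes> w \<otimes> a"
    have c: "v \<in> carrier W" "a \<in> S" "a \<in> carrier W" using w a S car by (auto simp: v_def)
    have v2: "v = a \<otimes> (w \<otimes> a)" using w c by (simp add: v_def m_assoc)
    have "desc a (w \<otimes> a)" "rdesc a (a \<otimes> w)"
      using desc_mult_right[of w a a] rdesc_mult_left[of w a a] w c False by auto
    hence nd: "\<not> desc a v" "\<not> rdesc a v"
      using desc_flip[of a "w \<otimes> a"] rdesc_flip[of a "a \<otimes> w"] w c by (auto simp: v_def[symmetric] v2[symmetric])
    have av: "a \<otimes> v = w \<otimes> a" "v \<otimes> a = a \<otimes> w" using w c by (simp_all add: v2) (simp add: v2[symmetric] v_def)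
    hence "f (a \<otimes> v \<otimes> a) = - f v" using K1[OF a c(1) nd] False by auto
    thus ?thesis using K4'[OF a c(1) nd] av w c by simp
  qed
  \<comment> \<open>What remains are words in which each of \<open>s\<close>, \<open>t\<close> is a
    descent on exactly one side.\<close>
  have K6: "(desc a w \<longleftrightarrow> \<not> rdesc a w)" if "a \<in> {s, t}" "w \<in> carrier W" "f w \<noteq> 0" for a w
    using K4' K5 that by blast
  \<comment> \<open>A leading \<open>a\<close> is moved to the end. The length is kept and
    \<open>f\<close> only changes sign, because by \<open>K4'\<close> it vanishes at the word
    without this \<open>a\<close>.\<close>
  have rot: "f (a \<otimes> w \<otimes> a) = - f w \<and> len (a \<otimes> w \<otimes> a) = len w \<and> rdesc a (a \<otimes> w \<otimes> a)"
    if a: "a \<in> {s, t}" and w: "w \<in> carrier W" "desc a w" "f w \<noteq> 0" for a w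
  proof -
    have c: "a \<in> S" "a \<in> carrier W" using a S car by auto
    have ne: "a \<otimes> w \<noteq> w \<otimes> a" using K2[OF a w(1)] w by auto
    have nr: "\<not> rdesc a w" using K6 a w by blast
    define v where "v = a \<otimes> w"
    have v: "v \<in> carrier W" "a \<otimes> v = w" using c w by (auto simp: v_def)
    have nd: "\<not> desc a v" "\<not> rdesc a v"
      using desc_flip[OF c(1) w(1)] rdesc_mult_left[OF w(1) c(1) c(1) ne] w nr by (auto simp: v_def)
    have "f (a \<otimes> v) + f (v \<otimes> a) = p a * f v"
      using anti[OF a v(1)] nd v by (simp add: LO_def RO_def)
    moreover have "f v = 0" using K4'[OF a v(1) nd] .
    ultimately have "f (v \<otimes> a) = - f w" using v by (simp add: add_eq_0_iff)
    moreover have "len (v \<otimes> a) = len w" using letters_rup[OF c(1) v(1) nd(2)] letters_up[OF c(1) v(1) nd(1)] v by simp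
    moreover have "rdesc a (v \<otimes> a)" using rdesc_flip[OF c(1) v(1)] nd by simp
    ultimately show ?thesis by (simp add: v_def)
  qed
  \<comment> \<open>Rotation takes leading letters \<open>s\<close>, \<open>t\<close> of
    \<open>x\<close> to the end of \<open>l\<close>, so \<open>x\<close> shrinks and stays outside
    the dihedral-like set. When \<open>x\<close> offers no such letter, the next two rotated
    letters, one \<open>s\<close> and one \<open>t\<close>, must pass through \<open>x\<close>,
    which would make it dihedral-like.\<close>
  have main: "f (x \<otimes> val l) = 0"
    if "x \<in> carrier W" "l \<in> lists {s, t}" "len (x \<otimes> val l) = len x + length l" "\<not> dihedral_like s t x" for x l
    using that
  proof (induction "len x" arbitrary: x l rule: less_induct)
    case less
    show ?case
    proof (rule ccontr)
      define w where "w = x \<otimes> val l"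
      assume "f (x \<otimes> val l) \<noteq> 0"
      hence fw: "f w \<noteq> 0" by (simp add: w_def)
      have "{s, t} \<subseteq> S" using S by blast
      hence lS: "l \<in> lists S" using less.prems(2) lists_mono by blast
      have wc: "w \<in> carrier W" using less.prems lS by (simp add: w_def)
      \<comment> \<open>Adjacent generators cannot both be right descents, so by \<open>K6\<close>
        one of them is a left descent.\<close>
      have "desc s w \<or> desc t w"
        using K6[of s w] K6[of t w] fw wc rdesc_nc[OF wc, of s t] st S by auto
      then obtain a b where ab: "nc a b" "{a, b} = {s, t}" and da: "desc a w" using st nc_sym by (metis insert_commute)
      have A: "a \<in> {s, t}" "b \<in> {s, t}" using ab by auto
      have c: "a \<in> S" "b \<in> S" "a \<in> carrier W" "b \<in> carrier W" using A S car by auto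
      note R = rot[OF A(1) wc da fw]
      have ndb: "\<not> desc b w" using desc_nc[OF wc da _ c(1,2)] ab by blast
      have vl: "val (k @ [a]) = val k \<otimes> a" if "k \<in> lists S" for k using val_append[OF that, of "[a]"] c by simp
      show False
      proof (cases "desc a x")
        case True
        define x' where "x' = a \<otimes> x"
        have x': "x' \<in> carrier W" "len x = Suc (len x')"
          using less.prems c letters_down[OF c(1) less.prems(1) True] by (auto simp: x'_def)
        have w': "a \<otimes> w \<otimes> a = x' \<otimes> val (l @ [a])"
          using less.prems lS c by (simp add: w_def x'_def vl m_assoc)
        have "f (x' \<otimes> val (l @ [a])) = 0"
        proof (rule less.hyps)
          show "len x' < len x" using x' by simp
          show "l @ [a] \<in> lists {s, t}" using less.prems(2) A by auto
          show "len (x' \<otimes> val (l @ [a])) = len x' + length (l @ [a])"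
            using R less.prems(3) x' by (simp add: w'[symmetric]) (simp add: w_def)
          show "\<not> dihedral_like s t x'" using less.prems(4) dihedral_like_left[OF c(1) less.prems(1) A(1)] by (simp add: x'_def)
        qed (rule x')
        thus False using R fw w' by simp
      next
        case nda: False
        have ia: "indep a x" using desc_mult_val_indep[OF less.prems(1) lS less.prems(3) c(1) nda] da by (simp add: w_def)
        have nbx: "\<not> desc b x" using desc_mult_val[OF less.prems(1) lS less.prems(3) c(2)] ndb by (auto simp: w_def)
        obtain k where k: "l = a # k"
        proof (cases l)
          case Nil thus ?thesis using da nda less.prems by (simp add: w_def)
        next
          case (Cons d k)
          have kS: "k \<in> lists S" using lS Cons by auto
          have "d = a"
          proof (rule ccontr)
            assume "d \<noteq> a"
            hence d: "d = b" using less.prems(2) Cons ab by auto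
            have e: "x \<otimes> b \<in> carrier W" "x \<otimes> b \<otimes> val k = w"
              using less.prems(1) c kS Cons d by (auto simp: w_def m_assoc)
            have "len w \<le> len (x \<otimes> b) + length k" using len_mult_val[OF e(1) kS] e by simp
            hence "\<not> rdesc b x" "len w = len (x \<otimes> b) + length k"
              using less.prems(3) Cons letters_rup[OF c(2) less.prems(1)]
              by (auto simp: w_def rdesc_def intro: ccontr)
            hence lk: "\<not> rdesc b x" "len (x \<otimes> b \<otimes> val k) = len (x \<otimes> b) + length k" using e by auto
            have "\<not> desc a (x \<otimes> b)"
              using folding[OF less.prems(1) c(1,2) nda lk(1)] ab by auto
            from desc_mult_val_indep[OF e(1) kS lk(2) c(1) this] have "indep a (x \<otimes> b)" using da e by simp
            thus False using letters_rup[OF c(2) less.prems(1) lk(1)] ab by (auto simp: indep_def)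
          qed
          thus ?thesis using Cons that by blast
        qed
        have kS: "k \<in> lists S" using lS k by auto
        have kaS: "k @ [a] \<in> lists S" using kS c by auto
        have xa: "a \<otimes> x = x \<otimes> a" using indep_commute[OF less.prems(1) c(1) ia] .
        have "w = a \<otimes> (x \<otimes> val k)"
          using less.prems(1) c kS k xa by (simp add: w_def m_assoc[symmetric])
        hence "a \<otimes> w = x \<otimes> val k" using c less.prems(1) kS by simp
        hence w': "a \<otimes> w \<otimes> a = x \<otimes> val (k @ [a])"
          using less.prems(1) c kS by (simp add: vl m_assoc)
        have add: "len (x \<otimes> val (k @ [a])) = len x + length (k @ [a])"
          using R less.prems(3) k by (simp add: w'[symmetric]) (simp add: w_def)
        define w2 where "w2 = x \<otimes> val (k @ [a])"
        have w2: "w2 \<in> carrier W" "f w2 \<noteq> 0" "rdesc a w2"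
          using R fw w' less.prems(1) kaS by (auto simp: w2_def)
        have "\<not> rdesc b w2" using rdesc_nc[OF w2(1,3) _ c(1,2)] ab by blast
        hence "desc b w2" using K6[OF A(2) w2(1,2)] by blast
        hence "indep b x" using desc_mult_val_indep[OF less.prems(1) kaS add c(2) nbx] by (simp add: w2_def)
        hence "dihedral_like s t x" using ia ab(2) by (auto simp: indep_def dihedral_like_def doubleton_eq_iff)
        thus False using less.prems(4) by blast
      qed
    qed
  qed
  show ?thesis using main[of w "[]"] w nG by simp
qed

end

section \<open>Decaying solutions of expanding recurrences\<close>

lemma geometric_zero:
  fixes g :: "nat \<Rightarrow> complex"
  assumes "\<And>n. g (Suc n) = x * g n" "1 \<le> norm x" "g \<longlonglongrightarrow> 0"
  shows "g n = 0"
proof -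
  have g: "g n = x ^ n * g 0" for n by (induction n) (auto simp: assms(1))
  have "(\<lambda>n. norm (g n)) \<longlonglongrightarrow> 0" using assms(3) by (simp add: tendsto_norm_zero_iff)
  moreover have "norm (g 0) \<le> norm (g n)" for n
    using mult_right_mono[OF one_le_power[OF assms(2), of n] norm_ge_zero[of "g 0"]]
    by (subst (2) g) (simp add: norm_mult norm_power)
  ultimately have "norm (g 0) \<le> 0" by (meson LIMSEQ_le_const)
  thus ?thesis using g[of n] by simp
qed

text \<open>The characteristic roots \<open>1 / (\<rho> \<sigma>)\<close> and \<open>- \<sigma> / \<rho>\<close> lie outside the open unit disc.\<close>

lemma expanding_recurrence_zero:
  fixes h :: "nat \<Rightarrow> complex" and \<rho> \<sigma> :: real
  assumes "0 < \<rho>" "\<rho> \<le> \<sigma>" "\<sigma> \<le> 1" "h \<longlonglongrightarrow> 0"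
    and rec: "\<And>n. of_real (\<rho>\<^sup>2) * h (Suc (Suc n)) = h n - of_real ((\<sigma> - 1 / \<sigma>) * \<rho>) * h (Suc n)"
  shows "h n = 0"
proof -
  define x1 x2 :: complex where "x1 = of_real (1 / (\<rho> * \<sigma>))" and "x2 = of_real (- \<sigma> / \<rho>)"
  have pos: "0 < \<sigma>" using assms by simp
  have "\<rho> * \<sigma> \<le> 1 * 1" using assms pos by (intro mult_mono) auto
  hence n1: "1 \<le> norm x1" using assms(1) pos by (simp only: x1_def norm_of_real) (simp add: field_simps)
  \<comment> \<open>It is \<open>\<rho> \<le> \<sigma>\<close> that keeps the root
    \<open>- \<sigma> / \<rho>\<close> out of the open unit disc.\<close>
  have n2: "1 \<le> norm x2" using assms(1,2) pos by (simp only: x2_def norm_of_real) (simp add: field_simps)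
  have s: "x1 + x2 = of_real (- (\<sigma> - 1 / \<sigma>) / \<rho>)"
    unfolding x1_def x2_def of_real_add[symmetric] using assms pos by (simp add: field_simps)
  have pr: "x1 * x2 = of_real (- 1 / \<rho>\<^sup>2)"
    unfolding x1_def x2_def of_real_mult[symmetric] using assms pos by (simp add: field_simps power2_eq_square)
  have rec': "h (Suc (Suc n)) = (x1 + x2) * h (Suc n) - x1 * x2 * h n" for n
  proof -
    have "of_real (\<rho>\<^sup>2) * (x1 + x2) = of_real (- ((\<sigma> - 1 / \<sigma>) * \<rho>))"
      unfolding s of_real_mult[symmetric]
      by (rule arg_cong[where f = of_real])
        (use assms(1) in \<open>simp add: power2_eq_square, simp add: algebra_simps\<close>)
    moreover have "of_real (\<rho>\<^sup>2) * (x1 * x2) = of_real (- 1)"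
      unfolding pr of_real_mult[symmetric]
      by (rule arg_cong[where f = of_real]) (use assms(1) in \<open>simp add: power2_eq_square\<close>)
    ultimately have "of_real (\<rho>\<^sup>2) * h (Suc (Suc n)) = of_real (\<rho>\<^sup>2) * ((x1 + x2) * h (Suc n) - x1 * x2 * h n)"
      unfolding rec right_diff_distrib mult.assoc[symmetric] by simp
    thus ?thesis using assms(1) by simp
  qed
  \<comment> \<open>Splitting off one root leaves a geometric sequence for the other. Decay makes it
    vanish, and then \<open>h\<close> itself is geometric.\<close>
  define g where "g n = h (Suc n) - x2 * h n" for n
  have "(\<lambda>n. h (Suc n) - x2 * h n) \<longlonglongrightarrow> 0 - x2 * 0"
    using assms(4) by (intro tendsto_intros) (auto simp: LIMSEQ_Suc)
  hence "g \<longlonglongrightarrow> 0" by (simp add: g_def[abs_def])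
  moreover have "g (Suc n) = x1 * g n" for n by (simp add: g_def rec' algebra_simps)
  ultimately have "g n = 0" for n using geometric_zero n1 by blast
  hence "h (Suc n) = x2 * h n" for n by (simp add: g_def)
  thus ?thesis using geometric_zero n2 assms(4) by blast
qed

section \<open>Central vectors away from dihedral words\<close>

context hecke
begin

text \<open>The condition satisfied by the value of a central operator at the trace vector, and by
  limits of averages over conjugates.\<close>

definition central :: "('w \<Rightarrow> complex) \<Rightarrow> bool" where
  "central z \<longleftrightarrow> (\<forall>w. w \<notin> carrier W \<longrightarrow> z w = 0) \<and> (\<forall>s \<in> S. LO s z = RO s z)"

lemma central_off: "central z \<Longrightarrow> w \<notin> carrier W \<Longrightarrow> z w = 0"
  by (simp add: central_def)

lemma central_LO: "central z \<Longrightarrow> s \<in> S \<Longrightarrow> LO s z = RO s z"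
  by (simp add: central_def)

text \<open>\<open>T\<^sub>a - p a / 2\<close> anticommutes with the commutator \<open>T\<^sub>a T\<^sub>b - T\<^sub>b T\<^sub>a\<close>.\<close>

lemma commutator_anticentral:
  assumes z: "central z" and a: "a \<in> S" and b: "b \<in> S"
  defines "f \<equiv> \<lambda>w. LO a (LO b z) w - LO b (LO a z) w"
  shows "LO a f w + RO a f w = p a * f w"
proof -
  have 1: "LO a (LO a (LO b z)) = (\<lambda>w. LO b z w + p a * LO a (LO b z) w)" using LO_square[OF a] by simp
  have 2: "RO a (LO a (LO b z)) = LO a (LO b (LO a z))"
    using LO_RO[OF a a] LO_RO[OF b a] central_LO[OF z a] by simp
  have 3: "LO b (LO a (LO a z)) = (\<lambda>w. LO b z w + p a * LO b (LO a z) w)"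
    using LO_square[OF a, of z] central_off[OF z] by (simp add: LO_add LO_scale)
  have "RO a (LO b (LO a z)) = LO b (LO a (RO a z))"
    using LO_RO[OF a a] LO_RO[OF b a] by simp
  hence 4: "RO a (LO b (LO a z)) = LO b (LO a (LO a z))"
    using central_LO[OF z a] by simp
  show ?thesis unfolding f_def LO_diff RO_diff 1 2 4 3 by (simp add: algebra_simps)
qed

lemma commutator_zero:
  assumes z: "central z" "vanishing z" and st: "nc s t" and w: "w \<in> carrier W" "\<not> dihedral_like s t w"
  shows "LO s (LO t z) w = LO t (LO s z) w"
proof -
  define f where "f = (\<lambda>w. LO s (LO t z) w - LO t (LO s z) w)"
  define g where "g = (\<lambda>w. LO t (LO s z) w - LO s (LO t z) w)"
  have S: "s \<in> S" "t \<in> S" using st ncS by auto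
  have van: "vanishing f" unfolding f_def using z S by (intro vanishing_diff vanishing_LO)
  have fg: "f = (\<lambda>w. (- 1) * g w)" by (simp add: f_def g_def fun_eq_iff)
  have "LO a f w + RO a f w = p a * f w" if "a \<in> {s, t}" for a w
  proof (cases "a = s")
    case True thus ?thesis using commutator_anticentral[OF z(1) S] by (simp add: f_def)
  next
    case False
    hence a: "a = t" using that by simp
    have "LO t g w + RO t g w = p t * g w" using commutator_anticentral[OF z(1) S(2,1)] by (simp add: g_def)
    thus ?thesis unfolding a fg LO_scale RO_scale by (simp add: algebra_simps) 
  qed
  hence "f w = 0" using anticentral_zero[OF st van _ w] by blast
  thus ?thesis by (simp add: f_def)
qed

lemma conj_down:
  assumes "w \<in> carrier W" "a \<in> S" "desc a w" "rdesc a w" "a \<otimes> w \<noteq> w \<otimes> a"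
  defines "v \<equiv> a \<otimes> w \<otimes> a"
  shows "v \<in> carrier W" "\<not> desc a v" "\<not> rdesc a v" "a \<otimes> v \<noteq> v \<otimes> a" "a \<otimes> v \<otimes> a = w"
proof -
  have c: "v \<in> carrier W" "a \<in> carrier W" using assms S_carrier by (auto simp: v_def)
  have v2: "v = a \<otimes> (w \<otimes> a)" using assms(1) c by (simp add: v_def m_assoc)
  have "desc a (w \<otimes> a)" "rdesc a (a \<otimes> w)"
    using desc_mult_right[of w a a] rdesc_mult_left[of w a a] assms by auto
  thus "\<not> desc a v" "\<not> rdesc a v"
    using desc_flip[of a "w \<otimes> a"] rdesc_flip[of a "a \<otimes> w"] assms(1,2) c v2 by (auto simp: v_def)
  have av: "a \<otimes> v = w \<otimes> a" unfolding v2 using assms(1,2) c by simp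
  have va: "v \<otimes> a = a \<otimes> w" unfolding v_def using assms(1,2) c by simp
  show "a \<otimes> v \<noteq> v \<otimes> a" unfolding av va using assms(5) by simp
  show "a \<otimes> v \<otimes> a = w" unfolding av using assms(1,2) by simp
  show "v \<in> carrier W" by (rule c)
qed

text \<open>The vector \<open>X = LO s z - r s z\<close> is an eigenvector for
  \<open>- 1 / r s\<close> on both sides, and off the dihedral-like set the left and right operators
  of \<open>t\<close> agree on it. Along words extended by \<open>s\<close> and \<open>t\<close>
  alternately its values obey the recurrence of \<open>expanding_recurrence_zero\<close> with
  \<open>\<rho> = r s\<close> and \<open>\<sigma> = r t\<close>.\<close>

lemma eigen_off_dihedral:
  assumes z: "central z" "vanishing z" and st: "nc s t" and le: "r s \<le> r t"
    and w: "w \<in> carrier W" "\<not> dihedral_like s t w"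
  shows "LO s z w = of_real (r s) * z w"
proof -
  define X where "X = (\<lambda>w. LO s z w - of_real (r s) * z w)"
  define \<rho> where "\<rho> = complex_of_real (r s)"
  have S: "s \<in> S" "t \<in> S" using st ncS by auto
  have c: "s \<in> carrier W" "t \<in> carrier W" using S S_carrier by auto
  have ts: "nc t s" "s \<noteq> t" using st nc_sym by auto
  have \<rho>: "\<rho> \<noteq> 0" "p s = \<rho> - 1 / \<rho>" using r_range[OF S(1)] by (auto simp: \<rho>_def p_def)
  have Gl: "dihedral_like s t (a \<otimes> w) = dihedral_like s t w" "dihedral_like s t (w \<otimes> a) = dihedral_like s t w"
    if "a = s \<or> a = t" "w \<in> carrier W" for a w
    using dihedral_like_left[of a w s t] dihedral_like_right[of a w s t] that S by auto
  have vanX: "vanishing X" unfolding X_def using z S by (intro vanishing_diff vanishing_LO vanishing_scale)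
  \<comment> \<open>This is \<open>(LO s + 1 / r s) X = 0\<close>, the quadratic relation in
    factored form.\<close>
  have Xs: "X (s \<otimes> w) = - X w / \<rho>" if "w \<in> carrier W" "\<not> desc s w" for w
    using that desc_flip[OF S(1) that(1)] c S \<rho>(1) unfolding X_def LO_def \<rho>_def[symmetric]
    by (simp add: \<rho>(2) field_simps)
  have X_RO: "X = (\<lambda>w. RO s z w - \<rho> * z w)" using central_LO[OF z(1) S(1)] by (simp add: X_def \<rho>_def)
  have Xr: "X (w \<otimes> s) = - X w / \<rho>" if "w \<in> carrier W" "\<not> rdesc s w" for w
    using that rdesc_flip[OF S(1) that(1)] c S \<rho>(1) unfolding X_RO RO_def
    by (simp add: \<rho>(2) field_simps)
  have Xt: "LO t X w = RO t X w" if "w \<in> carrier W" "\<not> dihedral_like s t w" for w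
  proof -
    have "RO t (LO s z) = LO s (LO t z)" using LO_RO[OF S] central_LO[OF z(1) S(2)] by simp
    thus ?thesis
      unfolding X_def LO_diff RO_diff LO_scale RO_scale
      using commutator_zero[OF z st that] central_LO[OF z(1) S(2)] by simp
  qed
  have Xt1: "X (t \<otimes> w) = X (w \<otimes> t)"
    if "w \<in> carrier W" "\<not> dihedral_like s t w" "\<not> desc t w" "\<not> rdesc t w" for w
    using Xt[OF that(1,2)] that by (simp add: LO_def RO_def)
  have Xt2: "X (t \<otimes> w \<otimes> t) = X w + p t * X (t \<otimes> w)"
    if "w \<in> carrier W" "\<not> dihedral_like s t w" "\<not> desc t w" "\<not> rdesc t (t \<otimes> w)" for w
    using Xt[of "t \<otimes> w"] that Gl c S desc_flip[OF S(2) that(1)] by (simp add: LO_def RO_def)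
  define P where "P u \<longleftrightarrow> u \<in> carrier W \<and> \<not> dihedral_like s t u \<and> \<not> desc t u \<and> \<not> rdesc t u \<and> t \<otimes> u \<noteq> u \<otimes> t" for u
  \<comment> \<open>One round of conjugation, by \<open>t\<close> and then by \<open>s\<close>. The
    predicate \<open>P\<close> describes words that a round lengthens by four letters and after
    which it can be repeated.\<close>
  define \<phi> where "\<phi> u = s \<otimes> (t \<otimes> u \<otimes> t) \<otimes> s" for u
  have step: "P (\<phi> u) \<and> len (\<phi> u) = len u + 4 \<and>
      \<rho>\<^sup>2 * X (\<phi> u) = X u + p t * X (t \<otimes> u) \<and>
      \<rho> * X (t \<otimes> \<phi> u) = X (t \<otimes> u) / \<rho> + p t * \<rho> * X (\<phi> u)" if "P u" for u
  proof -
    have u: "u \<in> carrier W" "\<not> dihedral_like s t u" "\<not> desc t u" "\<not> rdesc t u" "t \<otimes> u \<noteq> u \<otimes> t"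
      using that by (auto simp: P_def)
    define a where "a = t \<otimes> u \<otimes> t"
    note a = conj_nc_step[OF u(1) ts(1) u(3-5), folded a_def]
    note v = conj_nc_step[OF a(1) st a(2-4)]
    note ca = conj_up[OF a(1) S(1) a(2-4)]
    have \<phi>: "\<phi> u = s \<otimes> a \<otimes> s" by (simp add: \<phi>_def a_def)
    have G: "\<not> dihedral_like s t (t \<otimes> u)" "\<not> dihedral_like s t a" "\<not> dihedral_like s t (s \<otimes> a \<otimes> s)"
      using u Gl c a(1) by (auto simp: a_def)
    have 1: "P (\<phi> u)" using v G by (simp add: P_def \<phi>)
    have 2: "len (\<phi> u) = len u + 4" using v a by (simp add: \<phi>)
    have Xsa: "X (s \<otimes> a) = - X a / \<rho>" using Xs a by simp
    have Xsas: "X (s \<otimes> a \<otimes> s) = - X (s \<otimes> a) / \<rho>" using Xr[of "s \<otimes> a"] ca a c by simp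
    have Xa: "X a = X u + p t * X (t \<otimes> u)"
      unfolding a_def using Xt2 u conj_up(2)[OF u(1) S(2) u(3-5)] by simp
    have 3: "\<rho>\<^sup>2 * X (\<phi> u) = X u + p t * X (t \<otimes> u)"
      using Xsa Xsas Xa \<rho> by (simp add: \<phi> power2_eq_square)
    \<comment> \<open>To find \<open>X (t \<otimes> \<phi> u)\<close>, the final \<open>s\<close> is
      stripped first. The word \<open>A\<close> left over is \<open>b\<close> conjugated by
      \<open>t\<close>, so that \<open>Xt2\<close> applies.\<close>
    define b where "b = s \<otimes> (t \<otimes> u)"
    have b: "b \<in> carrier W" using u c by (simp add: b_def)
    have Gb: "\<not> dihedral_like s t b" using Gl G(1) u c by (simp add: b_def)
    have dtu: "desc t (t \<otimes> u)" using desc_flip u S by simp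
    have ndtu: "\<not> desc s (t \<otimes> u)" using desc_nc[of "t \<otimes> u" s t] dtu u c S st by auto
    have lb: "len b = len u + 2"
      using letters_up[OF S(1) _ ndtu] letters_up[OF S(2) u(1,3)] u c by (simp add: b_def)
    have dsb: "desc s b" using desc_flip[of s "t \<otimes> u"] ndtu u c S by (simp add: b_def)
    have ndb: "\<not> desc t b" using desc_nc[of b s t] dsb b S st by auto
    have bt: "b \<otimes> t = s \<otimes> a" using u c by (simp add: b_def a_def m_assoc)
    have lsa: "len (s \<otimes> a) = len u + 3" using letters_up[OF S(1) a(1,2)] a(5) by simp
    have nrb: "\<not> rdesc t b" using bt lsa lb by (simp add: rdesc_def)
    have "desc s (s \<otimes> a)" using desc_flip a S by simp
    hence ndsa: "\<not> desc t (s \<otimes> a)" using desc_nc[of "s \<otimes> a" s t] a c S st by auto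
    define A where "A = t \<otimes> (s \<otimes> a)"
    have A: "A \<in> carrier W" using a c by (simp add: A_def)
    have lA: "len A = len u + 4" using letters_up[OF S(2) _ ndsa] lsa a c by (simp add: A_def)
    have tb: "t \<otimes> b \<otimes> t = A" unfolding A_def bt[symmetric] using b c by (simp add: m_assoc)
    have "len (t \<otimes> b) = len u + 3" using letters_up[OF S(2) b ndb] lb by simp
    hence nrtb: "\<not> rdesc t (t \<otimes> b)" using tb lA by (simp add: rdesc_def)
    have As: "A \<otimes> s = t \<otimes> (s \<otimes> a \<otimes> s)" using a c by (simp add: A_def m_assoc)
    have "len (t \<otimes> (s \<otimes> a \<otimes> s)) = len u + 5" using letters_up[OF S(2) v(1,2)] 2 by (simp add: \<phi>)
    hence "\<not> rdesc s A" using lA As by (simp add: rdesc_def)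
    hence "X (t \<otimes> \<phi> u) = - X A / \<rho>" using Xr[OF A] As by (simp add: \<phi>)
    moreover have "X A = X b + p t * X (t \<otimes> b)" using Xt2[OF b Gb ndb nrtb] tb by simp
    moreover have "X b = - X (t \<otimes> u) / \<rho>" unfolding b_def using Xs ndtu u c by simp
    moreover have "X (t \<otimes> b) = - \<rho> * X (\<phi> u)" using Xt1[OF b Gb ndb nrb] bt Xsas \<rho> by (simp add: \<phi>)
    ultimately have "\<rho> * X (t \<otimes> \<phi> u) = X (t \<otimes> u) / \<rho> + p t * \<rho> * X (\<phi> u)" using \<rho> by (simp add: field_simps)
    thus ?thesis using 1 2 3 by blast
  qed
  have chain: "X w = 0 \<and> X (t \<otimes> w) = 0" if "P w" for w
  proof -
    define v where "v n = (\<phi> ^^ n) w" for n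
    have v: "v 0 = w" "\<And>n. v (Suc n) = \<phi> (v n)" by (simp_all add: v_def)
    have Pv: "P (v n)" for n by (induction n) (use v that step in auto)
    have vc: "v n \<in> carrier W" for n using Pv by (simp add: P_def)
    have "strict_mono (\<lambda>n. len (v n))" using step[OF Pv] by (simp add: strict_mono_Suc_iff v)
    hence injv: "inj v" by (metis (no_types, lifting) injI strict_mono_eq)
    have injtv: "inj (\<lambda>n. t \<otimes> v n)" using injv vc S unfolding inj_def by (metis cancel_left)
    have lim1: "(\<lambda>n. X (v n)) \<longlonglongrightarrow> 0" using vanX injv vc unfolding vanishing_def by auto
    have "range (\<lambda>n. t \<otimes> v n) \<subseteq> carrier W" using vc c by auto
    hence lim2: "(\<lambda>n. X (t \<otimes> v n)) \<longlonglongrightarrow> 0" using vanX injtv unfolding vanishing_def by blast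
    \<comment> \<open>Interleaving the two families of values, with the factor
      \<open>- 1 / \<rho>\<close> on the odd terms, merges their coupled relations into one
      recurrence of second order.\<close>
    define h where "h n = (if even n then X (v (n div 2)) else - X (t \<otimes> v (n div 2)) / \<rho>)" for n
    have half: "filterlim (\<lambda>n :: nat. n div 2) sequentially sequentially"
      unfolding filterlim_at_top by (intro allI eventually_sequentiallyI) (use div_le_mono[of "2 * _" _ 2] in fastforce)
    have hlim: "h \<longlonglongrightarrow> 0"
    proof (rule Lim_null_comparison)
      show "\<forall>\<^sub>F n in sequentially. norm (h n) \<le> norm (X (v (n div 2))) + norm (X (t \<otimes> v (n div 2))) / norm \<rho>"
        by (simp add: h_def norm_divide)
      have "(\<lambda>n. norm (X (v (n div 2))) + norm (X (t \<otimes> v (n div 2))) / norm \<rho>) \<longlonglongrightarrow> 0 + 0 / norm \<rho>"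
        using filterlim_compose[OF lim1 half] filterlim_compose[OF lim2 half] \<rho>
        by (intro tendsto_intros) (auto simp: tendsto_norm_zero_iff)
      thus "(\<lambda>n. norm (X (v (n div 2))) + norm (X (t \<otimes> v (n div 2))) / norm \<rho>) \<longlonglongrightarrow> 0" by simp
    qed
    have "h n = 0" for n
    proof (rule expanding_recurrence_zero[OF _ le _ hlim])
      fix n
      have st1: "\<rho>\<^sup>2 * X (v (Suc k)) = X (v k) + p t * X (t \<otimes> v k)"
        "\<rho> * X (t \<otimes> v (Suc k)) = X (t \<otimes> v k) / \<rho> + p t * \<rho> * X (v (Suc k))" for k
        using step[OF Pv, of k] v by auto
      have pt: "p t = of_real (r t - 1 / r t)" by (simp add: p_def)
      show "of_real ((r s)\<^sup>2) * h (Suc (Suc n)) = h n - of_real ((r t - 1 / r t) * r s) * h (Suc n)"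
        unfolding of_real_power of_real_mult pt[symmetric] \<rho>_def[symmetric]
      proof (cases "even n")
        case True
        then obtain k where k: "n = 2 * k" by blast
        show "\<rho>\<^sup>2 * h (Suc (Suc n)) = h n - p t * \<rho> * h (Suc n)"
          using st1(1)[of k] \<rho> by (simp add: h_def k)
      next
        case False
        then obtain k where k: "n = Suc (2 * k)" by (metis oddE Suc_eq_plus1)
        have "h (Suc (Suc n)) = - X (t \<otimes> v (Suc k)) / \<rho>" "h n = - X (t \<otimes> v k) / \<rho>" "h (Suc n) = X (v (Suc k))"
          by (simp_all add: h_def k)
        thus "\<rho>\<^sup>2 * h (Suc (Suc n)) = h n - p t * \<rho> * h (Suc n)"
          using st1(2)[of k] \<rho> by (simp add: power2_eq_square)
      qed
    qed (use r_range S in auto)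
    from this[of 0] this[of 1] show ?thesis using \<rho> by (simp add: h_def v)
  qed
  \<comment> \<open>A word commuting with \<open>t\<close> starts no chain, but multiplied by
    \<open>s\<close> it does; \<open>Xs\<close> brings the result back.\<close>
  have indep_case: "X w = 0 \<and> X (t \<otimes> w) = 0"
    if w: "w \<in> carrier W" "\<not> dihedral_like s t w" "\<not> desc t w" "t \<otimes> w = w \<otimes> t" for w
  proof -
    have it: "indep t w" using commute_indep w S by blast
    have sw: "s \<notin># letters w" using it ts by (auto simp: indep_def)
    have nd: "\<not> desc s w" "\<not> rdesc s w" using letters_down[OF S(1) w(1)] letters_rdown[OF S(1) w(1)] sw by auto
    have lsw: "letters (s \<otimes> w) = add_mset s (letters w)" using letters_up nd w S by simp
    have "desc s (s \<otimes> w)" using desc_flip nd w S by simp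
    hence a: "\<not> desc t (s \<otimes> w)" using desc_nc[of "s \<otimes> w" s t] w c S st by auto
    have "t \<notin># letters (s \<otimes> w)" using lsw it ts by (auto simp: indep_def)
    hence b: "\<not> rdesc t (s \<otimes> w)"
      using letters_rdown[OF S(2), of "s \<otimes> w"] w(1) c by (metis m_closed union_single_eq_member)
    have "t \<otimes> (s \<otimes> w) \<noteq> s \<otimes> w \<otimes> t"
      using commute_indep[of "s \<otimes> w" t] a lsw w c S ts by (auto simp: indep_def)
    hence "P (s \<otimes> w)" using a b w Gl c by (simp add: P_def)
    hence 0: "X (s \<otimes> w) = 0" "X (t \<otimes> (s \<otimes> w)) = 0" using chain by auto
    have "X w = 0" using Xs[OF w(1) nd(1)] 0 \<rho> by simp
    moreover have "desc t (t \<otimes> w)" using desc_flip[OF S(2) w(1)] w(3) by blast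
    hence "\<not> desc s (t \<otimes> w)" using desc_nc[of "t \<otimes> w" s t] w c S st by auto
    hence "X (s \<otimes> (t \<otimes> w)) = - X (t \<otimes> w) / \<rho>" using Xs w c by simp
    moreover have "s \<otimes> (t \<otimes> w) = s \<otimes> w \<otimes> t" unfolding w(4) using w c by (simp add: m_assoc)
    moreover have "X (t \<otimes> (s \<otimes> w)) = X (s \<otimes> w \<otimes> t)" using Xt1[of "s \<otimes> w"] a b w c Gl by simp
    ultimately show ?thesis using 0 \<rho> by simp
  qed
  have "X w = 0"
  proof (cases "t \<otimes> w = w \<otimes> t")
    case True
    show ?thesis
    proof (cases "desc t w")
      case d: True
      have "\<not> desc t (t \<otimes> w)" using desc_flip d w S by simp
      moreover have "t \<otimes> (t \<otimes> w) = t \<otimes> w \<otimes> t" using w S True by (metis cancel_left cancel_right)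
      ultimately have "X (t \<otimes> (t \<otimes> w)) = 0" using indep_case[of "t \<otimes> w"] w c Gl by blast
      thus ?thesis using w S by simp
    qed (use indep_case w True in blast)
  next
    case ne: False
    have dr: "desc t (w \<otimes> t) = desc t w" "rdesc t (t \<otimes> w) = rdesc t w"
      using desc_mult_right[OF w(1) S(2) S(2) ne] rdesc_mult_left[OF w(1) S(2) S(2) ne] by auto
    \<comment> \<open>Removing \<open>t\<close> from each side on which it is a descent leads to a
      word that satisfies \<open>P\<close>.\<close>
    consider "\<not> desc t w" "\<not> rdesc t w" | "desc t w" "\<not> rdesc t w" | "\<not> desc t w" "rdesc t w" | "desc t w" "rdesc t w"
      by blast
    thus ?thesis
    proof cases
      case 1 thus ?thesis using chain[of w] w ne by (simp add: P_def)
    next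
      case 2
      have "t \<otimes> (t \<otimes> w) \<noteq> t \<otimes> w \<otimes> t"
      proof
        assume "t \<otimes> (t \<otimes> w) = t \<otimes> w \<otimes> t"
        hence "t \<otimes> w = w \<otimes> t" using w S c by (metis cancel_left cancel_right m_closed)
        thus False using ne by simp
      qed
      hence "P (t \<otimes> w)" using 2 w c S dr Gl desc_flip[OF S(2) w(1)] by (simp add: P_def)
      thus ?thesis using chain[of "t \<otimes> w"] w S by simp
    next
      case 3
      have "t \<otimes> (w \<otimes> t) \<noteq> w \<otimes> t \<otimes> t"
      proof
        assume "t \<otimes> (w \<otimes> t) = w \<otimes> t \<otimes> t"
        hence "t \<otimes> w = w \<otimes> t" using w S c by (metis cancel_left cancel_right m_closed)
        thus False using ne by simp
      qed
      hence P: "P (w \<otimes> t)" using 3 w c S dr Gl rdesc_flip[OF S(2) w(1)] by (simp add: P_def)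
      hence "X (t \<otimes> (w \<otimes> t)) = X (w \<otimes> t \<otimes> t)" using Xt1 by (simp add: P_def)
      thus ?thesis using chain[OF P] w S by simp
    next
      case 4
      define v where "v = t \<otimes> w \<otimes> t"
      note v = conj_down[OF w(1) S(2) 4 ne, folded v_def]
      have Gv: "\<not> dihedral_like s t v" using w Gl c by (simp add: v_def)
      have P: "P v" using v Gv by (simp add: P_def)
      have "X (t \<otimes> v \<otimes> t) = X v + p t * X (t \<otimes> v)"
        by (rule Xt2[OF v(1) Gv v(2) conj_up(2)[OF v(1) S(2) v(2-4)]])
      thus ?thesis using chain[OF P] v by simp
    qed
  qed
  thus ?thesis by (simp add: X_def)
qed

end

section \<open>Central vectors and stable generators\<close>

context hecke
begin

text \<open>The inequality under which the neighbour \<open>t\<close> provides a recurrence whose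
  roots avoid the open unit disc.\<close>

definition stable :: "'w \<Rightarrow> bool" where
  "stable s \<longleftrightarrow> (\<exists>t. nc s t \<and> r s \<le> r t)"

lemma eigen_off:
  assumes "central z" "vanishing z" "nc s t" "r s \<le> r t"
    "w \<in> carrier W" "\<not> dihedral_like s t w" "\<not> desc s w"
  shows "z (s \<otimes> w) = of_real (r s) * z w"
  using eigen_off_dihedral[OF assms(1-6)] assms by (simp add: LO_def)

text \<open>Centrality at \<open>v \<otimes> w\<close>, solved for \<open>z w\<close>: the value at
  \<open>w\<close> is expressed by values at words with additional letters \<open>v\<close>.\<close>

lemma central_conj:
  assumes z: "central z" and w: "w \<in> carrier W" "v \<in> S" "\<not> desc v w" "\<not> rdesc v w" "v \<otimes> w \<noteq> w \<otimes> v"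
  shows "z w = z (v \<otimes> w \<otimes> v) - p v * z (v \<otimes> w)"
proof -
  have "LO v z (v \<otimes> w) = RO v z (v \<otimes> w)" using central_LO[OF z w(2)] by simp
  thus ?thesis
    using w conj_up(2)[OF w] desc_flip[OF w(2,1)] S_carrier[OF w(2)] by (simp add: LO_def RO_def algebra_simps)
qed

text \<open>Reduction to \<open>w\<close> inside every dihedral-like set at \<open>s\<close>: conjugation by a neighbour \<open>u\<close> of \<open>s\<close>
  with \<open>r u < r s\<close> carries \<open>w\<close> out of the dihedral-like set of \<open>s, t\<close>.\<close>

lemma eigen_unless_dihedral:
  assumes z: "central z" "vanishing z" and st: "nc s t" "r s \<le> r t"
    and su: "nc s u" and w: "w \<in> carrier W" "\<not> desc s w" "\<not> dihedral_like s u w"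
  shows "z (s \<otimes> w) = of_real (r s) * z w"
proof (cases "r s \<le> r u")
  case True thus ?thesis using eigen_off z su w by blast
next
  case False
  show ?thesis
  proof (cases "dihedral_like s t w")
    case False thus ?thesis using eigen_off z st w by blast
  next
    case G: True
    have S: "s \<in> S" "t \<in> S" "u \<in> S" using st su ncS by auto
    have c: "s \<in> carrier W" "u \<in> carrier W" using S S_carrier by auto
    have us: "nc u s" "u \<noteq> s" "u \<noteq> t" using su nc_sym st False by auto
    have ul: "u \<notin># letters w" using G us su by (auto simp: dihedral_like_def)
    have lu: "letters (u \<otimes> w) = add_mset u (letters w)"
      using letters_up letters_down[of u w] S w ul by fastforce
    have ndu: "\<not> desc u w" using ul letters_down[OF S(3) w(1)] by auto
    have lsw: "letters (s \<otimes> w) = add_mset s (letters w)" using letters_up S w by simp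
    have "u \<notin># letters (s \<otimes> w)" using ul us lsw by simp
    hence ndsu: "\<not> desc u (s \<otimes> w)" using letters_down[OF S(3), of "s \<otimes> w"] w(1) c by auto
    have "desc u (u \<otimes> w)" using desc_flip S w ndu by simp
    hence nds: "\<not> desc s (u \<otimes> w)" using desc_nc[of "u \<otimes> w" s u] w c S su by auto
    have Gu: "\<not> dihedral_like s t (u \<otimes> w)" using lu us su by (auto simp: dihedral_like_def)
    have Gus: "\<not> dihedral_like u s w" "\<not> dihedral_like u s (s \<otimes> w)"
      using w c S dihedral_like_sym dihedral_like_left[of s w u s] by auto
    \<comment> \<open>The letter \<open>u\<close> takes \<open>u \<otimes> w\<close> out of the
      dihedral-like set of \<open>s\<close>, \<open>t\<close>. Equations \<open>2\<close> and
      \<open>3\<close> hold because \<open>s\<close> is a neighbour of \<open>u\<close> with larger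
      parameter. Comparing both orders of \<open>s\<close> and \<open>u\<close> then cancels
      \<open>r u\<close>.\<close>
    have 1: "z (s \<otimes> (u \<otimes> w)) = of_real (r s) * z (u \<otimes> w)"
      using eigen_off[OF z st _ Gu nds] w c by simp
    have 2: "z (u \<otimes> w) = of_real (r u) * z w"
      using eigen_off[OF z us(1) _ w(1) Gus(1) ndu] False by simp
    have 3: "z (u \<otimes> (s \<otimes> w)) = of_real (r u) * z (s \<otimes> w)"
      using eigen_off[OF z us(1) _ _ Gus(2) ndsu] w c False by simp
    have "z (u \<otimes> (s \<otimes> w)) = z (s \<otimes> (u \<otimes> w))"
      using commutator_zero[OF z su w(1,3)] w c ndu ndsu nds by (simp add: LO_def)
    hence "of_real (r u) * z (s \<otimes> w) = of_real (r u) * (of_real (r s) * z w)" using 1 2 3 by simp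
    thus ?thesis using r_range[OF S(3)] by simp
  qed
qed

lemma ex_adjacent:
  assumes irr: "irreducible_system W S" and B: "B \<subseteq> S" "B \<noteq> {}" "B \<noteq> S"
  obtains b v where "b \<in> B" "v \<in> S" "v \<notin> B" "nc b v"
  using connected[OF irr B] by blast

text \<open>Induction on the number of generators missing from \<open>w\<close>. If \<open>w\<close>
  is dihedral-like for every neighbour of \<open>s\<close>, then \<open>central_conj\<close> adds a
  letter \<open>v\<close> that commutes with \<open>s\<close> and is adjacent to a letter of
  \<open>w\<close>. Connectedness supplies this \<open>v\<close>, because \<open>w\<close> has a
  letter and \<open>s\<close> is no descent.\<close>

lemma eigen_stable:
  assumes irr: "irreducible_system W S" and fin: "finite S" and card: "card S \<ge> 3"
    and z: "central z" "vanishing z" and s: "stable s"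
    and w: "w \<in> carrier W" "w \<noteq> \<one>" "\<not> desc s w"
  shows "z (s \<otimes> w) = of_real (r s) * z w"
  using w
proof (induction "card (S - set_mset (letters w))" arbitrary: w rule: less_induct)
  case less
  obtain t where st: "nc s t" "r s \<le> r t" using s stable_def by blast
  have S: "s \<in> S" "t \<in> S" using st ncS by auto
  have cs: "s \<in> carrier W" using S S_carrier by auto
  define B where "B = set_mset (letters w)"
  have BS: "B \<subseteq> S" using set_letters less.prems by (simp add: B_def)
  have B0: "B \<noteq> {}" using letters_empty less.prems by (auto simp: B_def)
  show ?case
  proof (cases "\<forall>u. nc s u \<longrightarrow> dihedral_like s u w")
    case False thus ?thesis using eigen_unless_dihedral z st less.prems by blast
  next
    case G: True
    show ?thesis
    proof (cases "\<exists>b \<in> B. \<exists>v \<in> S. v \<notin> B \<and> nc b v \<and> v \<noteq> s \<and> \<not> nc s v")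
      case True
      then obtain b v where bv: "b \<in> B" "v \<in> S" "v \<notin> B" "nc b v" "v \<noteq> s" "\<not> nc s v" by blast
      have vs: "\<not> nc v s" using bv nc_sym by blast
      have cv: "v \<in> carrier W" using bv S_carrier by auto
      have eig: "z (s \<otimes> x) = of_real (r s) * z x"
        if "x \<in> carrier W" "set_mset (letters x) = insert v B" "\<not> desc s x" for x
      proof (rule less.hyps)
        show "card (S - set_mset (letters x)) < card (S - set_mset (letters w))"
          unfolding that(2) B_def[symmetric] by (rule psubset_card_mono) (use fin bv in auto)
        show "x \<noteq> \<one>" using that(2) by auto
      qed (use that in auto)
      have up: "\<not> desc v x \<and> \<not> rdesc v x \<and> v \<otimes> x \<noteq> x \<otimes> v"
        if "x \<in> carrier W" "v \<notin># letters x" "b \<in># letters x" for x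
      proof -
        have "\<not> desc v x" "\<not> rdesc v x" using letters_down[of v x] letters_rdown[of v x] that bv by auto
        moreover have "\<not> indep v x" using that bv nc_sym by (auto simp: indep_def)
        ultimately show ?thesis using commute_indep that bv by blast
      qed
      have uw: "\<not> desc v w" "\<not> rdesc v w" "v \<otimes> w \<noteq> w \<otimes> v" using up[of w] less.prems bv by (auto simp: B_def)
      have lsw: "letters (s \<otimes> w) = add_mset s (letters w)" using letters_up S less.prems by simp
      have us: "\<not> desc v (s \<otimes> w)" "\<not> rdesc v (s \<otimes> w)" "v \<otimes> (s \<otimes> w) \<noteq> (s \<otimes> w) \<otimes> v"
        using up[of "s \<otimes> w"] less.prems cs bv lsw by (auto simp: B_def)
      have nd1: "\<not> desc s (v \<otimes> w)"
        using desc_commuting_mult[OF less.prems(1) S(1) bv(2,5) vs less.prems(3)] .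
      have nd2: "\<not> desc s (v \<otimes> w \<otimes> v)"
      proof -
        have nr: "\<not> rdesc v (v \<otimes> w)" using conj_up(2)[OF less.prems(1) bv(2) uw] .
        show ?thesis using folding[OF _ S(1) bv(2) nd1 nr] less.prems(1) cv bv by auto
      qed
      have L: "set_mset (letters (v \<otimes> w)) = insert v B" "set_mset (letters (v \<otimes> w \<otimes> v)) = insert v B"
        using letters_up[OF bv(2) less.prems(1) uw(1)] conj_up(3)[OF less.prems(1) bv(2) uw] by (auto simp: B_def)
      have comm: "v \<otimes> (s \<otimes> w) = s \<otimes> (v \<otimes> w)" using gen_left_commute bv S vs less.prems by simp
      have "z (s \<otimes> w) = z (v \<otimes> (s \<otimes> w) \<otimes> v) - p v * z (v \<otimes> (s \<otimes> w))"
        using central_conj[OF z(1) _ bv(2) us] less.prems cs by simp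
      also have "\<dots> = z (s \<otimes> (v \<otimes> w \<otimes> v)) - p v * z (s \<otimes> (v \<otimes> w))"
        using less.prems cs cv by (simp add: comm) (simp add: m_assoc)
      also have "\<dots> = of_real (r s) * z (v \<otimes> w \<otimes> v) - p v * (of_real (r s) * z (v \<otimes> w))"
        using eig[OF _ L(1) nd1] eig[OF _ L(2) nd2] less.prems cv by simp
      also have "\<dots> = of_real (r s) * (z (v \<otimes> w \<otimes> v) - p v * z (v \<otimes> w))" by (simp add: algebra_simps)
      also have "\<dots> = of_real (r s) * z w" using central_conj[OF z(1) less.prems(1) bv(2) uw] by simp
      finally show ?thesis .
    next
      case N: False
      have BG: "a = s \<or> a = u \<or> (\<not> nc s a \<and> \<not> nc u a)" if "nc s u" "a \<in> B" for u a
        using G that by (auto simp: dihedral_like_def B_def)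
      \<comment> \<open>If \<open>s\<close> has two neighbours, neither is a letter of
        \<open>w\<close>, since being dihedral-like for one of them excludes the other.\<close>
      have key: "a = s \<or> (\<not> nc s a \<and> (\<forall>u. nc s u \<longrightarrow> \<not> nc u a))" if a: "a \<in> B" for a
      proof (cases "\<exists>t'. nc s t' \<and> t' \<noteq> t")
        case True
        then obtain t' where t': "nc s t'" "t' \<noteq> t" by blast
        have "a = s \<or> \<not> nc s a" using BG[OF st(1) a] BG[OF t'(1) a] t' st by auto
        thus ?thesis using BG a st by blast
      next
        case only: False
        have ne: "{s, t} \<noteq> S"
        proof
          assume "{s, t} = S"
          moreover have "card {s, t} \<le> 2" by (simp add: card_insert_if)
          ultimately show False using card by simp
        qed
        \<comment> \<open>Three generators are needed when \<open>t\<close> is the only neighbour of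
          \<open>s\<close>: then \<open>t\<close> has a further neighbour \<open>v\<close>. It is
          not a letter of \<open>w\<close>, and if \<open>t\<close> were one, \<open>v\<close> could
          have been added to \<open>w\<close>.\<close>
        obtain c v where cv: "c \<in> {s, t}" "v \<in> S" "v \<notin> {s, t}" "nc c v"
          by (rule ex_adjacent[OF irr, of "{s, t}"]) (use S ne in auto)
        have ctv: "nc t v" "\<not> nc s v" using cv only by auto
        have "v \<notin> B" using BG[OF st(1)] cv ctv by blast
        hence "t \<notin> B" using N ctv cv by blast
        hence "a = s \<or> (\<not> nc s a \<and> \<not> nc t a)" using BG[OF st(1) a] a by blast
        thus ?thesis using only by blast
      qed
      have sB: "s \<notin> B"
      proof
        assume "s \<in> B"
        moreover have "\<forall>a \<in> B. \<not> nc s a" using key nc_irrefl by metis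
        ultimately have "desc s w" using desc_if_commuting_letters[OF less.prems(1)] by (simp add: B_def)
        thus False using less.prems by blast
      qed
      obtain b v where bv: "b \<in> B" "v \<in> S" "v \<notin> B" "nc b v"
        by (rule ex_adjacent[OF irr BS B0]) (use sB S in auto)
      have k: "\<not> nc s b" "\<And>u. nc s u \<Longrightarrow> \<not> nc u b" using key[OF bv(1)] bv sB by auto
      have "v \<noteq> s" using k(1) bv nc_sym by blast
      moreover have "\<not> nc s v" using k(2)[of v] bv nc_sym by blast
      ultimately show ?thesis using N bv by blast
    qed
  qed
qed

text \<open>A generator with minimal parameter is stable through any of its neighbours.\<close>

lemma ex_stable: assumes "irreducible_system W S" "finite S" "card S \<ge> 3" shows "\<exists>s \<in> S. stable s"
proof -
  have "S \<noteq> {}" using assms by auto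
  then obtain s where s: "s \<in> S" "\<And>t. t \<in> S \<Longrightarrow> r s \<le> r t"
    using assms(2) by (metis arg_min_if_finite(1) arg_min_least)
  have ne: "{s} \<noteq> S"
  proof
    assume "{s} = S"
    hence "card S = 1" by (metis One_nat_def card.empty card.insert empty_iff finite.emptyI)
    thus False using assms by simp
  qed
  obtain c v where "c \<in> {s}" "v \<in> S" "nc c v"
    by (rule ex_adjacent[OF assms(1), of "{s}"]) (use s ne in auto)
  thus ?thesis using s stable_def by blast
qed

text \<open>Of two adjacent generators the one with the smaller parameter is stable.\<close>

lemma unstable_commute:
  assumes "s \<in> S" "t \<in> S" "\<not> stable s" "\<not> stable t" shows "\<not> nc s t"
  using assms nc_sym unfolding stable_def by (meson linear)

lemma central_modulo_scalar:
  assumes irr: "irreducible_system W S" and fin: "finite S" and card: "card S \<ge> 3"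
    and z: "central z" "vanishing z"
  shows "\<exists>c. \<forall>s \<in> S. stable s \<longrightarrow>
      LO s (\<lambda>w. z w - c * delta \<one> w) = (\<lambda>w. of_real (r s) * (z w - c * delta \<one> w))"
proof -
  obtain s0 where s0: "s0 \<in> S" "stable s0" using ex_stable assms by blast
  have nz: "complex_of_real (r s) \<noteq> 0" if "s \<in> S" for s using r_range[OF that] by simp
  have nd1: "\<not> desc s \<one>" "\<not> rdesc s \<one>" for s by (simp_all add: desc_def rdesc_def)
  \<comment> \<open>The eigenvalue equation may fail at \<one>. This scalar repairs it there for the
    stable generator \<open>s0\<close>; comparing \<open>z (s \<otimes> s0)\<close> with
    \<open>z (s0 \<otimes> s)\<close> shows that it is repaired for all stable
    \<open>s\<close>.\<close>
  define c where "c = z \<one> - z s0 / of_real (r s0)"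
  define y where "y = (\<lambda>w. z w - c * delta \<one> w)"
  have l1: "letters s = {#s#}" if "s \<in> S" for s
    using letters_up[OF that, of \<one>] nd1 that S_carrier by simp
  have ys: "z s = of_real (r s) * y \<one>" if s: "s \<in> S" "stable s" for s
  proof (cases "s = s0")
    case True thus ?thesis using nz s by (simp add: y_def c_def delta_def)
  next
    case False
    have cc: "s \<in> carrier W" "s0 \<in> carrier W" using s s0 S_carrier by auto
    have ne: "s \<noteq> \<one>" "s0 \<noteq> \<one>" using l1[OF s(1)] l1[OF s0(1)] by auto
    have nd: "\<not> desc s s0" "\<not> desc s0 s" "\<not> rdesc s s0" "\<not> rdesc s0 s"
      using letters_down[of s s0] letters_down[of s0 s] letters_rdown[of s s0] letters_rdown[of s0 s] l1 s s0 cc False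
      by (auto simp: add_mset_eq_single)
    have "z (s \<otimes> s0) = of_real (r s) * z s0"
      by (rule eigen_stable[OF irr fin card z s(2)]) (use cc ne nd in auto)
    moreover have "z (s0 \<otimes> s) = of_real (r s0) * z s"
      by (rule eigen_stable[OF irr fin card z s0(2)]) (use cc ne nd in auto)
    moreover have "LO s z s0 = RO s z s0" using central_LO[OF z(1)] s by simp
    hence "z (s \<otimes> s0) = z (s0 \<otimes> s)" using nd cc by (simp add: LO_def RO_def)
    ultimately have "of_real (r s0) * z s = of_real (r s) * z s0" by simp
    thus ?thesis using nz[OF s0(1)] by (simp add: y_def c_def delta_def field_simps)
  qed
  have eig: "y (s \<otimes> w) = of_real (r s) * y w" if s: "s \<in> S" "stable s" and w: "w \<in> carrier W" "\<not> desc s w" for s w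
  proof (cases "w = \<one>")
    case True
    have "s \<noteq> \<one>" using l1[OF s(1)] by auto
    thus ?thesis using ys[OF s] True s S_carrier by (simp add: y_def delta_def)
  next
    case False
    have "letters (s \<otimes> w) \<noteq> {#}" using letters_up s w by simp
    hence "s \<otimes> w \<noteq> \<one>" by auto
    thus ?thesis using eigen_stable[OF irr fin card z s(2) w(1) False w(2)] False by (simp add: y_def delta_def)
  qed
  have "LO s y w = of_real (r s) * y w" if s: "s \<in> S" "stable s" for s w
  proof (cases "w \<in> carrier W")
    case w: True
    show ?thesis
    proof (cases "desc s w")
      case True
      have "\<not> desc s (s \<otimes> w)" using True desc_flip s w by simp
      hence "y w = of_real (r s) * y (s \<otimes> w)" using eig[OF s, of "s \<otimes> w"] w s S_carrier by simp
      hence "y (s \<otimes> w) = y w / of_real (r s)" using nz s by simp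
      thus ?thesis using True w nz[OF s(1)] by (simp add: LO_def p_def algebra_simps)
    qed (use eig s w in \<open>simp add: LO_def\<close>)
  next
    case False
    hence "w \<noteq> \<one>" by auto
    thus ?thesis using False central_off[OF z(1)] by (simp add: y_def delta_def)
  qed
  hence "\<forall>s \<in> S. stable s \<longrightarrow> LO s y = (\<lambda>w. of_real (r s) * y w)" by (simp add: fun_eq_iff)
  thus ?thesis unfolding y_def by blast
qed

end

section \<open>Square-summable families\<close>

abbreviation L2 :: "'i set \<Rightarrow> ('i \<Rightarrow> complex) set" where "L2 I \<equiv> carrier (ell2 I)"

abbreviation inn :: "'i set \<Rightarrow> ('i \<Rightarrow> complex) \<Rightarrow> ('i \<Rightarrow> complex) \<Rightarrow> complex" where
  "inn I \<equiv> ip (ell2 I)"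

lemma L2_iff: "f \<in> L2 I \<longleftrightarrow> (\<forall>i. i \<notin> I \<longrightarrow> f i = 0) \<and> (\<lambda>i. (cmod (f i))\<^sup>2) summable_on I"
  by (simp add: ell2_def)

lemma inn_def: "inn I f g = (\<Sum>\<^sub>\<infinity>i\<in>I. f i * cnj (g i))"
  by (simp add: ell2_def)

lemma L2_off: "f \<in> L2 I \<Longrightarrow> i \<notin> I \<Longrightarrow> f i = 0"
  by (simp add: L2_iff)

lemma L2_zero [simp]: "(\<lambda>_. 0) \<in> L2 I"
  by (simp add: L2_iff)

lemma L2_scale: "f \<in> L2 I \<Longrightarrow> (\<lambda>i. c * f i) \<in> L2 I"
  by (auto simp: L2_iff norm_mult power_mult_distrib intro: summable_on_cmult_right)

lemma L2_mono:
  assumes "f \<in> L2 I" "\<And>i. i \<notin> I \<Longrightarrow> g i = 0" "\<And>i. i \<in> I \<Longrightarrow> cmod (g i) \<le> C * cmod (f i)"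
  shows "g \<in> L2 I"
  unfolding L2_iff
proof
  have "(\<lambda>i. C\<^sup>2 * (cmod (f i))\<^sup>2) summable_on I"
    using assms(1) by (auto simp: L2_iff intro: summable_on_cmult_right)
  thus "(\<lambda>i. (cmod (g i))\<^sup>2) summable_on I"
    by (rule summable_on_comparison_test)
      (use power_mono[OF assms(3)] in \<open>auto simp: power_mult_distrib\<close>)
qed (use assms in auto)

lemma L2_add: assumes "f \<in> L2 I" "g \<in> L2 I" shows "(\<lambda>i. f i + g i) \<in> L2 I"
  unfolding L2_iff
proof
  have "(\<lambda>i. 2 * (cmod (f i))\<^sup>2 + 2 * (cmod (g i))\<^sup>2) summable_on I"
    using assms by (auto simp: L2_iff intro!: summable_on_add summable_on_cmult_right)
  thus "(\<lambda>i. (cmod (f i + g i))\<^sup>2) summable_on I"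
  proof (rule summable_on_comparison_test)
    fix i
    have "(cmod (f i + g i))\<^sup>2 \<le> (cmod (f i) + cmod (g i))\<^sup>2" by (intro power_mono norm_triangle_ineq) auto
    also have "\<dots> \<le> 2 * (cmod (f i))\<^sup>2 + 2 * (cmod (g i))\<^sup>2"
      using zero_le_power2[of "cmod (f i) - cmod (g i)"] by (simp add: power2_eq_square algebra_simps)
    finally show "(cmod (f i + g i))\<^sup>2 \<le> 2 * (cmod (f i))\<^sup>2 + 2 * (cmod (g i))\<^sup>2" .
  qed auto
qed (use assms in \<open>auto simp: L2_iff\<close>)

lemma L2_diff: "f \<in> L2 I \<Longrightarrow> g \<in> L2 I \<Longrightarrow> (\<lambda>i. f i - g i) \<in> L2 I"
  using L2_add[of f I "\<lambda>i. - 1 * g i"] L2_scale[of g I "- 1"] by simp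

lemma L2_sum: "finite F \<Longrightarrow> (\<And>a. a \<in> F \<Longrightarrow> f a \<in> L2 I) \<Longrightarrow> (\<lambda>i. \<Sum>a\<in>F. f a i) \<in> L2 I"
  by (induction F rule: finite_induct) (auto intro: L2_add)

lemma L2_finite_support:
  assumes "finite F" "F \<subseteq> I" "\<And>i. i \<notin> F \<Longrightarrow> f i = 0" shows "f \<in> L2 I"
proof -
  have "finite {i \<in> I. (cmod (f i))\<^sup>2 \<noteq> 0}"
    by (rule finite_subset[OF _ assms(1)]) (use assms(3) in auto)
  thus ?thesis
    using assms by (auto simp: L2_iff intro: finite_nonzero_values_imp_summable_on)
qed

lemma delta_L2: "i \<in> I \<Longrightarrow> delta i \<in> L2 I"
  by (rule L2_finite_support[of "{i}"]) (auto simp: delta_def)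

lemma prod_summable:
  assumes "f \<in> L2 I" "g \<in> L2 I" shows "(\<lambda>i. f i * cnj (g i)) summable_on I"
proof -
  have "(\<lambda>i. norm (f i * cnj (g i))) summable_on I"
    using assms by (intro abs_summable_product[where x = f and y = "\<lambda>i. cnj (g i)"])
      (simp_all add: L2_iff norm_mult power2_eq_square)
  thus ?thesis by (rule abs_summable_summable)
qed

lemma inn_add_left: "f \<in> L2 I \<Longrightarrow> g \<in> L2 I \<Longrightarrow> h \<in> L2 I \<Longrightarrow> inn I (\<lambda>i. f i + g i) h = inn I f h + inn I g h"
  unfolding inn_def by (simp add: distrib_right infsum_add prod_summable)

lemma inn_scale_left: "inn I (\<lambda>i. c * f i) g = c * inn I f g"
  unfolding inn_def by (simp add: mult.assoc infsum_cmult_right')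

lemma inn_cnj: "inn I g f = cnj (inn I f g)"
  unfolding inn_def infsum_cnj[symmetric] by (simp add: mult.commute)

lemma inn_add_right: "f \<in> L2 I \<Longrightarrow> g \<in> L2 I \<Longrightarrow> h \<in> L2 I \<Longrightarrow> inn I h (\<lambda>i. f i + g i) = inn I h f + inn I h g"
  by (subst (1 2 3) inn_cnj) (simp add: inn_add_left)

lemma inn_scale_right: "inn I g (\<lambda>i. c * f i) = cnj c * inn I g f"
  by (subst (1 2) inn_cnj) (simp add: inn_scale_left)

lemma inn_diff_left: "f \<in> L2 I \<Longrightarrow> g \<in> L2 I \<Longrightarrow> h \<in> L2 I \<Longrightarrow> inn I (\<lambda>i. f i - g i) h = inn I f h - inn I g h"
  using inn_add_left[of f I "\<lambda>i. - 1 * g i" h] inn_scale_left[of I "- 1" g h] L2_scale[of g I "- 1"] by simp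

lemma inn_diff_right: "f \<in> L2 I \<Longrightarrow> g \<in> L2 I \<Longrightarrow> h \<in> L2 I \<Longrightarrow> inn I h (\<lambda>i. f i - g i) = inn I h f - inn I h g"
  by (subst (1 2 3) inn_cnj) (simp add: inn_diff_left)

lemma inn_zero [simp]: "inn I (\<lambda>_. 0) g = 0" "inn I f (\<lambda>_. 0) = 0"
  by (simp_all add: inn_def)

lemma inn_sum_left:
  "finite F \<Longrightarrow> (\<And>a. a \<in> F \<Longrightarrow> f a \<in> L2 I) \<Longrightarrow> h \<in> L2 I \<Longrightarrow>
    inn I (\<lambda>i. \<Sum>a\<in>F. f a i) h = (\<Sum>a\<in>F. inn I (f a) h)"
  by (induction F rule: finite_induct) (auto simp: inn_add_left L2_sum)

lemma inn_delta: "i \<in> I \<Longrightarrow> inn I f (delta i) = f i"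
proof -
  assume i: "i \<in> I"
  have "inn I f (delta i) = (\<Sum>\<^sub>\<infinity>j\<in>{i}. f j * cnj (delta i j))"
    unfolding inn_def by (rule infsum_cong_neutral) (use i in \<open>auto simp: delta_def\<close>)
  thus ?thesis by (simp add: delta_def)
qed

definition nsq :: "'i set \<Rightarrow> ('i \<Rightarrow> complex) \<Rightarrow> real" where
  "nsq I f = (\<Sum>\<^sub>\<infinity>i\<in>I. (cmod (f i))\<^sup>2)"

lemma infsum_of_real: "(\<Sum>\<^sub>\<infinity>i\<in>I. complex_of_real (f i)) = of_real (\<Sum>\<^sub>\<infinity>i\<in>I. f i)"
proof (cases "f summable_on I")
  case True
  thus ?thesis by (metis has_sum_infsum has_sum_of_real_iff infsumI)
next
  case False
  have "\<not> (\<lambda>i. complex_of_real (f i)) summable_on I"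
    using summable_on_bounded_linear[OF bounded_linear_Re, of "\<lambda>i. complex_of_real (f i)"] False by auto
  thus ?thesis using False by (simp add: infsum_not_exists)
qed

lemma inn_self: "inn I f f = of_real (nsq I f)"
  unfolding inn_def nsq_def complex_norm_square[symmetric] by (rule infsum_of_real)

lemma nsq_nonneg: "0 \<le> nsq I f"
  unfolding nsq_def by (rule infsum_nonneg) auto

lemma nsq_scale: "nsq I (\<lambda>i. c * f i) = (cmod c)\<^sup>2 * nsq I f"
  unfolding nsq_def by (simp add: norm_mult power_mult_distrib infsum_cmult_right')

lemma cmod_le_nsq: assumes "f \<in> L2 I" shows "(cmod (f i))\<^sup>2 \<le> nsq I f"
proof (cases "i \<in> I")
  case True
  have "(\<Sum>j\<in>{i}. (cmod (f j))\<^sup>2) \<le> nsq I f"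
    unfolding nsq_def by (rule finite_sum_le_infsum) (use assms True in \<open>auto simp: L2_iff\<close>)
  thus ?thesis by simp
qed (use assms nsq_nonneg in \<open>auto simp: L2_iff\<close>)

lemma nsq_eq_0: assumes "f \<in> L2 I" shows "nsq I f = 0 \<longleftrightarrow> f = (\<lambda>_. 0)"
proof
  assume "nsq I f = 0"
  thus "f = (\<lambda>_. 0)" using cmod_le_nsq[OF assms] by (auto simp: fun_eq_iff)
qed (simp add: nsq_def)

text \<open>The expansion behind Cauchy-Schwarz, the parallelogram law and the contractivity of
  projections.\<close>

lemma nsq_diff_scale:
  assumes "f \<in> L2 I" "g \<in> L2 I"
  shows "nsq I (\<lambda>i. f i - c * g i) = nsq I f - 2 * Re (cnj c * inn I f g) + (cmod c)\<^sup>2 * nsq I g"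
proof -
  define t where "t = cnj c * inn I f g"
  have "complex_of_real (nsq I (\<lambda>i. f i - c * g i)) =
      inn I f f - cnj c * inn I f g - c * inn I g f + c * cnj c * inn I g g"
    unfolding inn_self[symmetric]
    using assms by (simp add: inn_diff_left inn_diff_right L2_diff L2_scale inn_scale_left inn_scale_right algebra_simps)
  also have "c * inn I g f = cnj t" unfolding t_def by (subst inn_cnj) simp
  also have "c * cnj c * inn I g g = of_real ((cmod c)\<^sup>2 * nsq I g)"
    unfolding inn_self complex_norm_square[symmetric] by simp
  finally have "complex_of_real (nsq I (\<lambda>i. f i - c * g i)) =
      of_real (nsq I f) - t - cnj t + of_real ((cmod c)\<^sup>2 * nsq I g)"
    by (simp add: inn_self t_def)
  from arg_cong[OF this, of Re] show ?thesis unfolding t_def[symmetric] by simp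
qed

lemma Cauchy_Schwarz:
  assumes "f \<in> L2 I" "g \<in> L2 I" shows "(cmod (inn I f g))\<^sup>2 \<le> nsq I f * nsq I g"
proof (cases "nsq I g = 0")
  case True
  hence "g = (\<lambda>_. 0)" using nsq_eq_0 assms by blast
  thus ?thesis by (simp add: nsq_def)
next
  case False
  hence pos: "nsq I g > 0" using nsq_nonneg[of I g] by simp
  define c where "c = inn I f g / of_real (nsq I g)"
  have "cnj c * inn I f g = of_real ((cmod (inn I f g))\<^sup>2 / nsq I g)"
    by (simp add: c_def complex_norm_square[symmetric] mult.commute[of "cnj _"] del: of_real_power)
  hence 1: "Re (cnj c * inn I f g) = (cmod (inn I f g))\<^sup>2 / nsq I g" by simp
  have 2: "(cmod c)\<^sup>2 * nsq I g = (cmod (inn I f g))\<^sup>2 / nsq I g"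
    using pos by (simp add: c_def norm_divide power_divide power2_eq_square)
  have "0 \<le> nsq I (\<lambda>i. f i - c * g i)" by (rule nsq_nonneg)
  hence "(cmod (inn I f g))\<^sup>2 / nsq I g \<le> nsq I f"
    unfolding nsq_diff_scale[OF assms] 1 2 by simp
  thus ?thesis using pos by (simp add: field_simps)
qed

lemma Cauchy_Schwarz_sqrt:
  "f \<in> L2 I \<Longrightarrow> g \<in> L2 I \<Longrightarrow> cmod (inn I f g) \<le> sqrt (nsq I f) * sqrt (nsq I g)"
  using real_sqrt_le_mono[OF Cauchy_Schwarz[of f I g]] by (simp add: real_sqrt_mult)

lemma parallelogram:
  assumes "f \<in> L2 I" "g \<in> L2 I"
  shows "nsq I (\<lambda>i. f i + g i) + nsq I (\<lambda>i. f i - g i) = 2 * nsq I f + 2 * nsq I g"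
  using nsq_diff_scale[OF assms, of 1] nsq_diff_scale[OF assms, of "- 1"] by simp

lemma nsq_add_le:
  assumes "f \<in> L2 I" "g \<in> L2 I" shows "nsq I (\<lambda>i. f i + g i) \<le> 2 * nsq I f + 2 * nsq I g"
  using parallelogram[OF assms] nsq_nonneg[of I "\<lambda>i. f i - g i"] by simp

lemma nsq_mono:
  assumes "f \<in> L2 I" "g \<in> L2 I" "\<And>i. i \<in> I \<Longrightarrow> cmod (g i) \<le> cmod (f i)" shows "nsq I g \<le> nsq I f"
  unfolding nsq_def by (rule infsum_mono) (use assms in \<open>auto simp: L2_iff intro: power_mono\<close>)

lemma L2_complete:
  assumes X: "\<And>n :: nat. X n \<in> L2 I"
    and cauchy: "\<And>e. 0 < e \<Longrightarrow> \<exists>N. \<forall>i\<ge>N. \<forall>j\<ge>N. nsq I (\<lambda>k. X i k - X j k) < e"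
  shows "\<exists>x \<in> L2 I. (\<lambda>n. nsq I (\<lambda>k. X n k - x k)) \<longlonglongrightarrow> 0"
proof -
  have "Cauchy (\<lambda>n. X n k)" for k
  proof (rule metric_CauchyI)
    fix e :: real assume e: "0 < e"
    then obtain N where N: "\<forall>i\<ge>N. \<forall>j\<ge>N. nsq I (\<lambda>k. X i k - X j k) < e\<^sup>2" using cauchy[of "e\<^sup>2"] by auto
    have "dist (X i k) (X j k) < e" if "i \<ge> N" "j \<ge> N" for i j
    proof -
      have "(cmod (X i k - X j k))\<^sup>2 < e\<^sup>2"
        using cmod_le_nsq[OF L2_diff[OF X[of i] X[of j]], of k] N that by (meson le_less_trans)
      thus ?thesis using e by (simp add: dist_norm power_less_imp_less_base)
    qed
    thus "\<exists>M. \<forall>m\<ge>M. \<forall>n\<ge>M. dist (X m k) (X n k) < e" by blast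
  qed
  then obtain x where x: "\<And>k. (\<lambda>n. X n k) \<longlonglongrightarrow> x k"
    unfolding Cauchy_convergent_iff convergent_def by metis
  \<comment> \<open>Only finite partial sums are passed to the coordinatewise limit; they yield both
    summability and the norm estimate.\<close>
  have bound: "(\<Sum>k\<in>F. (cmod (X n k - x k))\<^sup>2) \<le> e"
    if F: "finite F" "F \<subseteq> I" and N: "\<forall>i\<ge>N. \<forall>j\<ge>N. nsq I (\<lambda>k. X i k - X j k) < e" and n: "n \<ge> N" for F N n e
  proof -
    have lim: "(\<lambda>j. \<Sum>k\<in>F. (cmod (X n k - X j k))\<^sup>2) \<longlonglongrightarrow> (\<Sum>k\<in>F. (cmod (X n k - x k))\<^sup>2)"
      by (intro tendsto_intros x)
    have "(\<Sum>k\<in>F. (cmod (X n k - X j k))\<^sup>2) \<le> e" if "j \<ge> N" for j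
    proof -
      have "(\<Sum>k\<in>F. (cmod (X n k - X j k))\<^sup>2) \<le> nsq I (\<lambda>k. X n k - X j k)"
        unfolding nsq_def
        by (rule finite_sum_le_infsum) (use F L2_diff[OF X[of n] X[of j]] in \<open>auto simp: L2_iff\<close>)
      thus ?thesis using N n that by (meson less_imp_le order_trans)
    qed
    thus ?thesis using LIMSEQ_le_const2[OF lim] by blast
  qed
  have x0: "x k = 0" if "k \<notin> I" for k
    using x[of k] L2_off[OF X that] by (simp add: LIMSEQ_const_iff)
  have L: "(\<lambda>k. X n k - x k) \<in> L2 I" and le: "nsq I (\<lambda>k. X n k - x k) \<le> e"
    if N: "\<forall>i\<ge>N. \<forall>j\<ge>N. nsq I (\<lambda>k. X i k - X j k) < e" "n \<ge> N" for N n e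
  proof -
    have sm: "(\<lambda>k. (cmod (X n k - x k))\<^sup>2) summable_on I"
      by (rule nonneg_bdd_above_summable_on) (use bound[OF _ _ N] in \<open>auto intro!: bdd_aboveI2[of _ _ e]\<close>)
    thus "(\<lambda>k. X n k - x k) \<in> L2 I" using x0 L2_off[OF X] by (simp add: L2_iff)
    show "nsq I (\<lambda>k. X n k - x k) \<le> e"
      unfolding nsq_def by (rule infsum_le_finite_sums[OF sm]) (use bound[OF _ _ N] in auto)
  qed
  obtain N where N: "\<forall>i\<ge>N. \<forall>j\<ge>N. nsq I (\<lambda>k. X i k - X j k) < 1" using cauchy[of 1] by auto
  have "(\<lambda>k. X N k - (X N k - x k)) \<in> L2 I" by (rule L2_diff[OF X L[OF N]]) simp
  hence xL: "x \<in> L2 I" by simp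
  have "(\<lambda>n. nsq I (\<lambda>k. X n k - x k)) \<longlonglongrightarrow> 0"
  proof (rule LIMSEQ_I)
    fix e :: real assume "0 < e"
    then obtain N where N: "\<forall>i\<ge>N. \<forall>j\<ge>N. nsq I (\<lambda>k. X i k - X j k) < e / 2" using cauchy[of "e / 2"] by auto
    have "norm (nsq I (\<lambda>k. X n k - x k) - 0) < e" if "n \<ge> N" for n
      using le[OF N that] nsq_nonneg[of I "\<lambda>k. X n k - x k"] \<open>0 < e\<close> by simp
    thus "\<exists>no. \<forall>n\<ge>no. norm (nsq I (\<lambda>k. X n k - x k) - 0) < e" by blast
  qed
  thus ?thesis using xL by blast
qed

text \<open>Density of finitely supported vectors, stated for the net of truncations along which
  adjoints and weak limits are computed.\<close>

lemma truncation_tendsto: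
  assumes "f \<in> L2 I"
  shows "((\<lambda>F. nsq I (\<lambda>i. (if i \<in> F then f i else 0) - f i)) \<longlongrightarrow> 0) (finite_subsets_at_top I)"
proof -
  have s: "(\<lambda>i. (cmod (f i))\<^sup>2) summable_on I" using assms by (simp add: L2_iff)
  have eq: "nsq I (\<lambda>i. (if i \<in> F then f i else 0) - f i) = nsq I f - (\<Sum>i\<in>F. (cmod (f i))\<^sup>2)"
    if F: "finite F" "F \<subseteq> I" for F
  proof -
    have "nsq I (\<lambda>i. (if i \<in> F then f i else 0) - f i) = (\<Sum>\<^sub>\<infinity>i\<in>I - F. (cmod (f i))\<^sup>2)"
      unfolding nsq_def by (rule infsum_cong_neutral) auto
    also have "\<dots> = nsq I f - (\<Sum>i\<in>F. (cmod (f i))\<^sup>2)"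
      unfolding nsq_def using infsum_Diff[OF s _ F(2)] F by (simp add: summable_on_finite)
    finally show ?thesis .
  qed
  have "((\<lambda>F. \<Sum>i\<in>F. (cmod (f i))\<^sup>2) \<longlongrightarrow> nsq I f) (finite_subsets_at_top I)"
    using has_sum_infsum[OF s] by (simp add: has_sum_def nsq_def)
  hence "((\<lambda>F. nsq I f - (\<Sum>i\<in>F. (cmod (f i))\<^sup>2)) \<longlongrightarrow> nsq I f - nsq I f) (finite_subsets_at_top I)"
    by (intro tendsto_intros)
  hence lim: "((\<lambda>F. nsq I f - (\<Sum>i\<in>F. (cmod (f i))\<^sup>2)) \<longlongrightarrow> 0) (finite_subsets_at_top I)" by simp
  show ?thesis
    by (rule Lim_transform_eventually[OF lim])
      (use eq in \<open>auto intro!: eventually_finite_subsets_at_top_weakI\<close>)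
qed

lemma cring_complex_ring: "cring complex_ring"
proof (rule cringI)
  show "abelian_group complex_ring"
    by (rule abelian_groupI) (auto simp: complex_ring_def intro: exI[where x = "- x" for x])
  show "comm_monoid complex_ring" by (rule comm_monoidI) (auto simp: complex_ring_def)
qed (auto simp: complex_ring_def algebra_simps)

lemma bounded_ops_simps [simp]:
  "mult (bounded_ops H) = compose (carrier H)"
  "one (bounded_ops H) = (\<lambda>x \<in> carrier H. x)"
  "zero (bounded_ops H) = (\<lambda>x \<in> carrier H. \<zero>\<^bsub>H\<^esub>)"
  "add (bounded_ops H) = (\<lambda>T T'. \<lambda>x \<in> carrier H. T x \<oplus>\<^bsub>H\<^esub> T' x)"
  "smult (bounded_ops H) = (\<lambda>c T. \<lambda>x \<in> carrier H. c \<odot>\<^bsub>H\<^esub> T x)"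
  by (simp_all add: bounded_ops_def)

text \<open>With empty \<open>\<Lambda>\<close> this is \<open>ell2 I\<close>, so one operator
  theory covers \<open>ell2\<close> of W, the complement of the joint eigenvectors and the
  finite-dimensional summand.\<close>

definition perp :: "'i set \<Rightarrow> ('i \<Rightarrow> complex) set \<Rightarrow> ('i \<Rightarrow> complex) hilbert" where
  "perp I \<Lambda> = (ell2 I)\<lparr>carrier := {f \<in> L2 I. \<forall>g \<in> \<Lambda>. inn I f g = 0}\<rparr>"

lemma carrier_perp: "f \<in> carrier (perp I \<Lambda>) \<longleftrightarrow> f \<in> L2 I \<and> (\<forall>g \<in> \<Lambda>. inn I f g = 0)"
  by (simp add: perp_def)

lemma perp_simps [simp]:
  "zero (perp I \<Lambda>) = (\<lambda>_. 0)"
  "add (perp I \<Lambda>) = (\<lambda>f g i. f i + g i)"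
  "smult (perp I \<Lambda>) = (\<lambda>c f i. c * f i)"
  "ip (perp I \<Lambda>) = inn I"
  by (simp_all add: perp_def) (simp_all add: ell2_def)

lemma perp_empty: "perp I {} = ell2 I"
  by (simp add: perp_def)

lemma hnorm_perp: "hnorm (perp I \<Lambda>) f = sqrt (nsq I f)"
  by (simp add: hnorm_def inn_self)

text \<open>In the application \<open>\<Lambda>\<close> consists of the square-summable joint eigenvectors, and its span carries the
  abelian summand.\<close>

locale l2perp =
  fixes I :: "'i set" and \<Lambda> :: "('i \<Rightarrow> complex) set"
  assumes fin: "finite \<Lambda>" and Lam_L2: "g \<in> \<Lambda> \<Longrightarrow> g \<in> L2 I" and Lam_nz: "g \<in> \<Lambda> \<Longrightarrow> nsq I g \<noteq> 0"
    and orth: "g \<in> \<Lambda> \<Longrightarrow> h \<in> \<Lambda> \<Longrightarrow> g \<noteq> h \<Longrightarrow> inn I g h = 0"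
begin

abbreviation H where "H \<equiv> perp I \<Lambda>"
abbreviation cH where "cH \<equiv> carrier (perp I \<Lambda>)"
abbreviation B where "B \<equiv> carrier (bounded_ops H)"

lemma cH_L2: "f \<in> cH \<Longrightarrow> f \<in> L2 I" by (simp add: carrier_perp)

lemma cH_zero [simp]: "(\<lambda>_. 0) \<in> cH" by (simp add: carrier_perp)

lemma cH_add: "f \<in> cH \<Longrightarrow> g \<in> cH \<Longrightarrow> (\<lambda>i. f i + g i) \<in> cH"
  by (auto simp: carrier_perp L2_add inn_add_left Lam_L2)

lemma cH_diff: "f \<in> cH \<Longrightarrow> g \<in> cH \<Longrightarrow> (\<lambda>i. f i - g i) \<in> cH"
  by (auto simp: carrier_perp L2_diff inn_diff_left Lam_L2)

lemma cH_scale: "f \<in> cH \<Longrightarrow> (\<lambda>i. c * f i) \<in> cH"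
  by (auto simp: carrier_perp L2_scale inn_scale_left)

lemma eq_by_inn: assumes "a \<in> cH" "b \<in> cH" "\<And>g. g \<in> cH \<Longrightarrow> inn I a g = inn I b g" shows "a = b"
proof -
  have d: "(\<lambda>i. a i - b i) \<in> cH" using cH_diff assms by blast
  have "inn I (\<lambda>i. a i - b i) (\<lambda>i. a i - b i) = 0"
    using assms(3)[OF d] d assms by (subst inn_diff_left) (auto simp: cH_L2)
  hence "nsq I (\<lambda>i. a i - b i) = 0" by (simp add: inn_self)
  hence "(\<lambda>i. a i - b i) = (\<lambda>_. 0)" using nsq_eq_0[OF cH_L2[OF d]] by blast
  thus ?thesis by (simp add: fun_eq_iff)
qed

section \<open>The orthogonal projection\<close>

text \<open>The elements of \<open>\<Lambda>\<close> are orthogonal but not normalised, whence the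
  division by the squared norm.\<close>

definition P :: "('i \<Rightarrow> complex) \<Rightarrow> 'i \<Rightarrow> complex" where
  "P f = (\<lambda>i. f i - (\<Sum>g\<in>\<Lambda>. (inn I f g / of_real (nsq I g)) * g i))"

lemma sum_L2: "(\<lambda>i. \<Sum>g\<in>\<Lambda>. c g * g i) \<in> L2 I"
  by (rule L2_sum) (auto simp: fin Lam_L2 L2_scale)

lemma inn_sum_Lam: "h \<in> L2 I \<Longrightarrow> inn I (\<lambda>i. \<Sum>g\<in>\<Lambda>. c g * g i) h = (\<Sum>g\<in>\<Lambda>. c g * inn I g h)"
  by (subst inn_sum_left) (auto simp: fin Lam_L2 L2_scale inn_scale_left)

lemma P_cH: assumes "f \<in> L2 I" shows "P f \<in> cH"
proof -
  have "inn I (P f) h = 0" if h: "h \<in> \<Lambda>" for h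
  proof -
    have "inn I (P f) h = inn I f h - (\<Sum>g\<in>\<Lambda>. inn I f g / of_real (nsq I g) * inn I g h)"
      unfolding P_def inn_diff_left[OF assms sum_L2 Lam_L2[OF h]] inn_sum_Lam[OF Lam_L2[OF h]] ..
    also have "(\<Sum>g\<in>\<Lambda>. inn I f g / of_real (nsq I g) * inn I g h) =
        (\<Sum>g\<in>\<Lambda>. if g = h then inn I f h else 0)"
      by (intro sum.cong refl) (use orth h Lam_nz in \<open>auto simp: inn_self\<close>)
    finally show ?thesis using fin h by simp
  qed
  moreover have "P f \<in> L2 I" unfolding P_def by (rule L2_diff[OF assms sum_L2])
  ultimately show ?thesis by (simp add: carrier_perp)
qed

lemma P_L2: "f \<in> L2 I \<Longrightarrow> P f \<in> L2 I" by (rule cH_L2[OF P_cH])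

lemma P_id: "f \<in> cH \<Longrightarrow> P f = f"
  by (simp add: P_def carrier_perp)

lemma P_zero [simp]: "P (\<lambda>_. 0) = (\<lambda>_. 0)"
  by (simp add: P_def)

lemma P_add: "f \<in> L2 I \<Longrightarrow> g \<in> L2 I \<Longrightarrow> P (\<lambda>i. f i + g i) = (\<lambda>i. P f i + P g i)"
  by (simp add: P_def fun_eq_iff inn_add_left Lam_L2 add_divide_distrib distrib_right sum.distrib)

lemma P_scale: "P (\<lambda>i. c * f i) = (\<lambda>i. c * P f i)"
  by (simp add: P_def fun_eq_iff inn_scale_left sum_distrib_left algebra_simps)

lemma P_diff: "f \<in> L2 I \<Longrightarrow> g \<in> L2 I \<Longrightarrow> P (\<lambda>i. f i - g i) = (\<lambda>i. P f i - P g i)"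
  using P_add[of f "\<lambda>i. - 1 * g i"] P_scale[of "- 1" g] L2_scale[of g I "- 1"] by simp

lemma inn_P: assumes "f \<in> L2 I" "h \<in> cH" shows "inn I (P f) h = inn I f h" "inn I h (P f) = inn I h f"
proof -
  have z: "inn I g h = 0" if "g \<in> \<Lambda>" for g
    using assms that by (subst inn_cnj) (simp add: carrier_perp)
  show "inn I (P f) h = inn I f h"
    unfolding P_def inn_diff_left[OF assms(1) sum_L2 cH_L2[OF assms(2)]] inn_sum_Lam[OF cH_L2[OF assms(2)]]
    by (simp add: z)
  thus "inn I h (P f) = inn I h f" by (subst (1 2) inn_cnj) simp
qed

lemma P_Lam: assumes "g \<in> \<Lambda>" shows "P g = (\<lambda>_. 0)"
proof (rule eq_by_inn)
  show "P g \<in> cH" by (rule P_cH) (use assms Lam_L2 in auto)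
  show "(\<lambda>_. 0) \<in> cH" by simp
  fix h assume "h \<in> cH"
  thus "inn I (P g) h = inn I (\<lambda>_. 0) h"
    using inn_P(1)[OF Lam_L2[OF assms]] assms by (simp, subst inn_cnj) (simp add: carrier_perp)
qed

lemma nsq_P_le: assumes "f \<in> L2 I" shows "nsq I (P f) \<le> nsq I f"
proof -
  have "inn I (P f) f = of_real (nsq I (P f))" "inn I f (P f) = of_real (nsq I (P f))"
    using inn_P[OF assms P_cH[OF assms]] by (simp_all add: inn_self)
  hence "nsq I (\<lambda>i. f i - 1 * P f i) = nsq I f - nsq I (P f)"
    using nsq_diff_scale[OF assms P_L2[OF assms], of 1] by simp
  thus ?thesis using nsq_nonneg[of I "\<lambda>i. f i - 1 * P f i"] by simp
qed

lemma perp_abelian_group: "abelian_group H"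
proof (rule abelian_groupI)
  fix x assume x: "x \<in> carrier H"
  show "\<exists>y \<in> carrier H. y \<oplus>\<^bsub>H\<^esub> x = \<zero>\<^bsub>H\<^esub>"
    by (rule bexI[of _ "\<lambda>i. - 1 * x i"]) (use cH_scale[of x "- 1"] x in auto)
qed (use cH_add in \<open>auto simp: fun_eq_iff\<close>)

lemma perp_minus: assumes "f \<in> cH" "g \<in> cH" shows "f \<ominus>\<^bsub>H\<^esub> g = (\<lambda>i. f i - g i)"
proof -
  interpret abelian_group H by (rule perp_abelian_group)
  have "\<ominus>\<^bsub>H\<^esub> g = (\<lambda>i. - 1 * g i)"
    by (rule minus_equality) (use cH_scale[of g "- 1"] assms in auto)
  thus ?thesis by (simp add: a_minus_def)
qed

lemma hilbert_space_perp: "hilbert_space H"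
proof (rule hilbert_space.intro)
  show "Module.module complex_ring H"
    by (rule moduleI[OF cring_complex_ring perp_abelian_group])
      (use cH_scale in \<open>auto simp: complex_ring_def fun_eq_iff algebra_simps\<close>)
  show "hilbert_space_axioms H"
  proof
    fix x y z c
    assume x: "x \<in> carrier H"
    show "0 \<le> Re (ip H x x)" by (simp add: inn_self nsq_nonneg)
    show "ip H x x = 0 \<Longrightarrow> x = \<zero>\<^bsub>H\<^esub>" using x nsq_eq_0[of x I] by (simp add: inn_self cH_L2)
    assume y: "y \<in> carrier H"
    show "ip H (c \<odot>\<^bsub>H\<^esub> x) y = c * ip H x y" by (simp add: inn_scale_left)
    show "ip H y x = cnj (ip H x y)" by (simp, subst inn_cnj, simp)
    assume z: "z \<in> carrier H"
    show "ip H (x \<oplus>\<^bsub>H\<^esub> y) z = ip H x z + ip H y z" using x y z by (simp add: inn_add_left cH_L2)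
  next
    fix X :: "nat \<Rightarrow> 'i \<Rightarrow> complex"
    assume X: "\<And>n. X n \<in> carrier H"
      and cauchy: "\<And>e. 0 < e \<Longrightarrow> \<exists>N. \<forall>i\<ge>N. \<forall>j\<ge>N. hnorm H (X i \<ominus>\<^bsub>H\<^esub> X j) < e"
    have XH: "X n \<in> cH" for n using X by simp
    have hn: "hnorm H (X i \<ominus>\<^bsub>H\<^esub> x) = sqrt (nsq I (\<lambda>k. X i k - x k))" if "x \<in> cH" for i x
      by (subst perp_minus[OF XH that]) (rule hnorm_perp)
    have "\<exists>x\<in>L2 I. (\<lambda>n. nsq I (\<lambda>k. X n k - x k)) \<longlonglongrightarrow> 0"
    proof (rule L2_complete)
      fix e :: real assume e: "0 < e"
      obtain N where "\<forall>i\<ge>N. \<forall>j\<ge>N. sqrt (nsq I (\<lambda>k. X i k - X j k)) < sqrt e"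
        using cauchy[of "sqrt e"] e hn[OF XH] by auto
      thus "\<exists>N. \<forall>i\<ge>N. \<forall>j\<ge>N. nsq I (\<lambda>k. X i k - X j k) < e" by auto
    qed (rule cH_L2[OF XH])
    then obtain x where x: "x \<in> L2 I" "(\<lambda>n. nsq I (\<lambda>k. X n k - x k)) \<longlonglongrightarrow> 0" by blast
    have "inn I x g = 0" if g: "g \<in> \<Lambda>" for g
    proof -
      have "(cmod (inn I x g))\<^sup>2 \<le> nsq I (\<lambda>k. X n k - x k) * nsq I g" for n
      proof -
        have "inn I (\<lambda>k. X n k - x k) g = - inn I x g"
          using XH[of n] x g by (subst inn_diff_left) (auto simp: Lam_L2 carrier_perp)
        thus ?thesis using Cauchy_Schwarz[OF L2_diff[OF cH_L2[OF XH[of n]] x(1)] Lam_L2[OF g]] by simp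
      qed
      moreover have "(\<lambda>n. nsq I (\<lambda>k. X n k - x k) * nsq I g) \<longlonglongrightarrow> 0 * nsq I g"
        by (intro tendsto_intros x)
      ultimately have "(cmod (inn I x g))\<^sup>2 \<le> 0 * nsq I g" by (meson LIMSEQ_le_const)
      thus ?thesis by simp
    qed
    hence xc: "x \<in> cH" using x by (simp add: carrier_perp)
    moreover have "(\<lambda>n. sqrt (nsq I (\<lambda>k. X n k - x k))) \<longlonglongrightarrow> sqrt 0" by (intro tendsto_intros x)
    ultimately show "\<exists>x\<in>carrier H. (\<lambda>n. hnorm H (X n \<ominus>\<^bsub>H\<^esub> x)) \<longlonglongrightarrow> 0"
      using hn[OF xc] by (intro bexI[of _ x]) simp_all
  qed
qed

section \<open>Bounded operators\<close>

text \<open>Linearity and boundedness without extensionality, so that formulas can be tested before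
  they are restricted to the carrier. Bounds are on squared norms; \<open>bound_iff\<close>
  translates.\<close>

definition opr :: "(('i \<Rightarrow> complex) \<Rightarrow> 'i \<Rightarrow> complex) \<Rightarrow> bool" where
  "opr T \<longleftrightarrow> (\<forall>f \<in> cH. T f \<in> cH) \<and> (\<forall>f \<in> cH. \<forall>g \<in> cH. T (\<lambda>i. f i + g i) = (\<lambda>i. T f i + T g i)) \<and>
     (\<forall>c. \<forall>f \<in> cH. T (\<lambda>i. c * f i) = (\<lambda>i. c * T f i)) \<and> (\<exists>C. \<forall>f \<in> cH. nsq I (T f) \<le> C * nsq I f)"

lemma bound_iff:
  "(\<exists>C. \<forall>f \<in> cH. sqrt (nsq I (T f)) \<le> C * sqrt (nsq I f)) \<longleftrightarrow> (\<exists>C. \<forall>f \<in> cH. nsq I (T f) \<le> C * nsq I f)"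
proof
  assume "\<exists>C. \<forall>f \<in> cH. sqrt (nsq I (T f)) \<le> C * sqrt (nsq I f)"
  then obtain C where C: "\<And>f. f \<in> cH \<Longrightarrow> sqrt (nsq I (T f)) \<le> C * sqrt (nsq I f)" by blast
  have "nsq I (T f) \<le> C\<^sup>2 * nsq I f" if "f \<in> cH" for f
  proof -
    have "(sqrt (nsq I (T f)))\<^sup>2 \<le> (C * sqrt (nsq I f))\<^sup>2" by (intro power_mono C that) (simp add: nsq_nonneg)
    thus ?thesis by (simp add: nsq_nonneg power_mult_distrib)
  qed
  thus "\<exists>C. \<forall>f \<in> cH. nsq I (T f) \<le> C * nsq I f" by blast
next
  assume "\<exists>C. \<forall>f \<in> cH. nsq I (T f) \<le> C * nsq I f"
  then obtain C where "\<And>f. f \<in> cH \<Longrightarrow> nsq I (T f) \<le> C * nsq I f" by blast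
  hence "\<forall>f \<in> cH. sqrt (nsq I (T f)) \<le> sqrt C * sqrt (nsq I f)" by (simp flip: real_sqrt_mult)
  thus "\<exists>C. \<forall>f \<in> cH. sqrt (nsq I (T f)) \<le> C * sqrt (nsq I f)" by blast
qed

lemma B_iff: "T \<in> B \<longleftrightarrow> T \<in> extensional cH \<and> opr T"
  unfolding bounded_ops_def opr_def by (auto simp: hnorm_perp bound_iff PiE_def)

lemma opr_cong: assumes "opr T" "\<And>f. f \<in> cH \<Longrightarrow> T' f = T f" shows "opr T'"
  using assms cH_add cH_scale unfolding opr_def by simp

lemma restrict_B: "opr T \<Longrightarrow> restrict T cH \<in> B"
  unfolding B_iff by (auto intro: opr_cong)

lemma B_closed: "T \<in> B \<Longrightarrow> f \<in> cH \<Longrightarrow> T f \<in> cH"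
  unfolding B_iff opr_def by blast

lemma B_L2: "T \<in> B \<Longrightarrow> f \<in> cH \<Longrightarrow> T f \<in> L2 I"
  by (rule cH_L2[OF B_closed])

lemma B_add: "T \<in> B \<Longrightarrow> f \<in> cH \<Longrightarrow> g \<in> cH \<Longrightarrow> T (\<lambda>i. f i + g i) = (\<lambda>i. T f i + T g i)"
  unfolding B_iff opr_def by blast

lemma B_scale: "T \<in> B \<Longrightarrow> f \<in> cH \<Longrightarrow> T (\<lambda>i. c * f i) = (\<lambda>i. c * T f i)"
  unfolding B_iff opr_def by blast

lemma B_diff: "T \<in> B \<Longrightarrow> f \<in> cH \<Longrightarrow> g \<in> cH \<Longrightarrow> T (\<lambda>i. f i - g i) = (\<lambda>i. T f i - T g i)"
  using B_add[of T f "\<lambda>i. - 1 * g i"] B_scale[of T g "- 1"] cH_scale[of g "- 1"] by simp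

lemma B_zero: "T \<in> B \<Longrightarrow> T (\<lambda>_. 0) = (\<lambda>_. 0)"
  using B_scale[of T "\<lambda>_. 0" 0] by simp

lemma B_bound: assumes "T \<in> B" obtains C where "\<And>f. f \<in> cH \<Longrightarrow> nsq I (T f) \<le> C * nsq I f" "C \<ge> 0"
proof -
  obtain C where C: "\<And>f. f \<in> cH \<Longrightarrow> nsq I (T f) \<le> C * nsq I f" using assms unfolding B_iff opr_def by blast
  have "nsq I (T f) \<le> \<bar>C\<bar> * nsq I f" if "f \<in> cH" for f
    using C[OF that] mult_right_mono[OF abs_ge_self nsq_nonneg, of C I f] by linarith
  thus ?thesis using that by force
qed

lemma B_ext: "T \<in> B \<Longrightarrow> S \<in> B \<Longrightarrow> (\<And>f. f \<in> cH \<Longrightarrow> T f = S f) \<Longrightarrow> T = S"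
  unfolding B_iff by (metis extensionalityI)

lemma B_mult: assumes "T \<in> B" "S \<in> B" shows "compose cH T S \<in> B"
proof -
  obtain C where C: "\<And>f. f \<in> cH \<Longrightarrow> nsq I (T f) \<le> C * nsq I f" "C \<ge> 0" using B_bound assms by blast
  obtain D where D: "\<And>f. f \<in> cH \<Longrightarrow> nsq I (S f) \<le> D * nsq I f" using B_bound assms by blast
  have "nsq I (T (S f)) \<le> C * D * nsq I f" if "f \<in> cH" for f
    using C(1)[OF B_closed[OF assms(2) that]] mult_left_mono[OF D[OF that] C(2)] by simp
  hence "opr (\<lambda>f. T (S f))"
    unfolding opr_def by (auto simp: B_closed[OF assms(1)] B_closed[OF assms(2)] B_add[OF assms(1)] B_add[OF assms(2)]
        B_scale[OF assms(1)] B_scale[OF assms(2)])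
  from restrict_B[OF this] show ?thesis unfolding compose_def by simp
qed

lemma B_one: "(\<lambda>f \<in> cH. f) \<in> B"
  by (rule restrict_B) (auto simp: opr_def intro: exI[of _ 1])

lemma op_finite_sum:
  assumes "T \<in> B" "finite F" "F \<subseteq> I"
  shows "T (P (\<lambda>i. if i \<in> F then c i else 0)) = (\<lambda>j. \<Sum>i\<in>F. c i * T (P (delta i)) j)"
  using assms(2,3)
proof (induction F rule: finite_induct)
  case empty thus ?case using B_zero assms(1) by simp
next
  case (insert a F)
  have L: "(\<lambda>i. if i \<in> F then c i else 0) \<in> L2 I" using insert by (intro L2_finite_support[of F]) auto
  have d: "delta a \<in> L2 I" using insert by (auto intro: delta_L2)
  have "(\<lambda>i. if i \<in> insert a F then c i else 0) = (\<lambda>i. c a * delta a i + (if i \<in> F then c i else 0))"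
    using insert by (auto simp: delta_def fun_eq_iff)
  hence "T (P (\<lambda>i. if i \<in> insert a F then c i else 0)) =
      (\<lambda>j. c a * T (P (delta a)) j + T (P (\<lambda>i. if i \<in> F then c i else 0)) j)"
    using P_add[OF L2_scale[OF d] L] P_scale P_cH[OF L] P_cH[OF d] cH_scale[OF P_cH[OF d]]
    by (simp add: B_add[OF assms(1)] B_scale[OF assms(1)])
  thus ?case using insert by simp
qed

text \<open>The adjoint is given by \<open>(T\<^sup>* y) i = \<langle>y, T P \<delta>\<^sub>i\<rangle>\<close>.\<close>

lemma ex_adjoint:
  assumes T: "T \<in> B"
  shows "\<exists>T' \<in> B. \<forall>x \<in> cH. \<forall>y \<in> cH. inn I (T x) y = inn I x (T' y)"
proof -
  obtain C where C: "\<And>f. f \<in> cH \<Longrightarrow> nsq I (T f) \<le> C * nsq I f" "C \<ge> 0" using B_bound T by blast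
  define A where "A y = (\<lambda>i. if i \<in> I then inn I y (T (P (delta i))) else 0)" for y
  have TP: "T (P f) \<in> L2 I" "nsq I (T (P f)) \<le> C * nsq I f" if "f \<in> L2 I" for f
    using B_L2[OF T P_cH[OF that]] C(1)[OF P_cH[OF that]] mult_left_mono[OF nsq_P_le[OF that] C(2)] by auto
  have fin_inn: "inn I (T (P (\<lambda>i. if i \<in> F then c i else 0))) y = (\<Sum>i\<in>F. c i * cnj (A y i))"
    if F: "finite F" "F \<subseteq> I" and y: "y \<in> cH" for F c y
  proof -
    have "inn I (T (P (\<lambda>i. if i \<in> F then c i else 0))) y = (\<Sum>i\<in>F. inn I (\<lambda>j. c i * T (P (delta i)) j) y)"
      unfolding op_finite_sum[OF T F]
      by (rule inn_sum_left[OF F(1) L2_scale[OF TP(1)[OF delta_L2]] cH_L2[OF y]]) (use F in auto)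
    also have "\<dots> = (\<Sum>i\<in>F. c i * cnj (A y i))"
      using F by (intro sum.cong refl) (auto simp: inn_scale_left A_def inn_cnj[of I "T _" y])
    finally show ?thesis .
  qed
  \<comment> \<open>The operator is tested on the truncation of \<open>A y\<close> itself. This
    gives \<open>\<sigma>\<^sup>2 \<le> C * \<sigma> * nsq I y\<close>, where one factor
    \<open>\<sigma>\<close> cancels.\<close>
  have fb: "(\<Sum>i\<in>F. (cmod (A y i))\<^sup>2) \<le> C * nsq I y" if F: "finite F" "F \<subseteq> I" and y: "y \<in> cH" for F y
  proof -
    define \<sigma> where "\<sigma> = (\<Sum>i\<in>F. (cmod (A y i))\<^sup>2)"
    define x where "x = (\<lambda>i. if i \<in> F then A y i else 0)"
    have x: "x \<in> L2 I" unfolding x_def using F by (intro L2_finite_support[of F]) auto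
    have nx: "nsq I x = \<sigma>"
    proof -
      have "nsq I x = (\<Sum>\<^sub>\<infinity>i\<in>F. (cmod (A y i))\<^sup>2)"
        unfolding nsq_def x_def by (rule infsum_cong_neutral) (use F in auto)
      thus ?thesis using F by (simp add: \<sigma>_def)
    qed
    have "inn I (T (P x)) y = of_real \<sigma>"
      unfolding x_def fin_inn[OF F y] \<sigma>_def complex_norm_square[symmetric] by simp
    hence "\<sigma>\<^sup>2 \<le> nsq I (T (P x)) * nsq I y"
      using Cauchy_Schwarz[OF TP(1)[OF x] cH_L2[OF y]] by simp
    also have "\<dots> \<le> C * \<sigma> * nsq I y" using TP(2)[OF x] nx nsq_nonneg[of I y] by (intro mult_right_mono) auto
    finally have "\<sigma> * \<sigma> \<le> \<sigma> * (C * nsq I y)" by (simp add: power2_eq_square mult_ac)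
    moreover have "\<sigma> \<ge> 0" by (simp add: \<sigma>_def sum_nonneg)
    ultimately have "\<sigma> \<le> C * nsq I y"
      using C(2) nsq_nonneg[of I y] by (cases "\<sigma> = 0") (auto simp: mult_le_cancel_left)
    thus ?thesis by (simp add: \<sigma>_def)
  qed
  have AL: "A y \<in> L2 I" and An: "nsq I (A y) \<le> C * nsq I y" if y: "y \<in> cH" for y
  proof -
    have s: "(\<lambda>i. (cmod (A y i))\<^sup>2) summable_on I"
      by (rule nonneg_bdd_above_summable_on) (use fb[OF _ _ y] in \<open>auto intro!: bdd_aboveI2[of _ _ "C * nsq I y"]\<close>)
    thus "A y \<in> L2 I" by (simp add: L2_iff) (simp add: A_def)
    show "nsq I (A y) \<le> C * nsq I y"
      unfolding nsq_def[of I "A y"] by (rule infsum_le_finite_sums[OF s]) (rule fb[OF _ _ y])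
  qed
  \<comment> \<open>Boundedness of \<open>T\<close> extends the identity from finitely supported
    vectors along truncations.\<close>
  have main: "inn I (T (P x)) y = inn I x (A y)" if x: "x \<in> L2 I" and y: "y \<in> cH" for x y
  proof (rule tendsto_unique)
    let ?x = "\<lambda>F i. if i \<in> F then x i else 0"
    show "((\<lambda>F. \<Sum>i\<in>F. x i * cnj (A y i)) \<longlongrightarrow> inn I x (A y)) (finite_subsets_at_top I)"
      using has_sum_infsum[OF prod_summable[OF x AL[OF y]]] by (simp add: has_sum_def inn_def)
    have lim: "((\<lambda>F. sqrt (C * nsq I (\<lambda>i. ?x F i - x i)) * sqrt (nsq I y)) \<longlongrightarrow> sqrt (C * 0) * sqrt (nsq I y))
        (finite_subsets_at_top I)"
      by (intro tendsto_intros truncation_tendsto x)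
    have "((\<lambda>F. (\<Sum>i\<in>F. x i * cnj (A y i)) - inn I (T (P x)) y) \<longlongrightarrow> 0) (finite_subsets_at_top I)"
    proof (rule Lim_null_comparison)
      show "((\<lambda>F. sqrt (C * nsq I (\<lambda>i. ?x F i - x i)) * sqrt (nsq I y)) \<longlongrightarrow> 0) (finite_subsets_at_top I)"
        using lim by simp
      show "\<forall>\<^sub>F F in finite_subsets_at_top I. norm ((\<Sum>i\<in>F. x i * cnj (A y i)) - inn I (T (P x)) y)
          \<le> sqrt (C * nsq I (\<lambda>i. ?x F i - x i)) * sqrt (nsq I y)"
      proof (rule eventually_finite_subsets_at_top_weakI)
        fix F assume F: "finite F" "F \<subseteq> I"
        have xF: "?x F \<in> L2 I" using F by (intro L2_finite_support[of F]) auto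
        have d: "(\<lambda>i. ?x F i - x i) \<in> L2 I" using L2_diff xF x by blast
        have "(\<Sum>i\<in>F. x i * cnj (A y i)) - inn I (T (P x)) y = inn I (T (P (?x F))) y - inn I (T (P x)) y"
          unfolding fin_inn[OF F y] ..
        also have "\<dots> = inn I (T (P (\<lambda>i. ?x F i - x i))) y"
          unfolding P_diff[OF xF x] B_diff[OF T P_cH[OF xF] P_cH[OF x]]
          by (rule inn_diff_left[OF TP(1)[OF xF] TP(1)[OF x] cH_L2[OF y], symmetric])
        finally have "norm ((\<Sum>i\<in>F. x i * cnj (A y i)) - inn I (T (P x)) y)
            \<le> sqrt (nsq I (T (P (\<lambda>i. ?x F i - x i)))) * sqrt (nsq I y)"
          using Cauchy_Schwarz_sqrt[OF TP(1)[OF d] cH_L2[OF y]] by simp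
        also have "\<dots> \<le> sqrt (C * nsq I (\<lambda>i. ?x F i - x i)) * sqrt (nsq I y)"
          using TP(2)[OF d] nsq_nonneg[of I y] by (intro mult_right_mono real_sqrt_le_mono) auto
        finally show "norm ((\<Sum>i\<in>F. x i * cnj (A y i)) - inn I (T (P x)) y)
            \<le> sqrt (C * nsq I (\<lambda>i. ?x F i - x i)) * sqrt (nsq I y)" .
      qed
    qed
    thus "((\<lambda>F. \<Sum>i\<in>F. x i * cnj (A y i)) \<longlongrightarrow> inn I (T (P x)) y) (finite_subsets_at_top I)"
      by (simp add: LIM_zero_iff)
  qed simp
  \<comment> \<open>The projection kills \<open>\<Lambda>\<close>, so \<open>main\<close> at these
    vectors puts \<open>A y\<close> into the complement.\<close>
  have Ac: "A y \<in> cH" if y: "y \<in> cH" for y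
  proof -
    have "inn I (A y) g = 0" if g: "g \<in> \<Lambda>" for g
    proof -
      have "inn I g (A y) = inn I (T (P g)) y" using main[OF Lam_L2[OF g] y] by simp
      also have "\<dots> = 0" using P_Lam[OF g] B_zero[OF T] by simp
      finally show ?thesis by (subst inn_cnj) simp
    qed
    thus ?thesis using AL y by (simp add: carrier_perp)
  qed
  have "opr A"
    unfolding opr_def
  proof (intro conjI ballI allI)
    show "\<exists>C. \<forall>f\<in>cH. nsq I (A f) \<le> C * nsq I f" using An by blast
    fix f assume f: "f \<in> cH"
    show "A f \<in> cH" using Ac f .
    show "A (\<lambda>i. c * f i) = (\<lambda>i. c * A f i)" for c
      by (simp add: A_def fun_eq_iff inn_scale_left)
    fix g assume g: "g \<in> cH"
    show "A (\<lambda>i. f i + g i) = (\<lambda>i. A f i + A g i)"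
    proof
      fix i show "A (\<lambda>i. f i + g i) i = A f i + A g i"
        using inn_add_left[OF cH_L2[OF f] cH_L2[OF g] TP(1)[OF delta_L2], of i] by (simp add: A_def)
    qed
  qed
  hence "restrict A cH \<in> B" by (rule restrict_B)
  moreover have "inn I (T x) y = inn I x (restrict A cH y)" if "x \<in> cH" "y \<in> cH" for x y
    using main[OF cH_L2[OF that(1)] that(2)] P_id[OF that(1)] that by simp
  ultimately show ?thesis by blast
qed

lemma adj_spec: assumes "T \<in> B"
  shows adj_B: "adj H T \<in> B" and adj_inn: "\<And>x y. x \<in> cH \<Longrightarrow> y \<in> cH \<Longrightarrow> inn I (T x) y = inn I x (adj H T y)"
proof -
  obtain T' where T': "T' \<in> B" "\<And>x y. x \<in> cH \<Longrightarrow> y \<in> cH \<Longrightarrow> inn I (T x) y = inn I x (T' y)"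
    using ex_adjoint assms by blast
  have u: "S = T'" if S: "S \<in> B" "\<forall>x \<in> cH. \<forall>y \<in> cH. inn I (T x) y = inn I x (S y)" for S
  proof (rule B_ext[OF S(1) T'(1)])
    fix f assume f: "f \<in> cH"
    show "S f = T' f"
    proof (rule eq_by_inn)
      fix g assume g: "g \<in> cH"
      show "inn I (S f) g = inn I (T' f) g"
        using S(2) T'(2)[OF g f] f g by (subst (1 2) inn_cnj) simp
    qed (rule B_closed[OF S(1) f] B_closed[OF T'(1) f])+
  qed
  have "adj H T = T'"
    unfolding adj_def
  proof (rule the_equality)
    show "T' \<in> B \<and> (\<forall>x\<in>cH. \<forall>y\<in>cH. ip H (T x) y = ip H x (T' y))" using T' by simp
    fix S assume "S \<in> B \<and> (\<forall>x\<in>cH. \<forall>y\<in>cH. ip H (T x) y = ip H x (S y))"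
    thus "S = T'" by (intro u) simp_all
  qed
  thus "adj H T \<in> B" "\<And>x y. x \<in> cH \<Longrightarrow> y \<in> cH \<Longrightarrow> inn I (T x) y = inn I x (adj H T y)" using T' by auto
qed

lemma adj_inn': "T \<in> B \<Longrightarrow> x \<in> cH \<Longrightarrow> y \<in> cH \<Longrightarrow> inn I (adj H T x) y = inn I x (T y)"
  using adj_inn[of T y x] by (subst (1 2) inn_cnj) simp

lemma adj_eqI:
  assumes "T \<in> B" "S \<in> B" "\<And>x y. x \<in> cH \<Longrightarrow> y \<in> cH \<Longrightarrow> inn I (T x) y = inn I x (S y)"
  shows "adj H T = S"
proof (rule B_ext[OF adj_B[OF assms(1)] assms(2)])
  fix f assume f: "f \<in> cH"
  show "adj H T f = S f"
  proof (rule eq_by_inn)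
    fix g assume g: "g \<in> cH"
    show "inn I (adj H T f) g = inn I (S f) g"
      using assms(3)[OF g f] adj_inn[OF assms(1) g f] by (subst (1 2) inn_cnj) simp
  qed (rule B_closed[OF adj_B[OF assms(1)] f] B_closed[OF assms(2) f])+
qed

text \<open>The values at the projected basis vectors give the coordinates of the adjoint, and an
  operator is determined by its adjoint.\<close>

lemma op_eqI:
  assumes "T \<in> B" "S \<in> B" "\<And>i. i \<in> I \<Longrightarrow> T (P (delta i)) = S (P (delta i))"
  shows "T = S"
proof -
  have coord: "adj H T g i = (if i \<in> I then inn I g (T (P (delta i))) else 0)" if T: "T \<in> B" and g: "g \<in> cH" for T g i
  proof (cases "i \<in> I")
    case True
    have c: "adj H T g \<in> cH" using B_closed[OF adj_B[OF T] g] .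
    have "adj H T g i = inn I (adj H T g) (P (delta i))"
      unfolding inn_P(2)[OF delta_L2[OF True] c] inn_delta[OF True] ..
    also have "\<dots> = inn I g (T (P (delta i)))" using adj_inn'[OF T g P_cH[OF delta_L2[OF True]]] .
    finally show ?thesis using True by simp
  next
    case False
    have "adj H T g \<in> L2 I" using B_L2[OF adj_B[OF T] g] .
    thus ?thesis using False by (simp add: L2_off)
  qed
  have adj: "adj H T g = adj H S g" if "g \<in> cH" for g
    using coord[OF assms(1) that] coord[OF assms(2) that] assms(3) by (intro ext) simp
  show ?thesis
  proof (rule B_ext[OF assms(1,2)])
    fix f assume f: "f \<in> cH"
    show "T f = S f"
    proof (rule eq_by_inn)
      fix g assume g: "g \<in> cH"
      show "inn I (T f) g = inn I (S f) g"
        unfolding adj_inn[OF assms(1) f g] adj_inn[OF assms(2) f g] adj[OF g] ..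
    qed (rule B_closed[OF assms(1) f] B_closed[OF assms(2) f])+
  qed
qed

section \<open>Commutants\<close>

lemma commutant_iff:
  assumes "M \<subseteq> B"
  shows "T \<in> commutant H M \<longleftrightarrow> T \<in> B \<and> (\<forall>S \<in> M. \<forall>f \<in> cH. T (S f) = S (T f))"
proof -
  have "compose cH T S = compose cH S T \<longleftrightarrow> (\<forall>f \<in> cH. T (S f) = S (T f))" for S
    by (auto simp: compose_def restrict_def fun_eq_iff)
  thus ?thesis by (auto simp: commutant_def)
qed

lemma commutant_B: "commutant H M \<subseteq> B"
  by (auto simp: commutant_def)

lemma commutant_antimono: "M \<subseteq> N \<Longrightarrow> commutant H N \<subseteq> commutant H M"
  by (auto simp: commutant_def)

lemma bicommutant_superset: "M \<subseteq> B \<Longrightarrow> M \<subseteq> commutant H (commutant H M)"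
  using commutant_iff[of M] commutant_iff[OF commutant_B, of _ M] by auto

lemma adj_commutant:
  assumes M: "M \<subseteq> B" "adj H ` M \<subseteq> M" shows "adj H ` commutant H M \<subseteq> commutant H M"
proof (rule image_subsetI)
  fix T assume T: "T \<in> commutant H M"
  have TB: "T \<in> B" using T commutant_B by blast
  show "adj H T \<in> commutant H M"
    unfolding commutant_iff[OF M(1)]
  proof (intro conjI ballI)
    show "adj H T \<in> B" using adj_B TB .
    fix S f assume S: "S \<in> M" and f: "f \<in> cH"
    have SB: "S \<in> B" "adj H S \<in> M" "adj H S \<in> B" using S M adj_B by auto
    note cl = B_closed[OF SB(1)] B_closed[OF SB(3)] B_closed[OF TB] B_closed[OF adj_B[OF TB]]
    show "adj H T (S f) = S (adj H T f)"
    proof (rule eq_by_inn)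
      fix g assume g: "g \<in> cH"
      have "inn I (adj H T (S f)) g = inn I (S f) (T g)" by (rule adj_inn'[OF TB cl(1)[OF f] g])
      also have "\<dots> = inn I f (adj H S (T g))" by (rule adj_inn[OF SB(1) f cl(3)[OF g]])
      also have "adj H S (T g) = T (adj H S g)" using T SB g commutant_iff[OF M(1)] by metis
      also have "inn I f (T (adj H S g)) = inn I (adj H T f) (adj H S g)"
        by (rule adj_inn'[OF TB f cl(2)[OF g], symmetric])
      also have "\<dots> = inn I (S (adj H T f)) g" by (rule adj_inn[OF SB(1) cl(4)[OF f] g, symmetric])
      finally show "inn I (adj H T (S f)) g = inn I (S (adj H T f)) g" .
    qed (rule cl(1,2,3,4) f)+
  qed
qed

lemma von_neumann_bicommutant:
  assumes "M \<subseteq> B" "adj H ` M \<subseteq> M"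
  shows "von_neumann_algebra H (commutant H (commutant H M))"
  unfolding von_neumann_algebra_def
proof (intro conjI)
  show "commutant H (commutant H M) \<subseteq> carrier (bounded_ops H)" by (rule commutant_B)
  show "adj H ` commutant H (commutant H M) \<subseteq> commutant H (commutant H M)"
    by (intro adj_commutant commutant_B assms)
  have "commutant H (commutant H (commutant H M)) = commutant H M"
    by (intro equalityI commutant_antimono bicommutant_superset commutant_B assms)
  thus "commutant H (commutant H (commutant H (commutant H M))) = commutant H (commutant H M)" by simp
qed

lemma hull_von_neumann:
  assumes "M \<subseteq> B" "adj H ` M \<subseteq> M"
  shows "von_neumann_algebra H hull M = commutant H (commutant H M)"
proof (rule hull_unique)
  show "M \<subseteq> commutant H (commutant H M)" by (rule bicommutant_superset[OF assms(1)])
  show "von_neumann_algebra H (commutant H (commutant H M))" by (rule von_neumann_bicommutant[OF assms])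
  fix N assume N: "M \<subseteq> N" "von_neumann_algebra H N"
  have "commutant H (commutant H M) \<subseteq> commutant H (commutant H N)"
    by (intro commutant_antimono N)
  thus "commutant H (commutant H M) \<subseteq> N" using N by (simp add: von_neumann_algebra_def)
qed

end

lemma nsq_reindex: "bij_betw \<sigma> I I \<Longrightarrow> nsq I (\<lambda>i. f (\<sigma> i)) = nsq I f"
  unfolding nsq_def by (rule infsum_reindex_bij_betw)

text \<open>The common shape of the left and the right Hecke operators.\<close>

locale perturbed_involution =
  fixes I :: "'i set" and \<sigma> :: "'i \<Rightarrow> 'i" and d :: "'i \<Rightarrow> bool" and c :: real
    and A :: "('i \<Rightarrow> complex) \<Rightarrow> 'i \<Rightarrow> complex"
  assumes \<sigma>: "i \<in> I \<Longrightarrow> \<sigma> i \<in> I" "i \<in> I \<Longrightarrow> \<sigma> (\<sigma> i) = i"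
    and A: "A f i = (if i \<in> I then f (\<sigma> i) + (if d i then of_real c * f i else 0) else 0)"
begin

lemma bij: "bij_betw \<sigma> I I"
  by (rule bij_betw_byWitness[where f' = \<sigma>]) (use \<sigma> in auto)

definition shift where "shift f i = (if i \<in> I then f (\<sigma> i) else (0 :: complex))"
definition diag where "diag f i = (if i \<in> I \<and> d i then of_real c * f i else (0 :: complex))"

lemma A_split: "A f = (\<lambda>i. shift f i + diag f i)"
  by (auto simp: A shift_def diag_def fun_eq_iff)

lemma shift: assumes "f \<in> L2 I" shows "shift f \<in> L2 I" "nsq I (shift f) = nsq I f"
proof -
  have "(\<lambda>i. (cmod (f (\<sigma> i)))\<^sup>2) summable_on I"
    using summable_on_reindex_bij_betw[OF bij, of "\<lambda>i. (cmod (f i))\<^sup>2"] assms by (simp add: L2_iff)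
  hence "(\<lambda>i. (cmod (shift f i))\<^sup>2) summable_on I"
    by (rule summable_on_cong[THEN iffD1, rotated]) (simp add: shift_def)
  thus "shift f \<in> L2 I" by (simp add: L2_iff) (simp add: shift_def)
  have "nsq I (shift f) = nsq I (\<lambda>i. f (\<sigma> i))"
    unfolding nsq_def by (rule infsum_cong) (simp add: shift_def)
  thus "nsq I (shift f) = nsq I f" using nsq_reindex[OF bij] by metis
qed

lemma diag: assumes "f \<in> L2 I" shows "diag f \<in> L2 I" "nsq I (diag f) \<le> c\<^sup>2 * nsq I f"
proof -
  show L: "diag f \<in> L2 I" by (rule L2_mono[OF assms, of _ "\<bar>c\<bar>"]) (auto simp: diag_def norm_mult)
  have "nsq I (diag f) \<le> nsq I (\<lambda>i. of_real c * f i)"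
    by (rule nsq_mono[OF L2_scale[OF assms] L]) (auto simp: diag_def)
  thus "nsq I (diag f) \<le> c\<^sup>2 * nsq I f" by (simp add: nsq_scale)
qed

lemma A_L2: "f \<in> L2 I \<Longrightarrow> A f \<in> L2 I"
  unfolding A_split by (rule L2_add[OF shift(1) diag(1)])

lemma A_bound: "f \<in> L2 I \<Longrightarrow> nsq I (A f) \<le> (2 + 2 * c\<^sup>2) * nsq I f"
  using nsq_add_le[OF shift(1) diag(1), of f f] shift(2)[of f] diag(2)[of f]
  unfolding A_split by (simp add: algebra_simps)

text \<open>The permutation is its own inverse, and the diagonal part is real.\<close>

lemma A_selfadjoint: assumes "f \<in> L2 I" "g \<in> L2 I" shows "inn I (A f) g = inn I f (A g)"
proof -
  have "inn I (shift f) g = (\<Sum>\<^sub>\<infinity>i\<in>I. f (\<sigma> i) * cnj (g (\<sigma> (\<sigma> i))))"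
    unfolding inn_def by (rule infsum_cong) (simp add: shift_def \<sigma>)
  also have "\<dots> = (\<Sum>\<^sub>\<infinity>i\<in>I. f i * cnj (g (\<sigma> i)))"
    by (rule infsum_reindex_bij_betw[OF bij])
  also have "\<dots> = inn I f (shift g)"
    unfolding inn_def by (rule infsum_cong) (simp add: shift_def)
  finally have 1: "inn I (shift f) g = inn I f (shift g)" .
  have 2: "inn I (diag f) g = inn I f (diag g)"
    unfolding inn_def by (rule infsum_cong) (simp add: diag_def)
  show ?thesis
    unfolding A_split
    by (simp add: inn_add_left[OF shift(1) diag(1)] inn_add_right[OF shift(1) diag(1)] assms 1 2)
qed

end

context hecke
begin

abbreviation G where "G \<equiv> carrier W"

lemma LO_perturbed: "s \<in> S \<Longrightarrow> perturbed_involution G (\<lambda>w. s \<otimes> w) (desc s) (r s - 1 / r s) (LO s)"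
  by unfold_locales (auto simp: LO_def p_def S_carrier)

lemma RO_perturbed: "s \<in> S \<Longrightarrow> perturbed_involution G (\<lambda>w. w \<otimes> s) (rdesc s) (r s - 1 / r s) (RO s)"
  by unfold_locales (auto simp: RO_def p_def S_carrier)

lemmas LO_L2 = perturbed_involution.A_L2[OF LO_perturbed]
  and RO_L2 = perturbed_involution.A_L2[OF RO_perturbed]
  and LO_bound = perturbed_involution.A_bound[OF LO_perturbed]
  and RO_bound = perturbed_involution.A_bound[OF RO_perturbed]
  and LO_selfadjoint = perturbed_involution.A_selfadjoint[OF LO_perturbed]
  and RO_selfadjoint = perturbed_involution.A_selfadjoint[OF RO_perturbed]

lemma LO_delta:
  assumes "s \<in> S" "w \<in> G" shows "LO s (delta w) = (\<lambda>v. delta (s \<otimes> w) v + (if desc s w then p s * delta w v else 0))"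
proof
  fix v
  have "s \<otimes> v = w \<longleftrightarrow> v = s \<otimes> w" if "v \<in> G" using assms that by auto
  thus "LO s (delta w) v = delta (s \<otimes> w) v + (if desc s w then p s * delta w v else 0)"
    using assms S_carrier by (auto simp: LO_def delta_def)
qed

lemma RO_delta:
  assumes "s \<in> S" "w \<in> G" shows "RO s (delta w) = (\<lambda>v. delta (w \<otimes> s) v + (if rdesc s w then p s * delta w v else 0))"
proof
  fix v
  have "v \<otimes> s = w \<longleftrightarrow> v = w \<otimes> s" if "v \<in> G" using assms that by auto
  thus "RO s (delta w) v = delta (w \<otimes> s) v + (if rdesc s w then p s * delta w v else 0)"
    using assms S_carrier by (auto simp: RO_def delta_def)
qed

lemma not_desc_one [simp]: "\<not> desc s \<one>" "\<not> rdesc s \<one>"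
  by (simp_all add: desc_def rdesc_def)

lemma central_delta: "central (delta \<one>)"
  unfolding central_def
proof (intro conjI ballI allI impI)
  fix s assume "s \<in> S"
  thus "LO s (delta \<one>) = RO s (delta \<one>)" by (simp add: LO_delta RO_delta S_carrier)
next
  fix w assume "w \<notin> G" thus "delta \<one> w = 0" by (auto simp: delta_def)
qed

lemma central_diff: "central f \<Longrightarrow> central g \<Longrightarrow> central (\<lambda>w. f w - g w)"
  by (simp add: central_def LO_diff RO_diff)

lemma central_scale: "central f \<Longrightarrow> central (\<lambda>w. c * f w)"
  by (simp add: central_def LO_scale RO_scale)

lemma L2_vanishing: assumes f: "f \<in> L2 G" shows "vanishing f"
  unfolding vanishing_def
proof (intro allI impI)
  fix x :: "nat \<Rightarrow> 'w" assume x: "inj x" "range x \<subseteq> G"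
  have "(\<lambda>w. (cmod (f w))\<^sup>2) summable_on range x"
    by (rule summable_on_subset_banach[OF _ x(2)]) (use f in \<open>simp add: L2_iff\<close>)
  hence "((\<lambda>w. (cmod (f w))\<^sup>2) \<circ> x) summable_on UNIV"
    using summable_on_reindex[OF x(1)] by blast
  hence "(\<lambda>n. (cmod (f (x n)))\<^sup>2) \<longlonglongrightarrow> 0"
    by (intro summable_LIMSEQ_zero summable_on_imp_summable) (simp add: o_def)
  hence "(\<lambda>n. sqrt ((cmod (f (x n)))\<^sup>2)) \<longlonglongrightarrow> sqrt 0" by (intro tendsto_intros)
  thus "(\<lambda>n. f (x n)) \<longlonglongrightarrow> 0" by (simp add: tendsto_norm_zero_iff)
qed

section \<open>Characters\<close>

text \<open>The one-dimensional characters of the Hecke algebra: every generator goes to a root of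
  its quadratic relation, and scalars satisfy the commutation relations automatically.\<close>

definition characters :: "('w \<Rightarrow> real) set" where
  "characters = (\<Pi>\<^sub>E s\<in>S. {r s, - 1 / r s})"

text \<open>The joint eigenvector of a character, normalised to 1 at the identity. It has the same
  eigenvalues for left and right operators.\<close>

definition char_vec :: "('w \<Rightarrow> real) \<Rightarrow> 'w \<Rightarrow> complex" where
  "char_vec \<theta> w = (if w \<in> G then (\<Prod>a\<in>#letters w. of_real (\<theta> a)) else 0)"

definition Lam :: "('w \<Rightarrow> complex) set" where
  "Lam = {char_vec \<theta> | \<theta>. \<theta> \<in> characters \<and> char_vec \<theta> \<in> L2 G}"

lemma characters_cases: "\<theta> \<in> characters \<Longrightarrow> s \<in> S \<Longrightarrow> \<theta> s = r s \<or> \<theta> s = - 1 / r s"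
  unfolding characters_def by (auto dest!: PiE_mem)

lemma characters_root:
  assumes "\<theta> \<in> characters" "s \<in> S"
  shows "\<theta> s \<noteq> 0" "complex_of_real (\<theta> s) * of_real (\<theta> s) = 1 + p s * of_real (\<theta> s)"
proof -
  have r: "r s \<noteq> 0" using r_range[OF assms(2)] by simp
  thus "\<theta> s \<noteq> 0" using characters_cases[OF assms] by auto
  have "\<theta> s * \<theta> s = 1 + (r s - 1 / r s) * \<theta> s"
  proof (rule disjE[OF characters_cases[OF assms]])
    assume e: "\<theta> s = r s" show ?thesis unfolding e using r by (simp add: field_simps)
  next
    assume e: "\<theta> s = - 1 / r s" show ?thesis unfolding e using r by (simp add: field_simps)
  qed
  hence "complex_of_real (\<theta> s * \<theta> s) = of_real (1 + (r s - 1 / r s) * \<theta> s)" by simp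
  thus "complex_of_real (\<theta> s) * of_real (\<theta> s) = 1 + p s * of_real (\<theta> s)" by (simp add: p_def)
qed

lemma char_vec_one [simp]: "char_vec \<theta> \<one> = 1"
  by (simp add: char_vec_def)

lemma char_vec_off: "w \<notin> G \<Longrightarrow> char_vec \<theta> w = 0"
  by (simp add: char_vec_def)

lemma LO_char_vec: assumes "\<theta> \<in> characters" "s \<in> S"
  shows "LO s (char_vec \<theta>) = (\<lambda>w. of_real (\<theta> s) * char_vec \<theta> w)"
proof
  fix w
  show "LO s (char_vec \<theta>) w = of_real (\<theta> s) * char_vec \<theta> w"
  proof (cases "w \<in> G \<and> desc s w")
    case True
    hence "char_vec \<theta> w = of_real (\<theta> s) * char_vec \<theta> (s \<otimes> w)"
      using letters_down[OF assms(2), of w] S_carrier[OF assms(2)] by (simp add: char_vec_def)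
    moreover have "of_real (\<theta> s) * (of_real (\<theta> s) * x) = x + p s * (of_real (\<theta> s) * x)" for x :: complex
      using arg_cong[OF characters_root(2)[OF assms], of "\<lambda>y. y * x"] by (simp add: algebra_simps)
    ultimately show ?thesis using True by (simp add: LO_def)
  next
    case False
    thus ?thesis using letters_up[OF assms(2), of w] S_carrier[OF assms(2)] by (auto simp: LO_def char_vec_def)
  qed
qed

lemma RO_char_vec: assumes "\<theta> \<in> characters" "s \<in> S"
  shows "RO s (char_vec \<theta>) = (\<lambda>w. of_real (\<theta> s) * char_vec \<theta> w)"
proof
  fix w
  show "RO s (char_vec \<theta>) w = of_real (\<theta> s) * char_vec \<theta> w"
  proof (cases "w \<in> G \<and> rdesc s w")
    case True
    hence "char_vec \<theta> w = of_real (\<theta> s) * char_vec \<theta> (w \<otimes> s)"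
      using letters_rdown[OF assms(2), of w] S_carrier[OF assms(2)] by (simp add: char_vec_def)
    moreover have "of_real (\<theta> s) * (of_real (\<theta> s) * x) = x + p s * (of_real (\<theta> s) * x)" for x :: complex
      using arg_cong[OF characters_root(2)[OF assms], of "\<lambda>y. y * x"] by (simp add: algebra_simps)
    ultimately show ?thesis using True by (simp add: RO_def)
  next
    case False
    thus ?thesis using letters_rup[OF assms(2), of w] S_carrier[OF assms(2)] by (auto simp: RO_def char_vec_def)
  qed
qed

text \<open>Along a reduced word every letter multiplies the value by its eigenvalue, so joint
  eigenspaces have dimension at most one.\<close>

lemma joint_eigenvector:
  assumes \<theta>: "\<theta> \<in> characters" and y: "\<And>w. w \<notin> G \<Longrightarrow> y w = 0"
    and eig: "\<And>s. s \<in> S \<Longrightarrow> LO s y = (\<lambda>w. of_real (\<theta> s) * y w)"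
  shows "y = (\<lambda>w. y \<one> * char_vec \<theta> w)"
proof
  fix w
  show "y w = y \<one> * char_vec \<theta> w"
  proof (cases "w \<in> G")
    case True
    then obtain u where "red u" "val u = w" using ex_red by blast
    thus ?thesis
    proof (induction u arbitrary: w)
      case (Cons s u)
      have s: "s \<in> S" "val u \<in> G" "\<not> desc s (val u)" using Cons.prems red_lists desc_red by auto
      have "y w = of_real (\<theta> s) * y (val u)"
        using fun_cong[OF eig[OF s(1)], of "val u"] s Cons.prems by (simp add: LO_def)
      moreover have "char_vec \<theta> w = of_real (\<theta> s) * char_vec \<theta> (val u)"
        using fun_cong[OF LO_char_vec[OF \<theta> s(1)], of "val u"] s Cons.prems by (simp add: LO_def)
      ultimately show ?case using Cons by simp
    qed simp
  qed (simp add: y char_vec_off)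
qed

lemma char_vec_orthogonal:
  assumes "\<theta> \<in> characters" "\<eta> \<in> characters" "char_vec \<theta> \<in> L2 G" "char_vec \<eta> \<in> L2 G" "char_vec \<theta> \<noteq> char_vec \<eta>"
  shows "inn G (char_vec \<theta>) (char_vec \<eta>) = 0"
proof -
  have "\<theta> \<noteq> \<eta>" using assms by auto
  then obtain s where s: "s \<in> S" "\<theta> s \<noteq> \<eta> s" using assms(1,2) unfolding characters_def by (meson PiE_ext)
  have "of_real (\<theta> s) * inn G (char_vec \<theta>) (char_vec \<eta>) = of_real (\<eta> s) * inn G (char_vec \<theta>) (char_vec \<eta>)"
    using LO_selfadjoint[OF s(1) assms(3,4)] LO_char_vec[OF assms(1) s(1)] LO_char_vec[OF assms(2) s(1)]
    by (simp add: inn_scale_left inn_scale_right)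
  thus ?thesis using s by simp
qed

end

section \<open>Projections of central vectors onto the complement of the joint eigenvectors\<close>

locale hecke_irr = hecke W S m r for W :: "('w, 'b) monoid_scheme" (structure) and S m r +
  assumes irr: "irreducible_system W S" and finS: "finite S" and cardS: "card S \<ge> 3"
begin

sublocale l2perp G Lam
proof
  have "finite characters" unfolding characters_def by (rule finite_PiE[OF finS]) simp
  thus "finite Lam" by (rule finite_subset[rotated, OF finite_imageI[of _ char_vec]]) (auto simp: Lam_def)
  show "g \<in> L2 G" if "g \<in> Lam" for g using that by (auto simp: Lam_def)
  show "nsq G g \<noteq> 0" if "g \<in> Lam" for g
  proof -
    obtain \<theta> where g: "g = char_vec \<theta>" "g \<in> L2 G" using \<open>g \<in> Lam\<close> by (auto simp: Lam_def)
    hence "g \<one> \<noteq> 0" by simp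
    thus ?thesis using nsq_eq_0[OF g(2)] by (auto simp: fun_eq_iff)
  qed
  show "inn G g h = 0" if "g \<in> Lam" "h \<in> Lam" "g \<noteq> h" for g h
    using that char_vec_orthogonal by (auto simp: Lam_def)
qed

lemma Lam_eigen: assumes "g \<in> Lam"
  obtains \<theta> where "\<theta> \<in> characters" "g = char_vec \<theta>"
    "\<And>s. s \<in> S \<Longrightarrow> LO s g = (\<lambda>w. of_real (\<theta> s) * g w)" "\<And>s. s \<in> S \<Longrightarrow> RO s g = (\<lambda>w. of_real (\<theta> s) * g w)"
  using assms LO_char_vec RO_char_vec by (auto simp: Lam_def)

lemma LO_cH: assumes "s \<in> S" "f \<in> cH" shows "LO s f \<in> cH" "RO s f \<in> cH"
proof -
  have f: "f \<in> L2 G" using assms cH_L2 by blast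
  have 0: "inn G f g = 0" if "g \<in> Lam" for g using assms that by (simp add: carrier_perp)
  have "inn G (LO s f) g = 0 \<and> inn G (RO s f) g = 0" if g: "g \<in> Lam" for g
  proof -
    obtain \<theta> where \<theta>: "LO s g = (\<lambda>w. of_real (\<theta> s) * g w)" "RO s g = (\<lambda>w. of_real (\<theta> s) * g w)"
      using Lam_eigen[OF g] assms(1) by metis
    show ?thesis
      unfolding LO_selfadjoint[OF assms(1) f Lam_L2[OF g]] RO_selfadjoint[OF assms(1) f Lam_L2[OF g]] \<theta>
      by (simp add: inn_scale_right 0[OF g])
  qed
  thus "LO s f \<in> cH" "RO s f \<in> cH" using f assms LO_L2 RO_L2 by (auto simp: carrier_perp)
qed

text \<open>A self-adjoint operator that leaves the complement invariant commutes with the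
  projection onto it.\<close>

lemma P_LO: assumes s: "s \<in> S" and f: "f \<in> L2 G"
  shows "P (LO s f) = LO s (P f)" "P (RO s f) = RO s (P f)"
proof -
  have *: "P (A f) = A (P f)"
    if A: "\<And>f. f \<in> L2 G \<Longrightarrow> A f \<in> L2 G" "\<And>f. f \<in> cH \<Longrightarrow> A f \<in> cH"
      "\<And>f g. f \<in> L2 G \<Longrightarrow> g \<in> L2 G \<Longrightarrow> inn G (A f) g = inn G f (A g)" for A
  proof (rule eq_by_inn)
    show "P (A f) \<in> cH" using P_cH A f by blast
    show "A (P f) \<in> cH" using P_cH A f by blast
    fix g assume g: "g \<in> cH"
    have "inn G (P (A f)) g = inn G (A f) g" by (rule inn_P(1)[OF A(1)[OF f] g])
    also have "\<dots> = inn G f (A g)" by (rule A(3)[OF f cH_L2[OF g]])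
    also have "\<dots> = inn G (P f) (A g)" by (rule inn_P(1)[OF f A(2)[OF g], symmetric])
    also have "\<dots> = inn G (A (P f)) g" by (rule A(3)[OF P_L2[OF f] cH_L2[OF g], symmetric])
    finally show "inn G (P (A f)) g = inn G (A (P f)) g" .
  qed
  show "P (LO s f) = LO s (P f)" by (rule *) (use s LO_L2 LO_cH LO_selfadjoint in blast)+
  show "P (RO s f) = RO s (P f)" by (rule *) (use s RO_L2 LO_cH RO_selfadjoint in blast)+
qed

text \<open>Splitting \<open>y\<close> into eigenvectors of one commuting generator \<open>a\<close> after the other.\<close>

lemma P_central_eigen:
  assumes "finite M" "M \<subseteq> S" "\<And>s t. s \<in> M \<Longrightarrow> t \<in> M \<Longrightarrow> \<not> nc s t"
    "y \<in> L2 G" "central y" "\<And>s. s \<in> S - M \<Longrightarrow> \<exists>c \<in> {r s, - 1 / r s}. LO s y = (\<lambda>w. of_real c * y w)"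
  shows "P y = (\<lambda>_. 0)"
  using assms
proof (induction M arbitrary: y rule: finite_induct)
  case empty
  obtain \<theta>' where \<theta>': "\<And>s. s \<in> S \<Longrightarrow> \<theta>' s \<in> {r s, - 1 / r s} \<and> LO s y = (\<lambda>w. of_real (\<theta>' s) * y w)"
    using empty.prems(5) by (metis Diff_empty)
  define \<theta> where "\<theta> = restrict \<theta>' S"
  have \<theta>: "\<theta> \<in> characters" using \<theta>' by (auto simp: \<theta>_def characters_def)
  have y: "y = (\<lambda>w. y \<one> * char_vec \<theta> w)"
    using empty.prems(4) \<theta>' by (intro joint_eigenvector[OF \<theta>]) (auto simp: central_def \<theta>_def)
  show ?case
  proof (cases "y \<one> = 0")
    case True thus ?thesis using y by simp
  next
    case False
    have "(\<lambda>w. (1 / y \<one>) * y w) \<in> L2 G" by (rule L2_scale[OF empty.prems(3)])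
    moreover have "(\<lambda>w. (1 / y \<one>) * y w) = char_vec \<theta>" by (subst (2) y) (simp add: False fun_eq_iff)
    ultimately have "char_vec \<theta> \<in> Lam" using \<theta> by (auto simp: Lam_def)
    from P_Lam[OF this] have "P (\<lambda>w. y \<one> * char_vec \<theta> w) = (\<lambda>_. 0)" by (simp add: P_scale)
    thus ?thesis using y by metis
  qed
next
  case (insert a M)
  have aS: "a \<in> S" using insert.prems by auto
  have ra: "r a \<noteq> 0" "0 < r a" using r_range[OF aS] by auto
  have piece: "P (\<lambda>w. LO a y w - of_real c * y w) = (\<lambda>_. 0)" if c: "c \<in> {r a, - 1 / r a}" for c
  proof (rule insert.IH)
    define y' where "y' = (\<lambda>w. LO a y w - of_real c * y w)"
    have yL: "y \<in> L2 G" "central y" using insert.prems by auto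
    have y0: "y w = 0" if "w \<notin> G" for w using yL that central_off by blast
    have RO_LO: "RO s (LO a y) = LO a (LO s y)" if "s \<in> S" for s
      using LO_RO[OF aS that] central_LO[OF yL(2) that] by simp
    \<comment> \<open>Either \<open>s\<close> commutes with \<open>a\<close>, or \<open>y\<close> is
      an eigenvector for \<open>s\<close> and centrality lets \<open>RO a\<close> replace
      \<open>LO a\<close>.\<close>
    have com: "LO s (LO a y) = LO a (LO s y)" if s: "s \<in> S" for s
    proof (cases "s \<in> insert a M")
      case True thus ?thesis using insert.prems(2) aS s by (intro LO_commute) auto
    next
      case False
      then obtain d where d: "LO s y = (\<lambda>w. of_real d * y w)" using insert.prems(5) s by blast
      have "LO s (LO a y) = LO s (RO a y)" using central_LO[OF yL(2) aS] by simp
      also have "\<dots> = RO a (LO s y)" by (rule LO_RO[OF s aS])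
      also have "\<dots> = LO a (LO s y)" unfolding d RO_scale LO_scale using central_LO[OF yL(2) aS] by simp
      finally show ?thesis .
    qed
    show "(\<lambda>w. LO a y w - of_real c * y w) \<in> L2 G"
      by (intro L2_diff LO_L2 L2_scale aS yL)
    show "central (\<lambda>w. LO a y w - of_real c * y w)"
      unfolding central_def LO_diff RO_diff LO_scale RO_scale
      using com RO_LO central_LO[OF yL(2)] y0 by simp
    fix s assume s: "s \<in> S - M"
    show "\<exists>d\<in>{r s, - 1 / r s}. LO s (\<lambda>w. LO a y w - of_real c * y w) = (\<lambda>w. of_real d * (LO a y w - of_real c * y w))"
    proof (cases "s = a")
      case True
      \<comment> \<open>The other root: \<open>c + d = p a\<close> and \<open>c * d = - 1\<close>,
        so \<open>LO a - c\<close> maps into the eigenspace of \<open>d\<close>.\<close>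
      define d where "d = (r a - 1 / r a) - c"
      have d: "d \<in> {r a, - 1 / r a}" "c * d = - 1"
        using c ra by (cases "c = r a"; simp add: d_def)+
      have pa: "p a = of_real c + of_real d" by (simp add: p_def d_def)
      have "complex_of_real d * of_real c = of_real (c * d)" by simp
      hence one: "complex_of_real d * (of_real c * x) = - x" for x
        unfolding d(2) by (simp add: mult.assoc[symmetric])
      have sq: "LO a (LO a y) = (\<lambda>w. y w + p a * LO a y w)" by (rule LO_square[OF aS]) (rule y0)
      have "LO a (\<lambda>w. LO a y w - of_real c * y w) = (\<lambda>w. of_real d * (LO a y w - of_real c * y w))"
        unfolding LO_diff LO_scale sq
        by (intro ext) (simp add: pa one distrib_right right_diff_distrib)
      thus ?thesis using d True by blast
    next
      case False
      then obtain d where d: "d \<in> {r s, - 1 / r s}" "LO s y = (\<lambda>w. of_real d * y w)"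
        using insert.prems(5)[of s] s by blast
      have "LO s (\<lambda>w. LO a y w - of_real c * y w) = (\<lambda>w. of_real d * (LO a y w - of_real c * y w))"
        unfolding LO_diff LO_scale using com[of s] s d(2) by (simp add: LO_scale algebra_simps)
      thus ?thesis using d by blast
    qed
  qed (use insert.prems in auto)
  have L: "(\<lambda>w. LO a y w - of_real c * y w) \<in> L2 G" for c
    using insert.prems(3) by (intro L2_diff LO_L2 L2_scale aS)
  \<comment> \<open>The two pieces differ by the multiple of \<open>y\<close> by the distance of the
    two roots, which is not 0.\<close>
  have "P (\<lambda>w. (LO a y w - of_real (- 1 / r a) * y w) - (LO a y w - of_real (r a) * y w)) = (\<lambda>_. 0)"
    unfolding P_diff[OF L L] piece[of "r a", OF insertI1] piece[of "- 1 / r a", OF insertI2[OF singletonI]]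
    by simp
  moreover have "(\<lambda>w. (LO a y w - of_real (- 1 / r a) * y w) - (LO a y w - of_real (r a) * y w)) =
      (\<lambda>w. of_real (r a + 1 / r a) * y w)" by (simp add: algebra_simps)
  ultimately have "(\<lambda>w. of_real (r a + 1 / r a) * P y w) = (\<lambda>_. 0)" by (simp only: P_scale)
  moreover have "complex_of_real (r a + 1 / r a) \<noteq> 0"
    using ra by (metis add_pos_pos less_irrefl of_real_eq_0_iff zero_less_divide_1_iff)
  ultimately show ?case by (simp add: fun_eq_iff)
qed

text \<open>Once a multiple of \<open>delta \<one>\<close> is removed, stable generators act by
  scalars. The others commute pairwise and form the set to be split off in
  \<open>P_central_eigen\<close>.\<close>

theorem P_central: assumes "z \<in> L2 G" "central z" shows "\<exists>c. P z = (\<lambda>w. c * P (delta \<one>) w)"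
proof -
  obtain c where c: "\<And>s. s \<in> S \<Longrightarrow> stable s \<Longrightarrow>
      LO s (\<lambda>w. z w - c * delta \<one> w) = (\<lambda>w. of_real (r s) * (z w - c * delta \<one> w))"
    using central_modulo_scalar[OF irr finS cardS assms(2) L2_vanishing[OF assms(1)]] by blast
  have d: "delta \<one> \<in> L2 G" by (simp add: delta_L2)
  have "P (\<lambda>w. z w - c * delta \<one> w) = (\<lambda>_. 0)"
  proof (rule P_central_eigen[of "{s \<in> S. \<not> stable s}"])
    show "\<exists>c'\<in>{r s, - 1 / r s}. LO s (\<lambda>w. z w - c * delta \<one> w) = (\<lambda>w. of_real c' * (z w - c * delta \<one> w))"
      if "s \<in> S - {s \<in> S. \<not> stable s}" for s
      using c[of s] that by (intro bexI[of _ "r s"]) auto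
    show "(\<lambda>w. z w - c * delta \<one> w) \<in> L2 G" by (intro L2_diff L2_scale assms d)
    show "central (\<lambda>w. z w - c * delta \<one> w)" by (intro central_diff central_scale assms central_delta)
  qed (use finS unstable_commute in auto)
  hence "(\<lambda>w. P z w - c * P (delta \<one>) w) = (\<lambda>_. 0)"
    by (simp add: P_diff[OF assms(1) L2_scale[OF d]] P_scale)
  thus ?thesis by (auto simp: fun_eq_iff)
qed

end

context racg
begin

lemma red_snoc:
  assumes "red (u @ [s])"
  shows "red u" "s \<in> S" "\<not> rdesc s (val u)" "val (u @ [s]) = val u \<otimes> s"
proof -
  have "red (s # rev u)" using red_rev[OF assms] by simp
  hence r: "s \<in> S" "red (rev u)" "\<not> starts (proj (rev u)) s" by auto
  show "s \<in> S" by (rule r)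
  show u: "red u" using red_rev[OF r(2)] by simp
  have l: "u \<in> lists S" using red_lists u by blast
  have "\<not> desc s (val (rev u))" using desc_red r by blast
  thus "\<not> rdesc s (val u)" using val_rev[OF l] rdesc_inv[OF r(1) val_closed[OF l]] by simp
  show "val (u @ [s]) = val u \<otimes> s" using val_append[OF l, of "[s]"] r(1) by (simp add: S_carrier)
qed

lemma ex_red': assumes "w \<in> carrier W" obtains u where "red u" "val u = w"
  using ex_red[OF assms] by blast

end

section \<open>Left and right Hecke operators on the complement\<close>

context hecke_irr
begin

lemma opr_LO: assumes "s \<in> S" shows "opr (LO s)" "opr (RO s)"
proof -
  have "\<exists>C. \<forall>f\<in>cH. nsq G (LO s f) \<le> C * nsq G f" "\<exists>C. \<forall>f\<in>cH. nsq G (RO s f) \<le> C * nsq G f"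
    using LO_bound[OF assms cH_L2] RO_bound[OF assms cH_L2] by blast+
  thus "opr (LO s)" "opr (RO s)"
    unfolding opr_def using LO_cH[OF assms] by (auto simp: LO_add LO_scale RO_add RO_scale)
qed

definition TL where "TL s = restrict (LO s) cH"
definition TR where "TR s = restrict (RO s) cH"

lemma TL_B: "s \<in> S \<Longrightarrow> TL s \<in> B" and TR_B: "s \<in> S \<Longrightarrow> TR s \<in> B"
  unfolding TL_def TR_def by (simp_all add: restrict_B opr_LO)

lemma TL_app [simp]: "f \<in> cH \<Longrightarrow> TL s f = LO s f" and TR_app [simp]: "f \<in> cH \<Longrightarrow> TR s f = RO s f"
  by (simp_all add: TL_def TR_def)

lemma adj_TL: assumes "s \<in> S" shows "adj H (TL s) = TL s"
  by (rule adj_eqI[OF TL_B[OF assms] TL_B[OF assms]]) (simp add: LO_selfadjoint assms cH_L2)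

lemma adj_TR: assumes "s \<in> S" shows "adj H (TR s) = TR s"
  by (rule adj_eqI[OF TR_B[OF assms] TR_B[OF assms]]) (simp add: RO_selfadjoint assms cH_L2)

lemma TLS: "TL ` S \<subseteq> B" "adj H ` TL ` S \<subseteq> TL ` S"
  using TL_B adj_TL by auto

lemma TRS: "TR ` S \<subseteq> B" "adj H ` TR ` S \<subseteq> TR ` S"
  using TR_B adj_TR by auto

definition Vn where "Vn = commutant H (commutant H (TL ` S))"
text \<open>It contains \<open>Vn\<close>, since left and right operators commute. The trace
  arguments rest on commutation with the right operators and are therefore carried out in this
  algebra.\<close>

definition Rc where "Rc = commutant H (TR ` S)"

lemma Rc_iff: "T \<in> Rc \<longleftrightarrow> T \<in> B \<and> (\<forall>s \<in> S. \<forall>f \<in> cH. T (RO s f) = RO s (T f))"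
  unfolding Rc_def commutant_iff[OF TRS(1)] using B_closed by auto

lemma TL_commutant_iff: "T \<in> commutant H (TL ` S) \<longleftrightarrow> T \<in> B \<and> (\<forall>s \<in> S. \<forall>f \<in> cH. T (LO s f) = LO s (T f))"
  unfolding commutant_iff[OF TLS(1)] using B_closed by auto

lemma TR_commutant: "TR ` S \<subseteq> commutant H (TL ` S)"
proof
  fix T assume "T \<in> TR ` S"
  then obtain t where t: "t \<in> S" "T = TR t" by blast
  thus "T \<in> commutant H (TL ` S)"
    unfolding TL_commutant_iff using TR_B LO_cH LO_RO by auto
qed

lemma Vn_Rc: "Vn \<subseteq> Rc"
  unfolding Vn_def Rc_def by (rule commutant_antimono[OF TR_commutant])

lemma Rc_B: "T \<in> Rc \<Longrightarrow> T \<in> B"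
  by (simp add: Rc_iff)

lemma Rc_adj: "T \<in> Rc \<Longrightarrow> adj H T \<in> Rc"
  using adj_commutant[OF TRS] unfolding Rc_def by blast

lemma Rc_mult: assumes "T \<in> Rc" "T' \<in> Rc" shows "compose cH T T' \<in> Rc"
  unfolding Rc_iff
proof (intro conjI ballI)
  show "compose cH T T' \<in> B" using assms Rc_B B_mult by blast
  fix s f assume "s \<in> S" "f \<in> cH"
  thus "compose cH T T' (RO s f) = RO s (compose cH T T' f)"
    using assms LO_cH(2) B_closed[OF Rc_B[OF assms(2)]] by (simp add: compose_eq Rc_iff)
qed

section \<open>The trace vector\<close>

abbreviation Om where "Om \<equiv> P (delta \<one>)"

lemma Om_cH: "Om \<in> cH"
  by (rule P_cH) (simp add: delta_L2)

lemma foldr_RO_L2: "l \<in> lists S \<Longrightarrow> f \<in> L2 G \<Longrightarrow> foldr RO l f \<in> L2 G"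
  by (induction l) (auto intro: RO_L2)

lemma foldr_RO_cH: "l \<in> lists S \<Longrightarrow> f \<in> cH \<Longrightarrow> foldr RO l f \<in> cH"
  by (induction l) (auto intro: LO_cH)

lemma P_foldr_RO: "l \<in> lists S \<Longrightarrow> f \<in> L2 G \<Longrightarrow> P (foldr RO l f) = foldr RO l (P f)"
  by (induction l) (auto simp: P_LO foldr_RO_L2)

lemma Rc_foldr_RO: "T \<in> Rc \<Longrightarrow> l \<in> lists S \<Longrightarrow> f \<in> cH \<Longrightarrow> T (foldr RO l f) = foldr RO l (T f)"
  by (induction l) (auto simp: Rc_iff foldr_RO_cH)

lemma inn_foldr_RO:
  "l \<in> lists S \<Longrightarrow> f \<in> L2 G \<Longrightarrow> g \<in> L2 G \<Longrightarrow> inn G (foldr RO l f) g = inn G f (foldr RO (rev l) g)"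
  by (induction l arbitrary: g) (auto simp: RO_selfadjoint foldr_RO_L2 RO_L2)

lemma foldr_RO_delta: "red u \<Longrightarrow> foldr RO (rev u) (delta \<one>) = delta (val u)"
proof (induction u rule: rev_induct)
  case (snoc s u)
  note s = red_snoc[OF snoc.prems]
  have "val u \<in> G" using red_lists s by auto
  thus ?case using snoc.IH s by (simp add: RO_delta)
qed simp

lemma P_delta: assumes "red u" shows "P (delta (val u)) = foldr RO (rev u) Om"
proof -
  have "rev u \<in> lists S" using red_lists[OF assms] by auto
  from P_foldr_RO[OF this, of "delta \<one>"] show ?thesis using foldr_RO_delta[OF assms] by (simp add: delta_L2)
qed

text \<open>Right operators carry the trace vector to every projected basis vector, and the
  operators in \<open>Rc\<close> commute with them.\<close>

lemma Rc_determined: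
  assumes "T \<in> Rc" "T' \<in> Rc" "T Om = T' Om" shows "T = T'"
proof (rule op_eqI[OF Rc_B[OF assms(1)] Rc_B[OF assms(2)]])
  fix w assume "w \<in> G"
  then obtain u where u: "red u" "val u = w" by (rule ex_red')
  have "rev u \<in> lists S" using red_lists[OF u(1)] by auto
  thus "T (P (delta w)) = T' (P (delta w))"
    using P_delta[OF u(1)] u(2) Rc_foldr_RO assms Om_cH by metis
qed

text \<open>The antilinear conjugation that implements the adjoint on the trace vector.\<close>

definition Jv :: "('w \<Rightarrow> complex) \<Rightarrow> 'w \<Rightarrow> complex" where
  "Jv f w = (if w \<in> G then cnj (f (inv w)) else 0)"

text \<open>A coordinate of \<open>T Om\<close> is an inner product with the trace vector moved by
  right operators. Shifting these to the other side reverses their word, which accounts for the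
  inverse in \<open>Jv\<close>.\<close>

lemma Rc_adj_Om: assumes T: "T \<in> Rc" shows "adj H T Om = Jv (T Om)"
proof -
  have TO: "T Om \<in> cH" "adj H T Om \<in> cH"
    using B_closed[OF Rc_B[OF T] Om_cH] B_closed[OF adj_B[OF Rc_B[OF T]] Om_cH] by auto
  have key: "T Om w = cnj (adj H T Om (inv w))" if w: "w \<in> G" for w
  proof -
    obtain u where u: "red u" "val u = w" using w by (rule ex_red')
    have l: "u \<in> lists S" "rev u \<in> lists S" using red_lists[OF u(1)] by auto
    have "T Om w = inn G (T Om) (P (delta w))"
      using inn_P(2)[OF delta_L2[OF w] TO(1)] inn_delta[OF w] by metis
    also have "\<dots> = inn G (foldr RO u (T Om)) Om"
      using P_delta[OF u(1)] u(2) inn_foldr_RO[OF l(1) cH_L2[OF TO(1)] cH_L2[OF Om_cH]] by simp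
    also have "foldr RO u (T Om) = T (foldr RO u Om)" using Rc_foldr_RO[OF T l(1) Om_cH] by simp
    also have "foldr RO u Om = P (delta (inv w))"
      using P_delta[OF red_rev[OF u(1)]] val_rev[OF l(1)] u(2) by simp
    also have "inn G (T (P (delta (inv w)))) Om = inn G (P (delta (inv w))) (adj H T Om)"
      by (rule adj_inn[OF Rc_B[OF T] P_cH[OF delta_L2] Om_cH]) (use w in simp)
    also have "\<dots> = inn G (delta (inv w)) (adj H T Om)"
      by (rule inn_P(1)[OF delta_L2 TO(2)]) (use w in simp)
    also have "\<dots> = cnj (adj H T Om (inv w))"
      using inn_delta[of "inv w" G "adj H T Om"] w by (subst inn_cnj) simp
    finally show ?thesis .
  qed
  show ?thesis
  proof
    fix w show "adj H T Om w = Jv (T Om) w"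
      using key[of "inv w"] L2_off[OF cH_L2[OF TO(2)], of w] by (cases "w \<in> G") (auto simp: Jv_def)
  qed
qed

lemma inn_Jv_commute: "inn G a (Jv b) = inn G b (Jv a)"
proof -
  have bij: "bij_betw (\<lambda>w. inv w) G G" by (rule bij_betw_byWitness[where f' = "\<lambda>w. inv w"]) auto
  have "inn G a (Jv b) = (\<Sum>\<^sub>\<infinity>w\<in>G. a (inv (inv w)) * b (inv w))"
    unfolding inn_def by (rule infsum_cong) (simp add: Jv_def)
  also have "\<dots> = (\<Sum>\<^sub>\<infinity>w\<in>G. a (inv w) * b w)" 
    by (rule infsum_reindex_bij_betw[OF bij, of "\<lambda>w. a (inv w) * b w"])
  also have "\<dots> = inn G b (Jv a)"
    unfolding inn_def by (rule infsum_cong) (simp add: Jv_def)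
  finally show ?thesis .
qed

lemma trace_commute:
  assumes "T \<in> Rc" "T' \<in> Rc" shows "inn G (T (T' Om)) Om = inn G (T' (T Om)) Om"
proof -
  have *: "inn G (T (T' Om)) Om = inn G (T' Om) (Jv (T Om))" if "T \<in> Rc" "T' \<in> Rc" for T T'
    using adj_inn[OF Rc_B[OF that(1)] B_closed[OF Rc_B[OF that(2)] Om_cH] Om_cH] Rc_adj_Om[OF that(1)] by simp
  show ?thesis unfolding *[OF assms] *[OF assms(2,1)] by (rule inn_Jv_commute)
qed

text \<open>For an isometry \<open>V\<close> the range projection \<open>V V\<^sup>*\<close> has the
  trace of the identity. Hence it fixes the trace vector, and this determines it.\<close>

lemma finite_Vn: "finite_algebra H Vn"
  unfolding finite_algebra_def bounded_ops_simps
proof (intro ballI impI)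
  fix V assume "V \<in> Vn" and iso: "compose cH (adj H V) V = (\<lambda>f\<in>cH. f)"
  hence V: "V \<in> Rc" using Vn_Rc by blast
  define V' where "V' = adj H V"
  have V': "V' \<in> Rc" using Rc_adj[OF V] by (simp add: V'_def)
  have VV: "V' (V f) = f" if "f \<in> cH" for f using fun_cong[OF iso, of f] that by (simp add: V'_def compose_eq)
  define E where "E = compose cH V V'"
  have E: "E \<in> Rc" unfolding E_def by (rule Rc_mult[OF V V'])
  have cl: "V f \<in> cH" "V' f \<in> cH" if "f \<in> cH" for f
    using B_closed[OF Rc_B[OF V] that] B_closed[OF Rc_B[OF V'] that] by auto
  have EO: "E Om = V (V' Om)" by (simp add: E_def compose_eq Om_cH)
  have EcH: "E Om \<in> cH" using EO cl Om_cH by simp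
  have 1: "inn G (E Om) Om = inn G Om Om"
    unfolding EO using trace_commute[OF V V'] VV[OF Om_cH] by simp
  have "inn G (E Om) (E Om) = inn G (V' (V (V' Om))) (V' Om)"
    unfolding EO V'_def
    by (rule adj_inn'[OF Rc_B[OF V], symmetric]) (use cl Om_cH in \<open>auto simp: V'_def\<close>)
  also have "\<dots> = inn G (V' Om) (V' Om)" using VV cl Om_cH by simp
  also have "\<dots> = inn G (V (V' Om)) Om"
    unfolding V'_def by (rule adj_inn[OF Rc_B[OF V], symmetric]) (use cl Om_cH in \<open>auto simp: V'_def\<close>)
  finally have 2: "inn G (E Om) (E Om) = inn G Om Om" using 1 EO by simp
  have "of_real (nsq G (\<lambda>w. E Om w - 1 * Om w)) = (0 :: complex)"
    using nsq_diff_scale[OF cH_L2[OF EcH] cH_L2[OF Om_cH], of 1] 1 2 by (simp add: inn_self)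
  hence "nsq G (\<lambda>w. E Om w - Om w) = 0" by simp
  hence "(\<lambda>w. E Om w - Om w) = (\<lambda>_. 0)"
    using nsq_eq_0[OF L2_diff[OF cH_L2[OF EcH] cH_L2[OF Om_cH]]] by blast
  hence "E Om = Om" by (simp add: fun_eq_iff)
  moreover have "(\<lambda>f\<in>cH. f) \<in> Rc" using B_one LO_cH by (simp add: Rc_iff)
  ultimately have "E = (\<lambda>f\<in>cH. f)" using Rc_determined[OF E] Om_cH by simp
  thus "compose cH V (adj H V) = (\<lambda>f\<in>cH. f)" by (simp add: E_def V'_def)
qed

text \<open>For adjacent \<open>s\<close>, \<open>t\<close> the commutator \<open>C\<close> of their
  left operators is skew-adjoint and kills \<open>Lam\<close>, so its range lies in the complement.
  If \<open>Om\<close> were 0, then \<open>C (delta \<one>)\<close> would have norm 0, although it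
  equals the difference of the basis vectors at \<open>s \<otimes> t\<close> and
  \<open>t \<otimes> s\<close>.\<close>

lemma Om_nonzero: "Om \<noteq> (\<lambda>_. 0)"
proof
  assume 0: "Om = (\<lambda>_. 0)"
  obtain s where "s \<in> S" "stable s" using ex_stable[OF irr finS cardS] by blast
  then obtain t where st: "nc s t" by (auto simp: stable_def)
  have S: "s \<in> S" "t \<in> S" "s \<in> G" "t \<in> G" using st ncS S_carrier by auto
  define C where "C f = (\<lambda>w. LO s (LO t f) w - LO t (LO s f) w)" for f
  have CL: "C f \<in> L2 G" if "f \<in> L2 G" for f
    unfolding C_def by (intro L2_diff LO_L2 S that)
  have sa: "inn G (C f) g = - inn G f (C g)" if "f \<in> L2 G" "g \<in> L2 G" for f g
    unfolding C_def using that S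
    by (simp add: inn_diff_left inn_diff_right LO_L2 LO_selfadjoint)
  have Cg: "C g = (\<lambda>_. 0)" if g: "g \<in> Lam" for g
  proof -
    obtain \<theta> where "\<And>s. s \<in> S \<Longrightarrow> LO s g = (\<lambda>w. of_real (\<theta> s) * g w)" using Lam_eigen[OF g] by metis
    thus ?thesis using S by (simp add: C_def LO_scale)
  qed
  have CcH: "C f \<in> cH" if "f \<in> L2 G" for f
    unfolding carrier_perp using CL that sa Lam_L2 Cg by auto
  define f where "f = C (delta \<one>)"
  have d: "delta \<one> \<in> L2 G" by (simp add: delta_L2)
  have "inn G f f = - inn G (delta \<one>) (C f)" unfolding f_def by (rule sa[OF d CL[OF d]])
  also have "inn G (delta \<one>) (C f) = inn G Om (C f)"
    unfolding f_def by (rule inn_P(1)[OF d CcH[OF CL[OF d]], symmetric])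
  finally have "nsq G f = 0" using 0 by (simp add: inn_self)
  hence f0: "f = (\<lambda>_. 0)" using nsq_eq_0[OF CL[OF d]] by (simp add: f_def)
  have ls: "letters s = {#s#}" "letters t = {#t#}"
    using letters_up[of s \<one>] letters_up[of t \<one>] S by simp_all
  have nd: "\<not> desc s t" "\<not> desc t s"
    using letters_down[of s t] letters_down[of t s] S ls st by (auto simp: add_mset_eq_single nc_def)
  have "f = (\<lambda>v. delta (s \<otimes> t) v - delta (t \<otimes> s) v)"
    unfolding f_def C_def using S nd by (simp add: LO_delta)
  hence "s \<otimes> t = t \<otimes> s" using fun_cong[OF f0, of "s \<otimes> t"] by (auto simp: delta_def split: if_splits)
  hence "indep s t" using commute_indep nd S by blast
  thus False using ls st by (simp add: indep_def)
qed

text \<open>A central operator sends the trace vector to a vector on which left and right operators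
  agree, which by \<open>P_central\<close> is a multiple of the trace vector. Operators in
  \<open>Rc\<close> are determined by this value.\<close>

lemma factor_Vn: "factor H Vn"
  unfolding factor_def
proof (intro conjI)
  show "von_neumann_algebra H Vn" unfolding Vn_def by (rule von_neumann_bicommutant[OF TLS])
  show "carrier H \<noteq> {\<zero>\<^bsub>H\<^esub>}" using Om_cH Om_nonzero by auto
  have TLV: "TL ` S \<subseteq> Vn" unfolding Vn_def by (rule bicommutant_superset[OF TLS(1)])
  have one: "(\<lambda>f\<in>cH. (\<lambda>w. c * f w)) \<in> B" for c
    by (rule restrict_B) (auto simp: opr_def cH_scale nsq_scale fun_eq_iff algebra_simps intro: exI[of _ "(cmod c)\<^sup>2"])
  have sc: "c \<odot>\<^bsub>bounded_ops H\<^esub> \<one>\<^bsub>bounded_ops H\<^esub> = (\<lambda>f\<in>cH. (\<lambda>w. c * f w))" for c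
    by (auto simp: fun_eq_iff)
  show "Vn \<inter> commutant H Vn = range (\<lambda>c. c \<odot>\<^bsub>bounded_ops H\<^esub> \<one>\<^bsub>bounded_ops H\<^esub>)"
    unfolding sc
  proof (intro equalityI subsetI)
    fix T assume T: "T \<in> Vn \<inter> commutant H Vn"
    hence R: "T \<in> Rc" using Vn_Rc by blast
    have Tc: "T \<in> commutant H (TL ` S)" using T commutant_antimono[OF TLV] by blast
    have TO: "T Om \<in> cH" using B_closed[OF Rc_B[OF R] Om_cH] .
    have d: "delta \<one> \<in> L2 G" by (simp add: delta_L2)
    have "central (T Om)"
      unfolding central_def
    proof (intro conjI ballI allI impI)
      show "T Om w = 0" if "w \<notin> G" for w using L2_off[OF cH_L2[OF TO] that] .
      fix s assume s: "s \<in> S"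
      have "LO s (T Om) = T (LO s Om)" using Tc s Om_cH by (simp add: TL_commutant_iff)
      also have "LO s Om = RO s Om" using P_LO[OF s d] central_LO[OF central_delta s] by simp
      also have "T (RO s Om) = RO s (T Om)" using R s Om_cH by (simp add: Rc_iff)
      finally show "LO s (T Om) = RO s (T Om)" .
    qed
    then obtain c where "P (T Om) = (\<lambda>w. c * Om w)" using P_central[OF cH_L2[OF TO]] by blast
    hence c: "T Om = (\<lambda>w. c * Om w)" using P_id[OF TO] by simp
    have "(\<lambda>f\<in>cH. (\<lambda>w. c * f w)) \<in> Rc"
      using one LO_cH by (simp add: Rc_iff RO_scale)
    hence "T = (\<lambda>f\<in>cH. (\<lambda>w. c * f w))" using Rc_determined[OF R] c Om_cH by simp
    thus "T \<in> range (\<lambda>c. \<lambda>f\<in>cH. (\<lambda>w. c * f w))" by blast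
  next
    fix T assume "T \<in> range (\<lambda>c. \<lambda>f\<in>cH. (\<lambda>w. c * f w))"
    then obtain c where T: "T = (\<lambda>f\<in>cH. (\<lambda>w. c * f w))" by blast
    have "T \<in> commutant H M" if "M \<subseteq> B" for M
      unfolding commutant_iff[OF that] using one that B_closed B_scale by (auto simp: T subset_iff)
    thus "T \<in> Vn \<inter> commutant H Vn" using commutant_B unfolding Vn_def by blast
  qed
qed

end

section \<open>The representations\<close>

text \<open>With \<open>a\<^sup>2 + d\<^sup>2 = 1\<close> and \<open>2 a + d (r - 1 / r) = 0\<close>, the operator \<open>a + d T\<^sub>s\<close> is a reflection.\<close>

locale hecke_rep = hecke_irr W S m r for W :: "('w, 'b) monoid_scheme" (structure) and S m r +
  fixes a d :: "'w \<Rightarrow> real"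
  assumes ad: "s \<in> S \<Longrightarrow> 2 * a s + d s * (r s - 1 / r s) = 0"
    "s \<in> S \<Longrightarrow> (a s)\<^sup>2 + (d s)\<^sup>2 = 1" "s \<in> S \<Longrightarrow> d s \<noteq> 0"
begin

definition U :: "'w \<Rightarrow> ('w \<Rightarrow> complex) \<Rightarrow> 'w \<Rightarrow> complex" where
  "U s f = (\<lambda>w. of_real (a s) * f w + of_real (d s) * LO s f w)"

lemma U_cH: "s \<in> S \<Longrightarrow> f \<in> cH \<Longrightarrow> U s f \<in> cH"
  unfolding U_def by (intro cH_add cH_scale LO_cH)

lemma U_square: assumes "s \<in> S" "f \<in> cH" shows "U s (U s f) = f"
proof
  fix w
  have sq: "LO s (LO s f) = (\<lambda>w. f w + p s * LO s f w)"
    by (rule LO_square[OF assms(1)]) (rule L2_off[OF cH_L2[OF assms(2)]])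
  have 1: "complex_of_real (2 * a s + d s * (r s - 1 / r s)) = 0" using ad(1)[OF assms(1)] by simp
  have 2: "complex_of_real ((a s)\<^sup>2 + (d s)\<^sup>2) = 1" using ad(2)[OF assms(1)] by simp
  have "U s (U s f) w = of_real ((a s)\<^sup>2 + (d s)\<^sup>2) * f w
      + of_real (d s) * of_real (2 * a s + d s * (r s - 1 / r s)) * LO s f w"
    unfolding U_def LO_add LO_scale sq by (simp add: p_def power2_eq_square algebra_simps)
  thus "U s (U s f) w = f w" unfolding 1 2 by simp
qed

lemma U_commute: "s \<in> S \<Longrightarrow> t \<in> S \<Longrightarrow> \<not> nc s t \<Longrightarrow> U s (U t f) = U t (U s f)"
  unfolding U_def LO_add LO_scale by (simp add: LO_commute[of s t f] algebra_simps)

lemma U_selfadjoint: assumes "s \<in> S" "f \<in> cH" "g \<in> cH" shows "inn G (U s f) g = inn G f (U s g)"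
  unfolding U_def
  using assms by (simp add: inn_add_left inn_add_right inn_scale_left inn_scale_right L2_scale LO_L2 cH_L2 LO_selfadjoint)

lemma foldr_U_cH: "u \<in> lists S \<Longrightarrow> f \<in> cH \<Longrightarrow> foldr U u f \<in> cH"
  by (induction u) (auto simp: U_cH)

lemma foldr_U_cong:
  assumes "u \<in> lists S" "v \<in> lists S" "val u = val v" "f \<in> cH" shows "foldr U u f = foldr U v f"
proof -
  \<comment> \<open>The identity off \<open>cH\<close> makes the relations hold for every argument,
    as \<open>foldr_act_cong\<close> requires.\<close>
  define act' where "act' s f = (if f \<in> cH then U s f else f)" for s f
  have eq: "foldr act' u f = foldr U u f" if "u \<in> lists S" for u
    using that by (induction u) (auto simp: act'_def foldr_U_cH assms(4))
  have "foldr act' u f = foldr act' v f"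
    by (rule foldr_act_cong) (use assms U_square U_commute U_cH in \<open>auto simp: act'_def\<close>)
  thus ?thesis using eq assms by simp
qed

definition \<pi> :: "'w \<Rightarrow> ('w \<Rightarrow> complex) \<Rightarrow> 'w \<Rightarrow> complex" where
  "\<pi> w = restrict (foldr U (SOME u. u \<in> lists S \<and> val u = w)) cH"

lemma \<pi>_val: assumes "u \<in> lists S" "f \<in> cH" shows "\<pi> (val u) f = foldr U u f"
proof -
  have "(SOME v. v \<in> lists S \<and> val v = val u) \<in> lists S \<and> val (SOME v. v \<in> lists S \<and> val v = val u) = val u"
    by (rule someI[of _ u]) (use assms in simp)
  thus ?thesis using foldr_U_cong[OF _ assms(1) _ assms(2)] assms(2) by (simp add: \<pi>_def)
qed

lemma \<pi>_extensional: "\<pi> w \<in> extensional cH"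
  by (simp add: \<pi>_def)

lemma \<pi>_gen: "s \<in> S \<Longrightarrow> f \<in> cH \<Longrightarrow> \<pi> s f = U s f"
  using \<pi>_val[of "[s]" f] by (simp add: S_carrier)

lemma \<pi>_cH: assumes "w \<in> G" "f \<in> cH" shows "\<pi> w f \<in> cH"
proof -
  obtain u where "u \<in> lists S" "val u = w" using ex_word assms by blast
  thus ?thesis using \<pi>_val[of u f] foldr_U_cH[of u f] assms by simp
qed

lemma \<pi>_mult_app: assumes "g \<in> G" "h \<in> G" "f \<in> cH" shows "\<pi> (g \<otimes> h) f = \<pi> g (\<pi> h f)"
proof -
  obtain u where u: "u \<in> lists S" "val u = g" using ex_word assms by blast
  obtain v where v: "v \<in> lists S" "val v = h" using ex_word assms by blast
  note uv = u v
  have "u @ v \<in> lists S" using uv by auto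
  hence "\<pi> (val (u @ v)) f = foldr U u (foldr U v f)" using \<pi>_val[OF _ assms(3)] by simp
  moreover have "\<pi> (val u) (\<pi> (val v) f) = foldr U u (foldr U v f)"
    using \<pi>_val[OF uv(1) foldr_U_cH[OF uv(3) assms(3)]] \<pi>_val[OF uv(3) assms(3)] by simp
  ultimately show ?thesis using val_append[OF uv(1,3)] uv by simp
qed

lemma \<pi>_mult: assumes "g \<in> G" "h \<in> G" shows "\<pi> (g \<otimes> h) = compose cH (\<pi> g) (\<pi> h)"
  by (rule extensionalityI[OF \<pi>_extensional compose_extensional])
    (use \<pi>_mult_app assms in \<open>simp add: compose_eq\<close>)

lemma \<pi>_one: "\<pi> \<one> = (\<lambda>f\<in>cH. f)"
  by (rule extensionalityI[OF \<pi>_extensional restrict_extensional]) (use \<pi>_val[of "[]"] in simp)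

lemma opr_U: assumes "s \<in> S" shows "opr (U s)"
proof -
  have "nsq G (U s f) \<le> (2 * (a s)\<^sup>2 + 2 * ((d s)\<^sup>2 * (2 + 2 * (r s - 1 / r s)\<^sup>2))) * nsq G f" if f: "f \<in> cH" for f
  proof -
    have "nsq G (U s f) \<le> 2 * ((a s)\<^sup>2 * nsq G f) + 2 * ((d s)\<^sup>2 * nsq G (LO s f))"
      using nsq_add_le[OF L2_scale[OF cH_L2[OF f]] L2_scale[OF LO_L2[OF assms cH_L2[OF f]]],
          of "of_real (a s)" "of_real (d s)"]
      unfolding U_def by (simp add: nsq_scale)
    also have "\<dots> \<le> 2 * ((a s)\<^sup>2 * nsq G f) + 2 * ((d s)\<^sup>2 * ((2 + 2 * (r s - 1 / r s)\<^sup>2) * nsq G f))"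
      using mult_left_mono[OF LO_bound[OF assms cH_L2[OF f]], of "(d s)\<^sup>2"] by simp
    finally show ?thesis by (simp add: algebra_simps)
  qed
  hence "\<exists>C. \<forall>f\<in>cH. nsq G (U s f) \<le> C * nsq G f" by blast
  moreover have "U s (\<lambda>i. f i + g i) = (\<lambda>i. U s f i + U s g i)" "U s (\<lambda>i. c * f i) = (\<lambda>i. c * U s f i)" for f g c
    unfolding U_def LO_add LO_scale by (simp_all add: algebra_simps)
  ultimately show ?thesis unfolding opr_def using U_cH[OF assms] by simp
qed

lemma \<pi>_B: assumes "w \<in> G" shows "\<pi> w \<in> B"
proof -
  obtain u where "u \<in> lists S" "val u = w" using ex_word assms by blast
  thus ?thesis
  proof (induction u arbitrary: w rule: list.induct)
    case Nil thus ?case using \<pi>_one B_one by (metis val_simps(1))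
  next
    case (Cons s u)
    have s: "s \<in> S" "u \<in> lists S" using Cons.prems by auto
    have "\<pi> s = restrict (U s) cH"
      by (rule extensionalityI[OF \<pi>_extensional restrict_extensional]) (use \<pi>_gen s in simp)
    hence "\<pi> s \<in> B" using restrict_B[OF opr_U[OF s(1)]] by simp
    hence "compose cH (\<pi> s) (\<pi> (val u)) \<in> B" using B_mult Cons.IH s(2) by blast
    thus ?case using \<pi>_mult[OF S_carrier[OF s(1)] val_closed[OF s(2)]] Cons.prems by simp
  qed
qed

lemma inn_foldr_U:
  "u \<in> lists S \<Longrightarrow> f \<in> cH \<Longrightarrow> g \<in> cH \<Longrightarrow> inn G (foldr U u f) g = inn G f (foldr U (rev u) g)"
  by (induction u arbitrary: g) (auto simp: U_selfadjoint foldr_U_cH U_cH)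

lemma inn_\<pi>: assumes "w \<in> G" "f \<in> cH" "g \<in> cH" shows "inn G (\<pi> w f) g = inn G f (\<pi> (inv w) g)"
proof -
  obtain u where u: "u \<in> lists S" "val u = w" using ex_word assms by blast
  have "rev u \<in> lists S" using u by auto
  from \<pi>_val[OF this assms(3)] val_rev[OF u(1)] u(2) \<pi>_val[OF u(1) assms(2)] show ?thesis
    using inn_foldr_U[OF u(1) assms(2,3)] by simp
qed

lemma adj_\<pi>: "w \<in> G \<Longrightarrow> adj H (\<pi> w) = \<pi> (inv w)"
  by (rule adj_eqI) (auto intro: \<pi>_B inn_\<pi>)

lemma unitary_\<pi>: "unitary_representation W H \<pi>"
  unfolding unitary_representation_def
proof (intro conjI hilbert_space_perp homI)
  fix g assume g: "g \<in> G"
  show "\<pi> g \<in> carrier (bounded_ops H\<lparr>carrier := unitaries H\<rparr>)"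
    using g \<pi>_B[OF g] \<pi>_mult[of g "inv g"] \<pi>_mult[of "inv g" g] \<pi>_one by (simp add: unitaries_def adj_\<pi>)
  fix h assume "h \<in> G"
  thus "\<pi> (g \<otimes> h) = \<pi> g \<otimes>\<^bsub>bounded_ops H\<lparr>carrier := unitaries H\<rparr>\<^esub> \<pi> h"
    using \<pi>_mult[OF g] by simp
qed

text \<open>As \<open>d s\<close> is not 0, the reflection \<open>U s\<close> and the operator
  \<open>LO s\<close> are affine functions of each other, so they have the same commutant.\<close>

lemma rep_algebra_\<pi>: "rep_algebra W H \<pi> = Vn"
proof -
  have pB: "\<pi> ` G \<subseteq> B" using \<pi>_B by blast
  have "T \<in> commutant H (\<pi> ` G) \<longleftrightarrow> T \<in> commutant H (TL ` S)" for T
  proof (cases "T \<in> B")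
    case T: True
    note cl = B_closed[OF T] LO_cH(1)
    have TU: "T (U s f) = (\<lambda>w. of_real (a s) * T f w + of_real (d s) * T (LO s f) w)" if "s \<in> S" "f \<in> cH" for s f
      unfolding U_def using that cH_scale LO_cH by (simp add: B_add[OF T] B_scale[OF T])
    show ?thesis
    proof
      assume "T \<in> commutant H (\<pi> ` G)"
      hence c: "T (\<pi> s f) = \<pi> s (T f)" if "s \<in> S" "f \<in> cH" for s f
        using that S_carrier commutant_iff[OF pB] by blast
      have "T (LO s f) = LO s (T f)" if s: "s \<in> S" and f: "f \<in> cH" for s f
      proof -
        have "T (U s f) = U s (T f)" using c[OF s f] \<pi>_gen[OF s] cl(1) f by simp
        hence "of_real (d s) * T (LO s f) w = of_real (d s) * LO s (T f) w" for w
          unfolding TU[OF s f] by (auto simp: U_def fun_eq_iff)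
        thus ?thesis using ad(3)[OF s] by (simp add: fun_eq_iff)
      qed
      thus "T \<in> commutant H (TL ` S)" using T by (simp add: TL_commutant_iff)
    next
      assume "T \<in> commutant H (TL ` S)"
      hence c: "T (U s f) = U s (T f)" if "s \<in> S" "f \<in> cH" for s f
        using that TU by (simp add: TL_commutant_iff U_def)
      have "T (foldr U u f) = foldr U u (T f)" if "u \<in> lists S" "f \<in> cH" for u f
        using that by (induction u) (auto simp: c foldr_U_cH)
      hence "T (\<pi> w f) = \<pi> w (T f)" if "w \<in> G" "f \<in> cH" for w f
      proof -
        obtain u where "u \<in> lists S" "val u = w" using ex_word \<open>w \<in> G\<close> by blast
        thus ?thesis using \<pi>_val[of u f] \<pi>_val[of u "T f"] cl(1) that \<open>\<And>f u. u \<in> lists S \<Longrightarrow> f \<in> cH \<Longrightarrow> T (foldr U u f) = foldr U u (T f)\<close> by simp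
      qed
      thus "T \<in> commutant H (\<pi> ` G)" using T commutant_iff[OF pB] by blast
    qed
  next
    case False
    thus ?thesis using commutant_B by blast
  qed
  hence "commutant H (\<pi> ` G) = commutant H (TL ` S)" by blast
  thus ?thesis by (simp add: rep_algebra_def Vn_def)
qed

theorem finite_factor_representation_\<pi>: "finite_factor_representation W H \<pi>"
  unfolding finite_factor_representation_def rep_algebra_\<pi>
  using unitary_\<pi> factor_Vn finite_Vn by blast

end

section \<open>Diagonal algebras\<close>

context l2perp
begin

text \<open>This gives \<open>finsum\<close> in the record of bounded operators its meaning, both
  for dimension and for sums of projections.\<close>

lemma abelian_monoid_bounded_ops: "abelian_monoid (bounded_ops H)"
proof (rule abelian_monoidI)
  fix T T' assume T: "T \<in> B" "T' \<in> B"
  obtain C where C: "\<And>f. f \<in> cH \<Longrightarrow> nsq I (T f) \<le> C * nsq I f" using B_bound T by blast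
  obtain D where D: "\<And>f. f \<in> cH \<Longrightarrow> nsq I (T' f) \<le> D * nsq I f" using B_bound T by blast
  have "nsq I (\<lambda>i. T f i + T' f i) \<le> (2 * C + 2 * D) * nsq I f" if "f \<in> cH" for f
    using nsq_add_le[OF B_L2[OF T(1) that] B_L2[OF T(2) that]] C[OF that] D[OF that] by (simp add: distrib_right)
  hence "\<exists>C. \<forall>f\<in>cH. nsq I (\<lambda>i. T f i + T' f i) \<le> C * nsq I f" by blast
  hence "opr (\<lambda>f i. T f i + T' f i)"
    unfolding opr_def
    by (auto simp: cH_add B_closed[OF T(1)] B_closed[OF T(2)] B_add[OF T(1)] B_add[OF T(2)]
        B_scale[OF T(1)] B_scale[OF T(2)] algebra_simps)
  from restrict_B[OF this] show "T \<oplus>\<^bsub>bounded_ops H\<^esub> T' \<in> B" by simp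
next
  show "\<zero>\<^bsub>bounded_ops H\<^esub> \<in> B"
    using restrict_B[of "\<lambda>f. \<lambda>_. 0"] by (simp add: opr_def nsq_def exI[of _ 0])
next
  fix T assume T: "T \<in> B"
  show "\<zero>\<^bsub>bounded_ops H\<^esub> \<oplus>\<^bsub>bounded_ops H\<^esub> T = T"
    by (rule extensionalityI[where A = cH]) (use T in \<open>auto simp: B_iff\<close>)
qed (use B_closed in \<open>auto simp: add.assoc add.commute intro!: restrict_ext\<close>)

lemma finsum_bounded_ops:
  assumes "finite F" "\<And>b. b \<in> F \<Longrightarrow> g b \<in> B"
  shows "finsum (bounded_ops H) g F = (\<lambda>f\<in>cH. \<lambda>i. \<Sum>b\<in>F. g b f i)"
proof -
  interpret abelian_monoid "bounded_ops H" by (rule abelian_monoid_bounded_ops)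
  show ?thesis
    using assms
  proof (induction F rule: finite_induct)
    case (insert b F)
    have "finsum (bounded_ops H) g (insert b F) = g b \<oplus>\<^bsub>bounded_ops H\<^esub> finsum (bounded_ops H) g F"
      by (rule finsum_insert) (use insert in auto)
    thus ?case using insert by (auto simp: fun_eq_iff)
  qed simp
qed

end

lemma delta_apply: "delta i j = (if j = i then 1 else 0)"
  by (simp add: delta_def)

locale diagonal = fixes N :: "'n set" assumes finN: "finite N"
begin

sublocale l2perp N "{}"
  by unfold_locales auto

lemma cH_eq: "cH = {f. \<forall>i. i \<notin> N \<longrightarrow> f i = 0}"
  using finN L2_finite_support[of N N] by (auto simp: carrier_perp L2_off)

lemma P_cH_id: "i \<in> N \<Longrightarrow> P (delta i) = delta i"
  by (rule P_id) (auto simp: cH_eq delta_def)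

definition D :: "('n \<Rightarrow> complex) \<Rightarrow> ('n \<Rightarrow> complex) \<Rightarrow> 'n \<Rightarrow> complex" where
  "D \<mu> = (\<lambda>f\<in>cH. \<lambda>i. \<mu> i * f i)"

lemma D_app: "f \<in> cH \<Longrightarrow> D \<mu> f = (\<lambda>i. \<mu> i * f i)"
  by (simp add: D_def)

lemma D_B: "D \<mu> \<in> B"
  unfolding D_def
proof (rule restrict_B, unfold opr_def, intro conjI ballI allI)
  define C where "C = (\<Sum>i\<in>N. cmod (\<mu> i))"
  have C: "cmod (\<mu> i) \<le> C" if "i \<in> N" for i
    unfolding C_def by (rule member_le_sum) (use that finN in auto)
  show "\<exists>C. \<forall>f\<in>cH. nsq N (\<lambda>i. \<mu> i * f i) \<le> C * nsq N f"
  proof (intro exI ballI)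
    fix f assume f: "f \<in> cH"
    have "nsq N (\<lambda>i. \<mu> i * f i) \<le> nsq N (\<lambda>i. of_real C * f i)"
    proof (rule nsq_mono)
      show "(\<lambda>i. of_real C * f i) \<in> L2 N" by (rule L2_scale[OF cH_L2[OF f]])
      show "(\<lambda>i. \<mu> i * f i) \<in> L2 N" using f finN by (intro L2_finite_support[of N]) (auto simp: cH_eq)
      show "cmod (\<mu> i * f i) \<le> cmod (of_real C * f i)" if "i \<in> N" for i
        using C[OF that] norm_ge_zero[of "\<mu> i"] by (auto simp: norm_mult intro!: mult_right_mono)
    qed
    thus "nsq N (\<lambda>i. \<mu> i * f i) \<le> C\<^sup>2 * nsq N f" by (simp add: nsq_scale)
  qed
qed (auto simp: cH_eq algebra_simps)

lemma adj_D: "adj H (D \<mu>) = D (\<lambda>i. cnj (\<mu> i))"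
proof (rule adj_eqI[OF D_B D_B])
  fix x y assume "x \<in> cH" "y \<in> cH"
  thus "inn N (D \<mu> x) y = inn N x (D (\<lambda>i. cnj (\<mu> i)) y)"
    by (simp add: D_app inn_def algebra_simps)
qed

definition A where "A = range D"

lemma A_B: "A \<subseteq> B"
  using D_B by (auto simp: A_def)

text \<open>Commuting with the coordinate projections \<open>D (delta i)\<close> forces an operator
  to be diagonal. So \<open>A\<close> is its own commutant, which also makes it a von Neumann
  algebra.\<close>

lemma commutant_A: "commutant H A = A"
proof (intro equalityI subsetI)
  fix T assume "T \<in> A"
  thus "T \<in> commutant H A"
    unfolding commutant_iff[OF A_B] using A_B by (auto simp: A_def D_app cH_eq algebra_simps)
next
  fix T assume T: "T \<in> commutant H A"
  have TB: "T \<in> B" using T commutant_B by blast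
  define \<mu> where "\<mu> i = T (delta i) i" for i
  have "T = D \<mu>"
  proof (rule op_eqI[OF TB D_B])
    fix i assume i: "i \<in> N"
    have d: "delta i \<in> cH" using i by (auto simp: cH_eq delta_def)
    have Dd: "D (delta i) (delta i) = delta i" using d by (auto simp: D_app delta_def)
    have "T (D (delta i) (delta i)) = D (delta i) (T (delta i))"
      using T d commutant_iff[OF A_B] by (auto simp: A_def)
    hence e: "T (delta i) = (\<lambda>j. delta i j * T (delta i) j)" using Dd D_app[OF B_closed[OF TB d]] by simp
    have "T (delta i) = (\<lambda>j. \<mu> j * delta i j)"
    proof
      fix j show "T (delta i) j = \<mu> j * delta i j"
        using fun_cong[OF e, of j] by (cases "j = i") (simp_all add: \<mu>_def delta_apply)
    qed
    thus "T (P (delta i)) = D \<mu> (P (delta i))" unfolding P_cH_id[OF i] D_app[OF d] .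
  qed
  thus "T \<in> A" by (simp add: A_def)
qed

lemma von_neumann_A: "von_neumann_algebra H A"
  unfolding von_neumann_algebra_def commutant_A using A_B adj_D by (auto simp: A_def)

lemma abelian_A: "abelian_algebra H A"
  unfolding abelian_algebra_def
proof (intro ballI)
  fix T T' assume "T \<in> A" "T' \<in> A"
  thus "T \<otimes>\<^bsub>bounded_ops H\<^esub> T' = T' \<otimes>\<^bsub>bounded_ops H\<^esub> T"
    using commutant_A unfolding commutant_def by blast
qed

lemma finite_dimensional_A: "finite_dimensional H A"
  unfolding finite_dimensional_def
proof (rule exI[of _ "(\<lambda>i. D (delta i)) ` N"], intro conjI ballI)
  let ?e = "\<lambda>i. D (delta i)"
  show "?e ` N \<subseteq> A" by (auto simp: A_def)
  show "finite (?e ` N)" using finN by simp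
  have inj: "inj_on ?e N"
  proof (rule inj_onI)
    fix i j assume ij: "i \<in> N" "j \<in> N" "D (delta i) = D (delta j)"
    have d: "delta i \<in> cH" using ij by (auto simp: cH_eq delta_def)
    from fun_cong[OF fun_cong[OF ij(3), of "delta i"], of i] show "i = j"
      by (simp add: D_app[OF d]) (auto simp: delta_def split: if_splits)
  qed
  fix T assume "T \<in> A"
  then obtain \<mu> where T: "T = D \<mu>" by (auto simp: A_def)
  \<comment> \<open>Coefficients in \<open>finite_dimensional\<close> are indexed by the basis
    operators; injectivity of \<open>i \<mapsto> D (delta i)\<close> recovers the
    coordinate.\<close>
  define c where "c b = \<mu> (inv_into N ?e b)" for b
  have sB: "c b \<odot>\<^bsub>bounded_ops H\<^esub> b \<in> B" if b: "b \<in> ?e ` N" for b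
  proof -
    obtain i where i: "i \<in> N" "b = ?e i" using b by blast
    have "c b \<odot>\<^bsub>bounded_ops H\<^esub> b = D (\<lambda>j. c b * delta i j)"
      by (rule extensionalityI[where A = cH]) (auto simp: i(2) D_def mult.assoc)
    thus ?thesis using D_B by simp
  qed
  have "finsum (bounded_ops H) (\<lambda>b. c b \<odot>\<^bsub>bounded_ops H\<^esub> b) (?e ` N) =
      (\<lambda>f\<in>cH. \<lambda>j. \<Sum>b\<in>?e ` N. (c b \<odot>\<^bsub>bounded_ops H\<^esub> b) f j)"
    by (rule finsum_bounded_ops[OF finite_imageI[OF finN] sB])
  also have "\<dots> = D \<mu>"
    unfolding D_def[of \<mu>]
  proof (rule restrict_ext, rule ext)
    fix f j assume f: "f \<in> cH"
    show "(\<Sum>b\<in>?e ` N. (c b \<odot>\<^bsub>bounded_ops H\<^esub> b) f j) = \<mu> j * f j"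
    proof -
      have "(\<Sum>b\<in>?e ` N. (c b \<odot>\<^bsub>bounded_ops H\<^esub> b) f j) = (\<Sum>i\<in>N. c (?e i) * (delta i j * f j))"
        unfolding sum.reindex[OF inj] using f by (simp add: D_app)
      also have "\<dots> = (\<Sum>i\<in>N. if i = j then \<mu> j * f j else 0)"
      proof (rule sum.cong)
        fix i assume "i \<in> N"
        hence "c (?e i) = \<mu> i" by (simp add: c_def inv_into_f_f[OF inj])
        thus "c (?e i) * (delta i j * f j) = (if i = j then \<mu> j * f j else 0)"
          by (cases "i = j") (simp_all add: delta_apply)
      qed simp
      also have "\<dots> = \<mu> j * f j" using finN f by (auto simp: cH_eq)
      finally show ?thesis .
    qed
  qed
  finally have eq: "finsum (bounded_ops H) (\<lambda>b. c b \<odot>\<^bsub>bounded_ops H\<^esub> b) (?e ` N) = D \<mu>" .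
  show "\<exists>c. T = (\<Oplus>\<^bsub>bounded_ops H\<^esub>b\<in>?e ` N. c b \<odot>\<^bsub>bounded_ops H\<^esub> b)"
    by (rule exI[of _ c]) (simp only: T eq)
qed

end

section \<open>Direct sums\<close>

definition dsum :: "'v hilbert \<Rightarrow> 'u hilbert \<Rightarrow> ('v \<Rightarrow> 'v) \<Rightarrow> ('u \<Rightarrow> 'u) \<Rightarrow> 'v \<times> 'u \<Rightarrow> 'v \<times> 'u" where
  "dsum H K T T' = (\<lambda>(x, y) \<in> carrier (hilbert_sum H K). (T x, T' y))"

lemma hilbert_sum_simps [simp]:
  "carrier (hilbert_sum H K) = carrier H \<times> carrier K"
  "add (hilbert_sum H K) = (\<lambda>(x, y) (x', y'). (x \<oplus>\<^bsub>H\<^esub> x', y \<oplus>\<^bsub>K\<^esub> y'))"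
  "smult (hilbert_sum H K) = (\<lambda>c (x, y). (c \<odot>\<^bsub>H\<^esub> x, c \<odot>\<^bsub>K\<^esub> y))"
  "ip (hilbert_sum H K) = (\<lambda>(x, y) (x', y'). ip H x x' + ip K y y')"
  by (simp_all add: hilbert_sum_def)

lemma dsum_app: "x \<in> carrier H \<Longrightarrow> y \<in> carrier K \<Longrightarrow> dsum H K T T' (x, y) = (T x, T' y)"
  by (simp add: dsum_def)

lemma direct_sum_dsum: "direct_sum H M K N = {dsum H K T T' | T T'. T \<in> M \<and> T' \<in> N}"
  by (simp add: direct_sum_def dsum_def)

lemma dsum_eqI:
  assumes "\<And>x y. x \<in> carrier H \<Longrightarrow> y \<in> carrier K \<Longrightarrow> F (x, y) = (T x, T' y)" "F \<in> extensional (carrier H \<times> carrier K)"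
  shows "F = dsum H K T T'"
  by (rule extensionalityI[OF assms(2)]) (auto simp: dsum_def assms(1))

locale two_perps = H1: l2perp I \<Lambda> + H2: l2perp J \<Lambda>'
  for I :: "'i set" and \<Lambda> and J :: "'j set" and \<Lambda>'
begin

lemma dsum_B:
  assumes T: "T \<in> H1.B" "T' \<in> H2.B"
  shows "dsum H1.H H2.H T T' \<in> carrier (bounded_ops (hilbert_sum H1.H H2.H))"
proof -
  obtain C where C: "\<And>f. f \<in> H1.cH \<Longrightarrow> nsq I (T f) \<le> C * nsq I f" "C \<ge> 0" using H1.B_bound T by blast
  obtain D where D: "\<And>f. f \<in> H2.cH \<Longrightarrow> nsq J (T' f) \<le> D * nsq J f" "D \<ge> 0" using H2.B_bound T by blast
  have hn: "hnorm (hilbert_sum H1.H H2.H) (x, y) = sqrt (nsq I x + nsq J y)" for x y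
    by (simp add: hnorm_def inn_self)
  have "sqrt (nsq I (T x) + nsq J (T' y)) \<le> sqrt (C + D) * sqrt (nsq I x + nsq J y)"
    if "x \<in> H1.cH" "y \<in> H2.cH" for x y
  proof -
    have "0 \<le> D * nsq I x" "0 \<le> C * nsq J y" using C(2) D(2) nsq_nonneg[of I x] nsq_nonneg[of J y] by auto
    hence "nsq I (T x) + nsq J (T' y) \<le> (C + D) * (nsq I x + nsq J y)"
      using C(1)[OF that(1)] D(1)[OF that(2)] by (simp add: algebra_simps)
    thus ?thesis by (metis real_sqrt_le_mono real_sqrt_mult)
  qed
  hence "\<exists>C. \<forall>x\<in>carrier (hilbert_sum H1.H H2.H).
      hnorm (hilbert_sum H1.H H2.H) (dsum H1.H H2.H T T' x) \<le> C * hnorm (hilbert_sum H1.H H2.H) x"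
    by (intro exI[of _ "sqrt (C + D)"]) (auto simp: dsum_app hn)
  moreover have "dsum H1.H H2.H T T' \<in> carrier (hilbert_sum H1.H H2.H) \<rightarrow>\<^sub>E carrier (hilbert_sum H1.H H2.H)"
    using H1.B_closed[OF T(1)] H2.B_closed[OF T(2)] by (auto simp: dsum_def)
  moreover have "\<forall>x\<in>carrier (hilbert_sum H1.H H2.H). \<forall>y\<in>carrier (hilbert_sum H1.H H2.H).
      dsum H1.H H2.H T T' (x \<oplus>\<^bsub>hilbert_sum H1.H H2.H\<^esub> y) =
      dsum H1.H H2.H T T' x \<oplus>\<^bsub>hilbert_sum H1.H H2.H\<^esub> dsum H1.H H2.H T T' y"
    by (auto simp: dsum_app H1.cH_add H2.cH_add H1.B_add[OF T(1)] H2.B_add[OF T(2)])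
  moreover have "\<forall>c. \<forall>x\<in>carrier (hilbert_sum H1.H H2.H).
      dsum H1.H H2.H T T' (c \<odot>\<^bsub>hilbert_sum H1.H H2.H\<^esub> x) = c \<odot>\<^bsub>hilbert_sum H1.H H2.H\<^esub> dsum H1.H H2.H T T' x"
    by (auto simp: dsum_app H1.cH_scale H2.cH_scale H1.B_scale[OF T(1)] H2.B_scale[OF T(2)])
  ultimately show ?thesis by (simp add: bounded_ops_def del: hilbert_sum_simps)
qed

lemma adj_dsum:
  assumes T: "T \<in> H1.B" "T' \<in> H2.B"
  shows "adj (hilbert_sum H1.H H2.H) (dsum H1.H H2.H T T') = dsum H1.H H2.H (adj H1.H T) (adj H2.H T')"
  unfolding adj_def[of "hilbert_sum H1.H H2.H"]
proof (rule the_equality, intro conjI ballI)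
  show "dsum H1.H H2.H (adj H1.H T) (adj H2.H T') \<in> carrier (bounded_ops (hilbert_sum H1.H H2.H))"
    by (rule dsum_B[OF H1.adj_B[OF T(1)] H2.adj_B[OF T(2)]])
  fix x y assume "x \<in> carrier (hilbert_sum H1.H H2.H)" "y \<in> carrier (hilbert_sum H1.H H2.H)"
  thus "ip (hilbert_sum H1.H H2.H) (dsum H1.H H2.H T T' x) y =
      ip (hilbert_sum H1.H H2.H) x (dsum H1.H H2.H (adj H1.H T) (adj H2.H T') y)"
    using H1.adj_inn[OF T(1)] H2.adj_inn[OF T(2)] by (auto simp: dsum_app)
next
  fix F assume F: "F \<in> carrier (bounded_ops (hilbert_sum H1.H H2.H)) \<and>
      (\<forall>x\<in>carrier (hilbert_sum H1.H H2.H). \<forall>y\<in>carrier (hilbert_sum H1.H H2.H).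
        ip (hilbert_sum H1.H H2.H) (dsum H1.H H2.H T T' x) y = ip (hilbert_sum H1.H H2.H) x (F y))"
  hence ext: "F \<in> H1.cH \<times> H2.cH \<rightarrow>\<^sub>E H1.cH \<times> H2.cH" by (simp add: bounded_ops_def)
  show "F = dsum H1.H H2.H (adj H1.H T) (adj H2.H T')"
  proof (rule dsum_eqI)
    show "F \<in> extensional (H1.cH \<times> H2.cH)" using ext by (simp add: PiE_def)
    fix x y assume xy: "x \<in> H1.cH" "y \<in> H2.cH"
    obtain u v where uv: "F (x, y) = (u, v)" "u \<in> H1.cH" "v \<in> H2.cH"
      using ext xy by (metis (no_types, lifting) PiE_mem SigmaD1 SigmaD2 SigmaI surj_pair)
    have eq: "inn I (T x') x + inn J (T' y') y = inn I x' u + inn J y' v"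
      if "x' \<in> H1.cH" "y' \<in> H2.cH" for x' y'
      using F that xy uv by (force simp: dsum_app)
    \<comment> \<open>Testing against vectors with second component 0 isolates the first
      component.\<close>
    have "u = adj H1.H T x"
    proof (rule H1.eq_by_inn[OF uv(2) H1.B_closed[OF H1.adj_B[OF T(1)] xy(1)]])
      fix g assume g: "g \<in> H1.cH"
      have "inn I g u = inn I g (adj H1.H T x)"
        using eq[OF g H2.cH_zero] H1.adj_inn[OF T(1) g xy(1)] H2.B_zero[OF T(2)] by simp
      thus "inn I u g = inn I (adj H1.H T x) g" by (subst (1 2) inn_cnj) simp
    qed
    moreover have "v = adj H2.H T' y"
    proof (rule H2.eq_by_inn[OF uv(3) H2.B_closed[OF H2.adj_B[OF T(2)] xy(2)]])
      fix g assume g: "g \<in> H2.cH"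
      have "inn J g v = inn J g (adj H2.H T' y)"
        using eq[OF H1.cH_zero g] H2.adj_inn[OF T(2) g xy(2)] H1.B_zero[OF T(1)] by simp
      thus "inn J v g = inn J (adj H2.H T' y) g" by (subst (1 2) inn_cnj) simp
    qed
    ultimately show "F (x, y) = (adj H1.H T x, adj H2.H T' y)" using uv by simp
  qed
qed

end

context l2perp
begin

lemma cH_sum: "finite F \<Longrightarrow> (\<And>a. a \<in> F \<Longrightarrow> g a \<in> cH) \<Longrightarrow> (\<lambda>i. \<Sum>a\<in>F. g a i) \<in> cH"
  by (induction F rule: finite_induct) (auto intro: cH_add)

lemma B_sum:
  assumes "T \<in> B" shows "finite F \<Longrightarrow> (\<And>a. a \<in> F \<Longrightarrow> g a \<in> cH) \<Longrightarrow>
    T (\<lambda>i. \<Sum>a\<in>F. g a i) = (\<lambda>i. \<Sum>a\<in>F. T (g a) i)"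
  by (induction F rule: finite_induct) (auto simp: B_zero[OF assms] B_add[OF assms] cH_sum)

end

section \<open>The Hecke algebra\<close>

context hecke_irr
begin

text \<open>The whole space \<open>ell2 G\<close>, as the complement of the empty set.\<close>

sublocale E: l2perp G "{}"
  by unfold_locales auto

sublocale Kd: diagonal "{..<card Lam}"
  by unfold_locales simp

sublocale two_perps G Lam "{..<card Lam}" "{} :: (nat \<Rightarrow> complex) set"
  by unfold_locales

lemma E_cH: "f \<in> E.cH \<longleftrightarrow> f \<in> L2 G"
  by (simp add: carrier_perp)

definition Lop where "Lop s = restrict (LO s) E.cH"
definition Nn where "Nn = commutant E.H (commutant E.H (Lop ` S))"

lemma Lop_B: assumes "s \<in> S" shows "Lop s \<in> E.B"
proof -
  have "\<exists>C. \<forall>f\<in>E.cH. nsq G (LO s f) \<le> C * nsq G f" using LO_bound[OF assms] E_cH by blast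
  hence "E.opr (LO s)" unfolding E.opr_def using LO_L2[OF assms] E_cH by (auto simp: LO_add LO_scale)
  thus ?thesis unfolding Lop_def by (rule E.restrict_B)
qed

lemma Lop_app: "f \<in> L2 G \<Longrightarrow> Lop s f = LO s f"
  by (simp add: Lop_def E_cH)

lemma adj_Lop: assumes "s \<in> S" shows "adj E.H (Lop s) = Lop s"
  by (rule E.adj_eqI[OF Lop_B[OF assms] Lop_B[OF assms]]) (simp add: E_cH Lop_app LO_selfadjoint assms)

lemma LopS: "Lop ` S \<subseteq> E.B" "adj E.H ` Lop ` S \<subseteq> Lop ` S"
  using Lop_B adj_Lop by auto

lemma hecke_operator_eq:
  assumes "s \<in> S" "(q s - 1) / sqrt (q s) = r s - 1 / r s"
  shows "hecke_operator W S q s = Lop s"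
  unfolding hecke_operator_def
proof (rule the_equality, intro conjI ballI)
  let ?R = "\<lambda>T w. T (delta w) = (if word_length W S (s \<otimes> w) > word_length W S w then delta (s \<otimes> w)
         else delta (s \<otimes> w) \<oplus>\<^bsub>ell2 G\<^esub> complex_of_real ((q s - 1) / sqrt (q s)) \<odot>\<^bsub>ell2 G\<^esub> delta w)"
  have R: "?R T w \<longleftrightarrow> T (delta w) = LO s (delta w)" if w: "w \<in> G" for T w
  proof -
    have "desc s w \<longleftrightarrow> \<not> word_length W S (s \<otimes> w) > word_length W S w"
      using w assms S_carrier letters_up[OF assms(1) w] letters_down[OF assms(1) w]
      by (cases "desc s w") (auto simp: word_length_eq desc_def)
    thus ?thesis
      unfolding LO_delta[OF assms(1) w] assms(2) by (auto simp: ell2_def p_def)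
  qed
  show "Lop s \<in> carrier (bounded_ops (ell2 G))" using Lop_B[OF assms(1)] by (simp add: perp_empty)
  show "?R (Lop s) w" if "w \<in> G" for w using R[OF that] Lop_app delta_L2[OF that] by simp
  fix T assume T: "T \<in> carrier (bounded_ops (ell2 G)) \<and> (\<forall>w\<in>G. ?R T w)"
  show "T = Lop s"
  proof (rule E.op_eqI[OF _ Lop_B[OF assms(1)]])
    show "T \<in> E.B" using T by (simp add: perp_empty)
    fix w assume w: "w \<in> G"
    have "E.P (delta w) = delta w" using delta_L2[OF w] by (intro E.P_id) (simp add: E_cH)
    moreover have "T (delta w) = LO s (delta w)" using T w R[OF w] by blast
    ultimately show "T (E.P (delta w)) = Lop s (E.P (delta w))"
      by (simp only: Lop_app[OF delta_L2[OF w]])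
  qed
qed

lemma hecke_algebra_eq:
  assumes "\<And>s. s \<in> S \<Longrightarrow> (q s - 1) / sqrt (q s) = r s - 1 / r s"
  shows "hecke_algebra W S q = Nn"
proof -
  have "hecke_operator W S q ` S = Lop ` S" using hecke_operator_eq assms by (intro image_cong) auto
  thus ?thesis using E.hull_von_neumann[OF LopS] by (simp add: hecke_algebra_def Nn_def perp_empty)
qed

definition pe :: "('w \<Rightarrow> complex) \<Rightarrow> ('w \<Rightarrow> complex) \<Rightarrow> 'w \<Rightarrow> complex" where
  "pe e f = (\<lambda>w. (inn G f e / of_real (nsq G e)) * e w)"

text \<open>If \<open>e\<close> is an eigenvector of \<open>T\<close>, this is its
  eigenvalue.\<close>

definition coef :: "(('w \<Rightarrow> complex) \<Rightarrow> 'w \<Rightarrow> complex) \<Rightarrow> ('w \<Rightarrow> complex) \<Rightarrow> complex" where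
  "coef T e = inn G (T e) e / of_real (nsq G e)"

lemma pe_L2: "e \<in> Lam \<Longrightarrow> pe e f \<in> L2 G"
  unfolding pe_def by (rule L2_scale[OF Lam_L2])

lemma decompose: "f w = P f w + (\<Sum>e\<in>Lam. pe e f w)"
  by (simp add: P_def pe_def)

lemma inn_pe: "e \<in> Lam \<Longrightarrow> inn G (pe e f) e = inn G f e"
  unfolding pe_def inn_scale_left inn_self using Lam_nz by simp

lemma pe_self: "e \<in> Lam \<Longrightarrow> pe e e = e"
  using Lam_nz by (simp add: pe_def inn_self)

lemma pe_other: "e \<in> Lam \<Longrightarrow> e' \<in> Lam \<Longrightarrow> e \<noteq> e' \<Longrightarrow> pe e' e = (\<lambda>_. 0)"
  by (simp add: pe_def orth)

lemma pe_cH: "e \<in> Lam \<Longrightarrow> f \<in> cH \<Longrightarrow> pe e f = (\<lambda>_. 0)"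
  by (simp add: pe_def carrier_perp)

lemma nsq_pe_le: assumes "e \<in> Lam" "f \<in> L2 G" shows "nsq G (pe e f) \<le> nsq G f"
proof -
  have n: "nsq G e > 0" using Lam_nz[OF assms(1)] nsq_nonneg[of G e] by simp
  have eq: "nsq G (pe e f) = (cmod (inn G f e))\<^sup>2 / nsq G e"
    unfolding pe_def nsq_scale using n by (simp add: norm_divide power_divide power2_eq_square)
  show ?thesis
    unfolding eq using Cauchy_Schwarz[OF assms(2) Lam_L2[OF assms(1)]] n by (simp add: divide_le_eq)
qed

lemma Lop_commutant_iff:
  "T \<in> commutant E.H (Lop ` S) \<longleftrightarrow> T \<in> E.B \<and> (\<forall>s \<in> S. \<forall>f \<in> L2 G. T (LO s f) = LO s (T f))"
  unfolding E.commutant_iff[OF LopS(1)] using E.B_closed E_cH Lop_app by auto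

definition peop where "peop e = restrict (pe e) E.cH"

lemma peop_B: assumes "e \<in> Lam" shows "peop e \<in> E.B"
proof -
  have "\<exists>C. \<forall>f\<in>E.cH. nsq G (pe e f) \<le> C * nsq G f"
    using nsq_pe_le[OF assms] E_cH by (intro exI[of _ 1]) auto
  hence "E.opr (pe e)"
    unfolding E.opr_def
    by (auto simp: E_cH pe_L2 assms) (auto simp: pe_def inn_add_left inn_scale_left Lam_L2 assms add_divide_distrib distrib_right)
  thus ?thesis unfolding peop_def by (rule E.restrict_B)
qed

text \<open>A joint eigenvector of self-adjoint operators spans a reducing line. Consequently every
  operator in \<open>Nn\<close> has all of \<open>Lam\<close> as eigenvectors.\<close>

lemma peop_commutant: assumes e: "e \<in> Lam" shows "peop e \<in> commutant E.H (Lop ` S)"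
  unfolding Lop_commutant_iff
proof (intro conjI ballI)
  show "peop e \<in> E.B" by (rule peop_B[OF e])
  fix s f assume s: "s \<in> S" and f: "f \<in> L2 G"
  obtain \<theta> where \<theta>: "LO s e = (\<lambda>w. of_real (\<theta> s) * e w)" using Lam_eigen[OF e] s by metis
  have i: "inn G (LO s f) e = of_real (\<theta> s) * inn G f e"
    unfolding LO_selfadjoint[OF s f Lam_L2[OF e]] \<theta> by (simp add: inn_scale_right)
  have "pe e (LO s f) = (\<lambda>w. (inn G f e / of_real (nsq G e)) * LO s e w)"
    unfolding pe_def i \<theta> by (simp add: mult_ac)
  also have "\<dots> = LO s (pe e f)" unfolding pe_def by (rule LO_scale[symmetric])
  finally show "peop e (LO s f) = LO s (peop e f)"
    using LO_L2[OF s f] f by (simp add: peop_def E_cH)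
qed

text \<open>Operators commuting with the Hecke operators preserve joint eigenspaces, and these are
  one-dimensional.\<close>

lemma commutant_eigen:
  assumes T: "T \<in> commutant E.H (Lop ` S)" and e: "e \<in> Lam"
  shows "T e = (\<lambda>w. coef T e * e w)"
proof -
  have TB: "T \<in> E.B" using T Lop_commutant_iff by blast
  have eL: "e \<in> L2 G" by (rule Lam_L2[OF e])
  obtain \<theta> where \<theta>: "\<theta> \<in> characters" "e = char_vec \<theta>" "\<And>s. s \<in> S \<Longrightarrow> LO s e = (\<lambda>w. of_real (\<theta> s) * e w)"
    using Lam_eigen[OF e] by metis
  have TL: "T e \<in> L2 G" using E.B_L2[OF TB] eL E_cH by blast
  have "T e = (\<lambda>w. T e \<one> * char_vec \<theta> w)"
  proof (rule joint_eigenvector[OF \<theta>(1)])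
    show "T e w = 0" if "w \<notin> G" for w by (rule L2_off[OF TL that])
    fix s assume s: "s \<in> S"
    have "LO s (T e) = T (LO s e)" using T s eL by (simp add: Lop_commutant_iff)
    also have "\<dots> = (\<lambda>w. of_real (\<theta> s) * T e w)"
      unfolding \<theta>(3)[OF s] by (rule E.B_scale[OF TB]) (simp add: E_cH eL)
    finally show "LO s (T e) = (\<lambda>w. of_real (\<theta> s) * T e w)" .
  qed
  hence 1: "T e = (\<lambda>w. T e \<one> * e w)" using \<theta>(2) by simp
  have "coef T e = T e \<one>"
    unfolding coef_def by (subst 1) (simp add: inn_scale_left inn_self Lam_nz[OF e])
  thus ?thesis using 1 by simp
qed

lemma coef_adj: assumes "T \<in> E.B" "e \<in> Lam" shows "coef (adj E.H T) e = cnj (coef T e)"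
proof -
  have e: "e \<in> E.cH" using Lam_L2[OF assms(2)] by (simp add: E_cH)
  have "inn G (adj E.H T e) e = cnj (inn G (T e) e)"
    using E.adj_inn'[OF assms(1) e e] by (subst (2) inn_cnj) simp
  thus ?thesis by (simp add: coef_def)
qed

lemma commutant_inn:
  assumes T: "T \<in> commutant E.H (Lop ` S)" and e: "e \<in> Lam" and f: "f \<in> L2 G"
  shows "inn G (T f) e = coef T e * inn G f e"
proof -
  have TB: "T \<in> E.B" using T Lop_commutant_iff by blast
  have T': "adj E.H T \<in> commutant E.H (Lop ` S)" using E.adj_commutant[OF LopS] T by blast
  have "inn G (T f) e = inn G f (adj E.H T e)"
    by (rule E.adj_inn[OF TB]) (use f Lam_L2[OF e] in \<open>simp_all add: E_cH\<close>)
  thus ?thesis using commutant_eigen[OF T' e] coef_adj[OF TB e] by (simp add: inn_scale_right)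
qed

lemma commutant_reduces:
  assumes T: "T \<in> commutant E.H (Lop ` S)"
  shows "f \<in> cH \<Longrightarrow> T f \<in> cH" "f \<in> L2 G \<Longrightarrow> P (T f) = T (P f)"
    "e \<in> Lam \<Longrightarrow> f \<in> L2 G \<Longrightarrow> T (pe e f) = pe e (T f)"
proof -
  have *: "T f \<in> cH" if T: "T \<in> commutant E.H (Lop ` S)" and f: "f \<in> cH" for T f
  proof -
    have "T f \<in> L2 G" using E.B_L2[of T f] T f cH_L2[OF f] by (simp add: Lop_commutant_iff E_cH)
    thus ?thesis using commutant_inn[OF T _ cH_L2[OF f]] f by (simp add: carrier_perp)
  qed
  show "f \<in> cH \<Longrightarrow> T f \<in> cH" by (rule *[OF T])
  have TB: "T \<in> E.B" using T Lop_commutant_iff by blast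
  have T': "adj E.H T \<in> commutant E.H (Lop ` S)" using E.adj_commutant[OF LopS] T by blast
  show "P (T f) = T (P f)" if f: "f \<in> L2 G"
  proof (rule eq_by_inn)
    have TfL: "T f \<in> L2 G" using E.B_L2[OF TB] f by (simp add: E_cH)
    show "P (T f) \<in> cH" by (rule P_cH[OF TfL])
    show "T (P f) \<in> cH" by (rule *[OF T P_cH[OF f]])
    fix g assume g: "g \<in> cH"
    have gE: "g \<in> E.cH" "f \<in> E.cH" "P f \<in> E.cH" using cH_L2[OF g] f P_L2[OF f] by (auto simp: E_cH)
    have "inn G (P (T f)) g = inn G (T f) g" by (rule inn_P(1)[OF TfL g])
    also have "\<dots> = inn G f (adj E.H T g)" by (rule E.adj_inn[OF TB gE(2,1)])
    also have "\<dots> = inn G (P f) (adj E.H T g)" by (rule inn_P(1)[OF f *[OF T' g], symmetric])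
    also have "\<dots> = inn G (T (P f)) g" by (rule E.adj_inn[OF TB gE(3,1), symmetric])
    finally show "inn G (P (T f)) g = inn G (T (P f)) g" .
  qed
  show "T (pe e f) = pe e (T f)" if e: "e \<in> Lam" and f: "f \<in> L2 G"
  proof -
    have "T (pe e f) = (\<lambda>w. (inn G f e / of_real (nsq G e)) * T e w)"
      unfolding pe_def by (rule E.B_scale[OF TB]) (simp add: E_cH Lam_L2[OF e])
    thus ?thesis unfolding commutant_eigen[OF T e] pe_def commutant_inn[OF T e f] by (simp add: algebra_simps)
  qed
qed

lemma restrict_E_B: assumes "T \<in> E.B" "\<And>f. f \<in> cH \<Longrightarrow> T f \<in> cH" shows "restrict T cH \<in> B"
proof (rule restrict_B)
  obtain C where C: "\<And>f. f \<in> E.cH \<Longrightarrow> nsq G (T f) \<le> C * nsq G f" using E.B_bound assms by blast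
  have sub: "f \<in> cH \<Longrightarrow> f \<in> E.cH" for f using cH_L2 E_cH by blast
  have "\<exists>C. \<forall>f\<in>cH. nsq G (T f) \<le> C * nsq G f" using C sub by blast
  thus "opr T" unfolding opr_def using assms(2) sub E.B_add[OF assms(1)] E.B_scale[OF assms(1)] by simp
qed

lemma extend_B: assumes "T \<in> B" shows "restrict (\<lambda>f. T (P f)) E.cH \<in> E.B"
proof (rule E.restrict_B)
  obtain C where C: "\<And>f. f \<in> cH \<Longrightarrow> nsq G (T f) \<le> C * nsq G f" "C \<ge> 0" using B_bound assms by blast
  have "nsq G (T (P f)) \<le> C * nsq G f" if "f \<in> E.cH" for f
    using C(1)[OF P_cH] mult_left_mono[OF nsq_P_le C(2)] that by (fastforce simp: E_cH intro: order_trans)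
  hence "\<exists>C. \<forall>f\<in>E.cH. nsq G (T (P f)) \<le> C * nsq G f" by blast
  thus "E.opr (\<lambda>f. T (P f))"
    unfolding E.opr_def
    by (auto simp: E_cH B_L2[OF assms P_cH] P_add P_scale B_add[OF assms P_cH P_cH] B_scale[OF assms P_cH])
qed

lemma NnD: assumes "T \<in> Nn"
  shows "T \<in> E.B" "\<And>T' f. T' \<in> commutant E.H (Lop ` S) \<Longrightarrow> f \<in> L2 G \<Longrightarrow> T (T' f) = T' (T f)"
proof -
  show "T \<in> E.B" using assms E.commutant_B unfolding Nn_def by blast
  show "T (T' f) = T' (T f)" if "T' \<in> commutant E.H (Lop ` S)" "f \<in> L2 G" for T' f
    using assms that E_cH unfolding Nn_def E.commutant_iff[OF E.commutant_B] by blast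
qed

lemma Nn_pe: assumes "T \<in> Nn" "e \<in> Lam" "f \<in> L2 G" shows "T (pe e f) = pe e (T f)"
proof -
  have "T f \<in> L2 G" using E.B_L2[OF NnD(1)[OF assms(1)]] assms by (simp add: E_cH)
  thus ?thesis using NnD(2)[OF assms(1) peop_commutant[OF assms(2)] assms(3)] assms(3) by (simp add: peop_def E_cH)
qed

lemma Nn_eigen: assumes "T \<in> Nn" "e \<in> Lam" shows "T e = (\<lambda>w. coef T e * e w)"
  using Nn_pe[OF assms Lam_L2[OF assms(2)]] pe_self[OF assms(2)] by (simp add: pe_def coef_def)

lemma Nn_cH: assumes "T \<in> Nn" "f \<in> cH" shows "T f \<in> cH"
proof -
  have "T f \<in> L2 G" using E.B_L2[OF NnD(1)[OF assms(1)]] cH_L2[OF assms(2)] by (simp add: E_cH)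
  moreover have "inn G (T f) e = 0" if e: "e \<in> Lam" for e
  proof -
    have "pe e (T f) = T (\<lambda>_. 0)" using Nn_pe[OF assms(1) e cH_L2[OF assms(2)]] pe_cH[OF e assms(2)] by simp
    hence "pe e (T f) = (\<lambda>_. 0)" using E.B_zero[OF NnD(1)[OF assms(1)]] by simp
    thus ?thesis using inn_pe[OF e, of "T f"] by simp
  qed
  ultimately show ?thesis by (simp add: carrier_perp)
qed

text \<open>An operator commuting with the Hecke operators on the complement, extended by 0 to
  \<open>Lam\<close>, commutes with the Hecke operators on \<open>ell2 G\<close>. Commutation with
  these extensions is what membership in \<open>Vn\<close> asks for.\<close>

lemma Nn_Vn: assumes T: "T \<in> Nn" shows "restrict T cH \<in> Vn"
  unfolding Vn_def commutant_iff[OF commutant_B]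
proof (intro conjI ballI)
  show "restrict T cH \<in> B" by (rule restrict_E_B[OF NnD(1)[OF T] Nn_cH[OF T]])
  fix S' f assume S': "S' \<in> commutant H (TL ` S)" and f: "f \<in> cH"
  have SB: "S' \<in> B" using S' commutant_B by blast
  have "restrict (\<lambda>f. S' (P f)) E.cH \<in> commutant E.H (Lop ` S)"
    unfolding Lop_commutant_iff using extend_B[OF SB] S' LO_L2 P_LO(1) P_cH
    by (simp add: E_cH TL_commutant_iff)
  from NnD(2)[OF T this cH_L2[OF f]] have "T (S' f) = S' (T f)"
    using f Nn_cH[OF T f] cH_L2 P_id by (simp add: E_cH)
  thus "restrict T cH (S' f) = S' (restrict T cH f)" using f B_closed[OF SB f] by simp
qed

text \<open>By \<open>commutant_reduces\<close> the commutant of the Hecke operators preserves the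
  complement and commutes with each line projection \<open>pe e\<close>. So the scalars
  \<open>\<nu> e\<close> may be prescribed independently of each other and of
  \<open>T1\<close>.\<close>

lemma Nn_extend:
  assumes T1: "T1 \<in> Vn"
  shows "\<exists>T \<in> Nn. (\<forall>f \<in> cH. T f = T1 f) \<and> (\<forall>e \<in> Lam. coef T e = \<nu> e)"
proof -
  have T1B: "T1 \<in> B" using T1 commutant_B unfolding Vn_def by blast
  define F where "F = finsum (bounded_ops E.H) (\<lambda>e. \<lambda>f\<in>E.cH. \<lambda>w. \<nu> e * pe e f w) Lam"
  have eB: "(\<lambda>f\<in>E.cH. \<lambda>w. \<nu> e * pe e f w) \<in> E.B" if e: "e \<in> Lam" for e
  proof (rule E.restrict_B)
    have "\<exists>C. \<forall>f\<in>E.cH. nsq G (\<lambda>w. \<nu> e * pe e f w) \<le> C * nsq G f"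
      using nsq_pe_le[OF e] E_cH by (intro exI[of _ "(cmod (\<nu> e))\<^sup>2"]) (auto simp: nsq_scale intro!: mult_left_mono)
    thus "E.opr (\<lambda>f. \<lambda>w. \<nu> e * pe e f w)"
      unfolding E.opr_def
      by (auto simp: E_cH pe_L2 L2_scale e)
        (auto simp: pe_def inn_add_left inn_scale_left Lam_L2 e add_divide_distrib distrib_right distrib_left)
  qed
  interpret am: abelian_monoid "bounded_ops E.H" by (rule E.abelian_monoid_bounded_ops)
  have FB: "F \<in> E.B" unfolding F_def by (rule am.finsum_closed) (use eB in auto)
  have "F = (\<lambda>f\<in>E.cH. \<lambda>i. \<Sum>e\<in>Lam. (\<lambda>f\<in>E.cH. \<lambda>w. \<nu> e * pe e f w) f i)"
    unfolding F_def by (rule E.finsum_bounded_ops[OF fin eB])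
  hence F: "F f = (\<lambda>w. \<Sum>e\<in>Lam. \<nu> e * pe e f w)" if "f \<in> L2 G" for f
    using that by (simp add: E_cH)
  define T where "T = restrict (\<lambda>f. T1 (P f)) E.cH \<oplus>\<^bsub>bounded_ops E.H\<^esub> F"
  have TB: "T \<in> E.B" unfolding T_def by (rule am.a_closed[OF extend_B[OF T1B] FB])
  have T: "T f = (\<lambda>w. T1 (P f) w + (\<Sum>e\<in>Lam. \<nu> e * pe e f w))" if "f \<in> L2 G" for f
    unfolding T_def using that F by (simp add: E_cH)
  have "T \<in> Nn"
    unfolding Nn_def E.commutant_iff[OF E.commutant_B]
  proof (intro conjI ballI)
    fix S' f assume S': "S' \<in> commutant E.H (Lop ` S)" and "f \<in> E.cH"
    hence f: "f \<in> L2 G" by (simp add: E_cH)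
    have SB: "S' \<in> E.B" using S' Lop_commutant_iff by blast
    have SL: "S' g \<in> L2 G" if "g \<in> L2 G" for g using E.B_L2[OF SB] that by (simp add: E_cH)
    note red = commutant_reduces[OF S']
    have "restrict S' cH \<in> commutant H (TL ` S)"
      unfolding TL_commutant_iff
      using restrict_E_B[OF SB red(1)] S' LO_cH(1) cH_L2 by (simp add: Lop_commutant_iff)
    hence c: "T1 (S' g) = S' (T1 g)" if "g \<in> cH" for g
      using T1 that B_closed[OF T1B that] unfolding Vn_def commutant_iff[OF commutant_B] by fastforce
    have t1: "T1 (P f) \<in> E.cH" using B_L2[OF T1B P_cH[OF f]] by (simp add: E_cH)
    have t2: "(\<lambda>w. \<nu> e * pe e f w) \<in> E.cH" if "e \<in> Lam" for e using that by (simp add: E_cH L2_scale pe_L2)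
    have "S' (T f) = (\<lambda>w. S' (T1 (P f)) w + S' (\<lambda>w. \<Sum>e\<in>Lam. \<nu> e * pe e f w) w)"
      unfolding T[OF f] by (rule E.B_add[OF SB t1 E.cH_sum[OF fin t2]])
    also have "S' (\<lambda>w. \<Sum>e\<in>Lam. \<nu> e * pe e f w) = (\<lambda>w. \<Sum>e\<in>Lam. S' (\<lambda>w. \<nu> e * pe e f w) w)"
      by (rule E.B_sum[OF SB fin t2])
    also have "\<dots> = (\<lambda>w. \<Sum>e\<in>Lam. \<nu> e * pe e (S' f) w)"
    proof (intro ext sum.cong refl)
      fix w e assume e: "e \<in> Lam"
      have "S' (\<lambda>w. \<nu> e * pe e f w) = (\<lambda>w. \<nu> e * S' (pe e f) w)"
        by (rule E.B_scale[OF SB]) (simp add: E_cH pe_L2 e)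
      thus "S' (\<lambda>w. \<nu> e * pe e f w) w = \<nu> e * pe e (S' f) w" using red(3)[OF e f] by simp
    qed simp
    also have "S' (T1 (P f)) = T1 (P (S' f))" using c[OF P_cH[OF f]] red(2)[OF f] by simp
    finally show "T (S' f) = S' (T f)" using T[OF SL[OF f]] by simp
  qed (rule TB)
  moreover have "T f = T1 f" if "f \<in> cH" for f
    using T[OF cH_L2[OF that]] P_id[OF that] pe_cH[OF _ that] by simp
  moreover have "coef T e = \<nu> e" if e: "e \<in> Lam" for e
  proof -
    have "T e = (\<lambda>w. \<Sum>e'\<in>Lam. \<nu> e' * pe e' e w)"
      using T[OF Lam_L2[OF e]] P_Lam[OF e] B_zero[OF T1B] by simp
    also have "\<dots> = (\<lambda>w. \<Sum>e'\<in>Lam. if e' = e then \<nu> e * e w else 0)"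
      by (intro ext sum.cong refl) (use pe_self pe_other e in auto)
    also have "\<dots> = (\<lambda>w. \<nu> e * e w)" using fin e by simp
    finally show ?thesis using Lam_nz[OF e] by (simp add: coef_def inn_scale_left inn_self)
  qed
  ultimately show ?thesis by blast
qed

definition en :: "nat \<Rightarrow> 'w \<Rightarrow> complex" where
  "en = (SOME h. bij_betw h {..<card Lam} Lam)"

lemma en_bij: "bij_betw en {..<card Lam} Lam"
  unfolding en_def
  using someI_ex[OF ex_bij_betw_nat_finite[OF fin]] by (simp add: atLeast0LessThan)

definition \<Phi> where
  "\<Phi> T = dsum H Kd.H (restrict T cH) (Kd.D (\<lambda>i. coef T (en i)))"

lemma \<Phi>_app: "x \<in> cH \<Longrightarrow> y \<in> Kd.cH \<Longrightarrow> \<Phi> T (x, y) = (T x, \<lambda>i. coef T (en i) * y i)"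
  by (simp add: \<Phi>_def dsum_app Kd.D_app)

lemma \<Phi>_eqI:
  assumes "\<And>x y. x \<in> cH \<Longrightarrow> y \<in> Kd.cH \<Longrightarrow> F (x, y) = (T x, \<lambda>i. coef T (en i) * y i)" "F \<in> extensional (cH \<times> Kd.cH)"
  shows "\<Phi> T = F"
  by (rule extensionalityI[OF _ assms(2)]) (auto simp: \<Phi>_app assms(1), simp add: \<Phi>_def dsum_def)

lemma en_Lam: "i < card Lam \<Longrightarrow> en i \<in> Lam"
  using en_bij by (auto simp: bij_betw_def)

lemma Kd_off: "y \<in> Kd.cH \<Longrightarrow> \<not> i < card Lam \<Longrightarrow> y i = 0"
  by (simp add: Kd.cH_eq)

lemma Nn_cH_E: "f \<in> cH \<Longrightarrow> f \<in> E.cH" "e \<in> Lam \<Longrightarrow> e \<in> E.cH"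
  using cH_L2 Lam_L2 E_cH by auto

theorem Nn_isomorphic: "vn_isomorphic E.H Nn (hilbert_sum H Kd.H) (direct_sum H Vn Kd.H Kd.A)"
  unfolding vn_isomorphic_def
proof (intro bexI[of _ \<Phi>] conjI ballI allI)
  have scaleN: "coef (c \<odot>\<^bsub>bounded_ops E.H\<^esub> T) e = c * coef T e" if "e \<in> Lam" for c T e
    using Nn_cH_E(2)[OF that] by (simp add: coef_def inn_scale_left)
  show "\<Phi> (c \<odot>\<^bsub>bounded_ops E.H\<^esub> T) = c \<odot>\<^bsub>bounded_ops (hilbert_sum H Kd.H)\<^esub> \<Phi> T" if "T \<in> Nn" for c T
  proof (rule \<Phi>_eqI)
    fix x y assume xy: "x \<in> cH" "y \<in> Kd.cH"
    \<comment> \<open>Indices from \<open>card Lam\<close> on carry no eigenvector; there the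
      equation holds because \<open>y i = 0\<close>.\<close>
    have "c * (coef T (en i) * y i) = coef (c \<odot>\<^bsub>bounded_ops E.H\<^esub> T) (en i) * y i" for i
      using scaleN[OF en_Lam] Kd_off[OF xy(2)] by (cases "i < card Lam") (auto simp del: bounded_ops_simps)
    hence eq: "(\<lambda>i. coef (c \<odot>\<^bsub>bounded_ops E.H\<^esub> T) (en i) * y i) = (\<lambda>i. c * (coef T (en i) * y i))"
      by (simp only:)
    show "(c \<odot>\<^bsub>bounded_ops (hilbert_sum H Kd.H)\<^esub> \<Phi> T) (x, y) =
        ((c \<odot>\<^bsub>bounded_ops E.H\<^esub> T) x, \<lambda>i. coef (c \<odot>\<^bsub>bounded_ops E.H\<^esub> T) (en i) * y i)"
      unfolding eq using xy Nn_cH_E by (simp add: \<Phi>_app)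
  qed simp
  have E_adj: "adj E.H T \<in> Nn" if "T \<in> Nn" for T
    using E.adj_commutant[OF E.commutant_B E.adj_commutant[OF LopS]] that unfolding Nn_def by blast
  show "\<Phi> (adj E.H T) = adj (hilbert_sum H Kd.H) (\<Phi> T)" if T: "T \<in> Nn" for T
  proof -
    have rB: "restrict T cH \<in> B" using Nn_Vn[OF T] commutant_B unfolding Vn_def by blast
    have rB': "restrict (adj E.H T) cH \<in> B" using Nn_Vn[OF E_adj[OF T]] commutant_B unfolding Vn_def by blast
    have 1: "adj H (restrict T cH) = restrict (adj E.H T) cH"
      by (rule adj_eqI[OF rB rB']) (use E.adj_inn[OF NnD(1)[OF T]] Nn_cH_E in simp)
    have 2: "Kd.D (\<lambda>i. cnj (coef T (en i))) = Kd.D (\<lambda>i. coef (adj E.H T) (en i))"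
      unfolding Kd.D_def
    proof (rule restrict_ext, rule ext)
      fix y i assume y: "y \<in> Kd.cH"
      show "cnj (coef T (en i)) * y i = coef (adj E.H T) (en i) * y i"
        using coef_adj[OF NnD(1)[OF T] en_Lam, of i] Kd_off[OF y, of i] by (cases "i < card Lam") auto
    qed
    show ?thesis unfolding \<Phi>_def adj_dsum[OF rB Kd.D_B] 1 Kd.adj_D 2 ..
  qed
  have range: "\<Phi> T \<in> direct_sum H Vn Kd.H Kd.A" if "T \<in> Nn" for T
    unfolding direct_sum_dsum \<Phi>_def Kd.A_def using Nn_Vn[OF that] by blast
  show "\<Phi> \<in> ring_iso (bounded_ops E.H\<lparr>carrier := Nn\<rparr>)
      (bounded_ops (hilbert_sum H Kd.H)\<lparr>carrier := direct_sum H Vn Kd.H Kd.A\<rparr>)"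
    unfolding ring_iso_def
  proof (intro CollectI conjI ring_hom_memI)
    show "\<Phi> T \<in> carrier (bounded_ops (hilbert_sum H Kd.H)\<lparr>carrier := direct_sum H Vn Kd.H Kd.A\<rparr>)"
      if "T \<in> carrier (bounded_ops E.H\<lparr>carrier := Nn\<rparr>)" for T
      using range that by simp
    fix T T' assume "T \<in> carrier (bounded_ops E.H\<lparr>carrier := Nn\<rparr>)" "T' \<in> carrier (bounded_ops E.H\<lparr>carrier := Nn\<rparr>)"
    hence T: "T \<in> Nn" "T' \<in> Nn" by auto
    have "\<Phi> (compose E.cH T T') = compose (cH \<times> Kd.cH) (\<Phi> T) (\<Phi> T')"
    proof (rule \<Phi>_eqI)
      fix x y assume xy: "x \<in> cH" "y \<in> Kd.cH"
      have D: "(\<lambda>i. coef T' (en i) * y i) \<in> Kd.cH" using xy by (simp add: Kd.cH_eq)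
      have "coef (compose E.cH T T') e = coef T e * coef T' e" if e: "e \<in> Lam" for e
      proof -
        have TT: "T (T' e) = (\<lambda>w. coef T' e * T e w)"
          unfolding Nn_eigen[OF T(2) e] by (rule E.B_scale[OF NnD(1)[OF T(1)] Nn_cH_E(2)[OF e]])
        have "coef (compose E.cH T T') e = inn G (T (T' e)) e / of_real (nsq G e)"
          using Nn_cH_E(2)[OF e] by (simp add: coef_def compose_eq)
        also have "\<dots> = coef T' e * inn G (T e) e / of_real (nsq G e)"
          unfolding TT inn_scale_left ..
        finally show ?thesis by (simp add: coef_def[of T e])
      qed
      hence "coef T (en i) * (coef T' (en i) * y i) = coef (compose E.cH T T') (en i) * y i" for i
        using en_Lam Kd_off[OF xy(2)] by (cases "i < card Lam") auto
      hence eq: "(\<lambda>i. coef (compose E.cH T T') (en i) * y i) = (\<lambda>i. coef T (en i) * (coef T' (en i) * y i))"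
        by (simp only:)
      show "compose (cH \<times> Kd.cH) (\<Phi> T) (\<Phi> T') (x, y) =
          (compose E.cH T T' x, \<lambda>i. coef (compose E.cH T T') (en i) * y i)"
        unfolding eq using xy Nn_cH_E D Nn_cH[OF T(2)] by (simp add: compose_eq \<Phi>_app)
    qed simp
    thus "\<Phi> (T \<otimes>\<^bsub>bounded_ops E.H\<lparr>carrier := Nn\<rparr>\<^esub> T') = \<Phi> T \<otimes>\<^bsub>bounded_ops (hilbert_sum H Kd.H)\<lparr>carrier := direct_sum H Vn Kd.H Kd.A\<rparr>\<^esub> \<Phi> T'"
      by simp
    have "\<Phi> (T \<oplus>\<^bsub>bounded_ops E.H\<^esub> T') = \<Phi> T \<oplus>\<^bsub>bounded_ops (hilbert_sum H Kd.H)\<^esub> \<Phi> T'"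
    proof (rule \<Phi>_eqI)
      fix x y assume xy: "x \<in> cH" "y \<in> Kd.cH"
      have "coef (T \<oplus>\<^bsub>bounded_ops E.H\<^esub> T') e = coef T e + coef T' e" if e: "e \<in> Lam" for e
      proof -
        have "T e \<in> L2 G" "T' e \<in> L2 G" using E.B_L2 NnD(1) T Nn_cH_E(2)[OF e] by blast+
        thus ?thesis using Nn_cH_E(2)[OF e] Lam_L2[OF e] by (simp add: coef_def inn_add_left add_divide_distrib)
      qed
      hence "coef T (en i) * y i + coef T' (en i) * y i = coef (T \<oplus>\<^bsub>bounded_ops E.H\<^esub> T') (en i) * y i" for i
        using en_Lam Kd_off[OF xy(2)] by (cases "i < card Lam") (auto simp: distrib_right simp del: bounded_ops_simps)
      hence eq: "(\<lambda>i. coef (T \<oplus>\<^bsub>bounded_ops E.H\<^esub> T') (en i) * y i) =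
          (\<lambda>i. coef T (en i) * y i + coef T' (en i) * y i)"
        by (simp only:)
      show "(\<Phi> T \<oplus>\<^bsub>bounded_ops (hilbert_sum H Kd.H)\<^esub> \<Phi> T') (x, y) =
          ((T \<oplus>\<^bsub>bounded_ops E.H\<^esub> T') x, \<lambda>i. coef (T \<oplus>\<^bsub>bounded_ops E.H\<^esub> T') (en i) * y i)"
        unfolding eq using xy Nn_cH_E by (simp add: \<Phi>_app)
    qed simp
    thus "\<Phi> (T \<oplus>\<^bsub>bounded_ops E.H\<lparr>carrier := Nn\<rparr>\<^esub> T') = \<Phi> T \<oplus>\<^bsub>bounded_ops (hilbert_sum H Kd.H)\<lparr>carrier := direct_sum H Vn Kd.H Kd.A\<rparr>\<^esub> \<Phi> T'"
      by simp
  next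
    have "\<Phi> (\<lambda>f\<in>E.cH. f) = (\<lambda>z\<in>cH \<times> Kd.cH. z)"
    proof (rule \<Phi>_eqI)
      fix x y assume xy: "x \<in> cH" "y \<in> Kd.cH"
      have "coef (\<lambda>f\<in>E.cH. f) e = 1" if "e \<in> Lam" for e
        using Nn_cH_E(2)[OF that] Lam_nz[OF that] by (simp add: coef_def inn_self)
      hence "coef (\<lambda>f\<in>E.cH. f) (en i) * y i = y i" for i
        using en_Lam Kd_off[OF xy(2)] by (cases "i < card Lam") auto
      hence eq: "(\<lambda>i. coef (\<lambda>f\<in>E.cH. f) (en i) * y i) = y"
        by (rule ext)
      show "(\<lambda>z\<in>cH \<times> Kd.cH. z) (x, y) = ((\<lambda>f\<in>E.cH. f) x, \<lambda>i. coef (\<lambda>f\<in>E.cH. f) (en i) * y i)"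
        unfolding eq using xy Nn_cH_E by simp
    qed simp
    thus "\<Phi> \<one>\<^bsub>bounded_ops E.H\<lparr>carrier := Nn\<rparr>\<^esub> = \<one>\<^bsub>bounded_ops (hilbert_sum H Kd.H)\<lparr>carrier := direct_sum H Vn Kd.H Kd.A\<rparr>\<^esub>"
      by simp
  next
    have inj: "inj_on \<Phi> Nn"
    proof (rule inj_onI)
      fix T T' assume T: "T \<in> Nn" "T' \<in> Nn" and eq: "\<Phi> T = \<Phi> T'"
      have c: "T f = T' f" if "f \<in> cH" for f
        using fun_cong[OF eq, of "(f, \<lambda>_. 0)"] that Kd.cH_zero by (simp add: \<Phi>_app)
      have e: "T e = T' e" if "e \<in> Lam" for e
      proof -
        obtain i where i: "i < card Lam" "e = en i" using en_bij \<open>e \<in> Lam\<close> by (auto simp: bij_betw_def)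
        have d: "delta i \<in> Kd.cH" using i by (auto simp: Kd.cH_eq delta_def)
        have "(\<lambda>j. coef T (en j) * delta i j) = (\<lambda>j. coef T' (en j) * delta i j)"
          using fun_cong[OF eq, of "(\<lambda>_. 0, delta i)"] by (simp add: \<Phi>_app[OF cH_zero d])
        from fun_cong[OF this, of i] have "coef T e = coef T' e" by (simp add: delta_apply i(2))
        thus ?thesis using Nn_eigen[OF T(1) that] Nn_eigen[OF T(2) that] by simp
      qed
      show "T = T'"
      proof (rule E.B_ext[OF NnD(1)[OF T(1)] NnD(1)[OF T(2)]])
        fix f assume "f \<in> E.cH"
        hence f: "f \<in> L2 G" by (simp add: E_cH)
        have pE: "pe e f \<in> E.cH" if "e \<in> Lam" for e using pe_L2[OF that] by (simp add: E_cH)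
        have PE: "P f \<in> E.cH" using P_L2[OF f] by (simp add: E_cH)
        have f_eq: "f = (\<lambda>w. P f w + (\<Sum>e\<in>Lam. pe e f w))" by (rule ext) (rule decompose)
        \<comment> \<open>By linearity an operator in \<open>Nn\<close> is determined by its action
          on the complement and on \<open>Lam\<close>.\<close>
        have *: "T f = (\<lambda>w. T (P f) w + (\<Sum>e\<in>Lam. (inn G f e / of_real (nsq G e)) * T e w))" if T: "T \<in> Nn" for T
        proof -
          have TB: "T \<in> E.B" by (rule NnD(1)[OF T])
          have s: "T (pe e f) = (\<lambda>w. (inn G f e / of_real (nsq G e)) * T e w)" if "e \<in> Lam" for e
            unfolding pe_def by (rule E.B_scale[OF TB Nn_cH_E(2)[OF that]])
          have "T f = T (\<lambda>w. P f w + (\<Sum>e\<in>Lam. pe e f w))" using f_eq by simp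
          also have "\<dots> = (\<lambda>w. T (P f) w + T (\<lambda>w. \<Sum>e\<in>Lam. pe e f w) w)"
            by (rule E.B_add[OF TB PE E.cH_sum[OF fin pE]])
          also have "T (\<lambda>w. \<Sum>e\<in>Lam. pe e f w) = (\<lambda>w. \<Sum>e\<in>Lam. T (pe e f) w)"
            by (rule E.B_sum[OF TB fin pE])
          finally show ?thesis using s by simp
        qed
        show "T f = T' f" unfolding *[OF T(1)] *[OF T(2)] using c[OF P_cH[OF f]] e by simp
      qed
    qed
    have surj: "F \<in> \<Phi> ` Nn" if F: "F \<in> direct_sum H Vn Kd.H Kd.A" for F
    proof -
      obtain T1 \<mu> where F: "F = dsum H Kd.H T1 (Kd.D \<mu>)" "T1 \<in> Vn"
        using F unfolding direct_sum_dsum Kd.A_def by blast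
      obtain T where T: "T \<in> Nn" "\<And>f. f \<in> cH \<Longrightarrow> T f = T1 f"
        "\<And>e. e \<in> Lam \<Longrightarrow> coef T e = \<mu> (inv_into {..<card Lam} en e)"
        using Nn_extend[OF F(2), of "\<lambda>e. \<mu> (inv_into {..<card Lam} en e)"] by blast
      have "\<Phi> T = F"
      proof (rule \<Phi>_eqI)
        fix x y assume xy: "x \<in> cH" "y \<in> Kd.cH"
        have "inv_into {..<card Lam} en (en i) = i" if "i < card Lam" for i
          using en_bij that by (simp add: bij_betw_def)
        hence "coef T (en i) * y i = \<mu> i * y i" for i
          using T(3)[OF en_Lam] Kd_off[OF xy(2)] by (cases "i < card Lam") auto
        hence eq: "(\<lambda>i. coef T (en i) * y i) = (\<lambda>i. \<mu> i * y i)" by (rule ext)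
        show "F (x, y) = (T x, \<lambda>i. coef T (en i) * y i)"
          unfolding eq using xy T(2) by (simp add: F(1) dsum_app Kd.D_app)
      qed (simp add: F(1) dsum_def)
      thus ?thesis using T(1) by blast
    qed
    show "bij_betw \<Phi> (carrier (bounded_ops E.H\<lparr>carrier := Nn\<rparr>))
        (carrier (bounded_ops (hilbert_sum H Kd.H)\<lparr>carrier := direct_sum H Vn Kd.H Kd.A\<rparr>))"
      unfolding bij_betw_def using inj surj range by auto
  qed
qed

end

section \<open>Parameters near 1\<close>

context racg
begin

text \<open>Between the letters chosen from two neighbours \<open>x\<close>, \<open>y\<close> of
  \<open>c\<close> stands a \<open>c\<close>, which keeps every word reduced even if
  \<open>x\<close> and \<open>y\<close> commute. This is the source of exponential growth.\<close>

definition zigzag :: "'w \<Rightarrow> 'w \<Rightarrow> 'w \<Rightarrow> bool list \<Rightarrow> 'w list" where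
  "zigzag c x y bs = concat (map (\<lambda>b. [c, if b then x else y]) bs)"

lemma zigzag_simps [simp]:
  "zigzag c x y [] = []" "zigzag c x y (b # bs) = c # (if b then x else y) # zigzag c x y bs"
  by (simp_all add: zigzag_def)

lemma not_starts: "nc s t \<Longrightarrow> \<not> starts (proj (t # u)) s"
  by (auto simp: starts_def proj_Cons nc_def)

lemma red_zigzag: assumes "nc c x" "nc c y" shows "red (zigzag c x y bs)"
proof (induction bs)
  case (Cons b bs)
  define z where "z = (if b then x else y)"
  have z: "nc c z" "nc z c" "c \<in> S" "z \<in> S" using assms nc_sym ncS by (auto simp: z_def)
  have "\<not> starts (proj (zigzag c x y bs)) z"
    using not_starts[OF z(2)] by (cases bs) (auto simp: starts_def)
  hence "red (c # z # zigzag c x y bs)" using Cons not_starts[OF z(1)] z by simp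
  thus ?case by (simp add: z_def)
qed simp

lemma length_zigzag: "length (zigzag c x y bs) = 2 * length bs"
  by (induction bs) auto

lemma zigzag_not_desc:
  assumes "nc c x" "nc c y" "nc c z" shows "\<not> desc z (val (zigzag c x y bs))"
proof (cases bs)
  case Nil
  thus ?thesis by (simp add: desc_def)
next
  case (Cons b bs')
  have z: "z \<in> S" "nc z c" using assms(3) ncS nc_sym by auto
  have "\<not> starts (proj (zigzag c x y bs)) z" unfolding Cons zigzag_simps by (rule not_starts[OF z(2)])
  thus ?thesis using desc_red[OF red_zigzag[OF assms(1,2)] z(1)] by simp
qed

text \<open>If the first choices differed, both \<open>x\<close> and \<open>y\<close> would be
  descents of one element and hence commute. One of them would then be a descent of a shorter zigzag
  word, which \<open>zigzag_not_desc\<close> excludes.\<close>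

lemma zigzag_inj:
  assumes nc: "nc c x" "nc c y" and "x \<noteq> y"
  shows "length bs = length bs' \<Longrightarrow> val (zigzag c x y bs) = val (zigzag c x y bs') \<Longrightarrow> bs = bs'"
proof (induction bs bs' rule: list_induct2)
  case (Cons b bs b' bs')
  have S: "c \<in> S" "x \<in> S" "y \<in> S" using nc ncS by auto
  have l: "val (zigzag c x y bs) \<in> carrier W" for bs using red_lists[OF red_zigzag[OF nc]] by (rule val_closed)
  define z where "z b = (if b then x else y)" for b
  have z: "z b \<in> S" "nc c (z b)" for b using nc S by (auto simp: z_def)
  have "c \<otimes> (z b \<otimes> val (zigzag c x y bs)) = c \<otimes> (z b' \<otimes> val (zigzag c x y bs'))"
    using Cons.prems by (simp add: z_def)
  hence eq: "z b \<otimes> val (zigzag c x y bs) = z b' \<otimes> val (zigzag c x y bs')"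
    using l z(1) S S_carrier by (metis cancel_left m_closed)
  show ?case
  proof (cases "b = b'")
    case True
    hence "val (zigzag c x y bs) = val (zigzag c x y bs')" using arg_cong[OF eq, of "(\<otimes>) (z b)"] l z(1) by simp
    thus ?thesis using Cons.IH True by simp
  next
    case False
    hence ne: "z b \<noteq> z b'" using assms(3) by (auto simp: z_def)
    define w where "w = z b \<otimes> val (zigzag c x y bs)"
    have w: "w \<in> carrier W" using l z(1) S_carrier by (simp add: w_def)
    have d: "desc (z b) w" using desc_flip[OF z(1) l] zigzag_not_desc[OF nc z(2)] by (simp add: w_def)
    have d': "desc (z b') w" using desc_flip[OF z(1) l] zigzag_not_desc[OF nc z(2)] eq by (simp add: w_def)
    have "\<not> nc (z b) (z b')" using desc_nc[OF w d d' z(1) z(1)] .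
    hence "\<not> desc (z b') (z b \<otimes> val (zigzag c x y bs))"
      using desc_commuting_mult[OF l z(1) z(1) ne] zigzag_not_desc[OF nc z(2)] by blast
    thus ?thesis using d' by (simp add: w_def)
  qed
qed simp

end

context hecke_irr
begin

text \<open>A connected graph with at least three vertices has a vertex with two neighbours.\<close>

lemma ex_branch: obtains c x y where "nc c x" "nc c y" "x \<noteq> y"
proof -
  obtain s t where st: "nc s t" using ex_stable[OF irr finS cardS] by (auto simp: stable_def)
  have ne: "{s, t} \<noteq> S"
  proof
    assume "{s, t} = S"
    moreover have "card {s, t} \<le> 2" by (simp add: card_insert_if)
    ultimately show False using cardS by simp
  qed
  have "{s, t} \<subseteq> S" "{s, t} \<noteq> {}" using ncS st by auto
  then obtain b v where bv: "b \<in> {s, t}" "v \<in> S" "v \<notin> {s, t}" "nc b v"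
    using ne by (rule ex_adjacent[OF irr])
  from bv(1) consider "b = s" | "b = t" by blast
  thus ?thesis
  proof cases
    case 1
    thus ?thesis using that[of s t v] st bv by auto
  next
    case 2
    thus ?thesis using that[of t s v] st[unfolded nc_sym[of s t]] bv by auto
  qed
qed

text \<open>There are \<open>2\<^sup>n\<close> words \<open>zigzag c x y bs\<close> of length \<open>2 n\<close>, each of mass at least \<open>\<kappa>\<^sup>2\<^sup>n\<close>.\<close>

lemma Lam_empty:
  assumes \<kappa>: "\<And>s. s \<in> S \<Longrightarrow> \<kappa> \<le> (r s)\<^sup>2" "0 < \<kappa>" "1 \<le> 2 * \<kappa>\<^sup>2"
  shows "Lam = {}"
proof (rule ccontr)
  assume "Lam \<noteq> {}"
  then obtain \<theta> where \<theta>: "\<theta> \<in> characters" "char_vec \<theta> \<in> L2 G" by (auto simp: Lam_def)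
  obtain c x y where cxy: "nc c x" "nc c y" "x \<noteq> y" by (rule ex_branch)
  \<comment> \<open>Both roots qualify: \<open>r s\<close> by hypothesis, and
    \<open>- 1 / r s\<close> because its square is at least 1.\<close>
  have root: "\<kappa> \<le> (\<theta> s)\<^sup>2" if s: "s \<in> S" for s
  proof (rule disjE[OF characters_cases[OF \<theta>(1) s]])
    assume "\<theta> s = r s" thus ?thesis using \<kappa>(1) s by simp
  next
    assume e: "\<theta> s = - 1 / r s"
    have "(r s)\<^sup>2 \<le> 1" "0 < (r s)\<^sup>2" using r_range[OF s] by (auto simp: power_le_one)
    hence "1 \<le> 1 / (r s)\<^sup>2" by simp
    thus ?thesis using \<kappa>(1)[OF s] \<open>(r s)\<^sup>2 \<le> 1\<close> unfolding e by (simp add: power_divide)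
  qed
  have lower: "\<kappa> ^ length u \<le> (cmod (char_vec \<theta> (val u)))\<^sup>2" if "red u" for u
    using that
  proof (induction u)
    case (Cons s u)
    have s: "s \<in> S" "red u" "val u \<in> G" "\<not> desc s (val u)" using Cons.prems red_lists desc_red by auto
    have "char_vec \<theta> (val (s # u)) = of_real (\<theta> s) * char_vec \<theta> (val u)"
      using letters_up[OF s(1,3,4)] s S_carrier by (simp add: char_vec_def)
    hence "(cmod (char_vec \<theta> (val (s # u))))\<^sup>2 = (\<theta> s)\<^sup>2 * (cmod (char_vec \<theta> (val u)))\<^sup>2"
      by (simp add: norm_mult power_mult_distrib)
    thus ?case using mult_mono[OF root[OF s(1)] Cons.IH[OF s(2)]] \<kappa>(2) by simp
  qed simp
  define A where "A n = (\<lambda>bs. val (zigzag c x y bs)) ` {bs. set bs \<subseteq> UNIV \<and> length bs = n}" for n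
  have inj: "inj_on (\<lambda>bs. val (zigzag c x y bs)) {bs. set bs \<subseteq> UNIV \<and> length bs = n}" for n
    by (rule inj_onI) (use zigzag_inj[OF cxy] in auto)
  have finA: "finite (A n)" for n unfolding A_def using finite_lists_length_eq[of "UNIV :: bool set" n] by simp
  have lenA: "len w = 2 * n" if "w \<in> A n" for w n
    using that len_red[OF red_zigzag[OF cxy(1,2)]] length_zigzag by (auto simp: A_def)
  have AG: "A n \<subseteq> G" for n using red_lists[OF red_zigzag[OF cxy(1,2)]] val_closed by (auto simp: A_def)
  have sumA: "1 \<le> (\<Sum>w\<in>A n. (cmod (char_vec \<theta> w))\<^sup>2)" for n
  proof -
    have "(2 * \<kappa>\<^sup>2) ^ n = (\<Sum>bs\<in>{bs. set bs \<subseteq> (UNIV :: bool set) \<and> length bs = n}. \<kappa> ^ (2 * n))"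
      using card_lists_length_eq[of "UNIV :: bool set" n] by (simp add: power_mult_distrib power_mult)
    also have "\<dots> \<le> (\<Sum>bs\<in>{bs. set bs \<subseteq> UNIV \<and> length bs = n}. (cmod (char_vec \<theta> (val (zigzag c x y bs))))\<^sup>2)"
      by (rule sum_mono) (use lower[OF red_zigzag[OF cxy(1,2)]] length_zigzag in force)
    also have "\<dots> = (\<Sum>w\<in>A n. (cmod (char_vec \<theta> w))\<^sup>2)"
      unfolding A_def sum.reindex[OF inj] by simp
    finally show ?thesis using one_le_power[OF \<kappa>(3), of n] by simp
  qed
  \<comment> \<open>The disjoint sets \<open>A n\<close> each contribute at least 1 to the squared
    norm, so \<open>M\<close> of them are too many.\<close>
  obtain M :: nat where M: "nsq G (char_vec \<theta>) < M" using reals_Archimedean2 by blast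
  have "real M = (\<Sum>n<M. 1)" by simp
  also have "\<dots> \<le> (\<Sum>n<M. \<Sum>w\<in>A n. (cmod (char_vec \<theta> w))\<^sup>2)" by (rule sum_mono) (rule sumA)
  also have "\<dots> = (\<Sum>w\<in>(\<Union>n<M. A n). (cmod (char_vec \<theta> w))\<^sup>2)"
    by (rule sum.UNION_disjoint[symmetric]) (use finA lenA in \<open>auto, fastforce\<close>)
  also have "\<dots> \<le> nsq G (char_vec \<theta>)"
    unfolding nsq_def by (rule finite_sum_le_infsum) (use \<theta>(2) finA AG in \<open>auto simp: L2_iff\<close>)
  finally show False using M by simp
qed

end

section \<open>Averages of conjugates\<close>

text \<open>Formal iterated midpoints of group elements, so that averages can be transported between
  representations.\<close>

datatype 'w avg = Leaf 'w | Mid "'w avg" "'w avg"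

primrec ev :: "('w \<Rightarrow> ('i \<Rightarrow> complex) \<Rightarrow> 'i \<Rightarrow> complex) \<Rightarrow> 'w avg \<Rightarrow> ('i \<Rightarrow> complex) \<Rightarrow> 'i \<Rightarrow> complex" where
  "ev \<pi> (Leaf g) f = \<pi> g f"
| "ev \<pi> (Mid x y) f = (\<lambda>i. (1 / 2) * (ev \<pi> x f i + ev \<pi> y f i))"

definition conjugates :: "('w, 'b) monoid_scheme \<Rightarrow> 'w \<Rightarrow> 'w set" where
  "conjugates W s = (\<lambda>g. g \<otimes>\<^bsub>W\<^esub> s \<otimes>\<^bsub>W\<^esub> inv\<^bsub>W\<^esub> g) ` carrier W"

locale hecke_rep0 = hecke_rep W S m r a d for W :: "('w, 'b) monoid_scheme" (structure) and S m r a d +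
  assumes Lam0: "Lam = {}"
begin

lemma cH0: "f \<in> cH \<longleftrightarrow> f \<in> L2 G"
  by (simp add: carrier_perp Lam0)

lemma P0: "f \<in> L2 G \<Longrightarrow> P f = f"
  by (simp add: P_id cH0)

lemma delta_one_L2: "delta \<one> \<in> L2 G"
  by (simp add: delta_L2)

lemma Om0: "Om = delta \<one>"
  by (rule P0[OF delta_one_L2])

lemma \<pi>_L2: "g \<in> G \<Longrightarrow> f \<in> L2 G \<Longrightarrow> \<pi> g f \<in> L2 G"
  using \<pi>_cH cH0 by blast

lemma nsq_\<pi>: assumes "g \<in> G" "f \<in> L2 G" shows "nsq G (\<pi> g f) = nsq G f"
proof -
  have "inn G (\<pi> g f) (\<pi> g f) = inn G f (\<pi> (inv g) (\<pi> g f))"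
    by (rule inn_\<pi>) (use assms \<pi>_L2 cH0 in auto)
  also have "\<pi> (inv g) (\<pi> g f) = f"
    using \<pi>_mult_app[of "inv g" g f] assms \<pi>_one cH0 by simp
  finally show ?thesis by (simp add: inn_self)
qed

lemma \<pi>_Rc: "g \<in> G \<Longrightarrow> \<pi> g \<in> Rc"
  using bicommutant_superset[of "\<pi> ` G"] \<pi>_B Vn_Rc rep_algebra_\<pi> unfolding rep_algebra_def by blast

lemma ev_L2: "set_avg t \<subseteq> G \<Longrightarrow> f \<in> L2 G \<Longrightarrow> ev \<pi> t f \<in> L2 G"
proof (induction t)
  case (Mid x y)
  show ?case unfolding ev.simps by (intro L2_scale L2_add) (use Mid in auto)
qed (simp add: \<pi>_L2)

lemma nsq_ev: "set_avg t \<subseteq> G \<Longrightarrow> f \<in> L2 G \<Longrightarrow> nsq G (ev \<pi> t f) \<le> nsq G f"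
proof (induction t)
  case (Mid x y)
  have "nsq G (ev \<pi> (Mid x y) f) = (1 / 4) * nsq G (\<lambda>i. ev \<pi> x f i + ev \<pi> y f i)"
    unfolding ev.simps nsq_scale by (simp add: power_divide norm_divide)
  also have "\<dots> \<le> (1 / 4) * (2 * nsq G (ev \<pi> x f) + 2 * nsq G (ev \<pi> y f))"
    using nsq_add_le[of "ev \<pi> x f" G "ev \<pi> y f"] ev_L2 Mid.prems by auto
  finally show ?case using Mid by auto
qed (simp add: nsq_\<pi>)

lemma ev_add: "set_avg t \<subseteq> G \<Longrightarrow> f \<in> L2 G \<Longrightarrow> g \<in> L2 G \<Longrightarrow> ev \<pi> t (\<lambda>i. f i + g i) = (\<lambda>i. ev \<pi> t f i + ev \<pi> t g i)"
  by (induction t) (auto simp: B_add[OF \<pi>_B] cH0 fun_eq_iff algebra_simps)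

lemma ev_scale: "set_avg t \<subseteq> G \<Longrightarrow> f \<in> L2 G \<Longrightarrow> ev \<pi> t (\<lambda>i. c * f i) = (\<lambda>i. c * ev \<pi> t f i)"
  by (induction t) (auto simp: B_scale[OF \<pi>_B] cH0 fun_eq_iff algebra_simps)

lemma ev_RO: "set_avg t \<subseteq> G \<Longrightarrow> s \<in> S \<Longrightarrow> f \<in> L2 G \<Longrightarrow> ev \<pi> t (RO s f) = RO s (ev \<pi> t f)"
proof (induction t)
  case (Leaf g) thus ?case using \<pi>_Rc[of g] by (simp add: Rc_iff cH0)
next
  case (Mid x y) thus ?case unfolding ev.simps RO_scale RO_add by simp
qed

lemma conjugates_G: "s \<in> S \<Longrightarrow> conjugates W s \<subseteq> G"
  by (auto simp: conjugates_def S_carrier)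

lemma letters_gen: "s \<in> S \<Longrightarrow> letters s = {#s#}"
  using letters_up[of s \<one>] S_carrier by simp

lemma trace_gen: assumes "s \<in> S" shows "inn G (\<pi> s (delta \<one>)) (delta \<one>) = of_real (a s)"
proof -
  have "\<pi> s (delta \<one>) = (\<lambda>w. of_real (a s) * delta \<one> w + of_real (d s) * delta s w)"
    using \<pi>_gen[OF assms, of "delta \<one>"] delta_one_L2 assms
    by (simp add: cH0 U_def LO_delta S_carrier)
  moreover have "s \<noteq> \<one>" using letters_gen[OF assms] by auto
  ultimately show ?thesis by (simp add: inn_delta) (simp add: delta_def)
qed

text \<open>The vector state at \<open>delta \<one>\<close> is a trace on \<open>Rc\<close>, hence
  takes the same value at all conjugates and at their averages.\<close>

lemma trace_ev:
  assumes s: "s \<in> S"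
  shows "set_avg t \<subseteq> conjugates W s \<Longrightarrow> inn G (ev \<pi> t (delta \<one>)) (delta \<one>) = of_real (a s)"
proof (induction t)
  case (Leaf x)
  then obtain g where g: "g \<in> G" "x = g \<otimes> s \<otimes> inv g" by (auto simp: conjugates_def)
  have sG: "s \<in> G" using s S_carrier by blast
  have d: "delta \<one> \<in> cH" using delta_one_L2 cH0 by blast
  have 1: "\<pi> x (delta \<one>) = \<pi> g (\<pi> (s \<otimes> inv g) (delta \<one>))"
    using \<pi>_mult_app[of g "s \<otimes> inv g"] g sG d by (simp add: m_assoc)
  have 2: "inn G (\<pi> g (\<pi> (s \<otimes> inv g) (delta \<one>))) (delta \<one>) =
      inn G (\<pi> (s \<otimes> inv g) (\<pi> g (delta \<one>))) (delta \<one>)"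
    using trace_commute[OF \<pi>_Rc \<pi>_Rc, of g "s \<otimes> inv g"] g sG Om0 by simp
  have 3: "\<pi> (s \<otimes> inv g) (\<pi> g (delta \<one>)) = \<pi> s (delta \<one>)"
    using \<pi>_mult_app[of "s \<otimes> inv g" g] g sG d by (simp add: m_assoc)
  show ?case unfolding ev.simps 1 2 3 by (rule trace_gen[OF s])
next
  case (Mid x y)
  have sub: "set_avg x \<subseteq> G" "set_avg y \<subseteq> G" using Mid.prems conjugates_G[OF s] by auto
  show ?case
    unfolding ev.simps inn_scale_left inn_add_left[OF ev_L2[OF sub(1) delta_one_L2] ev_L2[OF sub(2) delta_one_L2] delta_one_L2]
    using Mid by simp
qed

text \<open>The right-hand counterpart of \<open>U\<close>. It agrees with \<open>U s\<close> at
  \<open>delta \<one>\<close> and commutes with the representation, so it expresses multiplication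
  by \<open>U s\<close> from the right as an operation on vectors.\<close>

definition RU :: "'w \<Rightarrow> ('w \<Rightarrow> complex) \<Rightarrow> 'w \<Rightarrow> complex" where
  "RU s f = (\<lambda>w. of_real (a s) * f w + of_real (d s) * RO s f w)"

lemma RU_L2: "s \<in> S \<Longrightarrow> f \<in> L2 G \<Longrightarrow> RU s f \<in> L2 G"
  unfolding RU_def by (intro L2_add L2_scale RO_L2)

lemma U_L2: "s \<in> S \<Longrightarrow> f \<in> L2 G \<Longrightarrow> U s f \<in> L2 G"
  using U_cH cH0 by blast

lemma RU_square: assumes "s \<in> S" "f \<in> L2 G" shows "RU s (RU s f) = f"
proof
  fix w
  have sq: "RO s (RO s f) = (\<lambda>w. f w + p s * RO s f w)"
  proof
    fix w show "RO s (RO s f) w = f w + p s * RO s f w"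
      using assms(1) L2_off[OF assms(2), of w] rdesc_flip[of s w] by (auto simp: RO_def S_carrier algebra_simps)
  qed
  have 1: "complex_of_real (2 * a s + d s * (r s - 1 / r s)) = 0" using ad(1)[OF assms(1)] by simp
  have 2: "complex_of_real ((a s)\<^sup>2 + (d s)\<^sup>2) = 1" using ad(2)[OF assms(1)] by simp
  have "RU s (RU s f) w = of_real ((a s)\<^sup>2 + (d s)\<^sup>2) * f w
      + of_real (d s) * of_real (2 * a s + d s * (r s - 1 / r s)) * RO s f w"
    unfolding RU_def RO_add RO_scale sq by (simp add: p_def power2_eq_square algebra_simps)
  thus "RU s (RU s f) w = f w" unfolding 1 2 by simp
qed

lemma nsq_RU: assumes "s \<in> S" "f \<in> L2 G" shows "nsq G (RU s f) = nsq G f"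
proof -
  have "inn G (RU s f) g = inn G f (RU s g)" if "g \<in> L2 G" for g
    unfolding RU_def using assms that
    by (simp add: inn_add_left inn_add_right inn_scale_left inn_scale_right L2_scale RO_L2 RO_selfadjoint)
  from this[OF RU_L2[OF assms]] show ?thesis using RU_square[OF assms] by (simp add: inn_self)
qed

lemma nsq_U: "s \<in> S \<Longrightarrow> f \<in> L2 G \<Longrightarrow> nsq G (U s f) = nsq G f"
  using nsq_\<pi>[of s f] \<pi>_gen[of s f] S_carrier cH0 by simp

text \<open>If \<open>f\<close> is the value at \<open>delta \<one>\<close> of an operator
  \<open>T\<close> in \<open>Rc\<close>, this is the value of
  \<open>U\<^sub>s T U\<^sub>s\<close>.\<close>

definition Ad :: "'w \<Rightarrow> ('w \<Rightarrow> complex) \<Rightarrow> 'w \<Rightarrow> complex" where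
  "Ad s f = U s (RU s f)"

lemma Ad_L2: "s \<in> S \<Longrightarrow> f \<in> L2 G \<Longrightarrow> Ad s f \<in> L2 G"
  unfolding Ad_def by (intro U_L2 RU_L2)

lemma nsq_Ad: "s \<in> S \<Longrightarrow> f \<in> L2 G \<Longrightarrow> nsq G (Ad s f) = nsq G f"
  unfolding Ad_def by (simp add: nsq_U nsq_RU RU_L2)

lemma Ad_add: "Ad s (\<lambda>w. f w + g w) = (\<lambda>w. Ad s f w + Ad s g w)"
  and Ad_diff: "Ad s (\<lambda>w. f w - g w) = (\<lambda>w. Ad s f w - Ad s g w)"
  and Ad_scale: "Ad s (\<lambda>w. c * f w) = (\<lambda>w. c * Ad s f w)"
proof -
  have U: "U s (\<lambda>w. f w + g w) = (\<lambda>w. U s f w + U s g w)" "U s (\<lambda>w. f w - g w) = (\<lambda>w. U s f w - U s g w)"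
    "U s (\<lambda>w. c * f w) = (\<lambda>w. c * U s f w)" for f g c
    unfolding U_def LO_add LO_diff LO_scale by (simp_all add: algebra_simps)
  have R: "RU s (\<lambda>w. f w + g w) = (\<lambda>w. RU s f w + RU s g w)" "RU s (\<lambda>w. f w - g w) = (\<lambda>w. RU s f w - RU s g w)"
    "RU s (\<lambda>w. c * f w) = (\<lambda>w. c * RU s f w)" for f g c
    unfolding RU_def RO_add RO_diff RO_scale by (simp_all add: algebra_simps)
  show "Ad s (\<lambda>w. f w + g w) = (\<lambda>w. Ad s f w + Ad s g w)" "Ad s (\<lambda>w. f w - g w) = (\<lambda>w. Ad s f w - Ad s g w)"
    "Ad s (\<lambda>w. c * f w) = (\<lambda>w. c * Ad s f w)"
    unfolding Ad_def R U by simp_all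
qed

lemma Ad_ev:
  assumes s: "s \<in> S"
  shows "set_avg t \<subseteq> G \<Longrightarrow> Ad s (ev \<pi> t (delta \<one>)) = ev \<pi> (map_avg (\<lambda>g. s \<otimes> g \<otimes> s) t) (delta \<one>)"
proof (induction t)
  case (Leaf g)
  have g: "g \<in> G" "s \<in> G" using Leaf s S_carrier by auto
  have dd: "delta \<one> \<in> cH" using delta_one_L2 cH0 by blast
  have "\<pi> (s \<otimes> g \<otimes> s) (delta \<one>) = U s (\<pi> g (U s (delta \<one>)))"
    using \<pi>_mult_app[of "s \<otimes> g" s] \<pi>_mult_app[of s g] \<pi>_gen[OF s] g dd U_cH[OF s] \<pi>_cH by simp
  also have "U s (delta \<one>) = RU s (delta \<one>)"
    unfolding U_def RU_def using central_LO[OF central_delta s] by simp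
  also have "\<pi> g (RU s (delta \<one>)) = RU s (\<pi> g (delta \<one>))"
    unfolding RU_def using \<pi>_Rc[OF g(1)] s dd LO_cH(2)[OF s dd] cH_scale
    by (simp add: B_add[OF \<pi>_B[OF g(1)]] B_scale[OF \<pi>_B[OF g(1)]] Rc_iff)
  finally show ?case by (simp add: Ad_def)
next
  case (Mid x y) thus ?case unfolding avg.map ev.simps Ad_scale Ad_add by simp
qed

lemma conjugates_conj: assumes "s' \<in> S" "s \<in> S" "x \<in> conjugates W s" shows "s' \<otimes> x \<otimes> s' \<in> conjugates W s"
proof -
  obtain g where g: "g \<in> G" "x = g \<otimes> s \<otimes> inv g" using assms by (auto simp: conjugates_def)
  have "s' \<otimes> x \<otimes> s' = (s' \<otimes> g) \<otimes> s \<otimes> inv (s' \<otimes> g)"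
    using g assms S_carrier by (simp add: inv_mult_group gen_inv m_assoc)
  thus ?thesis using g assms S_carrier by (auto simp: conjugates_def)
qed

text \<open>The vector of minimal norm in the closure of the averages is central, hence scalar; the trace
  identifies the scalar.\<close>

lemma averages_to_scalar:
  assumes s: "s \<in> S"
  shows "\<exists>t :: nat \<Rightarrow> 'w avg. (\<forall>n. set_avg (t n) \<subseteq> conjugates W s) \<and>
    (\<lambda>n. nsq G (\<lambda>w. ev \<pi> (t n) (delta \<one>) w - of_real (a s) * delta \<one> w)) \<longlonglongrightarrow> 0"
proof -
  define T where "T = {t. set_avg t \<subseteq> conjugates W s}"
  define x where "x t = ev \<pi> t (delta \<one>)" for t
  have TG: "set_avg t \<subseteq> G" if "t \<in> T" for t using that conjugates_G[OF s] by (auto simp: T_def)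
  have xL: "x t \<in> L2 G" if "t \<in> T" for t unfolding x_def by (rule ev_L2[OF TG[OF that] delta_one_L2])
  define \<mu> where "\<mu> = Inf ((\<lambda>t. nsq G (x t)) ` T)"
  have sG: "s \<in> G" using s S_carrier by blast
  have "\<one> \<otimes> s \<otimes> inv \<one> \<in> conjugates W s" unfolding conjugates_def by blast
  hence "Leaf s \<in> T" using sG by (simp add: T_def)
  hence ne: "(\<lambda>t. nsq G (x t)) ` T \<noteq> {}" by blast
  have bdd: "bdd_below ((\<lambda>t. nsq G (x t)) ` T)" by (rule bdd_belowI2[of _ 0]) (rule nsq_nonneg)
  have \<mu>: "\<mu> \<le> nsq G (x t)" if "t \<in> T" for t
    unfolding \<mu>_def by (rule cINF_lower[OF bdd that])
  \<comment> \<open>Midpoints of averages are averages, so by the parallelogram law almost minimal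
    vectors are close to each other.\<close>
  have close: "nsq G (\<lambda>w. x t w - x t' w) \<le> 4 * e"
    if t: "t \<in> T" "t' \<in> T" "nsq G (x t) \<le> \<mu> + e" "nsq G (x t') \<le> \<mu> + e" for t t' e
  proof -
    have "Mid t t' \<in> T" using t by (simp add: T_def)
    from \<mu>[OF this] have "\<mu> \<le> (1 / 4) * nsq G (\<lambda>w. x t w + x t' w)"
      unfolding x_def ev.simps nsq_scale by (simp add: power_divide norm_divide)
    thus ?thesis using parallelogram[OF xL[OF t(1)] xL[OF t(2)]] t by simp
  qed
  have "\<exists>t \<in> T. nsq G (x t) < \<mu> + 1 / real (Suc n)" for n
  proof -
    have "\<mu> < \<mu> + 1 / real (Suc n)" by simp
    thus ?thesis unfolding \<mu>_def using cInf_less_iff[OF ne bdd] by (metis (no_types, lifting) imageE)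
  qed
  then obtain t where t: "\<And>n. t n \<in> T" "\<And>n. nsq G (x (t n)) < \<mu> + 1 / real (Suc n)" by metis
  have tle: "nsq G (x (t i)) \<le> \<mu> + 1 / real (Suc n)" if "i \<ge> n" for i n
  proof -
    have "1 / real (Suc i) \<le> 1 / real (Suc n)" using that by (simp add: field_simps)
    thus ?thesis using t(2)[of i] by linarith
  qed
  have "\<exists>\<eta> \<in> L2 G. (\<lambda>n. nsq G (\<lambda>w. x (t n) w - \<eta> w)) \<longlonglongrightarrow> 0"
  proof (rule L2_complete)
    show "x (t n) \<in> L2 G" for n using xL t by blast
    fix e :: real assume "0 < e"
    then obtain N where N: "inverse (real (Suc N)) < e / 4" using reals_Archimedean[of "e / 4"] by auto
    have "nsq G (\<lambda>w. x (t i) w - x (t j) w) < e" if "i \<ge> N" "j \<ge> N" for i j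
      using close[OF t(1) t(1) tle[OF that(1)] tle[OF that(2)]] N by (simp add: inverse_eq_divide)
    thus "\<exists>N. \<forall>i\<ge>N. \<forall>j\<ge>N. nsq G (\<lambda>k. x (t i) k - x (t j) k) < e" by blast
  qed
  then obtain \<eta> where \<eta>: "\<eta> \<in> L2 G" "(\<lambda>n. nsq G (\<lambda>w. x (t n) w - \<eta> w)) \<longlonglongrightarrow> 0" by blast
  \<comment> \<open>Conjugation by a generator maps averages to averages of the same norm. Thus
    \<open>u\<close> and its image are both almost minimal, and \<open>close\<close>
    applies.\<close>
  have Ad_fix: "Ad s' \<eta> = \<eta>" if s': "s' \<in> S" for s'
  proof -
    have le: "nsq G (\<lambda>w. \<eta> w - Ad s' \<eta> w) \<le> 2 * nsq G (\<lambda>w. x (t n) w - \<eta> w)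
        + 2 * (2 * (4 * (1 / real (Suc n))) + 2 * nsq G (\<lambda>w. x (t n) w - \<eta> w))" for n
    proof -
      define u where "u = x (t n)"
      have uL: "u \<in> L2 G" using xL t by (simp add: u_def)
      define t' where "t' = map_avg (\<lambda>g. s' \<otimes> g \<otimes> s') (t n)"
      have t'T: "t' \<in> T" using t(1)[of n] conjugates_conj[OF s' s] by (auto simp: T_def t'_def avg.set_map)
      have Au: "Ad s' u = x t'" unfolding u_def x_def t'_def by (rule Ad_ev[OF s' TG[OF t(1)]])
      have "nsq G (x t') = nsq G u" unfolding Au[symmetric] by (rule nsq_Ad[OF s' uL])
      hence le': "nsq G (x t') \<le> \<mu> + 1 / real (Suc n)" using tle[of n n] by (simp add: u_def)
      have 1: "nsq G (\<lambda>w. u w - Ad s' u w) \<le> 4 * (1 / real (Suc n))"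
        unfolding Au unfolding u_def by (rule close[OF t(1) t'T tle[OF order_refl] le'])
      have 2: "nsq G (\<lambda>w. Ad s' u w - Ad s' \<eta> w) = nsq G (\<lambda>w. u w - \<eta> w)"
        unfolding Ad_diff[symmetric] by (rule nsq_Ad[OF s' L2_diff[OF uL \<eta>(1)]])
      have 3: "nsq G (\<lambda>w. \<eta> w - u w) = nsq G (\<lambda>w. u w - \<eta> w)"
        unfolding nsq_def by (simp add: norm_minus_commute)
      have "nsq G (\<lambda>w. \<eta> w - Ad s' \<eta> w) = nsq G (\<lambda>w. (\<eta> w - u w) + ((u w - Ad s' u w) + (Ad s' u w - Ad s' \<eta> w)))"
        by simp
      also have "\<dots> \<le> 2 * nsq G (\<lambda>w. \<eta> w - u w) + 2 * nsq G (\<lambda>w. (u w - Ad s' u w) + (Ad s' u w - Ad s' \<eta> w))"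
        by (intro nsq_add_le L2_diff L2_add uL \<eta> Ad_L2 s')
      also have "nsq G (\<lambda>w. (u w - Ad s' u w) + (Ad s' u w - Ad s' \<eta> w)) \<le>
          2 * nsq G (\<lambda>w. u w - Ad s' u w) + 2 * nsq G (\<lambda>w. Ad s' u w - Ad s' \<eta> w)"
        by (intro nsq_add_le L2_diff uL \<eta> Ad_L2 s')
      finally show ?thesis using 1 2 3 by (simp add: u_def)
    qed
    have "(\<lambda>n. 2 * nsq G (\<lambda>w. x (t n) w - \<eta> w) + 2 * (2 * (4 * (1 / real (Suc n))) + 2 * nsq G (\<lambda>w. x (t n) w - \<eta> w)))
        \<longlonglongrightarrow> 2 * 0 + 2 * (2 * (4 * 0) + 2 * 0)"
      using LIMSEQ_inverse_real_of_nat by (intro tendsto_intros \<eta>) (simp add: inverse_eq_divide)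
    hence "nsq G (\<lambda>w. \<eta> w - Ad s' \<eta> w) \<le> 2 * 0 + 2 * (2 * (4 * 0) + 2 * 0)"
      using le by (meson LIMSEQ_le_const)
    hence "nsq G (\<lambda>w. \<eta> w - Ad s' \<eta> w) = 0" using nsq_nonneg[of G "\<lambda>w. \<eta> w - Ad s' \<eta> w"] by simp
    hence "(\<lambda>w. \<eta> w - Ad s' \<eta> w) = (\<lambda>_. 0)" using nsq_eq_0[OF L2_diff[OF \<eta>(1) Ad_L2[OF s' \<eta>(1)]]] by blast
    thus ?thesis by (simp add: fun_eq_iff)
  qed
  \<comment> \<open>A vector fixed by \<open>Ad s'\<close> is one at which \<open>U s'\<close> and
    \<open>RU s'\<close> agree; as \<open>d s'\<close> is not 0, this is centrality.\<close>
  have "central \<eta>"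
    unfolding central_def
  proof (intro conjI ballI allI impI)
    show "\<eta> w = 0" if "w \<notin> G" for w using L2_off[OF \<eta>(1) that] .
    fix s' assume s': "s' \<in> S"
    have "RU s' \<eta> = U s' (U s' (RU s' \<eta>))" using U_square[OF s'] RU_L2[OF s' \<eta>(1)] cH0 by simp
    also have "\<dots> = U s' \<eta>" using Ad_fix[OF s'] by (simp add: Ad_def)
    finally have "U s' \<eta> w = RU s' \<eta> w" for w by simp
    hence "complex_of_real (d s') * LO s' \<eta> w = of_real (d s') * RO s' \<eta> w" for w
      unfolding RU_def U_def using add_left_imp_eq by blast
    hence "LO s' \<eta> w = RO s' \<eta> w" for w using ad(3)[OF s'] by (metis mult_cancel_left of_real_eq_0_iff)
    thus "LO s' \<eta> = RO s' \<eta>" by (rule ext)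
  qed
  then obtain c where c: "\<eta> = (\<lambda>w. c * delta \<one> w)" using P_central[OF \<eta>(1)] P0[OF \<eta>(1)] Om0 by auto
  have dn: "nsq G (delta \<one>) = 1"
  proof -
    have "complex_of_real (nsq G (delta \<one>)) = 1"
      unfolding inn_self[symmetric] by (simp add: inn_delta) (simp add: delta_def)
    thus ?thesis by simp
  qed
  have "(cmod (of_real (a s) - c))\<^sup>2 \<le> nsq G (\<lambda>w. x (t n) w - \<eta> w)" for n
  proof -
    have xn: "x (t n) \<in> L2 G" using xL t by blast
    have "inn G (\<lambda>w. x (t n) w - \<eta> w) (delta \<one>) = of_real (a s) - c"
      unfolding inn_diff_left[OF xn \<eta>(1) delta_one_L2]
      using trace_ev[OF s, of "t n"] t(1)[of n] unfolding c inn_scale_left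
      by (simp add: x_def T_def inn_self dn)
    thus ?thesis using Cauchy_Schwarz[OF L2_diff[OF xn \<eta>(1)] delta_one_L2] dn by simp
  qed
  hence "(cmod (of_real (a s) - c))\<^sup>2 \<le> 0" using \<eta>(2) by (meson LIMSEQ_le_const)
  hence "c = of_real (a s)" by simp
  thus ?thesis using \<eta>(2) t(1) c by (intro exI[of _ t]) (auto simp: x_def T_def)
qed

lemma foldr_RO_bound:
  "l \<in> lists S \<Longrightarrow> \<exists>C \<ge> 0. \<forall>f \<in> L2 G. nsq G (foldr RO l f) \<le> C * nsq G f"
proof (induction l)
  case (Cons s l)
  then obtain C where C: "C \<ge> 0" "\<And>f. f \<in> L2 G \<Longrightarrow> nsq G (foldr RO l f) \<le> C * nsq G f" by auto
  define D where "D = 2 + 2 * (r s - 1 / r s)\<^sup>2"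
  have D: "D \<ge> 0" by (simp add: D_def)
  have s: "s \<in> S" "l \<in> lists S" using Cons.prems by auto
  have "nsq G (foldr RO (s # l) f) \<le> D * C * nsq G f" if f: "f \<in> L2 G" for f
    using RO_bound[OF s(1) foldr_RO_L2[OF s(2) f], folded D_def] mult_left_mono[OF C(2)[OF f] D] by simp
  thus ?case using C(1) D by (intro exI[of _ "D * C"]) simp
qed (auto intro: exI[of _ 1])

text \<open>Convergence at \<open>delta \<one>\<close> spreads to every \<open>delta w\<close> by
  right operators, which commute with averages, and then to all vectors by truncation, since
  averages are contractions.\<close>

lemma ev_weak_limit:
  assumes s: "s \<in> S"
  shows "\<exists>t :: nat \<Rightarrow> 'w avg. (\<forall>n. set_avg (t n) \<subseteq> conjugates W s) \<and>
    (\<forall>f \<in> L2 G. (\<lambda>n. inn G (ev \<pi> (t n) f) f) \<longlonglongrightarrow> of_real (a s) * of_real (nsq G f))"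
proof -
  obtain t :: "nat \<Rightarrow> 'w avg" where t: "\<And>n. set_avg (t n) \<subseteq> conjugates W s"
    and lim: "(\<lambda>n. nsq G (\<lambda>w. ev \<pi> (t n) (delta \<one>) w - of_real (a s) * delta \<one> w)) \<longlonglongrightarrow> 0"
    using averages_to_scalar[OF s] by blast
  define \<alpha> where "\<alpha> = complex_of_real (a s)"
  have tG: "set_avg (t n) \<subseteq> G" for n using t conjugates_G[OF s] by blast
  define TT where "TT n = restrict (ev \<pi> (t n)) cH" for n
  have TB: "TT n \<in> B" for n
  proof -
    have "\<exists>C. \<forall>f\<in>cH. nsq G (ev \<pi> (t n) f) \<le> C * nsq G f"
      using nsq_ev[OF tG] cH0 by (intro exI[of _ 1]) simp
    hence "opr (ev \<pi> (t n))"
      unfolding opr_def using ev_L2[OF tG] ev_add[OF tG] ev_scale[OF tG] by (simp add: cH0)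
    thus ?thesis unfolding TT_def by (rule restrict_B)
  qed
  have TT: "TT n f = ev \<pi> (t n) f" if "f \<in> L2 G" for n f using that by (simp add: TT_def cH0)
  have delta_lim: "(\<lambda>n. inn G (ev \<pi> (t n) (delta w)) h) \<longlonglongrightarrow> \<alpha> * inn G (delta w) h"
    if w: "w \<in> G" and h: "h \<in> L2 G" for w h
  proof -
    obtain u where u: "red u" "val u = w" using w by (rule ex_red')
    have l: "rev u \<in> lists S" using red_lists[OF u(1)] by auto
    have dw: "delta w = foldr RO (rev u) (delta \<one>)" using foldr_RO_delta[OF u(1)] u(2) by simp
    have ev_f: "ev \<pi> (t n) (foldr RO k f) = foldr RO k (ev \<pi> (t n) f)" if "k \<in> lists S" "f \<in> L2 G" for k f n
      using that by (induction k) (auto simp: ev_RO[OF tG] foldr_RO_L2)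
    have lin: "foldr RO k (\<lambda>w. f w - c * g w) = (\<lambda>w. foldr RO k f w - c * foldr RO k g w)" for k f g c
      by (induction k) (auto simp: RO_diff RO_scale)
    obtain C where C: "C \<ge> 0" "\<And>f. f \<in> L2 G \<Longrightarrow> nsq G (foldr RO (rev u) f) \<le> C * nsq G f"
      using foldr_RO_bound[OF l] by blast
    define D where "D n = (\<lambda>w. ev \<pi> (t n) (delta \<one>) w - \<alpha> * delta \<one> w)" for n
    have DL: "D n \<in> L2 G" for n
      unfolding D_def by (intro L2_diff L2_scale ev_L2 tG delta_one_L2)
    have "(\<lambda>n. inn G (ev \<pi> (t n) (delta w)) h - \<alpha> * inn G (delta w) h) \<longlonglongrightarrow> 0"
    proof (rule Lim_null_comparison)
      have "(\<lambda>n. sqrt (C * nsq G (D n)) * sqrt (nsq G h)) \<longlonglongrightarrow> sqrt (C * 0) * sqrt (nsq G h)"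
        using lim by (intro tendsto_intros) (simp add: D_def \<alpha>_def)
      thus "(\<lambda>n. sqrt (C * nsq G (D n)) * sqrt (nsq G h)) \<longlonglongrightarrow> 0" by simp
      show "\<forall>\<^sub>F n in sequentially. norm (inn G (ev \<pi> (t n) (delta w)) h - \<alpha> * inn G (delta w) h)
          \<le> sqrt (C * nsq G (D n)) * sqrt (nsq G h)"
      proof (intro always_eventually allI)
        fix n
        have eL: "ev \<pi> (t n) (delta w) \<in> L2 G" by (rule ev_L2[OF tG delta_L2[OF w]])
        have "inn G (ev \<pi> (t n) (delta w)) h - \<alpha> * inn G (delta w) h
            = inn G (\<lambda>v. ev \<pi> (t n) (delta w) v - \<alpha> * delta w v) h"
          unfolding inn_diff_left[OF eL L2_scale[OF delta_L2[OF w]] h] inn_scale_left ..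
        also have "(\<lambda>v. ev \<pi> (t n) (delta w) v - \<alpha> * delta w v) = foldr RO (rev u) (D n)"
          unfolding D_def lin dw ev_f[OF l delta_one_L2] ..
        finally have "norm (inn G (ev \<pi> (t n) (delta w)) h - \<alpha> * inn G (delta w) h)
            \<le> sqrt (nsq G (foldr RO (rev u) (D n))) * sqrt (nsq G h)"
          using Cauchy_Schwarz_sqrt[OF foldr_RO_L2[OF l DL] h] by simp
        also have "\<dots> \<le> sqrt (C * nsq G (D n)) * sqrt (nsq G h)"
          using C(2)[OF DL] nsq_nonneg[of G h] by (intro mult_right_mono real_sqrt_le_mono) auto
        finally show "norm (inn G (ev \<pi> (t n) (delta w)) h - \<alpha> * inn G (delta w) h)
            \<le> sqrt (C * nsq G (D n)) * sqrt (nsq G h)" .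
      qed
    qed
    thus ?thesis by (simp add: LIM_zero_iff)
  qed
  have "(\<lambda>n. inn G (ev \<pi> (t n) f) f) \<longlonglongrightarrow> \<alpha> * of_real (nsq G f)" if f: "f \<in> L2 G" for f
  proof (rule LIMSEQ_I)
    fix e :: real assume e: "0 < e"
    let ?f = "\<lambda>F i. if i \<in> F then f i else 0"
    let ?g = "\<lambda>F. (1 + cmod \<alpha>) * (sqrt (nsq G (\<lambda>i. ?f F i - f i)) * sqrt (nsq G f))"
    have "(?g \<longlongrightarrow> (1 + cmod \<alpha>) * (sqrt 0 * sqrt (nsq G f))) (finite_subsets_at_top G)"
      by (intro tendsto_intros truncation_tendsto f)
    hence "(?g \<longlongrightarrow> 0) (finite_subsets_at_top G)" by simp
    hence "\<forall>\<^sub>F F in finite_subsets_at_top G. ?g F < e / 2"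
      using e by (intro order_tendstoD) auto
    \<comment> \<open>The truncation is fixed before \<open>n\<close>, because its error is bounded
      uniformly in \<open>n\<close>.\<close>
    then obtain F where F: "finite F" "F \<subseteq> G" "?g F < e / 2"
      unfolding eventually_finite_subsets_at_top by blast
    have fF: "?f F \<in> L2 G" using F by (intro L2_finite_support[of F]) auto
    have dF: "(\<lambda>i. ?f F i - f i) \<in> L2 G" using L2_diff fF f by blast
    have sumF: "ev \<pi> (t n) (?f F) = (\<lambda>j. \<Sum>i\<in>F. f i * ev \<pi> (t n) (delta i) j)" for n
      using op_finite_sum[OF TB F(1,2), of n f] P0[OF fF] TT[OF fF]
      by (simp add: P0[OF delta_L2] TT[OF delta_L2] subsetD[OF F(2)] cong: sum.cong)
    have eL: "ev \<pi> (t n) (delta i) \<in> L2 G" if "i \<in> F" for n i using ev_L2[OF tG delta_L2] that F by blast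
    have inn_sum: "inn G (ev \<pi> (t n) (?f F)) f = (\<Sum>i\<in>F. f i * inn G (ev \<pi> (t n) (delta i)) f)" for n
      unfolding sumF using inn_sum_left[OF F(1) L2_scale[OF eL] f] by (simp add: inn_scale_left)
    have inn_fF: "inn G (?f F) f = (\<Sum>i\<in>F. f i * inn G (delta i) f)"
    proof -
      have "?f F = (\<lambda>j. \<Sum>i\<in>F. f i * delta i j)"
        using F(1) by (auto simp: fun_eq_iff delta_apply if_distrib cong: if_cong)
      moreover have "inn G (\<lambda>j. \<Sum>i\<in>F. f i * delta i j) f = (\<Sum>i\<in>F. inn G (\<lambda>j. f i * delta i j) f)"
        by (rule inn_sum_left[OF F(1) L2_scale[OF delta_L2] f]) (use F in blast)
      ultimately show ?thesis by (simp add: inn_scale_left)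
    qed
    have "(\<lambda>n. inn G (ev \<pi> (t n) (?f F)) f) \<longlonglongrightarrow> (\<Sum>i\<in>F. f i * (\<alpha> * inn G (delta i) f))"
      unfolding inn_sum by (intro tendsto_sum tendsto_mult tendsto_const delta_lim f) (use F in blast)
    hence "(\<lambda>n. inn G (ev \<pi> (t n) (?f F)) f) \<longlonglongrightarrow> \<alpha> * inn G (?f F) f"
      unfolding inn_fF by (simp add: sum_distrib_left mult_ac)
    then obtain N where N: "\<And>n. n \<ge> N \<Longrightarrow> norm (inn G (ev \<pi> (t n) (?f F)) f - \<alpha> * inn G (?f F) f) < e / 2"
      using LIMSEQ_D[OF _ half_gt_zero[OF e]] by blast
    have "norm (inn G (ev \<pi> (t n) f) f - \<alpha> * of_real (nsq G f)) < e" if n: "n \<ge> N" for n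
    proof -
      define k where "k = (\<lambda>i. ?f F i - f i)"
      have kL: "k \<in> L2 G" using dF by (simp add: k_def)
      have k: "k \<in> L2 G" "(\<lambda>i. (- 1) * k i) \<in> L2 G" using kL L2_scale[OF kL] by blast+
      have f_eq: "f = (\<lambda>i. ?f F i + (- 1) * k i)" by (simp add: k_def)
      have ev_eq: "ev \<pi> (t n) f = (\<lambda>i. ev \<pi> (t n) (?f F) i + (- 1) * ev \<pi> (t n) k i)"
        by (subst f_eq) (simp only: ev_add[OF tG fF k(2)] ev_scale[OF tG k(1)])
      have ek: "ev \<pi> (t n) k \<in> L2 G" by (rule ev_L2[OF tG k(1)])
      have 1: "inn G (ev \<pi> (t n) f) f = inn G (ev \<pi> (t n) (?f F)) f + (- 1) * inn G (ev \<pi> (t n) k) f"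
        unfolding ev_eq inn_add_left[OF ev_L2[OF tG fF] L2_scale[OF ek] f] inn_scale_left ..
      have 2: "inn G f f = inn G (?f F) f + (- 1) * inn G k f"
        using inn_add_left[OF fF k(2) f] f_eq inn_scale_left[of G "- 1" k f] by simp
      have "norm (inn G (ev \<pi> (t n) k) f) \<le> sqrt (nsq G (ev \<pi> (t n) k)) * sqrt (nsq G f)"
        by (rule Cauchy_Schwarz_sqrt[OF ek f])
      also have "\<dots> \<le> sqrt (nsq G k) * sqrt (nsq G f)"
        using nsq_ev[OF tG k(1)] nsq_nonneg[of G f] by (intro mult_right_mono real_sqrt_le_mono) auto
      finally have 3: "norm (inn G (ev \<pi> (t n) k) f) \<le> sqrt (nsq G k) * sqrt (nsq G f)" .
      have 4: "norm (\<alpha> * inn G k f) \<le> cmod \<alpha> * (sqrt (nsq G k) * sqrt (nsq G f))"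
        unfolding norm_mult by (rule mult_left_mono[OF Cauchy_Schwarz_sqrt[OF k(1) f]]) simp
      have "inn G (ev \<pi> (t n) f) f - \<alpha> * of_real (nsq G f) =
          (inn G (ev \<pi> (t n) (?f F)) f - \<alpha> * inn G (?f F) f) + (\<alpha> * inn G k f - inn G (ev \<pi> (t n) k) f)"
        unfolding inn_self[symmetric] 1 2 by (simp add: algebra_simps)
      hence "norm (inn G (ev \<pi> (t n) f) f - \<alpha> * of_real (nsq G f)) \<le>
          norm (inn G (ev \<pi> (t n) (?f F)) f - \<alpha> * inn G (?f F) f) + (norm (\<alpha> * inn G k f) + norm (inn G (ev \<pi> (t n) k) f))"
        by (simp only:) (rule order_trans[OF norm_triangle_ineq add_left_mono[OF norm_triangle_ineq4]])
      also have "\<dots> < e / 2 + e / 2"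
        using N[OF n] 3 4 F(3) unfolding k_def[symmetric] by (simp add: distrib_right)
      finally show ?thesis by simp
    qed
    thus "\<exists>no. \<forall>n\<ge>no. norm (inn G (ev \<pi> (t n) f) f - \<alpha> * of_real (nsq G f)) < e" by blast
  qed
  thus ?thesis using t by (auto simp: \<alpha>_def)
qed

end

section \<open>Inequivalence and existence of the representations\<close>

text \<open>The number \<open>\<alpha>\<close> appears both as a weak limit and as a trace, so that
  a comparison can use the limit for one representation and the trace for the other.\<close>

definition averages_to ::
    "('w, 'b) monoid_scheme \<Rightarrow> 'w \<Rightarrow> ('w \<Rightarrow> ('w \<Rightarrow> complex) \<Rightarrow> 'w \<Rightarrow> complex) \<Rightarrow> real \<Rightarrow> bool" where
  "averages_to W s \<pi> \<alpha> \<longleftrightarrow>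
     (\<forall>g \<in> carrier W. \<forall>f \<in> L2 (carrier W). \<pi> g f \<in> L2 (carrier W)) \<and>
     (\<exists>t :: nat \<Rightarrow> 'w avg. (\<forall>n. set_avg (t n) \<subseteq> conjugates W s) \<and>
        (\<forall>f \<in> L2 (carrier W). (\<lambda>n. inn (carrier W) (ev \<pi> (t n) f) f)
           \<longlonglongrightarrow> of_real \<alpha> * of_real (nsq (carrier W) f))) \<and>
     (\<forall>t. set_avg t \<subseteq> conjugates W s \<longrightarrow>
        inn (carrier W) (ev \<pi> t (delta \<one>\<^bsub>W\<^esub>)) (delta \<one>\<^bsub>W\<^esub>) = of_real \<alpha>)"

text \<open>The averages belonging to \<open>\<pi>\<close> are evaluated at the vector that the
  intertwiner carries to \<open>delta \<one>\<close>. They converge to \<open>\<alpha>\<close>,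
  while each of them is a trace for \<open>\<rho>\<close> and equals \<open>\<beta>\<close>.\<close>

lemma averages_to_unique:
  fixes W (structure)
  assumes W: "group W" "s \<in> carrier W"
    and ue: "unitarily_equivalent W (ell2 (carrier W)) \<pi> (ell2 (carrier W)) \<rho>"
    and \<pi>: "averages_to W s \<pi> \<alpha>" and \<rho>: "averages_to W s \<rho> \<beta>"
  shows "\<alpha> = \<beta>"
proof -
  interpret group W by (rule W)
  let ?G = "carrier W"
  have el: "add (ell2 ?G) = (\<lambda>f g i. f i + g i)" "smult (ell2 ?G) = (\<lambda>c f i. c * f i)" by (simp_all add: ell2_def)
  obtain V where bij: "bij_betw V (L2 ?G) (L2 ?G)"
    and add: "\<And>x y. x \<in> L2 ?G \<Longrightarrow> y \<in> L2 ?G \<Longrightarrow> V (\<lambda>i. x i + y i) = (\<lambda>i. V x i + V y i)"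
    and scale: "\<And>c x. x \<in> L2 ?G \<Longrightarrow> V (\<lambda>i. c * x i) = (\<lambda>i. c * V x i)"
    and ip: "\<And>x y. x \<in> L2 ?G \<Longrightarrow> y \<in> L2 ?G \<Longrightarrow> inn ?G (V x) (V y) = inn ?G x y"
    and inter: "\<And>g x. g \<in> ?G \<Longrightarrow> x \<in> L2 ?G \<Longrightarrow> V (\<pi> g x) = \<rho> g (V x)"
    using ue unfolding unitarily_equivalent_def el by blast
  have L2\<pi>: "\<pi> g f \<in> L2 ?G" if "g \<in> ?G" "f \<in> L2 ?G" for g f using \<pi> that by (simp add: averages_to_def)
  have evL: "ev \<pi> t f \<in> L2 ?G" if "f \<in> L2 ?G" "set_avg t \<subseteq> ?G" for t f
    using that(2)
  proof (induction t)
    case (Mid x y)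
    show ?case unfolding ev.simps by (intro L2_scale L2_add) (use Mid in auto)
  qed (simp add: L2\<pi> that)
  have evV: "V (ev \<pi> t f) = ev \<rho> t (V f)" if "f \<in> L2 ?G" "set_avg t \<subseteq> ?G" for t f
    using that(2)
  proof (induction t)
    case (Mid x y)
    have xy: "ev \<pi> x f \<in> L2 ?G" "ev \<pi> y f \<in> L2 ?G" using evL[OF that(1)] Mid.prems by auto
    show ?case unfolding ev.simps scale[OF L2_add[OF xy]] add[OF xy] using Mid by simp
  qed (simp add: inter that)
  have conj: "conjugates W s \<subseteq> ?G" using W(2) by (auto simp: conjugates_def)
  have \<delta>: "delta \<one> \<in> L2 ?G" by (simp add: delta_L2)
  then obtain \<xi> where \<xi>: "\<xi> \<in> L2 ?G" "V \<xi> = delta \<one>" using bij unfolding bij_betw_def by (metis imageE)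
  have "complex_of_real (nsq ?G \<xi>) = inn ?G (delta \<one>) (delta \<one>)"
    using ip[OF \<xi>(1) \<xi>(1)] \<xi>(2) by (simp add: inn_self)
  also have "\<dots> = 1" by (simp add: inn_delta) (simp add: delta_def)
  finally have n\<xi>: "nsq ?G \<xi> = 1" by simp
  obtain t :: "nat \<Rightarrow> _ avg" where t: "\<And>n. set_avg (t n) \<subseteq> conjugates W s"
    and lim: "(\<lambda>n. inn ?G (ev \<pi> (t n) \<xi>) \<xi>) \<longlonglongrightarrow> of_real \<alpha> * of_real (nsq ?G \<xi>)"
    using \<pi> \<xi>(1) unfolding averages_to_def by blast
  have tG: "set_avg (t n) \<subseteq> ?G" for n using t conj by blast
  have "inn ?G (ev \<pi> (t n) \<xi>) \<xi> = of_real \<beta>" for n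
  proof -
    have "inn ?G (ev \<pi> (t n) \<xi>) \<xi> = inn ?G (ev \<rho> (t n) (delta \<one>)) (delta \<one>)"
      using ip[OF evL[OF \<xi>(1) tG] \<xi>(1)] evV[OF \<xi>(1) tG] \<xi>(2) by simp
    thus ?thesis using \<rho> t by (simp add: averages_to_def)
  qed
  hence "complex_of_real \<beta> = of_real \<alpha>" using lim n\<xi> by (simp add: LIMSEQ_const_iff)
  thus ?thesis by simp
qed

lemma ex_hecke_representation:
  fixes W :: "('w, 'b) monoid_scheme"
  assumes "right_angled_coxeter_system W S m" "irreducible_system W S" "finite S" "card S \<ge> 3"
    and a: "a \<in> S \<rightarrow>\<^sub>E {-1<..<1}"
  shows "\<exists>(H :: ('w \<Rightarrow> complex) hilbert) \<pi>. finite_factor_representation W H \<pi> \<and>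
    (\<exists>(K :: (nat \<Rightarrow> complex) hilbert) A.
       hilbert_space K \<and> von_neumann_algebra K A \<and> finite_dimensional K A \<and> abelian_algebra K A \<and>
       vn_isomorphic (ell2 (carrier W)) (hecke_algebra W S (hecke_parameter S a))
         (hilbert_sum H K) (direct_sum H (rep_algebra W H \<pi>) K A)) \<and>
    ((\<forall>s \<in> S. \<bar>a s\<bar> < 1 / 10) \<longrightarrow> H = ell2 (carrier W) \<and> (\<forall>s \<in> S. averages_to W s \<pi> (a s)))"
proof -
  define r where "r s = (1 - \<bar>a s\<bar>) / sqrt (1 - (a s)\<^sup>2)" for s
  \<comment> \<open>Since \<open>r s - 1 / r s\<close> equals
    \<open>- (2 * \<bar>a s\<bar>) / sqrt (1 - (a s)\<^sup>2)\<close>, the sign of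
    \<open>a s\<close> is needed for \<open>2 * a s + d s * (r s - 1 / r s) = 0\<close>. At
    \<open>a s = 0\<close> either sign would do.\<close>
  define d where "d s = (if a s < 0 then - 1 else 1) * sqrt (1 - (a s)\<^sup>2)" for s
  have as: "\<bar>a s\<bar> < 1" if "s \<in> S" for s using a that by (auto simp: PiE_iff abs_less_iff)
  have sq: "0 < sqrt (1 - (a s)\<^sup>2)" "(sqrt (1 - (a s)\<^sup>2))\<^sup>2 = 1 - \<bar>a s\<bar>\<^sup>2" if "s \<in> S" for s
    using as[OF that] abs_square_less_1[of "a s"] by auto
  have r2: "(r s)\<^sup>2 = (1 - \<bar>a s\<bar>) / (1 + \<bar>a s\<bar>)" if "s \<in> S" for s
  proof -
    have "1 - \<bar>a s\<bar>\<^sup>2 = (1 - \<bar>a s\<bar>) * (1 + \<bar>a s\<bar>)" by (simp add: power2_eq_square algebra_simps)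
    thus ?thesis using as[OF that] unfolding r_def power_divide sq(2)[OF that]
      by (simp add: power2_eq_square)
  qed
  have r0: "0 < r s" if "s \<in> S" for s using as[OF that] sq(1)[OF that] by (simp add: r_def)
  have rr: "r s - 1 / r s = - (2 * \<bar>a s\<bar>) / sqrt (1 - (a s)\<^sup>2)" if s: "s \<in> S" for s
  proof -
    have "r s - 1 / r s = ((r s)\<^sup>2 - 1) / r s" using r0[OF s] by (simp add: field_simps power2_eq_square)
    also have "(r s)\<^sup>2 - 1 = - (2 * \<bar>a s\<bar>) / (1 + \<bar>a s\<bar>)"
      unfolding r2[OF s] by (simp add: field_simps)
    also have "\<dots> / r s = - (2 * \<bar>a s\<bar>) * sqrt (1 - (a s)\<^sup>2) / ((1 + \<bar>a s\<bar>) * (1 - \<bar>a s\<bar>))"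
      by (simp add: r_def)
    also have "(1 + \<bar>a s\<bar>) * (1 - \<bar>a s\<bar>) = sqrt (1 - (a s)\<^sup>2) * sqrt (1 - (a s)\<^sup>2)"
      using sq(2)[OF s] by (simp add: power2_eq_square algebra_simps)
    finally show ?thesis using sq(1)[OF s] by (metis mult_divide_mult_cancel_right less_irrefl)
  qed
  interpret hecke_rep W S m r a d
  proof
    fix s assume s: "s \<in> S"
    have "(r s)\<^sup>2 \<le> 1\<^sup>2" unfolding r2[OF s] by (simp add: field_simps)
    thus "0 < r s \<and> r s \<le> 1" using r0[OF s] by (simp add: abs_square_le_1)
    show "2 * a s + d s * (r s - 1 / r s) = 0" using sq(1)[OF s] by (simp add: rr[OF s] d_def)
    show "(a s)\<^sup>2 + (d s)\<^sup>2 = 1" using sq(2)[OF s] by (simp add: d_def power_mult_distrib)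
    show "d s \<noteq> 0" using sq(1)[OF s] by (simp add: d_def)
  qed (use assms in auto)
  have q: "(hecke_parameter S a s - 1) / sqrt (hecke_parameter S a s) = r s - 1 / r s" if s: "s \<in> S" for s
  proof -
    have "a \<in> S \<rightarrow> {-1<..<1}" using a by auto
    from sqrt_hecke_parameter[OF this s] have "sqrt (hecke_parameter S a s) = r s" by (simp add: r_def)
    moreover have "hecke_parameter S a s = (r s)\<^sup>2" using s by (simp add: hecke_parameter_def r_def)
    ultimately show ?thesis using r0[OF s] by (simp add: field_simps power2_eq_square)
  qed
  have hecke: "hecke_algebra W S (hecke_parameter S a) = Nn" by (rule hecke_algebra_eq) (rule q)
  have iso: "vn_isomorphic (ell2 (carrier W)) (hecke_algebra W S (hecke_parameter S a))
      (hilbert_sum H Kd.H) (direct_sum H (rep_algebra W H \<pi>) Kd.H Kd.A)"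
    using Nn_isomorphic unfolding hecke rep_algebra_\<pi> perp_empty[of "carrier W"] .
  have small: "H = ell2 (carrier W) \<and> (\<forall>s \<in> S. averages_to W s \<pi> (a s))" if small: "\<forall>s \<in> S. \<bar>a s\<bar> < 1 / 10"
  proof -
    \<comment> \<open>The value of \<open>(1 - x) / (1 + x)\<close> at \<open>x = 1 / 10\<close>.
      Twice its square is 162/121, which exceeds 1 as \<open>Lam_empty\<close> demands.\<close>
    have "9 / 11 \<le> (r s)\<^sup>2" if "s \<in> S" for s
      using small that unfolding r2[OF that] by (auto simp: field_simps)
    hence L: "Lam = {}" by (rule Lam_empty) (simp_all add: power2_eq_square)
    interpret hecke_rep0 W S m r a d by unfold_locales (rule L)
    show ?thesis
      using \<pi>_L2 ev_weak_limit trace_ev unfolding averages_to_def L perp_empty by blast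
  qed
  show ?thesis
    using finite_factor_representation_\<pi> Kd.hilbert_space_perp Kd.von_neumann_A Kd.finite_dimensional_A
      Kd.abelian_A iso small by blast
qed

theorem theoremC:
  fixes W :: "('w, 'b) monoid_scheme" and S :: "'w set" and m :: "'w \<Rightarrow> 'w \<Rightarrow> enat"
  assumes "right_angled_coxeter_system W S m"
    and "irreducible_system W S"
    and "finite S" and "card S \<ge> 3"
  shows "\<exists>(H :: ('w \<Rightarrow> real) \<Rightarrow> ('w \<Rightarrow> complex) hilbert) \<pi>.
    (\<forall>a \<in> S \<rightarrow>\<^sub>E {-1<..<1}. finite_factor_representation W (H a) (\<pi> a)) \<and>
    (\<forall>a \<in> S \<rightarrow>\<^sub>E {-1<..<1}.
       \<exists>(K :: (nat \<Rightarrow> complex) hilbert) A.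
         hilbert_space K \<and> von_neumann_algebra K A \<and>
         finite_dimensional K A \<and> abelian_algebra K A \<and>
         vn_isomorphic
           (ell2 (carrier W)) (hecke_algebra W S (hecke_parameter S a))
           (hilbert_sum (H a) K) (direct_sum (H a) (rep_algebra W (H a) (\<pi> a)) K A)) \<and>
    (\<exists>U. openin (open_cube S) U \<and> (\<lambda>s \<in> S. 0) \<in> U \<and>
       (\<forall>a \<in> U. \<forall>b \<in> U. a \<noteq> b \<longrightarrow>
          \<not> unitarily_equivalent W (H a) (\<pi> a) (H b) (\<pi> b)))"
proof -
  interpret racg W S m by unfold_locales (rule assms(1))
  \<comment> \<open>Space and representation are chosen together with all their properties. For
    small parameters the space is \<open>ell2\<close> of W itself, so that
    \<open>averages_to\<close> applies to all these representations on one space.\<close>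
  define Q where "Q a H \<pi> \<longleftrightarrow> finite_factor_representation W H \<pi> \<and>
    (\<exists>(K :: (nat \<Rightarrow> complex) hilbert) A.
       hilbert_space K \<and> von_neumann_algebra K A \<and> finite_dimensional K A \<and> abelian_algebra K A \<and>
       vn_isomorphic (ell2 (carrier W)) (hecke_algebra W S (hecke_parameter S a))
         (hilbert_sum H K) (direct_sum H (rep_algebra W H \<pi>) K A)) \<and>
    ((\<forall>s \<in> S. \<bar>a s\<bar> < 1 / 10) \<longrightarrow> H = ell2 (carrier W) \<and> (\<forall>s \<in> S. averages_to W s \<pi> (a s)))"
    for a and H :: "('w \<Rightarrow> complex) hilbert" and \<pi>
  have "\<forall>a \<in> S \<rightarrow>\<^sub>E {-1<..<1}. \<exists>H \<pi>. Q a H \<pi>"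
    unfolding Q_def using ex_hecke_representation[OF assms] by (rule ballI)
  from bchoice[OF this] obtain H where "\<forall>a \<in> S \<rightarrow>\<^sub>E {-1<..<1}. \<exists>\<pi>. Q a (H a) \<pi>" ..
  from bchoice[OF this] obtain \<pi> where Q: "\<forall>a \<in> S \<rightarrow>\<^sub>E {-1<..<1}. Q a (H a) (\<pi> a)" ..
  have rep: "a \<in> S \<rightarrow>\<^sub>E {-1<..<1} \<Longrightarrow> finite_factor_representation W (H a) (\<pi> a)" and
    iso: "a \<in> S \<rightarrow>\<^sub>E {-1<..<1} \<Longrightarrow> \<exists>(K :: (nat \<Rightarrow> complex) hilbert) A.
         hilbert_space K \<and> von_neumann_algebra K A \<and>
         finite_dimensional K A \<and> abelian_algebra K A \<and>
         vn_isomorphic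
           (ell2 (carrier W)) (hecke_algebra W S (hecke_parameter S a))
           (hilbert_sum (H a) K) (direct_sum (H a) (rep_algebra W (H a) (\<pi> a)) K A)" and
    small: "a \<in> S \<rightarrow>\<^sub>E {-1<..<1} \<Longrightarrow> (\<forall>s \<in> S. \<bar>a s\<bar> < 1 / 10) \<Longrightarrow>
         H a = ell2 (carrier W) \<and> (\<forall>s \<in> S. averages_to W s (\<pi> a) (a s))"
    for a using Q unfolding Q_def by blast+
  let ?U = "S \<rightarrow>\<^sub>E {-(1/10)<..<1/10 :: real}"
  have open_U: "openin (open_cube S) ?U"
  proof (rule openin_PiE[THEN iffD2, OF assms(3)], rule disjI2, rule ballI)
    have eq: "{-(1/10)<..<1/10 :: real} = {-1<..<1} \<inter> {-(1/10)<..<1/10}" by auto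
    show "openin (top_of_set {-1<..<1}) {-(1/10)<..<1/10 :: real}"
      by (subst eq) (rule openin_open_Int, rule open_greaterThanLessThan)
  qed
  have U: "a \<in> S \<rightarrow>\<^sub>E {-1<..<1}" "\<forall>s \<in> S. \<bar>a s\<bar> < 1 / 10" if a: "a \<in> ?U" for a
  proof -
    have "?U \<subseteq> S \<rightarrow>\<^sub>E {-1<..<1}" by (rule PiE_mono) auto
    thus "a \<in> S \<rightarrow>\<^sub>E {-1<..<1}" using a by blast
    show "\<forall>s \<in> S. \<bar>a s\<bar> < 1 / 10"
    proof
      fix s assume "s \<in> S"
      from PiE_mem[OF a this] show "\<bar>a s\<bar> < 1 / 10" unfolding greaterThanLessThan_iff by linarith
    qed
  qed
  have "\<not> unitarily_equivalent W (H a) (\<pi> a) (H b) (\<pi> b)" if ab: "a \<in> ?U" "b \<in> ?U" "a \<noteq> b" for a b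
  proof
    assume ue: "unitarily_equivalent W (H a) (\<pi> a) (H b) (\<pi> b)"
    note sa = small[OF U[OF ab(1)]] and sb = small[OF U[OF ab(2)]]
    have "a s = b s" if "s \<in> S" for s
      using averages_to_unique[OF is_group, of s "\<pi> a" "\<pi> b" "a s" "b s"] ue sa sb that S_carrier by simp
    thus False using ab PiE_ext by blast
  qed
  hence "\<forall>a \<in> ?U. \<forall>b \<in> ?U. a \<noteq> b \<longrightarrow> \<not> unitarily_equivalent W (H a) (\<pi> a) (H b) (\<pi> b)"
    by (intro ballI impI)
  moreover have "(\<lambda>s \<in> S. 0) \<in> ?U" by simp
  ultimately have "openin (open_cube S) ?U \<and> (\<lambda>s \<in> S. 0) \<in> ?U \<and>
      (\<forall>a \<in> ?U. \<forall>b \<in> ?U. a \<noteq> b \<longrightarrow> \<not> unitarily_equivalent W (H a) (\<pi> a) (H b) (\<pi> b))"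
    using open_U by (intro conjI)
  thus ?thesis
    by (intro exI[of _ H] exI[of _ \<pi>] conjI ballI) (erule rep, erule iso, rule exI[of _ ?U], assumption)
qed

end
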